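(* Let $N=2$, $\mu_1,\mu_2,\rho>0$ and $b_1,b_2>0$. Consider the problem $$(\ast)\quad\begin{cases}-\Delta u+\lambda_1u=\beta uv+\mu_1u^3+\rho v^2u & \text{in }\mathbb{R}^2,\\ -\Delta v+\lambda_2v=\frac{\beta}{2}u^2+\mu_2v^3+\rho u^2v&\text{in }\mathbb{R}^2,\end{cases}\qquad \int_{\mathbb{R}^2}u^2dx=b_1^2,\quad \int_{\mathbb{R}^2}v^2dx=b_2^2 .$$ (i) If $\max\{(\mu_1+\rho)b_1^2,(\mu_2+\rho)b_2^2\}<\|Q\|_{L^2(\mathbb{R}^2)}^2$, then: a) for every $\beta<0$, problem $(\ast)$ has no positive solutions; b) for every $\beta>0$, when $0<b_2\le\|Q\|_{L^2(\mathbb{R}^2)}$, one has $-\infty<m_\beta(b_1,b_2)<0$ and $m_\beta(b_1,b_2)$ is achieved by some $(u,v)$ which is a positive solution of $(\ast)$. (ii) If $\dfrac{\mu_1b_1^4+\mu_2b_2^4+2\rho b_1^2b_2^2}{b_1^2+b_2^2}>\|Q\|_{L^2(\mathbb{R}^2)}^2$, then $m_\beta(b_1,b_2)=-\infty$ for any $\beta\in\mathbb{R}$.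
   Context: $Q\in H^1(\mathbb{R}^2)$ is the unique positive radial solution of $-\Delta Q+Q=Q^3$ in $\mathbb{R}^2$. For $b>0$, $\mathrm{T}_b=\{u\in H^1(\mathbb{R}^2):\int_{\mathbb{R}^2}u^2dx=b^2\}$, $$J_\beta(u,v)=\frac12\int_{\mathbb{R}^2}(|\nabla u|^2+|\nabla v|^2)dx-\frac14\int_{\mathbb{R}^2}(\mu_1u^4+\mu_2v^4+2\rho u^2v^2)dx-\frac{\beta}{2}\int_{\mathbb{R}^2}u^2v\,dx,$$ and $m_\beta(b_1,b_2)=\inf_{\mathrm{T}_{b_1}\times \mathrm{T}_{b_2}}J_\beta$. The frequencies $\lambda_1,\lambda_2$ are unknown: a solution of $(\ast)$ is $(u,v)\in H^1(\mathbb{R}^2)\times H^1(\mathbb{R}^2)$ satisfying it for some $\lambda_1,\lambda_2\in\mathbb{R}$; it is positive if $u>0$ and $v>0$. *)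

theory Defs
  imports "HOL-Analysis.Analysis"
begin

text \<open>\<open>Ck k f\<close> says that \<open>f\<close> is \<open>k\<close> times continuously differentiable on the whole space.\<close>

primrec Ck :: "nat \<Rightarrow> ('a::euclidean_space \<Rightarrow> real) \<Rightarrow> bool" where
  "Ck 0 f \<longleftrightarrow> continuous_on UNIV f"
| "Ck (Suc k) f \<longleftrightarrow> (\<forall>x. f differentiable (at x)) \<and>
     (\<forall>e\<in>Basis. Ck k (\<lambda>x. frechet_derivative f (at x) e))"

definition test_function :: "('a::euclidean_space \<Rightarrow> real) \<Rightarrow> bool" where
  "test_function \<phi> \<longleftrightarrow> (\<forall>k. Ck k \<phi>) \<and> compact (closure {x. \<phi> x \<noteq> 0})"

definition grad :: "('a::euclidean_space \<Rightarrow> real) \<Rightarrow> 'a \<Rightarrow> 'a" where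
  "grad \<phi> x = (\<Sum>e\<in>Basis. frechet_derivative \<phi> (at x) e *\<^sub>R e)"

text \<open>Elements of the Sobolev space are represented by Lebesgue measurable functions; no quotient
  by equality almost everywhere is taken, and the space is closed under modification on null sets.\<close>

definition locally_integrable ::
    "('a::euclidean_space \<Rightarrow> 'b::euclidean_space) \<Rightarrow> bool" where
  "locally_integrable f \<longleftrightarrow> (\<forall>K. compact K \<longrightarrow> f absolutely_integrable_on K)"

definition has_weak_gradient ::
    "('a::euclidean_space \<Rightarrow> real) \<Rightarrow> ('a \<Rightarrow> 'a) \<Rightarrow> bool" where
  "has_weak_gradient u g \<longleftrightarrow> locally_integrable u \<and> locally_integrable g \<and>
     (\<forall>\<phi>. test_function \<phi> \<longrightarrow>
        (\<integral>x. u x *\<^sub>R grad \<phi> x \<partial>lebesgue) = - (\<integral>x. \<phi> x *\<^sub>R g x \<partial>lebesgue))"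

definition L2 :: "('a::euclidean_space \<Rightarrow> 'b::euclidean_space) set" where
  "L2 = {f. f \<in> borel_measurable lebesgue \<and> integrable lebesgue (\<lambda>x. (norm (f x))\<^sup>2)}"

definition L2_norm :: "('a::euclidean_space \<Rightarrow> 'b::euclidean_space) \<Rightarrow> real" where
  "L2_norm f = sqrt (\<integral>x. (norm (f x))\<^sup>2 \<partial>lebesgue)"

definition H1 :: "('a::euclidean_space \<Rightarrow> real) set" where
  "H1 = {u. u \<in> L2 \<and> (\<exists>g. has_weak_gradient u g \<and> g \<in> L2)}"

text \<open>A weak gradient is determined only up to null sets; the choice made here does not affect
  the integrals in which it occurs.\<close>

definition weak_grad :: "('a::euclidean_space \<Rightarrow> real) \<Rightarrow> 'a \<Rightarrow> 'a" where
  "weak_grad u = (SOME g. has_weak_gradient u g)"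

definition ae_positive :: "('a::euclidean_space \<Rightarrow> real) \<Rightarrow> bool" where
  "ae_positive u \<longleftrightarrow> (AE x in lebesgue. 0 < u x)"

text \<open>\<open>weakly_solves \<lambda> u f\<close> is the equation \<open>- \<Delta> u + \<lambda> u = f\<close> on the whole space in the sense of
  distributions.\<close>

definition weakly_solves ::
    "real \<Rightarrow> ('a::euclidean_space \<Rightarrow> real) \<Rightarrow> ('a \<Rightarrow> real) \<Rightarrow> bool" where
  "weakly_solves lam u f \<longleftrightarrow>
     (\<forall>\<phi>. test_function \<phi> \<longrightarrow>
        (\<integral>x. weak_grad u x \<bullet> grad \<phi> x \<partial>lebesgue) + lam * (\<integral>x. u x * \<phi> x \<partial>lebesgue)
          = (\<integral>x. f x * \<phi> x \<partial>lebesgue))"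

definition radial :: "('a::euclidean_space \<Rightarrow> real) \<Rightarrow> bool" where
  "radial u \<longleftrightarrow> (\<exists>f. AE x in lebesgue. u x = f (norm x))"

definition positive_radial_solution :: "(real^2 \<Rightarrow> real) \<Rightarrow> bool" where
  "positive_radial_solution Q \<longleftrightarrow>
     Q \<in> H1 \<and> ae_positive Q \<and> radial Q \<and> weakly_solves 1 Q (\<lambda>x. Q x ^ 3)"

definition is_unique_positive_radial_solution :: "(real^2 \<Rightarrow> real) \<Rightarrow> bool" where
  "is_unique_positive_radial_solution Q \<longleftrightarrow> positive_radial_solution Q \<and>
     (\<forall>R. positive_radial_solution R \<longrightarrow> (AE x in lebesgue. R x = Q x))"

definition mass_sphere :: "real \<Rightarrow> (real^2 \<Rightarrow> real) set" where
  "mass_sphere b = {u \<in> H1. (\<integral>x. (u x)\<^sup>2 \<partial>lebesgue) = b\<^sup>2}"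

definition energy ::
    "real \<Rightarrow> real \<Rightarrow> real \<Rightarrow> real \<Rightarrow> (real^2 \<Rightarrow> real) \<Rightarrow> (real^2 \<Rightarrow> real) \<Rightarrow> real" where
  "energy \<mu>1 \<mu>2 \<rho> \<beta> u v =
     1/2 * (\<integral>x. (norm (weak_grad u x))\<^sup>2 + (norm (weak_grad v x))\<^sup>2 \<partial>lebesgue)
     - 1/4 * (\<integral>x. \<mu>1 * u x ^ 4 + \<mu>2 * v x ^ 4 + 2 * \<rho> * (u x)\<^sup>2 * (v x)\<^sup>2 \<partial>lebesgue)
     - \<beta>/2 * (\<integral>x. (u x)\<^sup>2 * v x \<partial>lebesgue)"

definition min_energy :: "real \<Rightarrow> real \<Rightarrow> real \<Rightarrow> real \<Rightarrow> real \<Rightarrow> real \<Rightarrow> ereal" where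
  "min_energy \<mu>1 \<mu>2 \<rho> \<beta> b1 b2 =
     (INF (u, v) \<in> mass_sphere b1 \<times> mass_sphere b2. ereal (energy \<mu>1 \<mu>2 \<rho> \<beta> u v))"

text \<open>The frequencies \<open>l1\<close>, \<open>l2\<close> are part of the unknown.\<close>

definition normalized_solution ::
    "real \<Rightarrow> real \<Rightarrow> real \<Rightarrow> real \<Rightarrow> real \<Rightarrow> real \<Rightarrow> (real^2 \<Rightarrow> real) \<Rightarrow> (real^2 \<Rightarrow> real) \<Rightarrow> bool" where
  "normalized_solution \<mu>1 \<mu>2 \<rho> \<beta> b1 b2 u v \<longleftrightarrow>
     u \<in> H1 \<and> v \<in> H1 \<and>
     (\<exists>l1 l2.
        weakly_solves l1 u (\<lambda>x. \<beta> * u x * v x + \<mu>1 * u x ^ 3 + \<rho> * (v x)\<^sup>2 * u x) \<and>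
        weakly_solves l2 v (\<lambda>x. \<beta>/2 * (u x)\<^sup>2 + \<mu>2 * v x ^ 3 + \<rho> * (u x)\<^sup>2 * v x)) \<and>
     (\<integral>x. (u x)\<^sup>2 \<partial>lebesgue) = b1\<^sup>2 \<and> (\<integral>x. (v x)\<^sup>2 \<partial>lebesgue) = b2\<^sup>2"

definition positive_normalized_solution ::
    "real \<Rightarrow> real \<Rightarrow> real \<Rightarrow> real \<Rightarrow> real \<Rightarrow> real \<Rightarrow> (real^2 \<Rightarrow> real) \<Rightarrow> (real^2 \<Rightarrow> real) \<Rightarrow> bool" where
  "positive_normalized_solution \<mu>1 \<mu>2 \<rho> \<beta> b1 b2 u v \<longleftrightarrow>
     normalized_solution \<mu>1 \<mu>2 \<rho> \<beta> b1 b2 u v \<and> ae_positive u \<and> ae_positive v"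

end

theory Submission
 imports Defs "HOL-Complex_Analysis.Great_Picard"
begin

text \<open>Write \<open>|f|\<close> for the norm of \<open>L\<^sup>2\<close>. Everything rests on the sharp inequality \<open>\<integral>u\<^sup>4 \<le> 2 / |Q|\<^sup>2 * |u|\<^sup>2 * |\<nabla>u|\<^sup>2\<close>.
 An optimizer exists among radially decreasing functions, for which the embedding into \<open>L\<^sup>4\<close> is compact;
 rescaled, it is a positive radial solution of \<open>- \<Delta>R + R = R\<^sup>3\<close>, hence equal to \<open>Q\<close> by uniqueness.
 Symmetrization is by polarization: among the competitors of a pair, one that maximizes the integral against
 a Gaussian is fixed by all polarizations, hence radially decreasing.

 For \<open>\<beta> > 0\<close> the inequality makes the energy coercive, a dilation of \<open>Q\<close> makes it negative, and it attains its minimum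
 on a product of balls of \<open>L\<^sup>2\<close>. If a minimizer were interior, its multiplier would vanish, but \<open>- \<Delta>u \<ge> \<mu>u\<^sup>3\<close> has no
 positive solution. For \<open>\<beta> < 0\<close> the Pohozaev identity together with the equations tested by the solution
 bounds \<open>|\<nabla>u|\<^sup>2 + |\<nabla>v|\<^sup>2\<close> by twice the quartic energy, against the sharp inequality. In (ii) concentrating \<open>Q\<close> drives
 the energy to \<open>-\<infinity>\<close>.\<close>

text \<open>Solutions are only known to lie in \<open>H^1\<close>, and this shapes the proof.
  Identities with second derivatives are established for mollifications and passed to the limit in a
  form that contains first derivatives only; positivity of optimizers is drawn from radial
  monotonicity. Compactness means almost everywhere convergence of a subsequence, which bounds the
  \<open>L^2\<close> norm and the Dirichlet integral of the limit from above; mass may be lost, so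
  extremal problems carry inequality constraints and equality is recovered afterwards. Polarization
  reduces to inequalities between two reflected points, and one reflection acts on both components;
  the couplings \<open>u^2 v^2\<close> and \<open>u^2 v\<close> profit because they are supermodular
  on nonnegative values. In the plane a mass-preserving dilation multiplies the Dirichlet integral
  and the quartic term by the same factor, hence a threshold on the mass. The work is done on Borel
  representatives with an explicit weak gradient (\<open>sob\<close>); the given notions are
  translated at both ends.\<close>

abbreviation (input) tends_seq (infixr "---->" 60)
 where "X ----> L \<equiv> X \<longlonglongrightarrow> L"

abbreviation (input) "L1 \<equiv> integrable lborel"

abbreviation (input) "BM \<equiv> borel_measurable borel"

abbreviation (input) "aelim F f \<equiv> AE x in lborel. (\<lambda>n. F n x) \<longlonglongrightarrow> f x"

section \<open>Test functions\<close>

definition pd :: "'a => ('a::euclidean_space => real) => 'a => real" where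
 "pd e f x = frechet_derivative f (at x) e"

lemma grad_pd: "grad f x = (\<Sum>e\<in>Basis. pd e f x *\<^sub>R e)"
 by (simp add: grad_def pd_def)

lemma grad_inner_Basis: "e \<in> Basis ==> grad f x \<bullet> e = pd e f x"
 by (simp add: grad_pd inner_sum_left inner_Basis if_distrib cong: if_cong)

lemma pd_eq: "(f has_derivative f') (at x) ==> pd e f x = f' e"
 unfolding pd_def using frechet_derivative_at by metis

lemma Ck_Suc_iff: "Ck (Suc k) f \<longleftrightarrow> (\<forall>x. f differentiable (at x)) & (\<forall>e\<in>Basis. Ck k (pd e f))"
 by (simp add: pd_def[abs_def])

declare Ck.simps(2) [simp del]

lemma Ck_SucI:
 assumes "!!x. (f has_derivative f' x) (at x)" "!!e. e \<in> Basis ==> Ck k (\<lambda>x. f' x e)"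
 shows "Ck (Suc k) f"
proof -
 have "pd e f = (\<lambda>x. f' x e)" for e using assms(1) by (auto simp: pd_eq)
 then show ?thesis using assms by (auto simp: Ck_Suc_iff differentiable_def)
qed

lemma Ck_Suc_has_derivative: "Ck (Suc k) f ==> (f has_derivative (\<lambda>h. \<Sum>e\<in>Basis. (h \<bullet> e) * pd e f x)) (at x)"
proof -
 assume "Ck (Suc k) f"
 then have "(f has_derivative frechet_derivative f (at x)) (at x)"
  by (simp add: Ck_Suc_iff frechet_derivative_works)
 moreover have "frechet_derivative f (at x) = (\<lambda>h. \<Sum>e\<in>Basis. (h \<bullet> e) * pd e f x)"
 proof
  fix h
  interpret linear "frechet_derivative f (at x)"
   using calculation has_derivative_linear by blast
  have "frechet_derivative f (at x) h = frechet_derivative f (at x) (\<Sum>e\<in>Basis. (h \<bullet> e) *\<^sub>R e)"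
   by (simp add: euclidean_representation)
  then show "frechet_derivative f (at x) h = (\<Sum>e\<in>Basis. (h \<bullet> e) * pd e f x)"
   by (simp add: sum scale pd_def)
 qed
 ultimately show ?thesis by simp
qed

lemma Ck_Suc_has_derivative_grad: "Ck (Suc k) f ==> (f has_derivative (\<lambda>h. grad f x \<bullet> h)) (at x)"
 using Ck_Suc_has_derivative[of k f x] by (simp add: grad_pd inner_sum_left mult.commute inner_commute[of _ h for h] inner_sum_right)

lemma Ck_Suc_continuous: "Ck (Suc k) f ==> Ck k f"
proof (induction k arbitrary: f)
 case 0
 then show ?case
  by (auto simp: Ck_Suc_iff intro!: differentiable_imp_continuous_on simp: differentiable_on_def differentiable_at_withinI)
next
 case (Suc k)
 then show ?case by (auto simp: Ck_Suc_iff[of "Suc k"] Ck_Suc_iff[of k])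
qed

lemma Ck_const: "Ck k (\<lambda>x. c)"
 by (induction k arbitrary: c) (auto intro!: Ck_SucI derivative_eq_intros)

lemma Ck_add: "Ck k f ==> Ck k g ==> Ck k (\<lambda>x. f x + g x)"
proof (induction k arbitrary: f g)
 case (Suc k)
 note d = Ck_Suc_has_derivative_grad[OF Suc.prems(1)] Ck_Suc_has_derivative_grad[OF Suc.prems(2)]
 show ?case
 proof (rule Ck_SucI[OF has_derivative_add[OF d]])
  fix e :: 'a assume "e \<in> Basis"
  then show "Ck k (\<lambda>x. grad f x \<bullet> e + grad g x \<bullet> e)" using Suc
   by (simp add: grad_inner_Basis Ck_Suc_iff)
 qed
qed (auto intro: continuous_intros)

lemma Ck_mult: "Ck k f ==> Ck k g ==> Ck k (\<lambda>x. f x * g x)"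
proof (induction k arbitrary: f g)
 case (Suc k)
 note d = Ck_Suc_has_derivative_grad[OF Suc.prems(1)] Ck_Suc_has_derivative_grad[OF Suc.prems(2)]
 show ?case
 proof (rule Ck_SucI[OF has_derivative_mult[OF d]])
  fix e :: 'a assume "e \<in> Basis"
  then show "Ck k (\<lambda>x. f x * (grad g x \<bullet> e) + (grad f x \<bullet> e) * g x)"
   using Suc.IH Suc.prems[THEN Ck_Suc_continuous] Suc.prems
   by (auto simp: grad_inner_Basis Ck_Suc_iff intro!: Ck_add)
 qed
qed (auto intro: continuous_intros)

lemma Ck_sum: "(!!i. i \<in> A ==> Ck k (f i)) ==> Ck k (\<lambda>x. \<Sum>i\<in>A. f i x)"
 by (induction A rule: infinite_finite_induct) (auto intro: Ck_add Ck_const)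

lemma Ck_prod: "(!!i. i \<in> A ==> Ck k (f i)) ==> Ck k (\<lambda>x. \<Prod>i\<in>A. f i x)"
 by (induction A rule: infinite_finite_induct) (auto intro: Ck_mult Ck_const)

lemma Ck_inner: "Ck k (\<lambda>x. x \<bullet> a)"
 by (cases k) (auto intro!: Ck_SucI derivative_eq_intros continuous_intros Ck_const)

lemma Ck_inner_self: "Ck k (\<lambda>x::'a::euclidean_space. x \<bullet> x)"
proof -
 have "(\<lambda>x::'a. x \<bullet> x) = (\<lambda>x. \<Sum>b\<in>Basis. (x \<bullet> b) * (x \<bullet> b))"
  by (subst euclidean_inner) simp
 then show ?thesis by (simp only:) (intro Ck_sum Ck_mult Ck_inner)
qed

text \<open>The family \<open>F\<close> lists all derivatives of the outer function, so the
  induction on \<open>k\<close> can raise the index \<open>i\<close> at each use of the chain rule.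
  Applied to \<open>exp\<close> and \<open>flat\<close>.\<close>

lemma Ck_compose:
 assumes F: "!!i t. (F i has_real_derivative F (Suc i) t) (at t)"
 shows "Ck k g ==> Ck k (\<lambda>x. F i (g x))"
proof (induction k arbitrary: i)
 case 0
 have "continuous_on UNIV (F i)" using F by (meson DERIV_isCont continuous_at_imp_continuous_on)
 with 0 show ?case by (auto intro: continuous_on_compose2)
next
 case (Suc k)
 note d = Ck_Suc_has_derivative_grad[OF Suc.prems]
 show ?case
 proof (rule Ck_SucI)
  fix x show "((\<lambda>x. F i (g x)) has_derivative (\<lambda>h. F (Suc i) (g x) * (grad g x \<bullet> h))) (at x)"
   using has_derivative_compose[OF d, of "F i" "\<lambda>h. F (Suc i) (g x) * h"] F
   by (simp add: has_field_derivative_def)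
 next
  fix e :: 'a assume "e \<in> Basis"
  then show "Ck k (\<lambda>x. F (Suc i) (g x) * (grad g x \<bullet> e))"
   using Suc.IH Ck_Suc_continuous[OF Suc.prems] Suc.prems
   by (auto simp: grad_inner_Basis Ck_Suc_iff intro!: Ck_mult)
 qed
qed

lemma Ck_affine: "Ck k f ==> Ck k (\<lambda>x. f (a + c *\<^sub>R x))"
proof (induction k arbitrary: f)
 case 0 then show ?case by (auto intro!: continuous_on_compose2[of UNIV f] continuous_intros)
next
 case (Suc k)
 note d = Ck_Suc_has_derivative_grad[OF Suc.prems]
 show ?case
 proof (rule Ck_SucI)
  fix x
  have "((\<lambda>x. a + c *\<^sub>R x) has_derivative (\<lambda>h. c *\<^sub>R h)) (at x)" by (auto intro!: derivative_eq_intros)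
  from has_derivative_compose[OF this d]
  show "((\<lambda>x. f (a + c *\<^sub>R x)) has_derivative (\<lambda>h. c * (grad f (a + c *\<^sub>R x) \<bullet> h))) (at x)" by simp
 next
  fix e :: 'a assume "e \<in> Basis"
  then show "Ck k (\<lambda>x. c * (grad f (a + c *\<^sub>R x) \<bullet> e))" using Suc
   by (auto simp: grad_inner_Basis Ck_Suc_iff intro!: Ck_mult Ck_const)
 qed
qed

lemma pd_cmul: "f differentiable (at x) ==> pd e (\<lambda>x. c * f x) x = c * pd e f x"
 by (subst pd_eq[OF has_derivative_mult_right[of f]]) (auto simp: frechet_derivative_works pd_def)

lemma pd_add: "f differentiable (at x) ==> g differentiable (at x) ==> pd e (\<lambda>x. f x + g x) x = pd e f x + pd e g x"
 by (subst pd_eq[OF has_derivative_add[of f _ _ g]]) (auto simp: frechet_derivative_works pd_def)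

lemma pd_mult: "f differentiable (at x) ==> g differentiable (at x) ==> pd e (\<lambda>x. f x * g x) x = f x * pd e g x + pd e f x * g x"
 by (subst pd_eq[OF has_derivative_mult[of f _ _ _ g]]) (auto simp: frechet_derivative_works pd_def)

lemma pd_affine: assumes "f differentiable (at (a + c *\<^sub>R x))"
 shows "pd e (\<lambda>x. f (a + c *\<^sub>R x)) x = c * pd e f (a + c *\<^sub>R x)"
proof -
 have d: "(f has_derivative frechet_derivative f (at (a + c *\<^sub>R x))) (at (a + c *\<^sub>R x))"
  using assms by (simp add: frechet_derivative_works)
 have "((\<lambda>x. a + c *\<^sub>R x) has_derivative (\<lambda>h. c *\<^sub>R h)) (at x)" by (auto intro!: derivative_eq_intros)
 from pd_eq[OF has_derivative_compose[OF this d], of e]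
 show ?thesis using linear_scale[OF has_derivative_linear[OF d]] by (simp add: pd_def)
qed

text \<open>The function \<open>flat i\<close> is the \<open>i\<close>-th derivative of the function equal to \<open>exp (- 1 / t)\<close>
 for \<open>t > 0\<close> and to \<open>0\<close> for \<open>t \<le> 0\<close>.\<close>

fun flat_poly :: "nat => real poly" where
 "flat_poly 0 = 1"
| "flat_poly (Suc i) = [:0,0,1:] * (flat_poly i - pderiv (flat_poly i))"

definition flat :: "nat => real => real" where
 "flat i t = (if t > 0 then poly (flat_poly i) (1/t) * exp (- (1/t)) else 0)"

text \<open>For \<open>t > 0\<close>, differentiating \<open>p(1/t) * exp (-1/t)\<close> gives
  \<open>(p - p')(1/t) / t^2 * exp (-1/t)\<close>, which is the recursion of
  \<open>flat_poly\<close>. At \<open>0\<close> the substitution \<open>s = 1/t\<close> turns the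
  difference quotient into a polynomial divided by \<open>exp s\<close>.\<close>

lemma flat_DERIV: "(flat i has_real_derivative flat (Suc i) t) (at t)"
proof -
 have pos: ?thesis if "t > 0"
 proof -
  have "((\<lambda>t. poly (flat_poly i) (1/t) * exp (- (1/t))) has_real_derivative flat (Suc i) t) (at t)"
   using that
   by (auto simp: flat_def field_simps power2_eq_square intro!: derivative_eq_intros)
  then show ?thesis
   by (rule has_field_derivative_transform_within_open[where S="{0<..}"]) (use that in "auto simp: flat_def")
 qed
 have neg: ?thesis if "t < 0"
 proof -
  have "((\<lambda>t. 0) has_real_derivative flat (Suc i) t) (at t)"
   using that by (auto simp: flat_def)
  then show ?thesis
   by (rule has_field_derivative_transform_within_open[where S="{..<0}"]) (use that in "auto simp: flat_def")
 qed
 have zero: ?thesis if "t = 0"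
 proof -
  \<comment> \<open>\<open>pCons 0\<close> multiplies by \<open>s\<close>; this accounts for the
    division by \<open>h\<close> in the difference quotient.\<close>
  have "((\<lambda>s. poly (pCons 0 (flat_poly i)) s / exp s) \<longlongrightarrow> 0) at_top"
  proof -
   have "((\<lambda>s. poly p s / exp s) \<longlongrightarrow> 0) at_top" for p :: "real poly"
   proof -
    have "((\<lambda>s. \<Sum>k\<le>degree p. coeff p k * (s ^ k / exp s)) \<longlongrightarrow> (\<Sum>k\<le>degree p. coeff p k * 0)) at_top"
     by (intro tendsto_sum tendsto_mult tendsto_const tendsto_power_div_exp_0)
    then show ?thesis by (simp add: poly_altdef sum_divide_distrib)
   qed
   then show ?thesis .
  qed
  then have "((\<lambda>h. poly (pCons 0 (flat_poly i)) (inverse h) / exp (inverse h)) \<longlongrightarrow> 0) (at_right 0)"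
   by (rule filterlim_compose[OF _ filterlim_inverse_at_top_right])
  then have "((\<lambda>h. (flat i h - flat i 0) / h) \<longlongrightarrow> 0) (at_right 0)"
   by (rule Lim_transform_eventually)
    (auto simp: flat_def eventually_at_filter exp_minus field_simps)
  moreover have "((\<lambda>h. (flat i h - flat i 0) / h) \<longlongrightarrow> 0) (at_left 0)"
   by (rule Lim_transform_eventually[of "\<lambda>_. 0"]) (auto simp: flat_def eventually_at_filter)
  ultimately have "((\<lambda>h. (flat i h - flat i 0) / h) \<longlongrightarrow> 0) (at 0)"
   by (simp add: filterlim_at_split)
  then show ?thesis using that by (simp add: DERIV_def flat_def)
 qed
 show ?thesis using pos neg zero by linarith
qed

lemma flat0: "flat 0 t = (if t > 0 then exp (- (1/t)) else 0)"
 by (simp add: flat_def)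

lemma flat0_nonneg: "flat 0 t >= 0" and flat0_le1: "flat 0 t <= 1"
 and flat0_mono: "s <= t ==> flat 0 s <= flat 0 t"
 by (auto simp: flat0 field_simps)

lemma Ck_flat: "Ck k g ==> Ck k (\<lambda>x. flat 0 (g x))"
 by (rule Ck_compose[of flat, OF flat_DERIV])

lemma Ck_exp: "Ck k g ==> Ck k (\<lambda>x. exp (g x))"
 by (rule Ck_compose[of "\<lambda>_. exp"]) (rule DERIV_exp)

lemma test_function_iff: "test_function \<phi> \<longleftrightarrow> (\<forall>k. Ck k \<phi>) & (\<exists>R. \<forall>x. norm x > R --> \<phi> x = 0)"
proof -
 have "compact (closure {x. \<phi> x \<noteq> 0}) \<longleftrightarrow> (\<exists>R. \<forall>x. norm x > R --> \<phi> x = 0)"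
  unfolding compact_closure bounded_iff by (auto simp: not_le[symmetric])
 then show ?thesis by (simp add: test_function_def)
qed

lemma test_Ck: "test_function \<phi> ==> Ck k \<phi>" by (simp add: test_function_iff)

lemma test_has_derivative: "test_function \<phi> ==> (\<phi> has_derivative (\<lambda>h. grad \<phi> x \<bullet> h)) (at x)"
 using test_Ck Ck_Suc_has_derivative_grad by blast

lemma test_differentiable: "test_function \<phi> ==> \<phi> differentiable (at x)"
 using test_has_derivative differentiable_def by blast

lemma test_continuous: "test_function \<phi> ==> continuous_on A \<phi>"
 using test_Ck[of \<phi> 0] by (auto intro: continuous_on_subset)

lemma test_borel [measurable_dest, intro]: "test_function \<phi> ==> \<phi> \<in> BM"
 using test_continuous[of \<phi> UNIV] borel_measurable_continuous_onI by blast

lemma test_add: "test_function \<phi> ==> test_function \<psi> ==> test_function (\<lambda>x. \<phi> x + \<psi> x)"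
 unfolding test_function_iff
proof safe
 fix R R' assume *: "\<forall>x. norm x > R --> \<phi> x = 0" "\<forall>x. norm x > R' --> \<psi> x = 0"
 show "\<exists>R. \<forall>x. norm x > R --> \<phi> x + \<psi> x = 0"
  by (rule exI[of _ "max R R'"]) (use * in auto)
qed (auto intro: Ck_add)

lemma test_smooth_mult: "(!!k. Ck k \<phi>) ==> test_function \<psi> ==> test_function (\<lambda>x. \<phi> x * \<psi> x)"
 unfolding test_function_iff by (auto intro: Ck_mult)

lemma test_mult: "test_function \<phi> ==> test_function \<psi> ==> test_function (\<lambda>x. \<phi> x * \<psi> x)"
 using test_Ck test_smooth_mult by blast

lemma test_cmult: "test_function \<psi> ==> test_function (\<lambda>x. c * \<psi> x)"
 by (rule test_smooth_mult[OF Ck_const])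

lemma test_minus: "test_function \<phi> ==> test_function \<psi> ==> test_function (\<lambda>x. \<phi> x - \<psi> x)"
 using test_add[OF _ test_cmult[of \<psi> "-1"], of \<phi>] by simp

lemma test_zero: "test_function (\<lambda>x. 0)"
 unfolding test_function_iff by (auto intro: Ck_const)

lemma test_power: "test_function \<phi> ==> test_function (\<lambda>x. \<phi> x ^ Suc n)"
 by (induction n) (auto intro: test_mult)

lemma test_pd: assumes "test_function \<phi>" "e \<in> Basis" shows "test_function (pd e \<phi>)"
proof -
 obtain R where R: "norm x > R ==> \<phi> x = 0" for x using assms by (auto simp: test_function_iff)
 have "pd e \<phi> x = 0" if "norm x > R" for x
 proof -
  have "((\<lambda>x. 0::real) has_derivative (\<lambda>h. 0)) (at x)" by simp
  then have "(\<phi> has_derivative (\<lambda>h. 0)) (at x)"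
   by (rule has_derivative_transform_within_open[of _ _ _ _ "{x. norm x > R}"])
    (use that R in "auto intro!: open_Collect_less continuous_intros")
  from pd_eq[OF this] show ?thesis by simp
 qed
 moreover have "Ck k (pd e \<phi>)" for k using test_Ck[OF assms(1), of "Suc k"] assms(2)
  by (simp add: Ck_Suc_iff)
 ultimately show ?thesis by (auto simp: test_function_iff)
qed

lemma test_affine: assumes "test_function \<phi>" "c \<noteq> 0" shows "test_function (\<lambda>x. \<phi> (a + c *\<^sub>R x))"
proof -
 obtain R where R: "norm x > R ==> \<phi> x = 0" for x using assms by (auto simp: test_function_iff)
 have "\<phi> (a + c *\<^sub>R x) = 0" if "norm x > (R + norm a) / \<bar>c\<bar>" for x
 proof -
  have "\<bar>c\<bar> * norm x > R + norm a" using that assms(2) by (simp add: field_simps)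
  moreover have "norm (c *\<^sub>R x) <= norm (a + c *\<^sub>R x) + norm a"
   using norm_triangle_ineq4[of "a + c *\<^sub>R x" a] by simp
  ultimately show ?thesis by (intro R) simp
 qed
 then show ?thesis using assms by (auto simp: test_function_iff intro!: Ck_affine)
qed

lemma test_translate: "test_function \<phi> ==> test_function (\<lambda>x. \<phi> (x + a))"
 using test_affine[of \<phi> 1 a] by (simp add: add.commute)

lemma test_scale: "test_function \<phi> ==> c \<noteq> 0 ==> test_function (\<lambda>x. \<phi> (c *\<^sub>R x))"
 using test_affine[of \<phi> c 0] by simp

lemma test_reflect: "test_function \<phi> ==> test_function (\<lambda>y. \<phi> (x - y))"
 using test_affine[of \<phi> "-1" x] by simp

lemma test_bounded: assumes "test_function \<phi>" obtains B where "B > 0" "!!x. \<bar>\<phi> x\<bar> <= B"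
proof -
 obtain R where R: "norm x > R ==> \<phi> x = 0" for x using assms by (auto simp: test_function_iff)
 have "bounded (\<phi> ` cball 0 R)"
  by (intro compact_imp_bounded compact_continuous_image test_continuous assms) simp
 then obtain B where B: "x \<in> cball 0 R ==> \<bar>\<phi> x\<bar> <= B" for x by (force simp: bounded_iff)
 have "\<bar>\<phi> x\<bar> <= max 1 B" for x using B[of x] R[of x] by (cases "norm x > R") auto
 then show ?thesis by (intro that[of "max 1 B"]) auto
qed

lemma test_support: assumes "test_function \<phi>" obtains R where "R > 0" "!!x. norm x >= R ==> \<phi> x = 0"
proof -
 obtain R where R: "norm x > R ==> \<phi> x = 0" for x using assms by (auto simp: test_function_iff)
 show ?thesis by (rule that[of "max 1 (R+1)"]) (auto intro: R)
qed

lemmas bochner_cong = Bochner_Integration.integral_cong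
lemmas integrable_dom = Bochner_Integration.integrable_bound

lemma integrable_cball: "L1 (\<lambda>x::'a::euclidean_space. c * indicator (cball 0 R) x :: real)"
 using emeasure_lborel_cball_finite[of "0::'a" R] by (intro integrable_mult_right integrable_real_indicator) auto

lemma integrable_bounded_support:
 fixes f :: "'a::euclidean_space => 'b::{banach,second_countable_topology}"
 assumes [measurable]: "f \<in> BM" and "!!x. norm (f x) <= B" "!!x. norm x > R ==> f x = 0"
 shows "L1 f"
proof (rule integrable_dom[OF integrable_cball[of B R]])
 show "AE x in lborel. norm (f x) <= norm (B * indicator (cball 0 R) x)"
 proof (rule AE_I2)
  fix x show "norm (f x) <= norm (B * indicator (cball 0 R) x)"
   using assms(2)[of x] assms(3)[of x] by (cases "norm x > R") (auto split: split_indicator)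
 qed
qed auto

lemma test_integrable: assumes "test_function \<phi>" shows "L1 \<phi>"
proof -
 obtain B R where "!!x. \<bar>\<phi> x\<bar> <= B" "!!x. norm x >= R ==> \<phi> x = 0"
  using test_bounded[OF assms] test_support[OF assms] by metis
 then show ?thesis using assms by (intro integrable_bounded_support[of \<phi> B R]) auto
qed

lemma test_grad_borel [measurable_dest, intro]: "test_function \<phi> ==> grad \<phi> \<in> BM"
 unfolding grad_pd[abs_def] using test_borel[OF test_pd] by (intro borel_measurable_sum borel_measurable_scaleR) auto

lemma test_grad_bounded: assumes "test_function \<phi>" obtains B R where "B > 0" "!!x. norm (grad \<phi> x) <= B"
 "!!x. norm x > R ==> grad \<phi> x = 0"
proof -
 have "\<exists>B. B > 0 & (\<forall>x. \<bar>pd e \<phi> x\<bar> <= B)" if "e \<in> Basis" for e :: 'a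
  using test_bounded[OF test_pd[OF assms that]] by metis
 then obtain B where B: "!!e. e \<in> Basis ==> B e > 0" "!!e x. e \<in> Basis ==> \<bar>pd e \<phi> x\<bar> <= B e" by metis
 have "\<exists>R. \<forall>x. norm x > R --> pd e \<phi> x = 0" if "e \<in> Basis" for e :: 'a
  using test_pd[OF assms that] by (auto simp: test_function_iff)
 then obtain R where R: "!!e x. e \<in> Basis ==> norm x > R e ==> pd e \<phi> x = 0" by metis
 show ?thesis
 proof (rule that[of "\<Sum>e\<in>Basis. B e" "Max (R ` Basis)"])
  show "0 < sum B Basis" using B by (intro sum_pos) auto
  show "norm (grad \<phi> x) <= sum B Basis" for x
   unfolding grad_pd by (rule order_trans[OF norm_sum sum_mono]) (use B in auto)
  show "grad \<phi> x = 0" if "norm x > Max (R ` Basis)" for x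
   unfolding grad_pd using that by (intro sum.neutral) (auto simp: R Max_less_iff)
 qed
qed

section \<open>Bump functions and mollifier kernels\<close>

definition bump :: "real => 'a::euclidean_space => real" where
 "bump \<epsilon> x = flat 0 (1 - (x \<bullet> x) / \<epsilon>^2)"

lemma bump_test: "\<epsilon> > 0 ==> test_function (bump \<epsilon>)"
 unfolding test_function_iff
proof safe
 fix k
 have "Ck k (\<lambda>x::'a. 1 + (- 1 / \<epsilon>^2) * (x \<bullet> x))" by (intro Ck_add Ck_mult Ck_const Ck_inner_self)
 then show "Ck k (bump \<epsilon> :: 'a => real)"
  using Ck_flat[of k "\<lambda>x::'a. 1 + (- 1 / \<epsilon>^2) * (x \<bullet> x)"] by (simp add: bump_def[abs_def])
next
 assume "\<epsilon> > 0"
 then have "bump \<epsilon> x = 0" if "norm x > \<epsilon>" for x :: 'a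
  using that power_mono[of \<epsilon> "norm x" 2] by (auto simp: bump_def flat0 power2_norm_eq_inner field_simps)
 then show "\<exists>R. \<forall>x::'a. norm x > R --> bump \<epsilon> x = 0" by blast
qed

lemma bump_nonneg: "bump \<epsilon> x >= 0" by (simp add: bump_def flat0_nonneg)
lemma bump_antimono: "norm x <= norm y ==> bump \<epsilon> y <= bump \<epsilon> x"
 unfolding bump_def by (intro flat0_mono) (simp add: divide_right_mono power_mono flip: power2_norm_eq_inner)
lemma bump_0: "\<epsilon> > 0 ==> norm x >= \<epsilon> ==> bump \<epsilon> x = 0"
  using power_mono[of \<epsilon> "norm x" 2] by (auto simp: bump_def flat0 power2_norm_eq_inner field_simps)
lemma bump_pos: "\<epsilon> > 0 ==> norm x < \<epsilon> ==> bump \<epsilon> x > 0"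
 using power_strict_mono[of "norm x" \<epsilon> 2] by (auto simp: bump_def flat0 power2_norm_eq_inner field_simps)
lemma bump_borel [measurable]: "bump \<epsilon> \<in> BM"
proof -
 have "continuous_on UNIV (\<lambda>x::'a. 1 - (x \<bullet> x) / \<epsilon>^2)" by (cases "\<epsilon>=0") (auto intro!: continuous_intros)
 moreover have "continuous_on UNIV (flat 0)"
  using flat_DERIV by (meson DERIV_isCont continuous_at_imp_continuous_on)
 ultimately have "continuous_on UNIV (bump \<epsilon> :: 'a => real)"
  unfolding bump_def[abs_def] by (auto intro: continuous_on_compose2[of UNIV "flat 0"])
 then show ?thesis by (rule borel_measurable_continuous_onI)
qed

lemma bump_integral_pos: "\<epsilon> > 0 ==> (\<integral>x. bump \<epsilon> x \<partial>(lborel::'a::euclidean_space measure)) > 0"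
proof -
 assume e: "\<epsilon> > 0"
 have i: "L1 (bump \<epsilon> :: 'a => real)" by (intro test_integrable bump_test e)
 have "(\<integral>x. bump \<epsilon> x \<partial>(lborel::'a::euclidean_space measure)) \<noteq> 0"
 proof
  assume "(\<integral>x. bump \<epsilon> x \<partial>(lborel::'a::euclidean_space measure)) = 0"
  then have "AE x in lborel. bump \<epsilon> (x::'a) = 0"
   using integral_nonneg_eq_0_iff_AE[OF i] by (simp add: bump_nonneg)
  then have "AE x in lborel. x \<notin> ball (0::'a) \<epsilon>"
  proof eventually_elim
   case (elim x) then show ?case using bump_pos[OF e, of x] by auto
  qed
  then have "ball (0::'a) \<epsilon> \<in> null_sets lborel" by (simp add: AE_iff_null_sets)
  then have "negligible (ball (0::'a) \<epsilon>)"
   by (simp add: negligible_iff_null_sets null_sets_completionI)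
  then show False using open_not_negligible[of "ball (0::'a) \<epsilon>"] e by simp
 qed
 moreover have "(\<integral>x. bump \<epsilon> x \<partial>(lborel::'a::euclidean_space measure)) >= 0"
  by (simp add: bump_nonneg)
 ultimately show ?thesis by simp
qed

definition kern :: "real => 'a::euclidean_space => real" where
 "kern \<epsilon> x = bump \<epsilon> x / (\<integral>y. bump \<epsilon> y \<partial>(lborel::'a measure))"

lemma kern_test: "\<epsilon> > 0 ==> test_function (kern \<epsilon>)"
 using test_cmult[OF bump_test, of \<epsilon> "inverse _"] by (simp add: kern_def[abs_def] field_simps)
lemma kern_borel [measurable]: "kern \<epsilon> \<in> BM" unfolding kern_def[abs_def] by measurable
lemma kern_nonneg: "kern \<epsilon> x >= 0" by (simp add: kern_def bump_nonneg)
text \<open>Radial monotonicity of the kernel makes mollification respect reflections: each point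
  gives more weight to its own half-plane (see \<open>pol_moll\<close>).\<close>

lemma kern_antimono: "norm (x::'a::euclidean_space) <= norm (y::'a) ==> kern \<epsilon> y <= kern \<epsilon> x"
 unfolding kern_def by (intro divide_right_mono bump_antimono) (auto simp: bump_nonneg)
lemma kern_eq: "norm (x::'a::euclidean_space) = norm (y::'a) ==> kern \<epsilon> x = kern \<epsilon> y"
 using kern_antimono[of x y] kern_antimono[of y x] by (simp add: order_antisym)
lemma kern_0: "\<epsilon> > 0 ==> norm x >= \<epsilon> ==> kern \<epsilon> x = 0" by (simp add: kern_def bump_0)
lemma kern_integrable: "\<epsilon> > 0 ==> L1 (kern \<epsilon>)" by (intro test_integrable kern_test)
lemma kern_integral: "\<epsilon> > 0 ==> (LBINT x. kern \<epsilon> (x::'a::euclidean_space)) = 1"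
proof -
 assume "\<epsilon> > 0"
 then show ?thesis using bump_integral_pos[of \<epsilon>, where 'a='a] by (simp add: kern_def[abs_def])
qed

section \<open>The fundamental lemma of the calculus of variations\<close>

text \<open>The factors \<open>exp (- 1 / (n t))\<close> tend to \<open>1\<close> for
  \<open>t > 0\<close> and are replaced by \<open>0\<close> for \<open>t \<le> 0\<close>. Their
  product over the coordinates stays below the indicator, which therefore dominates in
  \<open>fundamental_lemma\<close>.\<close>

lemma box_indicator_limit:
 fixes a b :: "'a::euclidean_space"
 obtains \<phi> where "!!n. test_function (\<phi> n)" "!!n x. 0 <= \<phi> n x & \<phi> n x <= indicator (box a b) x"
  "!!x. (\<lambda>n. \<phi> n x) ----> indicator (box a b) x"
proof -
 define \<phi> where "\<phi> n x = (\<Prod>e\<in>Basis. flat 0 (real (Suc n) * (x \<bullet> e - a \<bullet> e)) * flat 0 (real (Suc n) * (b \<bullet> e - x \<bullet> e)))" for n x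
 have Z: "\<phi> n x = 0" if "x \<notin> box a b" for n x
 proof -
  from that obtain e where e: "e \<in> Basis" "x \<bullet> e <= a \<bullet> e \<or> b \<bullet> e <= x \<bullet> e" by (auto simp: box_def not_less)
  then have "flat 0 (real (Suc n) * (x \<bullet> e - a \<bullet> e)) = 0 \<or> flat 0 (real (Suc n) * (b \<bullet> e - x \<bullet> e)) = 0"
   by (auto simp: flat0 zero_less_mult_iff)
  then show ?thesis unfolding \<phi>_def using e(1) by (intro prod_zero) auto
 qed
 have le1: "0 <= \<phi> n x & \<phi> n x <= 1" for n x
  unfolding \<phi>_def by (auto intro!: prod_nonneg prod_le_1 mult_nonneg_nonneg flat0_nonneg mult_le_one flat0_le1)
 have A: "0 <= \<phi> n x & \<phi> n x <= indicator (box a b) x" for n x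
  using le1 Z by (auto split: split_indicator)
 have T: "test_function (\<phi> n)" for n
 proof -
  have eq: "\<phi> n = (\<lambda>x. \<Prod>e\<in>Basis. flat 0 (real (Suc n) * (x \<bullet> e + - (a \<bullet> e))) * flat 0 (real (Suc n) * (b \<bullet> e + (-1) * (x \<bullet> e))))"
   by (simp add: \<phi>_def[abs_def])
  have "Ck k (\<phi> n)" for k unfolding eq
   by (intro Ck_prod Ck_mult Ck_flat Ck_const Ck_add Ck_inner)
  moreover obtain R where "\<forall>x\<in>box a b. norm x <= R" using bounded_box[of a b] by (auto simp: bounded_iff)
  then have "\<forall>x. norm x > R --> \<phi> n x = 0" using Z by force
  ultimately show ?thesis by (auto simp: test_function_iff)
 qed
 have L: "(\<lambda>n. \<phi> n x) ----> indicator (box a b) x" for x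
 proof (cases "x \<in> box a b")
  case True
  have f1: "(\<lambda>n. flat 0 (real (Suc n) * t)) ----> 1" if "t > 0" for t
  proof -
   have "(\<lambda>n. exp (- (inverse t * inverse (real (Suc n))))) ----> exp (- (inverse t * 0))"
    by (intro tendsto_intros LIMSEQ_inverse_real_of_nat)
   then show ?thesis using that by (simp add: flat0 divide_inverse mult.commute)
  qed
  have "(\<lambda>n. \<phi> n x) ----> (\<Prod>e\<in>(Basis::'a set). 1 * 1)"
   unfolding \<phi>_def using True by (intro tendsto_prod tendsto_mult f1) (auto simp: box_def)
  then show ?thesis using True by simp
 qed (simp add: Z)
 show ?thesis using that[OF T A L] .
qed

text \<open>Integrals of \<open>g\<close> over boxes vanish by dominated convergence. On a large box
  the positive and negative parts of \<open>g\<close> are densities of two finite measures that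
  agree on the intersection-stable family of boxes, hence everywhere. So the two parts coincide
  almost everywhere, and since one of them is always zero, both are.\<close>

lemma fundamental_lemma:
 fixes g :: "'a::euclidean_space => real"
 assumes [measurable]: "g \<in> BM"
  and li: "!!R. L1 (\<lambda>x. indicator (cball 0 R) x * g x)"
  and z: "!!\<phi>. test_function \<phi> ==> (LBINT x. \<phi> x * g x) = 0"
 shows "AE x in lborel. g x = 0"
proof -
 have bx: "L1 (\<lambda>x. indicator (box a b) x * g x)" and bz: "(LBINT x. indicator (box a b) x * g x) = 0" for a b
 proof -
  obtain R where R: "\<forall>x\<in>box a b. norm x <= R" using bounded_box[of a b] by (auto simp: bounded_iff)
  show i: "L1 (\<lambda>x. indicator (box a b) x * g x)"
   by (rule integrable_dom[OF li[of R]]) (use R in "auto split: split_indicator")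
  obtain \<phi> where \<phi>: "!!n. test_function (\<phi> n)" "!!n x. 0 <= \<phi> n x & \<phi> n x <= indicator (box a b) x"
   "!!x. (\<lambda>n. \<phi> n x) ----> indicator (box a b) x" using box_indicator_limit by blast
  have [measurable]: "\<phi> n \<in> BM" for n using \<phi>(1) by (rule test_borel)
  have "(\<lambda>n. LBINT x. \<phi> n x * g x) ----> (LBINT x. indicator (box a b) x * g x)"
  proof (rule integral_dominated_convergence[where w="\<lambda>x. norm (indicator (box a b) x * g x)"])
   show "AE x in lborel. norm (\<phi> n x * g x) <= norm (indicator (box a b) x * g x)" for n
    using \<phi>(2) by (auto simp: abs_mult intro!: AE_I2 mult_right_mono)
  qed (use i \<phi>(3) in "auto intro!: tendsto_mult")
  then show "(LBINT x. indicator (box a b) x * g x) = 0"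
   using z[OF \<phi>(1)] by (simp add: LIMSEQ_const_iff)
 qed
 have main: "AE x in lborel. x \<in> box (- real n *\<^sub>R One) (real n *\<^sub>R One) --> g x = 0" for n
 proof -
  let ?B = "box (- real n *\<^sub>R One) (real n *\<^sub>R One) :: 'a set"
  define p where "p x = indicator ?B x * max 0 (g x)" for x
  define q where "q x = indicator ?B x * max 0 (- g x)" for x
  have [measurable]: "p \<in> BM" "q \<in> BM"
   unfolding p_def q_def by measurable
  have pq0: "p x >= 0" "q x >= 0" for x by (auto simp: p_def q_def)
  have sub: "L1 (\<lambda>x. indicator A x * p x)" "L1 (\<lambda>x. indicator A x * q x)" if [measurable]: "A \<in> sets borel" for A
   by (rule integrable_dom[OF bx[of "- real n *\<^sub>R One" "real n *\<^sub>R One"]];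
     auto simp: p_def q_def split: split_indicator)+
  let ?M = "density lborel (\<lambda>x. ennreal (p x))" and ?N = "density lborel (\<lambda>x. ennreal (q x))"
  have em: "emeasure ?M A = ennreal (LBINT x. indicator A x * p x)"
    "emeasure ?N A = ennreal (LBINT x. indicator A x * q x)" if [measurable]: "A \<in> sets borel" for A
   using sub[OF that] pq0
   by (auto simp: emeasure_density nn_integral_eq_integral[symmetric] ennreal_mult' mult.commute intro!: nn_integral_cong split: split_indicator)
  have "?M = ?N"
  proof (rule measure_eqI_generator_eq[where E="range (\<lambda>(a, b). box a b)" and \<Omega>=UNIV and A="\<lambda>i. box (- real i *\<^sub>R One) (real i *\<^sub>R One)"])
   show "Int_stable (range (\<lambda>(a, b). box a b :: 'a set))" by (auto simp: Int_stable_def box_Int_box)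
   show "sets ?M = sigma_sets UNIV (range (\<lambda>(a, b). box a b))" by (simp add: borel_eq_box)
   show "sets ?N = sigma_sets UNIV (range (\<lambda>(a, b). box a b))" by (simp add: borel_eq_box)
   show "(\<Union>i. box (- real i *\<^sub>R One) (real i *\<^sub>R One)) = (UNIV :: 'a set)" using UN_box_eq_UNIV[where 'a='a] by (simp only: scaleR_minus_left)
   show "emeasure ?M (box (- real i *\<^sub>R One) (real i *\<^sub>R One)) \<noteq> \<infinity>" for i by (simp add: em)
   show "emeasure ?M X = emeasure ?N X" if X: "X \<in> range (\<lambda>(a, b). box a b)" for X
   proof -
    from X obtain a b where ab: "X = box a b" by auto
    then have [measurable]: "X \<in> sets borel" by simp
    \<comment> \<open>A box meets the large box \<open>?B\<close> in a box again, over which the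
      integral of \<open>g\<close> is zero.\<close>
    obtain c d where cd: "X \<inter> ?B = box c d" unfolding ab box_Int_box by blast
    have "(LBINT x. indicator X x * p x) - (LBINT x. indicator X x * q x) = (LBINT x. indicator X x * p x - indicator X x * q x)"
     using sub[of X] by simp
    also have "\<dots> = (LBINT x. indicator (X \<inter> ?B) x * g x)"
     by (intro bochner_cong) (auto simp: p_def q_def split: split_indicator)
    also have "\<dots> = 0" unfolding cd by (rule bz)
    finally show ?thesis by (simp add: em)
   qed
  qed auto
  then have "AE x in lborel. ennreal (p x) = ennreal (q x)"
   by (intro sigma_finite_measure.density_unique[OF sigma_finite_lborel]) auto
  then show ?thesis
   by eventually_elim (auto simp: p_def q_def max_def pq0 split: if_splits)
 qed
 have "AE x in lborel. \<forall>n. x \<in> box (- real n *\<^sub>R One) (real n *\<^sub>R One) --> g x = 0"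
  unfolding AE_all_countable using main by blast
 then show ?thesis
 proof eventually_elim
  case (elim x)
  have "x \<in> (\<Union>i::nat. box (- (real i *\<^sub>R One)) (real i *\<^sub>R One))" unfolding UN_box_eq_UNIV by simp
  then obtain n :: nat where "x \<in> box (- (real n *\<^sub>R One)) (real n *\<^sub>R One)" by blast
  then show ?case using elim by (auto simp: scaleR_minus_left)
 qed
qed

text \<open>Integrability of the limit is part of the conclusion, so this also proves membership of
  limits in the spaces. The bounds \<open>B k\<close> may vary as long as they converge.\<close>

lemma fatou_real:
 fixes h :: "nat => 'a => real"
 assumes [measurable]: "!!k. h k \<in> borel_measurable M" "g \<in> borel_measurable M"
  and nn: "!!k. AE x in M. 0 <= h k x"
  and lim: "AE x in M. (\<lambda>k. h k x) ----> g x"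
  and int: "!!k. integrable M (h k)" and le: "!!k. (\<integral>x. h k x \<partial>M) <= B k" and B: "B ----> L"
 shows "integrable M g" "(\<integral>x. g x \<partial>M) <= L"
proof -
 have g0: "AE x in M. 0 <= g x"
  using lim nn[unfolded AE_all_countable[symmetric]]
 proof -
  have "AE x in M. \<forall>k. 0 <= h k x" unfolding AE_all_countable using nn by blast
  with lim show ?thesis by eventually_elim (auto intro: LIMSEQ_le_const)
 qed
 have Bnn: "0 <= B k" for k using le[of k] integral_nonneg_AE[OF nn[of k]] by linarith
 have "(\<integral>\<^sup>+x. ennreal (g x) \<partial>M) = (\<integral>\<^sup>+x. liminf (\<lambda>k. ennreal (h k x)) \<partial>M)"
 proof (rule nn_integral_cong_AE)
  show "AE x in M. ennreal (g x) = liminf (\<lambda>k. ennreal (h k x))"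
   using lim by eventually_elim (metis lim_imp_Liminf sequentially_bot tendsto_ennrealI)
 qed
 also have "\<dots> <= liminf (\<lambda>k. \<integral>\<^sup>+x. ennreal (h k x) \<partial>M)" by (rule nn_integral_liminf) auto
 also have "\<dots> <= liminf (\<lambda>k. ennreal (B k))"
  using nn_integral_eq_integral[OF int nn] le by (intro Liminf_mono) (auto intro!: always_eventually ennreal_leI)
 also have "\<dots> = ennreal L" using B by (metis lim_imp_Liminf sequentially_bot tendsto_ennrealI)
 finally have *: "(\<integral>\<^sup>+x. ennreal (g x) \<partial>M) <= ennreal L" .
 show i: "integrable M g"
  by (rule integrableI_nonneg) (use g0 * in "auto simp: top_unique less_top[symmetric]")
 have "L >= 0" using Bnn B by (intro LIMSEQ_le_const) auto
 then show "(\<integral>x. g x \<partial>M) <= L"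
  using * nn_integral_eq_integral[OF i g0] by (simp add: ennreal_le_iff)
qed

section \<open>Square-integrable functions\<close>

text \<open>Borel functions and \<open>lborel\<close> are used throughout, where products,
  translations and iterated integrals are measurable without null-set arguments;
  \<open>L2_iff\<close> compares this with \<open>L2\<close>.\<close>

definition ltwo :: "('a::euclidean_space => 'b::euclidean_space) => bool" where
 "ltwo f \<longleftrightarrow> f \<in> BM & L1 (\<lambda>x. (norm (f x))^2)"

definition msq :: "('a::euclidean_space => 'b::euclidean_space) => real" where
 "msq f = (LBINT x. (norm (f x))^2)"

abbreviation (input) "l2lim F f \<equiv> (\<lambda>n. msq (\<lambda>x. F n x - f x)) \<longlonglongrightarrow> 0"

lemma ltwo_borel [measurable_dest]: "ltwo f ==> f \<in> BM" by (simp add: ltwo_def)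
lemma ltwo_int: "ltwo f ==> L1 (\<lambda>x. (norm (f x))^2)" by (simp add: ltwo_def)
lemma msq_nonneg [simp]: "0 <= msq f" by (simp add: msq_def)
lemma msq_real: "msq (f :: 'a::euclidean_space => real) = (LBINT x. (f x)^2)" by (simp add: msq_def)
lemma ltwo_int_real: "ltwo (f :: 'a::euclidean_space => real) ==> L1 (\<lambda>x. (f x)^2)"
 using ltwo_int[of f] by simp

lemma ltwo_bound:
 assumes "g \<in> BM" "L1 h" "AE x in lborel. (norm (g x))^2 <= h x"
 shows "ltwo g"
proof -
 have [measurable]: "g \<in> BM" by fact
 have "L1 (\<lambda>x. (norm (g x))^2)"
  by (rule integrable_dom[OF assms(2)]) (use assms(3) in auto)
 then show ?thesis using assms(1) by (simp add: ltwo_def)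
qed

lemma norm_add_sq: "(norm (a + b :: 'b::real_normed_vector))^2 <= 2 * (norm a)^2 + 2 * (norm b)^2"
proof -
 have "(norm (a + b))^2 <= (norm a + norm b)^2" by (intro power_mono norm_triangle_ineq) auto
 also have "\<dots> <= 2 * (norm a)^2 + 2 * (norm b)^2"
  using zero_le_power2[of "norm a - norm b"] by (simp add: power2_sum power2_diff)
 finally show ?thesis .
qed

lemma ltwo_dom:
 assumes "ltwo f" "g \<in> BM" "!!x. norm (g x) <= B * norm (f x)" shows "ltwo g"
 by (rule ltwo_bound[of _ "\<lambda>x. B^2 * (norm (f x))^2"])
  (use assms power_mono[OF assms(3) norm_ge_zero, of _ 2] in "auto simp: ltwo_def power_mult_distrib")

lemma ltwo_add: assumes "ltwo f" "ltwo g" shows "ltwo (\<lambda>x. f x + g x)"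
 by (rule ltwo_bound[of _ "\<lambda>x. 2 * (norm (f x))^2 + 2 * (norm (g x))^2"])
  (use assms in "auto simp: ltwo_def intro!: norm_add_sq")

lemma ltwo_scale: "ltwo f ==> ltwo (\<lambda>x. c *\<^sub>R f x)"
 by (auto simp: ltwo_def power_mult_distrib)

lemma ltwo_cmult: "ltwo (f :: _ => real) ==> ltwo (\<lambda>x. c * f x)" using ltwo_scale[of f c] by simp

lemma ltwo_minus: assumes "ltwo f" "ltwo g" shows "ltwo (\<lambda>x. f x - g x)"
 using ltwo_add[OF assms(1) ltwo_scale[OF assms(2), of "-1"]] by simp

lemma msq_scale: "msq (\<lambda>x. c *\<^sub>R f x) = c^2 * msq f"
 by (simp add: msq_def power_mult_distrib)

lemma msq_cmult: "msq (\<lambda>x. c * f x) = c^2 * msq (f :: _ => real)"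
 by (simp add: msq_def power_mult_distrib)

lemma msq_minus_commute: "msq (\<lambda>x. f x - g x) = msq (\<lambda>x. g x - f x)"
 by (simp add: msq_def norm_minus_commute)

lemma ltwo_norm_mult: assumes "ltwo f" "ltwo g" shows "L1 (\<lambda>x. norm (f x) * norm (g x))"
proof (rule integrable_dom)
 show "L1 (\<lambda>x. (norm (f x))^2 + (norm (g x))^2)" using assms by (auto simp: ltwo_def)
 have "norm a * norm b <= (norm a)^2 + (norm b)^2" for a :: 'b and b :: 'c
  using sum_squares_bound[of "norm a" "norm b"] mult_nonneg_nonneg[OF norm_ge_zero norm_ge_zero, of a b] by linarith
 then show "AE x in lborel. norm (norm (f x) * norm (g x)) <= norm ((norm (f x))^2 + (norm (g x))^2)" by auto
qed (use assms in measurable)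

lemma ltwo_inner: assumes "ltwo f" "ltwo g" shows "L1 (\<lambda>x. f x \<bullet> g x)"
 by (rule integrable_dom[OF ltwo_norm_mult[OF assms]])
  (use assms in "auto simp: Cauchy_Schwarz_ineq2")

lemma ltwo_mult: assumes "ltwo (f :: _ => real)" "ltwo (g :: _ => real)" shows "L1 (\<lambda>x. f x * g x)"
 using ltwo_inner[OF assms] by simp

lemma ltwo_component: assumes "ltwo f" shows "ltwo (\<lambda>x. f x \<bullet> e)"
 by (rule ltwo_dom[OF assms, of _ "norm e"]) (use assms in \<open>auto simp: ltwo_def Cauchy_Schwarz_ineq2 mult.commute[of "norm e"]\<close>)

lemma msq_inner_le: assumes "ltwo f" shows "msq (\<lambda>x. f x \<bullet> h) <= (norm h)^2 * msq f"
proof -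
 have "msq (\<lambda>x. f x \<bullet> h) <= (LBINT x. (norm h)^2 * (norm (f x))^2)" unfolding msq_def
 proof (rule integral_mono[OF ltwo_int[OF ltwo_component[OF assms]]])
  show "(norm (f x \<bullet> h))^2 <= (norm h)^2 * (norm (f x))^2" for x
   using Cauchy_Schwarz_ineq[of "f x" h] by (simp add: power2_norm_eq_inner mult.commute)
 qed (use assms in "simp add: ltwo_int")
 then show ?thesis by (simp add: msq_def)
qed

lemma msq_mono: assumes "ltwo f" "ltwo g" "!!x. norm (f x) <= norm (g x)" shows "msq f <= msq g"
 unfolding msq_def using assms by (intro integral_mono ltwo_int power_mono) auto

lemma msq_dominated:
 fixes f :: "nat => 'a::euclidean_space => 'b::euclidean_space"
 assumes f: "!!n. f n \<in> BM" and H: "ltwo H" and AE: "AE x in lborel. (\<lambda>n. f n x) ----> 0"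
  and le: "!!n x. norm (f n x) <= norm (H x)"
 shows "(\<lambda>n. msq (f n)) ----> 0"
proof -
 note [measurable] = f
 have "(\<lambda>n. LBINT x. (norm (f n x))^2) ----> (\<integral>x. 0 \<partial>(lborel::'a measure))"
 proof (rule integral_dominated_convergence[where w="\<lambda>x. (norm (H x))^2"])
  show "AE x in lborel. (\<lambda>n. (norm (f n x))^2) ----> 0" using AE
  proof eventually_elim
   case (elim x)
   have "(\<lambda>n. (norm (f n x))^2) ----> (norm (0::'b))^2" by (intro tendsto_intros elim)
   then show ?case by simp
  qed
 qed (use le H in "auto intro: power_mono ltwo_int")
 then show ?thesis by (simp add: msq_def)
qed

lemma msq_add: assumes "ltwo f" "ltwo g"
 shows "msq (\<lambda>x. f x + g x) = msq f + 2 * (LBINT x. f x \<bullet> g x) + msq g"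
proof -
 have "msq (\<lambda>x. f x + g x) = (LBINT x. (norm (f x))^2 + 2 * (f x \<bullet> g x) + (norm (g x))^2)"
  unfolding msq_def by (intro bochner_cong refl) (simp add: power2_norm_eq_inner inner_add inner_commute)
 then show ?thesis using assms ltwo_inner[OF assms] by (simp add: msq_def ltwo_def)
qed

lemma msq_add_scale: assumes "ltwo f" "ltwo g"
 shows "msq (\<lambda>x. f x + t *\<^sub>R g x) = msq f + 2 * t * (LBINT x. f x \<bullet> g x) + t^2 * msq g"
 using msq_add[OF assms(1) ltwo_scale[OF assms(2), of t]] by (simp add: msq_scale)

lemma msq_add_le: assumes "ltwo f" "ltwo g" shows "msq (\<lambda>x. f x + g x) <= 2 * msq f + 2 * msq g"
proof -
 have "msq (\<lambda>x. f x + g x) <= (LBINT x. 2 * (norm (f x))^2 + 2 * (norm (g x))^2)"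
  unfolding msq_def by (rule integral_mono) (use ltwo_add[OF assms] assms in "auto simp: ltwo_def intro: norm_add_sq")
 then show ?thesis using assms by (simp add: msq_def ltwo_def)
qed

lemma msq_minus_le: assumes "ltwo f" "ltwo g" shows "msq (\<lambda>x. f x - g x) <= 2 * msq f + 2 * msq g"
 using msq_add_le[OF assms(1) ltwo_scale[OF assms(2), of "-1"]] msq_scale[of "-1" g] by simp

lemma msq_triangle: assumes "ltwo f" "ltwo g" "ltwo h"
 shows "msq (\<lambda>x. f x - h x) <= 2 * msq (\<lambda>x. f x - g x) + 2 * msq (\<lambda>x. g x - h x)"
 using msq_add_le[OF ltwo_minus[OF assms(1,2)] ltwo_minus[OF assms(2,3)]] by simp

text \<open>Applied to \<open>msq (f + t g) \<ge> 0\<close> this is the Cauchy-Schwarz inequality.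
  With \<open>a = 0\<close> it forces \<open>b = 0\<close>, the form in which stationarity is
  extracted in \<open>riesz_subspace\<close>.\<close>

lemma quad_nonneg_disc:
 fixes a b c :: real assumes c: "c >= 0" and q: "!!t. 0 <= a + 2 * t * b + t^2 * c" shows "b^2 <= a * c"
proof (cases "c = 0")
 case True
 then have "b = 0" using q[of "- (a + 1) / (2 * b)"] by (cases "b = 0") (simp_all add: field_simps)
 with True show ?thesis by simp
next
 case False
 then show ?thesis using q[of "- b / c"] c by (simp add: field_simps power2_eq_square)
qed

lemma cauchy_schwarz: assumes "ltwo f" "ltwo g" shows "(LBINT x. f x \<bullet> g x)^2 <= msq f * msq g"
 by (rule quad_nonneg_disc) (simp_all add: msq_add_scale[OF assms, symmetric])

lemma cauchy_schwarz_abs: assumes "ltwo f" "ltwo g" shows "\<bar>LBINT x. f x \<bullet> g x\<bar> <= sqrt (msq f * msq g)"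
 using cauchy_schwarz[OF assms] by (simp add: real_le_rsqrt)

lemma inner_conv: assumes "!!n. ltwo (f n)" "ltwo g" "ltwo h" "l2lim f g"
 shows "(\<lambda>n. LBINT x. f n x \<bullet> h x) ----> (LBINT x. g x \<bullet> h x)"
proof -
 have "(\<lambda>n. (LBINT x. f n x \<bullet> h x) - (LBINT x. g x \<bullet> h x)) ----> 0"
 proof (rule Lim_null_comparison)
  show "\<forall>\<^sub>F n in sequentially. norm ((LBINT x. f n x \<bullet> h x) - (LBINT x. g x \<bullet> h x)) <= sqrt (msq (\<lambda>x. f n x - g x) * msq h)"
  proof (rule always_eventually, rule allI)
   fix n
   have "(LBINT x. f n x \<bullet> h x) - (LBINT x. g x \<bullet> h x) = (LBINT x. (f n x - g x) \<bullet> h x)"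
    using ltwo_inner[OF assms(1,3)] ltwo_inner[OF assms(2,3)] by (simp add: inner_diff_left)
   then show "norm ((LBINT x. f n x \<bullet> h x) - (LBINT x. g x \<bullet> h x)) <= sqrt (msq (\<lambda>x. f n x - g x) * msq h)"
    using cauchy_schwarz_abs[OF ltwo_minus[OF assms(1,2)] assms(3)] by simp
  qed
  have "(\<lambda>n. sqrt (msq (\<lambda>x. f n x - g x) * msq h)) ----> sqrt (0 * msq h)"
   by (intro tendsto_intros assms)
  then show "(\<lambda>n. sqrt (msq (\<lambda>x. f n x - g x) * msq h)) ----> 0" by simp
 qed
 then show ?thesis by (simp add: LIM_zero_iff)
qed

lemma msq_conv: assumes "!!n. ltwo (f n)" "ltwo g" "l2lim f g"
 shows "(\<lambda>n. msq (f n)) ----> msq g"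
proof -
 have eq: "msq (f n) = msq g + 2 * ((LBINT x. f n x \<bullet> g x) - msq g) + msq (\<lambda>x. f n x - g x)" for n
 proof -
  have "(LBINT x. g x \<bullet> (f n x - g x)) = (LBINT x. f n x \<bullet> g x) - msq g"
   using ltwo_inner[OF assms(1)[of n] assms(2)] ltwo_inner[OF assms(2) assms(2)]
   by (simp add: inner_diff_right inner_commute msq_def power2_norm_eq_inner)
  then show ?thesis using msq_add[OF assms(2) ltwo_minus[OF assms(1) assms(2)], of n] by simp
 qed
 have "(LBINT x. g x \<bullet> g x) = msq g" by (simp add: msq_def power2_norm_eq_inner)
 then have "(\<lambda>n. msq g + 2 * ((LBINT x. f n x \<bullet> g x) - msq g) + msq (\<lambda>x. f n x - g x)) ----> msq g + 2 * (msq g - msq g) + 0"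
  using inner_conv[OF assms(1,2,2,3)] assms(3) by (intro tendsto_intros) auto
 then show ?thesis using eq by simp
qed

text \<open>Riesz-Fischer. A subsequence whose increments \<open>D k\<close> have squared norm below
  \<open>(1/8)^k\<close> leaves room for the weight \<open>2^k\<close>: the sum of
  \<open>2^k * (D k)^2\<close> has finite integral, so it is finite almost everywhere and the
  subsequence converges there. Fatou's inequality then gives convergence in \<open>L^2\<close>, of
  the whole sequence because it is Cauchy.\<close>

lemma ltwo_complete:
 fixes f :: "nat => 'a::euclidean_space => 'b::euclidean_space"
 assumes f: "!!n. ltwo (f n)"
  and C: "!!e. e > 0 ==> \<exists>N. \<forall>m\<ge>N. \<forall>n\<ge>N. msq (\<lambda>x. f m x - f n x) < e"
 obtains g r where "ltwo g" "l2lim f g"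
  "strict_mono (r :: nat => nat)" "aelim (\<lambda>n. f (r n)) g"
proof -
 note [measurable] = ltwo_borel[OF f]
 have "\<exists>N. \<forall>m\<ge>N. \<forall>n\<ge>N. msq (\<lambda>x. f m x - f n x) < (1/8)^k" for k :: nat by (rule C) simp
 then obtain N where N: "!!k m n. m >= N k ==> n >= N k ==> msq (\<lambda>x. f m x - f n x) < (1/8)^k" by metis
 define r where "r k = (\<Sum>i\<le>k. Suc (N i))" for k
 have r: "strict_mono r" by (rule strict_mono_Suc_iff[THEN iffD2]) (simp add: r_def)
 have rN: "r k >= N k" for k unfolding r_def by (induction k) auto
 define D where "D k x = norm (f (r (Suc k)) x - f (r k) x)" for k x
 have [measurable]: "D k \<in> BM" for k unfolding D_def by measurable
 have Dint: "L1 (\<lambda>x. (D k x)^2)" and Dle: "(LBINT x. (D k x)^2) < (1/8)^k" for k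
 proof -
  show "L1 (\<lambda>x. (D k x)^2)" unfolding D_def using ltwo_minus[OF f f] by (simp add: ltwo_def)
  have "r (Suc k) >= N k" using rN[of k] r by (meson le_trans less_imp_le lessI strict_mono_less)
  then show "(LBINT x. (D k x)^2) < (1/8)^k"
   using N[of k "r (Suc k)" "r k"] rN[of k] by (simp add: msq_def D_def)
 qed
 have "(\<integral>\<^sup>+x. (\<Sum>k. ennreal (2^k * (D k x)^2)) \<partial>lborel) = (\<Sum>k. \<integral>\<^sup>+x. ennreal (2^k * (D k x)^2) \<partial>lborel)"
  by (rule nn_integral_suminf) auto
 also have "\<dots> <= (\<Sum>k. ennreal ((1/4)^k))"
 proof (intro suminf_le allI)
  fix k
  have "(\<integral>\<^sup>+x. ennreal (2^k * (D k x)^2) \<partial>lborel) = ennreal (2^k * (LBINT x. (D k x)^2))"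
   using Dint[of k] by (subst nn_integral_eq_integral) auto
  also have "\<dots> <= ennreal (2^k * (1/8)^k)" using Dle[of k] by (intro ennreal_leI) auto
  also have "2^k * (1/8)^k = (1/4::real)^k" by (simp flip: power_mult_distrib)
  finally show "(\<integral>\<^sup>+x. ennreal (2^k * (D k x)^2) \<partial>lborel) <= ennreal ((1/4)^k)" .
 qed auto
 also have "\<dots> = ennreal (\<Sum>k. (1/4)^k)" by (rule suminf_ennreal2) auto
 also have "\<dots> < \<infinity>" by simp
 finally have "(\<integral>\<^sup>+x. (\<Sum>k. ennreal (2^k * (D k x)^2)) \<partial>lborel) \<noteq> \<infinity>" by simp
 then have "AE x in lborel. (\<Sum>k. ennreal (2^k * (D k x)^2)) \<noteq> \<infinity>"
  by (intro nn_integral_noteq_infinite) auto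
 then have conv: "AE x in lborel. convergent (\<lambda>n. f (r n) x)"
 proof eventually_elim
  case (elim x)
  then have s: "summable (\<lambda>k. 2^k * (D k x)^2)"
   using summable_iff_suminf_neq_top[of "\<lambda>k. 2^k * (D k x)^2"] by auto
  \<comment> \<open>Completing a square: summability of the weighted squares becomes summability of
    the increments themselves.\<close>
  have "D k x <= (1/2)^k + 2^k * (D k x)^2" for k
  proof -
   have "0 <= 2^k * (D k x - (1/2)^k / 2)^2" by simp
   also have "\<dots> = 2^k * (D k x)^2 - D k x + (1/2)^k / 4"
    by (simp add: power2_diff algebra_simps power_mult_distrib power2_eq_square power_divide)
   finally show ?thesis using zero_le_power[of "1/2::real" k] by linarith
  qed
  moreover have "summable (\<lambda>k. (1/2)^k + 2^k * (D k x)^2)" by (intro summable_add summable_geometric s) auto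
  ultimately have "summable (\<lambda>k. D k x)"
   by (intro summable_comparison_test[of "\<lambda>k. D k x"]) (auto simp: D_def)
  then have "summable (\<lambda>k. f (r (Suc k)) x - f (r k) x)" unfolding D_def by (rule summable_norm_cancel)
  then have "convergent (\<lambda>n. (\<Sum>k<n. f (r (Suc k)) x - f (r k) x) + f (r 0) x)"
   by (intro convergent_add convergent_const) (simp add: summable_iff_convergent)
  then show ?case using sum_lessThan_telescope[of "\<lambda>k. f (r k) x"] by simp
 qed
 define g where "g x = lim (\<lambda>n. f (r n) x)" for x
 have [measurable]: "g \<in> BM" unfolding g_def[abs_def] by measurable
 have AE: "aelim (\<lambda>n. f (r n)) g"
  using conv by eventually_elim (simp add: g_def convergent_LIMSEQ_iff)
 have F: "L1 (\<lambda>x. (norm (f m x - g x))^2) & msq (\<lambda>x. f m x - g x) <= (1/8)^k" if "m >= N k" for m k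
 proof -
  have AE': "AE x in lborel. (\<lambda>n. (norm (f m x - f (r (n + k)) x))^2) ----> (norm (f m x - g x))^2"
   using AE by eventually_elim (auto intro!: tendsto_intros LIMSEQ_ignore_initial_segment)
  have "r (n + k) >= N k" for n
   using rN[of k] r by (meson le_add2 le_trans strict_mono_less_eq)
  then have le: "(LBINT x. (norm (f m x - f (r (n + k)) x))^2) <= (1/8)^k" for n
   using N[of k m "r (n+k)"] that by (simp add: msq_def less_imp_le)
  have i: "L1 (\<lambda>x. (norm (f m x - f (r (n + k)) x))^2)" for n
   using ltwo_minus[OF f f] by (simp add: ltwo_def)
  show ?thesis unfolding msq_def
   by (intro conjI; rule fatou_real[OF _ _ _ AE' i le tendsto_const]) auto
 qed
 have g: "ltwo g"
 proof -
  have "ltwo (\<lambda>x. f (N 0) x - g x)" using F[of 0 "N 0"] by (simp add: ltwo_def)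
  from ltwo_minus[OF f[of "N 0"] this] show ?thesis by simp
 qed
 have "l2lim f g"
 proof (rule LIMSEQ_I)
  fix e :: real assume "e > 0"
  then obtain k where k: "(1/8)^k < e" using real_arch_pow_inv[of e "1/8"] by auto
  show "\<exists>no. \<forall>n\<ge>no. norm (msq (\<lambda>x. f n x - g x) - 0) < e"
   by (rule exI[of _ "N k"]) (use F[of k] k in force)
 qed
 with g r AE that show ?thesis by blast
qed

section \<open>Riesz representation and density of test fields\<close>

text \<open>\<open>S\<close> is not assumed closed, so the representing function is the limit of a
  minimizing sequence of \<open>msq f / 2 - l f\<close> in \<open>S\<close>. The sequence is
  returned because it shows that \<open>g\<close> lies in the closure of \<open>S\<close>; inserting
  it in the bound on \<open>l\<close> yields \<open>msq g \<le> C\<close>.\<close>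

theorem riesz_subspace:
 fixes S :: "('a::euclidean_space => 'b::euclidean_space) set" and l :: "('a => 'b) => real"
 assumes S2: "!!f. f \<in> S ==> ltwo f" and S0: "(\<lambda>x. 0) \<in> S"
  and Sadd: "!!f g. f \<in> S ==> g \<in> S ==> (\<lambda>x. f x + g x) \<in> S"
  and Ssc: "!!f c. f \<in> S ==> (\<lambda>x. c *\<^sub>R f x) \<in> S"
  and ladd: "!!f g. f \<in> S ==> g \<in> S ==> l (\<lambda>x. f x + g x) = l f + l g"
  and lsc: "!!f c. f \<in> S ==> l (\<lambda>x. c *\<^sub>R f x) = c * l f"
  and lb: "!!f. f \<in> S ==> (l f)^2 <= C * msq f"
 obtains g \<phi> where "ltwo g" "!!n. \<phi> n \<in> S" "l2lim \<phi> g"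
  "!!f. f \<in> S ==> (LBINT x. g x \<bullet> f x) = l f" "C >= 0 ==> msq g <= C"
proof -
 define I where "I f = msq f / 2 - l f" for f
 have Ib: "I f >= - (1 + \<bar>C\<bar>) / 2" if "f \<in> S" for f
 proof -
  have "(l f)^2 <= \<bar>C\<bar> * msq f" using lb[OF that] mult_right_mono[of C "\<bar>C\<bar>" "msq f"] by (meson abs_ge_self msq_nonneg order_trans)
  also have "\<dots> <= ((\<bar>C\<bar> + msq f)/2)^2"
   using zero_le_power2[of "\<bar>C\<bar> - msq f"] by (simp add: power2_sum power2_diff field_simps)
  finally have "l f <= (\<bar>C\<bar> + msq f) / 2" by (rule power2_le_imp_le) simp
  then show ?thesis by (simp add: I_def field_simps)
 qed
 define m where "m = Inf (I ` S)"
 have bdd: "bdd_below (I ` S)" using Ib by (auto intro!: bdd_belowI[of _ "- (1 + \<bar>C\<bar>) / 2"])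
 have m: "m <= I f" if "f \<in> S" for f unfolding m_def using that bdd by (auto intro: cInf_lower)
 have "\<exists>f\<in>S. I f < m + 1 / real (Suc n)" for n
 proof -
  have "Inf (I ` S) < m + 1 / real (Suc n)" by (simp add: m_def)
  then show ?thesis using S0 bdd by (subst (asm) cInf_less_iff) auto
 qed
 then obtain \<phi> where \<phi>: "!!n. \<phi> n \<in> S" "!!n. I (\<phi> n) < m + 1 / real (Suc n)" by metis
 \<comment> \<open>Parallelogram law: \<open>4 * (I f + I g - 2 * I ?h)\<close> equals the squared
   distance of \<open>f\<close> and \<open>g\<close>, and the midpoint \<open>?h\<close> has
   \<open>I ?h \<ge> m\<close>.\<close>
 have par: "msq (\<lambda>x. f x - g x) <= 4 * (I f + I g - 2 * m)" if fg: "f \<in> S" "g \<in> S" for f g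
 proof -
  let ?h = "\<lambda>x. (1/2) *\<^sub>R (f x + g x)"
  have h: "?h \<in> S" using fg by (intro Ssc Sadd)
  have 1: "msq ?h = (1/4) * (msq f + 2 * (LBINT x. f x \<bullet> g x) + msq g)"
   using msq_scale[of "1/2" "\<lambda>x. f x + g x"] msq_add[OF S2 S2, OF fg] by (simp add: power_divide)
  have 2: "msq (\<lambda>x. f x - g x) = msq f - 2 * (LBINT x. f x \<bullet> g x) + msq g"
   using msq_add_scale[OF S2 S2, OF fg, of "-1"] by simp
  have 3: "l ?h = (l f + l g) / 2" using lsc[OF Sadd[OF fg], of "1/2"] ladd[OF fg] by simp
  have "I ?h >= m" by (rule m[OF h])
  then have 0: "m <= msq ?h / 2 - l ?h" unfolding I_def .
  have key: "d <= 4 * (p / 2 - a + (q / 2 - b) - 2 * m)"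
   if "m <= A / 2 - B" "A = (1/4) * (p + 2 * P + q)" "d = p - 2 * P + q" "B = (a + b) / 2" for A B p P q d a b :: real
   using that by (simp add: field_simps)
  show ?thesis unfolding I_def by (rule key[OF 0 1 2 3])
 qed
 have "\<exists>N. \<forall>i\<ge>N. \<forall>j\<ge>N. msq (\<lambda>x. \<phi> i x - \<phi> j x) < e" if e: "e > 0" for e
 proof -
  obtain N where N: "1 / real (Suc N) < e / 8" using e nat_approx_posE[of "e/8"] by auto
  show ?thesis
  proof (intro exI[of _ N] allI impI)
   fix i j assume ij: "i >= N" "j >= N"
   have "1 / real (Suc i) <= 1 / real (Suc N)" "1 / real (Suc j) <= 1 / real (Suc N)"
    using ij by (auto intro!: divide_left_mono)
   then show "msq (\<lambda>x. \<phi> i x - \<phi> j x) < e" using par[OF \<phi>(1) \<phi>(1), of i j] \<phi>(2)[of i] \<phi>(2)[of j] N by argo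
  qed
 qed
 with S2[OF \<phi>(1)] obtain g where g: "ltwo g" and lim: "l2lim \<phi> g"
  by (rule ltwo_complete[of \<phi>]) blast+
 have rep: "(LBINT x. g x \<bullet> f x) = l f" if f: "f \<in> S" for f
 proof -
  have ineq: "0 <= 0 + 2 * t * ((LBINT x. g x \<bullet> f x) - l f) + t^2 * msq f" for t
  proof -
   have *: "- 2 / real (Suc n) <= 2 * t * ((LBINT x. \<phi> n x \<bullet> f x) - l f) + t^2 * msq f" for n
   proof -
    have "m <= I (\<lambda>x. \<phi> n x + t *\<^sub>R f x)" by (intro m Sadd Ssc \<phi> f)
    also have "\<dots> = I (\<phi> n) + t * (LBINT x. \<phi> n x \<bullet> f x) + t^2 * msq f / 2 - t * l f"
     using msq_add_scale[OF S2[OF \<phi>(1)] S2[OF f], of n t] ladd[OF \<phi>(1) Ssc[OF f]] lsc[OF f]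
     by (simp add: I_def)
    finally show ?thesis using \<phi>(2)[of n] by (simp add: algebra_simps)
   qed
   have "(\<lambda>n. - 2 * (1 / real (Suc n))) ----> - 2 * 0"
    by (intro tendsto_mult tendsto_const lim_const_over_n[THEN LIMSEQ_Suc])
   moreover have "(\<lambda>n. 2 * t * ((LBINT x. \<phi> n x \<bullet> f x) - l f) + t^2 * msq f) ----> 2 * t * ((LBINT x. g x \<bullet> f x) - l f) + t^2 * msq f"
    by (intro tendsto_intros inner_conv lim g S2 \<phi> f)
   ultimately have "- 2 * 0 <= 2 * t * ((LBINT x. g x \<bullet> f x) - l f) + t^2 * msq f"
    by (rule LIMSEQ_le) (use * in auto)
   then show ?thesis by simp
  qed
  from quad_nonneg_disc[OF msq_nonneg this] show ?thesis by simp
 qed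
 have "msq g <= C" if C: "C >= 0"
 proof -
  have "(\<lambda>n. (LBINT x. \<phi> n x \<bullet> g x)^2) ----> (LBINT x. g x \<bullet> g x)^2"
   by (intro tendsto_intros inner_conv lim g S2 \<phi>)
  moreover have "(\<lambda>n. C * msq (\<phi> n)) ----> C * msq g"
   by (intro tendsto_intros msq_conv lim g S2 \<phi>)
  ultimately have "(LBINT x. g x \<bullet> g x)^2 <= C * msq g"
   by (rule LIMSEQ_le) (use rep[OF \<phi>(1)] lb[OF \<phi>(1)] in "auto simp: inner_commute")
  moreover have "(LBINT x. g x \<bullet> g x) = msq g" by (simp add: msq_def power2_norm_eq_inner)
  ultimately have "msq g * msq g <= C * msq g" by (simp add: power2_eq_square)
  then show ?thesis using C msq_nonneg[of g] by (cases "msq g = 0") (auto simp: mult_le_cancel_right)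
 qed
 with that g \<phi>(1) lim rep show ?thesis by blast
qed

definition test_field :: "('a::euclidean_space => 'b::euclidean_space) => bool" where
 "test_field F \<longleftrightarrow> (\<forall>e\<in>Basis. test_function (\<lambda>x. F x \<bullet> e))"

lemma test_field_add: "test_field F ==> test_field G ==> test_field (\<lambda>x. F x + G x)"
 by (auto simp: test_field_def inner_add_left intro: test_add)
lemma test_field_scale: "test_field F ==> test_field (\<lambda>x. c *\<^sub>R F x)"
 by (auto simp: test_field_def intro: test_cmult)
lemma test_field_zero: "test_field (\<lambda>x. 0)" by (simp add: test_field_def test_zero)
lemma test_field_borel: "test_field F ==> F \<in> BM"
proof -
 assume F: "test_field F"
 have [measurable]: "(\<lambda>x. F x \<bullet> e) \<in> BM" if "e \<in> Basis" for e using F that by (auto simp: test_field_def)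
 have "(\<lambda>x. \<Sum>e\<in>Basis. (F x \<bullet> e) *\<^sub>R e) \<in> BM" by measurable
 then show ?thesis by (simp add: euclidean_representation)
qed
lemma test_ltwo: "test_function \<phi> ==> ltwo \<phi>"
 using test_integrable[OF test_mult[of \<phi> \<phi>]] by (simp add: ltwo_def power2_eq_square)
lemma test_field_ltwo: "test_field F ==> ltwo F"
proof -
 assume F: "test_field F"
 have "ltwo (\<lambda>x. (F x \<bullet> e) *\<^sub>R e)" if "e \<in> Basis" for e
  using test_ltwo[of "\<lambda>x. F x \<bullet> e"] F that by (auto simp: ltwo_def test_field_def)
 then have "L1 (\<lambda>x. \<Sum>e\<in>Basis. (F x \<bullet> e)^2)" by (intro Bochner_Integration.integrable_sum) (auto simp: ltwo_def)
 then show ?thesis using test_field_borel[OF F] unfolding ltwo_def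
  by (simp add: norm_eq_sqrt_inner euclidean_inner[of "F _" "F _"] power2_eq_square sum_nonneg)
qed

lemma ltwo_locally_integrable:
 assumes "ltwo (g :: 'a::euclidean_space => 'b::euclidean_space)" shows "L1 (\<lambda>x. indicator (cball 0 R) x *\<^sub>R g x)"
proof -
 have "(indicator (cball 0 R) :: 'a => real) \<in> BM" by (intro borel_measurable_indicator) auto
 moreover have "L1 (indicator (cball 0 R) :: 'a => real)"
  using integrable_cball[of 1 R] by simp
 moreover have "(\<lambda>x. (indicator (cball 0 R) x)^2) = (indicator (cball 0 R) :: 'a => real)" by (auto split: split_indicator)
 ultimately have "ltwo (indicator (cball 0 R) :: 'a => real)" by (simp add: ltwo_def)
 have [measurable]: "cball (0::'a) R \<in> sets borel" by simp
 from ltwo_norm_mult[OF \<open>ltwo (indicator (cball 0 R))\<close> assms]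
 show ?thesis by (rule integrable_dom) (use assms in "auto split: split_indicator")
qed

lemma fundamental_ltwo:
 assumes g: "ltwo (g :: 'a::euclidean_space => 'b::euclidean_space)" and z: "!!\<phi> e. e \<in> Basis ==> test_function \<phi> ==> (LBINT x. \<phi> x * (g x \<bullet> e)) = 0"
 shows "AE x in lborel. g x = 0"
proof -
 have "AE x in lborel. g x \<bullet> e = 0" if e: "e \<in> Basis" for e
 proof (rule fundamental_lemma)
  show "L1 (\<lambda>x. indicator (cball 0 R) x * (g x \<bullet> e))" for R
   using ltwo_locally_integrable[OF ltwo_component[OF g]] by simp
 qed (use g z[OF e] in "auto simp: ltwo_def")
 then have "AE x in lborel. \<forall>e\<in>Basis. g x \<bullet> e = 0" by (intro AE_finite_allI) auto
 then show ?thesis by eventually_elim (simp add: euclidean_all_zero_iff)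
qed

text \<open>Riesz representation of the pairing with \<open>f\<close> on test fields produces some
  \<open>g\<close> in their closure. The difference \<open>g - f\<close> is orthogonal to all test
  fields, so \<open>g = f\<close> almost everywhere and the approximants of \<open>g\<close> serve
  for \<open>f\<close>.\<close>

theorem test_field_dense:
 assumes f: "ltwo (f :: 'a::euclidean_space => 'b::euclidean_space)"
 obtains \<phi> where "!!n. test_field (\<phi> n)" "l2lim \<phi> f"
proof -
 define l where "l F = (LBINT x. f x \<bullet> F x)" for F :: "'a => 'b"
 have i: "test_field F ==> L1 (\<lambda>x. f x \<bullet> F x)" for F using f test_field_ltwo ltwo_inner by blast
 obtain g \<phi> where g: "ltwo g" and \<phi>: "!!n. \<phi> n \<in> Collect test_field" "l2lim \<phi> g"
  and rep: "!!F. F \<in> Collect test_field ==> (LBINT x. g x \<bullet> F x) = l F"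
 proof (rule riesz_subspace[of "Collect test_field" l "msq f"])
  show "(l F)^2 <= msq f * msq F" if "F \<in> Collect test_field" for F
   unfolding l_def using that by (intro cauchy_schwarz f test_field_ltwo) auto
 qed (auto simp: test_field_ltwo test_field_zero test_field_add test_field_scale l_def inner_add_right i)
 have "AE x in lborel. g x - f x = 0"
 proof (rule fundamental_ltwo)
  fix \<phi> :: "'a => real" and e :: 'b assume *: "test_function \<phi>" "e \<in> Basis"
  then have F: "test_field (\<lambda>x. \<phi> x *\<^sub>R e)" by (auto simp: test_field_def inner_Basis test_zero)
  have "(LBINT x. g x \<bullet> (\<phi> x *\<^sub>R e)) = (LBINT x. f x \<bullet> (\<phi> x *\<^sub>R e))" using rep[of "\<lambda>x. \<phi> x *\<^sub>R e"] F by (simp only: l_def mem_Collect_eq)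
  moreover have "L1 (\<lambda>x. g x \<bullet> (\<phi> x *\<^sub>R e))" "L1 (\<lambda>x. f x \<bullet> (\<phi> x *\<^sub>R e))"
   using F g f test_field_ltwo ltwo_inner by blast+
  ultimately show "(LBINT x. \<phi> x * ((g x - f x) \<bullet> e)) = 0"
   by (simp add: inner_diff_left right_diff_distrib)
 qed (intro ltwo_minus g f)
 then have "msq (\<lambda>x. \<phi> n x - f x) = msq (\<lambda>x. \<phi> n x - g x)" for n
 proof -
  have [measurable]: "\<phi> n \<in> BM" "g \<in> BM" "f \<in> BM"
   using \<phi>(1)[of n] test_field_borel g f by (auto simp: ltwo_def)
  have "AE x in lborel. (norm (\<phi> n x - f x))^2 = (norm (\<phi> n x - g x))^2"
   using \<open>AE x in lborel. g x - f x = 0\<close> by eventually_elim simp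
  then show ?thesis unfolding msq_def by (intro integral_cong_AE) auto
 qed
 then show ?thesis using that[of \<phi>] \<phi> by simp
qed

section \<open>Affine changes of variables and Taylor estimates for test functions\<close>

lemma nn_integral_affine:
 fixes f :: "'a::euclidean_space => ennreal"
 assumes [measurable]: "f \<in> BM" and c: "c \<noteq> 0"
 shows "(\<integral>\<^sup>+x. f x \<partial>lborel) = ennreal (\<bar>c\<bar> ^ DIM('a)) * (\<integral>\<^sup>+x. f (t + c *\<^sub>R x) \<partial>lborel)"
 by (subst lborel_affine[OF c, of t]) (simp add: nn_integral_density nn_integral_distr nn_integral_cmult)

lemma has_bochner_integral_affine:
 fixes f :: "'a::euclidean_space => 'b::euclidean_space"
 assumes [measurable]: "f \<in> BM" and c: "c \<noteq> 0"
 shows "L1 (\<lambda>x. f (t + c *\<^sub>R x)) \<longleftrightarrow> L1 f"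
  "(LBINT x. f x) = (\<bar>c\<bar> ^ DIM('a)) *\<^sub>R (LBINT x. f (t + c *\<^sub>R x))"
proof -
 have "L1 f \<longleftrightarrow> integrable (density (distr lborel borel (\<lambda>x. t + c *\<^sub>R x)) (\<lambda>_. ennreal (\<bar>c\<bar> ^ DIM('a)))) f"
  using lborel_affine[OF c, of t] by (simp add: ennreal_power)
 also have "\<dots> \<longleftrightarrow> L1 (\<lambda>x. f (t + c *\<^sub>R x))"
 proof -
  have "L1 (\<lambda>x. k *\<^sub>R g x) \<longleftrightarrow> L1 g" if "k \<noteq> 0" for k and g :: "'a => 'b"
   using integrable_scaleR_right[of "inverse k" lborel "\<lambda>x. k *\<^sub>R g x"] that by auto
  then show ?thesis using c by (subst integrable_density) (auto simp: integrable_distr_eq)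
 qed
 finally show "L1 (\<lambda>x. f (t + c *\<^sub>R x)) \<longleftrightarrow> L1 f" ..
 have "(LBINT x. f x) = (\<integral>x. f x \<partial>density (distr lborel borel (\<lambda>x. t + c *\<^sub>R x)) (\<lambda>_. ennreal (\<bar>c\<bar> ^ DIM('a))))"
  using lborel_affine[OF c, of t] by (simp add: ennreal_power)
 also have "\<dots> = (\<bar>c\<bar> ^ DIM('a)) *\<^sub>R (LBINT x. f (t + c *\<^sub>R x))"
  using c by (subst integral_density) (auto simp: integral_distr)
 finally show "(LBINT x. f x) = (\<bar>c\<bar> ^ DIM('a)) *\<^sub>R (LBINT x. f (t + c *\<^sub>R x))" .
qed

lemma integral_translate:
 fixes f :: "'a::euclidean_space => 'b::euclidean_space"
 assumes "f \<in> BM"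
 shows "L1 (\<lambda>x. f (x + t)) \<longleftrightarrow> L1 f" "(LBINT x. f (x + t)) = (LBINT x. f x)"
 using has_bochner_integral_affine[OF assms, of 1 t] by (simp_all add: add.commute)

lemma nn_integral_translate:
 fixes f :: "'a::euclidean_space => ennreal"
 assumes "f \<in> BM" shows "(\<integral>\<^sup>+x. f (x + t) \<partial>lborel) = (\<integral>\<^sup>+x. f x \<partial>lborel)"
 using nn_integral_affine[OF assms, of 1 t] by (simp add: add.commute)

lemma integral_reflect_pt:
 fixes f :: "'a::euclidean_space => 'b::euclidean_space"
 assumes "f \<in> BM"
 shows "L1 (\<lambda>x. f (t - x)) \<longleftrightarrow> L1 f" "(LBINT x. f (t - x)) = (LBINT x. f x)"
 using has_bochner_integral_affine[OF assms, of "-1" t] by simp_all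

lemma ltwo_translate: assumes "ltwo f" shows "ltwo (\<lambda>x. f (x + t))"
proof -
 note [measurable] = ltwo_borel[OF assms(1)]
 show ?thesis using assms integral_translate(1)[of "\<lambda>x. (norm (f x))^2" t] by (simp add: ltwo_def)
qed

lemma msq_translate: assumes "ltwo f" shows "msq (\<lambda>x. f (x + t)) = msq f"
proof -
 note [measurable] = ltwo_borel[OF assms(1)]
 show ?thesis using integral_translate(2)[of "\<lambda>x. (norm (f x))^2" t] by (simp add: msq_def)
qed

lemma ltwo_dilate: fixes f :: "'a::euclidean_space => 'b::euclidean_space"
 assumes "ltwo f" "c \<noteq> 0" shows "ltwo (\<lambda>x. f (c *\<^sub>R x))" "msq f = \<bar>c\<bar> ^ DIM('a) * msq (\<lambda>x. f (c *\<^sub>R x))"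
proof -
 note [measurable] = ltwo_borel[OF assms(1)]
 show "ltwo (\<lambda>x. f (c *\<^sub>R x))" "msq f = \<bar>c\<bar> ^ DIM('a) * msq (\<lambda>x. f (c *\<^sub>R x))"
  using assms has_bochner_integral_affine[of "\<lambda>x. (norm (f x))^2" c 0] by (auto simp add: ltwo_def msq_def)
qed

lemma sum_Basis_delta: "e \<in> Basis ==> (\<Sum>i\<in>Basis. (e \<bullet> i) * f i) = (f e :: real)"
proof -
 assume e: "e \<in> Basis"
 have "(\<Sum>i\<in>Basis. (e \<bullet> i) * f i) = (\<Sum>i\<in>Basis. if i = e then f i else 0)"
  using e by (intro sum.cong) (auto simp: inner_Basis)
 then show ?thesis using e by simp
qed

lemma grad_inner: "grad f x \<bullet> h = (\<Sum>e\<in>Basis. (h \<bullet> e) * pd e f x)"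
 unfolding grad_pd inner_sum_left by (intro sum.cong refl) (simp add: inner_commute)

lemma onorm_inner_le: assumes "norm (a :: 'a::euclidean_space) <= B" shows "onorm (\<lambda>h. a \<bullet> h) <= B"
proof (rule onorm_le)
 fix h show "norm (a \<bullet> h) <= B * norm h"
  using Cauchy_Schwarz_ineq2[of a h] mult_right_mono[OF assms norm_ge_zero[of h]] by simp
qed

lemma test_lipschitz: assumes "test_function \<phi>" obtains L where "L > 0" "!!x y. \<bar>\<phi> x - \<phi> y\<bar> <= L * norm (x - y)"
proof -
 obtain B where B: "B > 0" "!!x. norm (grad \<phi> x) <= B" using test_grad_bounded[OF assms] by metis
 have "norm (\<phi> x - \<phi> y) <= B * norm (x - y)" for x y
 proof (rule differentiable_bound[of UNIV \<phi> "\<lambda>x h. grad \<phi> x \<bullet> h"])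
  show "onorm (\<lambda>h. grad \<phi> z \<bullet> h) <= B" for z
   by (rule onorm_inner_le) (rule B)
  show "(\<phi> has_derivative (\<lambda>h. grad \<phi> z \<bullet> h)) (at z within UNIV)" for z
   by (rule test_has_derivative[OF assms])
 qed simp_all
 then show ?thesis using that[OF B(1)] by (simp only: real_norm_def)
qed

text \<open>On the segment from \<open>x\<close> to \<open>x + h\<close> the function minus its
  linearization has gradient at most \<open>L * |h|\<close>, whence the quadratic remainder. The
  second bound confines the remainder to a fixed ball for \<open>|h| \<le> 1\<close>, so its
  integral is quadratic in \<open>h\<close> as well.\<close>

lemma test_taylor:
 fixes \<phi> :: "'a::euclidean_space => real"
 assumes "test_function \<phi>"
 obtains L R where "L > 0" "R > 0" "!!x h. \<bar>\<phi> (x + h) - \<phi> x - grad \<phi> x \<bullet> h\<bar> <= L * (norm h)^2"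
  "!!x h. norm h <= 1 ==> norm x > R ==> \<phi> (x + h) - \<phi> x - grad \<phi> x \<bullet> h = 0"
proof -
 have "\<exists>L>0. \<forall>x y. \<bar>pd e \<phi> x - pd e \<phi> y\<bar> <= L * norm (x - y)" if "e \<in> Basis" for e
  using test_lipschitz[OF test_pd[OF assms that]] by metis
 then obtain Le where Le: "!!e. e \<in> Basis ==> Le e > 0" "!!e x y. e \<in> Basis ==> \<bar>pd e \<phi> x - pd e \<phi> y\<bar> <= Le e * norm (x - y)" by metis
 define L where "L = (\<Sum>e\<in>Basis. Le e)"
 have L0: "L > 0" unfolding L_def using Le by (intro sum_pos) auto
 have gl: "norm (grad \<phi> x - grad \<phi> y) <= L * norm (x - y)" for x y
 proof -
  have "norm (grad \<phi> x - grad \<phi> y) <= (\<Sum>e\<in>Basis. \<bar>(grad \<phi> x - grad \<phi> y) \<bullet> e\<bar>)" by (rule norm_le_l1)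
  also have "\<dots> <= (\<Sum>e\<in>Basis. Le e * norm (x - y))"
   by (intro sum_mono) (simp add: inner_diff_left grad_inner_Basis Le)
  finally show ?thesis by (simp add: L_def sum_distrib_right)
 qed
 obtain R1 where R1: "!!x. norm x > R1 ==> \<phi> x = 0" using assms by (auto simp: test_function_iff)
 obtain R2 where R2: "!!x. norm x > R2 ==> grad \<phi> x = 0" using test_grad_bounded[OF assms] by metis
 show ?thesis
 \<comment> \<open>The margin in \<open>R1 + 1\<close> keeps \<open>x + h\<close> outside the
   support for \<open>|h| \<le> 1\<close>.\<close>
 proof (rule that[OF L0, of "max 1 (max (R1 + 1) R2)"])
  fix x h
  let ?f = "\<lambda>y. \<phi> y - grad \<phi> x \<bullet> y"
  have "norm (?f (x + h) - ?f x) <= (L * norm h) * norm ((x + h) - x)"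
  proof (rule differentiable_bound[of "closed_segment x (x + h)" ?f "\<lambda>y k. (grad \<phi> y - grad \<phi> x) \<bullet> k"])
   fix y assume y: "y \<in> closed_segment x (x + h)"
   show "(?f has_derivative (\<lambda>k. (grad \<phi> y - grad \<phi> x) \<bullet> k)) (at y within closed_segment x (x + h))"
    unfolding inner_diff_left
    by (rule has_derivative_at_withinI[OF has_derivative_diff[OF test_has_derivative[OF assms]
       bounded_linear_imp_has_derivative[OF bounded_linear_inner_right]]])
   have "norm (y - x) <= norm h" using segment_bound(1)[OF y] by (simp add: norm_minus_commute)
   then have "norm (grad \<phi> y - grad \<phi> x) <= L * norm h"
    using gl[of y x] L0 by (meson mult_left_mono order_trans less_imp_le)
   then show "onorm (\<lambda>k. (grad \<phi> y - grad \<phi> x) \<bullet> k) <= L * norm h"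
    by (rule onorm_inner_le)
  qed auto
  then show "\<bar>\<phi> (x + h) - \<phi> x - grad \<phi> x \<bullet> h\<bar> <= L * (norm h)^2"
   by (simp add: inner_add_right power2_eq_square algebra_simps)
 next
  fix x h :: 'a assume h: "norm h <= 1" and x: "norm x > max 1 (max (R1 + 1) R2)"
  have "norm (x + h) > R1" using norm_diff_ineq[of x h] h x by linarith
  then show "\<phi> (x + h) - \<phi> x - grad \<phi> x \<bullet> h = 0" using x h R1 R2 by simp
 qed simp
qed

lemma integral_bound_ball:
 fixes f :: "'a::euclidean_space => real"
 assumes [measurable]: "f \<in> BM" and B: "!!x. \<bar>f x\<bar> <= B" and R: "!!x. norm x > R ==> f x = 0"
 shows "\<bar>LBINT x. f x\<bar> <= B * measure lborel (cball (0::'a) R)"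
proof -
 have "\<bar>LBINT x. f x\<bar> <= (LBINT x. \<bar>f x\<bar>)" using integral_norm_bound[of lborel f] by simp
 also have "\<dots> <= (LBINT x. B * indicator (cball (0::'a) R) x)"
 proof (rule integral_mono)
  show "L1 (\<lambda>x. \<bar>f x\<bar>)" using integrable_bounded_support[of f B R] B R by auto
  show "L1 (\<lambda>x::'a. B * indicator (cball 0 R) x)" by (rule integrable_cball)
  show "\<bar>f x\<bar> <= B * indicator (cball 0 R) x" for x using B[of x] R[of x] by (cases "norm x > R") auto
 qed
 also have "\<dots> = B * measure lborel (cball (0::'a) R)" using integrable_cball[of 1 R, where 'a='a] by simp
 finally show ?thesis .
qed

text \<open>By translation invariance \<open>\<phi> (x + t e) - \<phi> x\<close> has integral zero.
  Its linear part is \<open>t\<close> times the integral in question and the remainder is of order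
  \<open>t^2\<close>, so division by \<open>t\<close> leaves zero.\<close>

lemma test_pd_integral_0:
 assumes \<phi>: "test_function \<phi>" and e: "e \<in> Basis" shows "(LBINT x. pd e \<phi> x) = 0"
proof -
 obtain L R where L: "L > 0" "R > 0" "!!x h. \<bar>\<phi> (x + h) - \<phi> x - grad \<phi> x \<bullet> h\<bar> <= L * (norm h)^2"
  "!!x h. norm h <= 1 ==> norm x > R ==> \<phi> (x + h) - \<phi> x - grad \<phi> x \<bullet> h = 0" using test_taylor[OF \<phi>] by metis
 let ?V = "measure lborel (cball (0::'a) R)"
 have [measurable]: "\<phi> \<in> BM" "pd e \<phi> \<in> BM" using \<phi> test_pd[OF \<phi> e] by auto
 have bd: "t * \<bar>LBINT x. pd e \<phi> x\<bar> <= L * t^2 * ?V" if t: "0 < t" "t <= 1" for t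
 proof -
  have i: "L1 \<phi>" "L1 (\<lambda>x. \<phi> (x + t *\<^sub>R e))" "L1 (\<lambda>x. t * pd e \<phi> x)"
   using test_integrable \<phi> test_translate test_pd[OF \<phi> e] by auto
  have "(LBINT x. \<phi> (x + t *\<^sub>R e) - \<phi> x - t * pd e \<phi> x) = - (t * (LBINT x. pd e \<phi> x))"
   using i by (simp add: integral_translate)
  then have "t * \<bar>LBINT x. pd e \<phi> x\<bar> = \<bar>LBINT x. \<phi> (x + t *\<^sub>R e) - \<phi> x - t * pd e \<phi> x\<bar>"
   using t by (simp add: abs_mult)
  also have "\<dots> <= L * t^2 * ?V"
  proof (rule integral_bound_ball)
   have eq: "\<phi> (x + t *\<^sub>R e) - \<phi> x - t * pd e \<phi> x = \<phi> (x + t *\<^sub>R e) - \<phi> x - grad \<phi> x \<bullet> (t *\<^sub>R e)" for x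
    using e by (simp add: grad_inner_Basis)
   show "\<bar>\<phi> (x + t *\<^sub>R e) - \<phi> x - t * pd e \<phi> x\<bar> <= L * t^2" for x
    unfolding eq using L(3)[of x "t *\<^sub>R e"] e by (simp add: power_mult_distrib)
   show "\<phi> (x + t *\<^sub>R e) - \<phi> x - t * pd e \<phi> x = 0" if "norm x > R" for x
    unfolding eq using e t that by (intro L(4)) auto
  qed measurable
  finally show ?thesis .
 qed
 have "\<bar>LBINT x. pd e \<phi> x\<bar> <= 0"
 proof (rule LIMSEQ_le_const)
  show "(\<lambda>n. L * ?V * (1 / real (Suc n))) ----> 0"
   using tendsto_mult[OF tendsto_const lim_const_over_n[THEN LIMSEQ_Suc, of 1], of "L * ?V"] by simp
  have "\<bar>LBINT x. pd e \<phi> x\<bar> <= L * ?V * t" if t: "0 < t" "t <= 1" for t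
  proof -
   have "t * \<bar>LBINT x. pd e \<phi> x\<bar> <= t * (L * ?V * t)" using bd[OF t] by (simp add: power2_eq_square mult_ac)
   then show ?thesis using t by (simp only: mult_le_cancel_left_pos)
  qed
  from this[of "1 / real (Suc n)" for n]
  show "\<exists>N. \<forall>n\<ge>N. \<bar>LBINT x. pd e \<phi> x\<bar> <= L * ?V * (1 / real (Suc n))"
   by (intro exI[of _ 0] allI impI) simp
 qed
 then show ?thesis by simp
qed

lemma test_field_grad: "test_function \<phi> ==> test_field (grad \<phi>)"
 by (auto simp: test_field_def grad_inner_Basis test_pd cong: if_cong)

lemma grad_ltwo: "test_function \<phi> ==> ltwo (grad \<phi>)" by (intro test_field_ltwo test_field_grad)

text \<open>Nonnegativity of the variance of \<open>f\<close> under the probability density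
  \<open>K\<close>.\<close>

lemma jensen_sq:
 fixes f :: "'a::euclidean_space => 'b::euclidean_space"
 assumes K: "!!z. K z >= 0" "L1 K" "(LBINT z. K z) = 1"
  and i1: "L1 (\<lambda>z. K z *\<^sub>R f z)" and i2: "L1 (\<lambda>z. K z * (norm (f z))^2)"
 shows "(norm (LBINT z. K z *\<^sub>R f z))^2 <= (LBINT z. K z * (norm (f z))^2)"
proof -
 let ?m = "LBINT z. K z *\<^sub>R f z"
 have "0 <= (LBINT z. K z * (norm (f z - ?m))^2)" using K(1) by (intro integral_nonneg_AE) simp
 also have "\<dots> = (LBINT z. K z * (norm (f z))^2 - 2 * ((K z *\<^sub>R f z) \<bullet> ?m) + K z * (norm ?m)^2)"
  by (intro bochner_cong refl)
   (simp add: power2_norm_eq_inner inner_diff inner_commute algebra_simps)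
 also have "\<dots> = (LBINT z. K z * (norm (f z))^2) - 2 * (?m \<bullet> ?m) + (norm ?m)^2"
 proof -
  have i3: "L1 (\<lambda>z. (K z *\<^sub>R f z) \<bullet> ?m)" "(LBINT z. (K z *\<^sub>R f z) \<bullet> ?m) = ?m \<bullet> ?m"
   using i1 by (auto simp del: inner_scaleR_left)
  show ?thesis using i2 i3 K by (simp del: inner_scaleR_left)
 qed
 finally show ?thesis by (simp add: power2_norm_eq_inner)
qed

text \<open>The difference is the average over \<open>t\<close> in \<open>[0,1]\<close> of
  \<open>grad \<phi> (x + t h) \<bullet> h\<close>; Jensen's inequality, exchange of the integrals
  and translation invariance give the constant one.\<close>

lemma test_translation_bound:
 fixes \<phi> :: "'a::euclidean_space => real"
 assumes \<phi>: "test_function \<phi>"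
 shows "msq (\<lambda>x. \<phi> (x + h) - \<phi> x) <= msq (\<lambda>x. grad \<phi> x \<bullet> h)"
proof -
 have [measurable]: "grad \<phi> \<in> BM" "\<phi> \<in> BM" using \<phi> test_grad_borel by auto
 have gcont: "continuous_on UNIV (\<lambda>x. grad \<phi> x \<bullet> h)"
  unfolding grad_inner using test_pd[OF \<phi>] test_continuous by (intro continuous_intros) blast
 have "(\<integral>\<^sup>+x. ennreal ((\<phi> (x + h) - \<phi> x)^2) \<partial>lborel) <= (\<integral>\<^sup>+x. \<integral>\<^sup>+t. ennreal (indicator {0..1} t * (grad \<phi> (x + t *\<^sub>R h) \<bullet> h)^2) \<partial>lborel \<partial>lborel)"
 proof (rule nn_integral_mono)
  fix x
  let ?f = "\<lambda>t. grad \<phi> (x + t *\<^sub>R h) \<bullet> h"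
  have cf: "continuous_on A ?f" for A
   by (rule continuous_on_compose2[OF gcont]) (auto intro!: continuous_intros)
  have FTC: "(LBINT t. indicator {0..1} t *\<^sub>R ?f t) = \<phi> (x + 1 *\<^sub>R h) - \<phi> (x + 0 *\<^sub>R h)"
  proof (rule integral_FTC_Icc)
   fix t :: real
   have "((\<lambda>t. x + t *\<^sub>R h) has_derivative (\<lambda>s. s *\<^sub>R h)) (at t)" by (auto intro!: derivative_eq_intros)
   from has_derivative_compose[OF this test_has_derivative[OF \<phi>]]
   have "((\<lambda>t. \<phi> (x + t *\<^sub>R h)) has_vector_derivative ?f t) (at t)"
    by (simp add: has_vector_derivative_def)
   then show "((\<lambda>t. \<phi> (x + t *\<^sub>R h)) has_vector_derivative ?f t) (at t within {0..1})"
    by (rule has_vector_derivative_at_within)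
  qed (auto intro: cf)
  have i1: "L1 (\<lambda>t. indicator {0..1::real} t *\<^sub>R ?f t)"
   by (rule borel_integrable_compact) (auto intro: cf)
  have i2: "L1 (\<lambda>t. indicator {0..1::real} t * (?f t)^2)"
  proof -
   have "continuous_on {0..1} (\<lambda>t. (?f t)^2)" by (intro continuous_on_power cf)
   from borel_integrable_compact[OF _ this] show ?thesis by simp
  qed
  have "(norm (LBINT t. indicator {0..1} t *\<^sub>R ?f t))^2 <= (LBINT t. indicator {0..1} t * (norm (?f t))^2)"
   by (rule jensen_sq) (use i1 i2 in auto)
  then have "(\<phi> (x + h) - \<phi> x)^2 <= (LBINT t. indicator {0..1} t * (?f t)^2)" unfolding FTC by simp
  then show "ennreal ((\<phi> (x + h) - \<phi> x)^2) <= (\<integral>\<^sup>+t. ennreal (indicator {0..1} t * (?f t)^2) \<partial>lborel)"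
   using i2 by (subst nn_integral_eq_integral) (auto intro!: ennreal_leI)
 qed
 also have "\<dots> = (\<integral>\<^sup>+t. \<integral>\<^sup>+x. ennreal (indicator {0..1} t * (grad \<phi> (x + t *\<^sub>R h) \<bullet> h)^2) \<partial>lborel \<partial>lborel)"
  by (rule lborel_pair.Fubini') measurable
 also have "\<dots> = (\<integral>\<^sup>+t. ennreal (msq (\<lambda>x. grad \<phi> x \<bullet> h)) * indicator {0..1::real} t \<partial>lborel)"
 proof (rule nn_integral_cong)
  fix t :: real
  have l: "ltwo (\<lambda>x. grad \<phi> x \<bullet> h)" by (intro ltwo_component grad_ltwo \<phi>)
  have "(\<integral>\<^sup>+x. ennreal (indicator {0..1} t * (grad \<phi> (x + t *\<^sub>R h) \<bullet> h)^2) \<partial>lborel) = indicator {0..1} t * (\<integral>\<^sup>+x. ennreal ((grad \<phi> (x + t *\<^sub>R h) \<bullet> h)^2) \<partial>lborel)"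
   by (auto split: split_indicator)
  also have "(\<integral>\<^sup>+x. ennreal ((grad \<phi> (x + t *\<^sub>R h) \<bullet> h)^2) \<partial>lborel) = (\<integral>\<^sup>+x. ennreal ((grad \<phi> x \<bullet> h)^2) \<partial>lborel)"
   by (rule nn_integral_translate[of "\<lambda>x. ennreal ((grad \<phi> x \<bullet> h)^2)"]) measurable
  also have "\<dots> = ennreal (msq (\<lambda>x. grad \<phi> x \<bullet> h))" using ltwo_int_real[OF l] by (simp add: nn_integral_eq_integral msq_def)
  finally show "(\<integral>\<^sup>+x. ennreal (indicator {0..1} t * (grad \<phi> (x + t *\<^sub>R h) \<bullet> h)^2) \<partial>lborel) = ennreal (msq (\<lambda>x. grad \<phi> x \<bullet> h)) * indicator {0..1} t"
   by (simp add: mult.commute)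
 qed
 also have "\<dots> = ennreal (msq (\<lambda>x. grad \<phi> x \<bullet> h))" by (simp add: nn_integral_cmult)
 finally show ?thesis
  using ltwo_int[OF ltwo_minus[OF ltwo_translate[OF test_ltwo[OF \<phi>], of h] test_ltwo[OF \<phi>]]]
  by (simp add: msq_def nn_integral_eq_integral)
qed

text \<open>Test fields satisfy a Lipschitz bound in \<open>h\<close> and are dense. The
  approximation error enters once translated and once untranslated, with the same norm, which
  explains the fraction \<open>e / 16\<close>.\<close>

lemma translation_continuous:
 fixes f :: "'a::euclidean_space => 'b::euclidean_space"
 assumes f: "ltwo f" and h: "h ----> 0"
 shows "(\<lambda>n. msq (\<lambda>x. f (x + h n) - f x)) ----> 0"
proof -
 have tst: "(\<lambda>n. msq (\<lambda>x. F (x + h n) - F x)) ----> 0" if F: "test_field F" for F :: "'a => 'b"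
 proof -
  define D where "D = (\<Sum>e\<in>Basis. msq (grad (\<lambda>x. F x \<bullet> e)))"
  have T: "test_function (\<lambda>x. F x \<bullet> e)" if "e \<in> Basis" for e using F that by (simp add: test_field_def)
  have "msq (\<lambda>x. F (x + k) - F x) <= (norm k)^2 * D" for k
  proof -
   have l: "ltwo (\<lambda>x. F (x + k) - F x)" by (intro ltwo_minus ltwo_translate test_field_ltwo F)
   have "msq (\<lambda>x. F (x + k) - F x) = (LBINT x. \<Sum>e\<in>Basis. (norm ((F (x + k) - F x) \<bullet> e))^2)"
    unfolding msq_def power2_norm_eq_inner by (subst euclidean_inner) simp
   also have "\<dots> = (\<Sum>e\<in>Basis. msq (\<lambda>x. (F (x + k) - F x) \<bullet> e))"
    unfolding msq_def by (intro Bochner_Integration.integral_sum ltwo_int ltwo_component l)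
   also have "\<dots> <= (\<Sum>e\<in>Basis. (norm k)^2 * msq (grad (\<lambda>x. F x \<bullet> e)))"
    using test_translation_bound[OF T, of _ k] by (intro sum_mono order_trans[OF _ msq_inner_le[OF grad_ltwo[OF T]]]) (simp_all add: inner_diff_left)
   finally show ?thesis by (simp add: D_def sum_distrib_left)
  qed
  then have b: "norm (msq (\<lambda>x. F (x + h n) - F x)) <= (norm (h n))^2 * D" for n by simp
  have "(\<lambda>n. (norm (h n))^2 * D) ----> (norm (0::'a))^2 * D" by (intro tendsto_intros h)
  then have "(\<lambda>n. (norm (h n))^2 * D) ----> 0" by simp
  then show ?thesis by (rule Lim_null_comparison[OF always_eventually[OF allI[OF b]]])
 qed
 show ?thesis
 proof (rule LIMSEQ_I)
  fix e :: real assume e: "e > 0"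
  obtain \<phi> where \<phi>: "!!n. test_field (\<phi> n)" "l2lim \<phi> f" using test_field_dense[OF f] by blast
  then obtain k where k: "msq (\<lambda>x. \<phi> k x - f x) < e / 16" using e LIMSEQ_D[of _ 0 "e/16"] by fastforce
  define F where "F = \<phi> k"
  have F: "test_field F" "ltwo F" using \<phi> test_field_ltwo by (auto simp: F_def)
  define d where "d = (\<lambda>x. f x - F x)"
  have d: "ltwo d" "msq d < e / 16" unfolding d_def using ltwo_minus f F k by (auto simp: F_def msq_minus_commute)
  obtain N where N: "!!n. n >= N ==> msq (\<lambda>x. F (x + h n) - F x) < e / 4"
   using tst[OF F(1), THEN LIMSEQ_D, of "e/4"] e by auto
  have "norm (msq (\<lambda>x. f (x + h n) - f x) - 0) < e" if n: "n >= N" for n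
  proof -
   have "(\<lambda>x. f (x + h n) - f x) = (\<lambda>x. (d (x + h n) - d x) + (F (x + h n) - F x))" by (auto simp: d_def)
   then have "msq (\<lambda>x. f (x + h n) - f x) <= 2 * msq (\<lambda>x. d (x + h n) - d x) + 2 * msq (\<lambda>x. F (x + h n) - F x)"
    using msq_add_le[OF ltwo_minus[OF ltwo_translate[OF d(1)] d(1)] ltwo_minus[OF ltwo_translate[OF F(2)] F(2)], of "h n" "h n"] by simp
   moreover have "msq (\<lambda>x. d (x + h n) - d x) <= 2 * msq d + 2 * msq d"
    using msq_minus_le[OF ltwo_translate[OF d(1)] d(1), of "h n"] msq_translate[OF d(1)] by simp
   ultimately show ?thesis using N[OF n] d(2) by simp
  qed
  then show "\<exists>no. \<forall>n\<ge>no. norm (msq (\<lambda>x. f (x + h n) - f x) - 0) < e" by blast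
 qed
qed

section \<open>Mollification\<close>

definition moll :: "('a::euclidean_space => real) => ('a => 'b::euclidean_space) => 'a => 'b" where
 "moll K u x = (LBINT y. K (x - y) *\<^sub>R u y)"

lemma moll_integrable: assumes "test_function K" "ltwo u" shows "L1 (\<lambda>y. K (x - y) *\<^sub>R u y)"
proof (rule integrable_dom)
 show "L1 (\<lambda>y. norm (K (x - y)) * norm (u y))"
  by (intro ltwo_norm_mult test_ltwo test_reflect assms)
 have [measurable]: "K \<in> BM" "u \<in> BM" using assms by (auto simp: ltwo_def)
 show "(\<lambda>y. K (x - y) *\<^sub>R u y) \<in> borel_measurable lborel" by measurable
qed auto

lemma moll_alt: assumes "test_function K" "ltwo u"
 shows "moll K u x = (LBINT z. K z *\<^sub>R u (x - z))" "L1 (\<lambda>z. K z *\<^sub>R u (x - z))"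
proof -
 have [measurable]: "K \<in> BM" "u \<in> BM" using assms by (auto simp: ltwo_def)
 show "moll K u x = (LBINT z. K z *\<^sub>R u (x - z))"  "L1 (\<lambda>z. K z *\<^sub>R u (x - z))"
  unfolding moll_def using integral_reflect_pt[of "\<lambda>y. K (x - y) *\<^sub>R u y" x] moll_integrable[OF assms] by simp_all
qed

lemma moll_component: assumes "test_function K" "ltwo u" shows "moll K u x \<bullet> e = moll K (\<lambda>y. u y \<bullet> e) x"
 unfolding moll_def using integral_inner_left[where c=e and f="\<lambda>y. K (x - y) *\<^sub>R u y" and M=lborel] moll_integrable[OF assms]
 by simp

text \<open>The derivative falls on the kernel: by \<open>test_taylor\<close> the remainder is at
  most \<open>L * |h|^2\<close> and, for fixed \<open>x\<close>, lives on a ball of the integration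
  variable, where \<open>u\<close> is integrable. Since derivatives of the kernel are again test
  functions, the lemma can be iterated.\<close>

lemma moll_has_derivative:
 fixes u :: "'a::euclidean_space => real"
 assumes K: "test_function K" and u: "ltwo u"
 shows "(moll K u has_derivative (\<lambda>h. \<Sum>e\<in>Basis. (h \<bullet> e) * moll (pd e K) u x)) (at x)"
proof -
 obtain L R where L: "L > 0" "R > 0" "!!x h. \<bar>K (x + h) - K x - grad K x \<bullet> h\<bar> <= L * (norm h)^2"
  "!!x h. norm h <= 1 ==> norm x > R ==> K (x + h) - K x - grad K x \<bullet> h = 0" using test_taylor[OF K] by metis
 note [measurable] = ltwo_borel[OF u]
 let ?D = "\<lambda>h. \<Sum>e\<in>Basis. (h \<bullet> e) * moll (pd e K) u x"
 have iu: "L1 (\<lambda>y. indicator (cball 0 (norm x + R)) y * u y)"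
  using ltwo_locally_integrable[OF u, of "norm x + R"] by simp
 define C where "C = L * (LBINT y. \<bar>indicator (cball 0 (norm x + R)) y * u y\<bar>)"
 have bd: "\<bar>moll K u (x + h) - moll K u x - ?D h\<bar> <= C * (norm h)^2" if h: "norm h <= 1" for h
 proof -
  have i: "L1 (\<lambda>y. K (x + h - y) * u y)" "L1 (\<lambda>y. K (x - y) * u y)"
   "!!e. e \<in> Basis ==> L1 (\<lambda>y. pd e K (x - y) * u y)"
   using moll_integrable[OF K u] moll_integrable[OF test_pd[OF K] u] by auto
  have Deq: "?D h = (LBINT y. (grad K (x - y) \<bullet> h) * u y)"
   and Di: "L1 (\<lambda>y. (grad K (x - y) \<bullet> h) * u y)"
  proof -
   have eq: "(grad K (x - y) \<bullet> h) * u y = (\<Sum>e\<in>Basis. (h \<bullet> e) * (pd e K (x - y) * u y))" for y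
    by (simp add: grad_inner sum_distrib_right sum_distrib_left mult_ac)
   show "?D h = (LBINT y. (grad K (x - y) \<bullet> h) * u y)"
    unfolding eq moll_def using i(3) by (subst Bochner_Integration.integral_sum) auto
   show "L1 (\<lambda>y. (grad K (x - y) \<bullet> h) * u y)" unfolding eq using i(3) by auto
  qed
  have meq: "moll K u (x + h) - moll K u x - ?D h = (LBINT y. (K (x - y + h) - K (x - y) - grad K (x - y) \<bullet> h) * u y)"
  proof -
   have "x - y + h = x + h - y" for y by simp
   then have "(LBINT y. (K (x - y + h) - K (x - y) - grad K (x - y) \<bullet> h) * u y)
     = (LBINT y. K (x + h - y) * u y - K (x - y) * u y - (grad K (x - y) \<bullet> h) * u y)"
    by (simp only: left_diff_distrib)
   also have "\<dots> = moll K u (x + h) - moll K u x - (LBINT y. (grad K (x - y) \<bullet> h) * u y)"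
    unfolding moll_def using i(1,2) Di by simp
   finally show ?thesis unfolding Deq ..
  qed
  have "\<bar>moll K u (x + h) - moll K u x - ?D h\<bar> <= (LBINT y. \<bar>(K (x - y + h) - K (x - y) - grad K (x - y) \<bullet> h) * u y\<bar>)"
   unfolding meq using integral_norm_bound[of lborel "\<lambda>y. (K (x - y + h) - K (x - y) - grad K (x - y) \<bullet> h) * u y"] by simp
  also have "\<dots> <= (LBINT y. (L * (norm h)^2) * \<bar>indicator (cball 0 (norm x + R)) y * u y\<bar>)"
  proof (rule integral_mono)
   show "L1 (\<lambda>y. \<bar>(K (x - y + h) - K (x - y) - grad K (x - y) \<bullet> h) * u y\<bar>)"
    using i(1,2) Di by (intro integrable_abs) (simp add: left_diff_distrib algebra_simps)
   show "L1 (\<lambda>y. (L * (norm h)^2) * \<bar>indicator (cball 0 (norm x + R)) y * u y\<bar>)"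
    using iu by (intro integrable_mult_right integrable_abs)
   fix y
   show "\<bar>(K (x - y + h) - K (x - y) - grad K (x - y) \<bullet> h) * u y\<bar> <= (L * (norm h)^2) * \<bar>indicator (cball 0 (norm x + R)) y * u y\<bar>"
   proof (cases "norm y > norm x + R")
    case True
    then have "norm (x - y) > R" using norm_triangle_ineq2[of y x] by (simp add: norm_minus_commute)
    then show ?thesis using L(4)[OF h] L(1) by (simp add: abs_mult)
   next
    case False
    then show ?thesis using L(3)[of "x - y" h] by (auto simp: abs_mult intro!: mult_right_mono)
   qed
  qed
  also have "\<dots> = C * (norm h)^2" by (simp add: C_def)
  finally show ?thesis .
 qed
 have C0: "C >= 0" unfolding C_def using L by simp
 show ?thesis unfolding has_derivative_at
 proof (intro conjI)
  show "bounded_linear ?D"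
   by (intro bounded_linear_sum bounded_linear_mult_const bounded_linear_inner_left)
  show "(\<lambda>h. norm (moll K u (x + h) - moll K u x - ?D h) / norm h) \<midarrow>0\<rightarrow> 0"
  proof (rule tendsto_sandwich[of "\<lambda>_. 0" _ _ "\<lambda>h. C * norm h"])
   show "((\<lambda>h. C * norm h) \<longlongrightarrow> 0) (at 0)" by (auto intro!: tendsto_eq_intros)
   show "\<forall>\<^sub>F h in at 0. norm (moll K u (x + h) - moll K u x - ?D h) / norm h <= C * norm h"
   proof -
    have "\<forall>\<^sub>F h::'a in at 0. h \<noteq> 0 & norm h < 1" unfolding eventually_at by (auto intro!: exI[of _ 1])
    then show ?thesis by eventually_elim (use bd in "auto simp: field_simps power2_eq_square")
   qed
  qed auto
 qed
qed

lemma moll_pd: assumes "test_function K" "ltwo (u :: 'a::euclidean_space => real)" "e \<in> Basis" shows "pd e (moll K u) x = moll (pd e K) u x"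
 by (subst pd_eq[OF moll_has_derivative[OF assms(1,2)]]) (rule sum_Basis_delta[OF assms(3)])

lemma Ck_moll: "test_function K ==> ltwo (u :: 'a::euclidean_space => real) ==> Ck k (moll K u)"
proof (induction k arbitrary: K)
 case 0
 then show ?case using moll_has_derivative[OF 0]
  by (auto intro!: continuous_at_imp_continuous_on has_derivative_continuous)
next
 case (Suc k)
 show ?case unfolding Ck_Suc_iff
 proof (intro conjI allI ballI)
  show "moll K u differentiable at x" for x using moll_has_derivative[OF Suc.prems] differentiable_def by blast
  fix e :: 'a assume e: "e \<in> Basis"
  have "pd e (moll K u) = moll (pd e K) u" using moll_pd[OF Suc.prems e] by auto
  then show "Ck k (pd e (moll K u))" using Suc.IH[OF test_pd[OF Suc.prems(1) e] Suc.prems(2)] by simp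
 qed
qed

lemma moll_borel: assumes "test_function K" "ltwo (u :: 'a::euclidean_space => 'b::euclidean_space)" shows "moll K u \<in> BM"
proof -
 have "moll K (\<lambda>y. u y \<bullet> e) \<in> BM" for e :: 'b
  using Ck_moll[OF assms(1) ltwo_component[OF assms(2)], of 0 e] by (auto intro: borel_measurable_continuous_onI)
 then have "(\<lambda>x. \<Sum>e\<in>Basis. (moll K u x \<bullet> e) *\<^sub>R e) \<in> BM" unfolding moll_component[OF assms] by measurable
 then show ?thesis by (simp add: euclidean_representation)
qed

lemma moll_test: assumes "ltwo (u :: 'a::euclidean_space => real)" "!!x. norm x > R ==> u x = 0" "test_function K"
 shows "test_function (moll K u)"
proof -
 obtain r where r: "norm x > r ==> K x = 0" for x using assms(3) by (auto simp: test_function_iff)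
 have "moll K u x = 0" if "norm x > R + r" for x
 proof -
  have "K (x - y) *\<^sub>R u y = 0" for y
  proof (cases "norm y > R")
   case False
   then have "norm (x - y) > r" using that norm_triangle_ineq2[of x y] by linarith
   then show ?thesis using r by simp
  qed (simp add: assms)
  then have "(\<lambda>y. K (x - y) *\<^sub>R u y) = (\<lambda>y. 0)" by (rule ext)
  then show ?thesis unfolding moll_def by (simp only:) simp
 qed
 then show ?thesis using Ck_moll[OF assms(3,1)] by (auto simp: test_function_iff)
qed

text \<open>Mollification averages the translates of \<open>u\<close>, so by Jensen and exchange of
  integrals its distance to \<open>u\<close> is at most the worst translation error below scale
  \<epsilon>. With continuity of translations this gives convergence, with
  \<open>sob_translation_bound\<close> a rate that is uniform on bounded sets of
  \<open>H^1\<close>.\<close>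

lemma moll_diff_bound:
 fixes u :: "'a::euclidean_space => 'b::euclidean_space"
 assumes u: "ltwo u" and e: "\<epsilon> > 0" and B: "!!z. norm z < \<epsilon> ==> msq (\<lambda>x. u (x + z) - u x) <= B"
 shows "ltwo (moll (kern \<epsilon>) u)" "msq (\<lambda>x. moll (kern \<epsilon>) u x - u x) <= B"
proof -
 let ?K = "kern \<epsilon> :: 'a => real"
 note K = kern_test[OF e, where 'a='a]
 note [measurable] = ltwo_borel[OF u]
 have mm[measurable]: "moll ?K u \<in> BM" using moll_borel K u by blast
 have B0: "B >= 0" using B[of 0] e by (simp add: msq_def)
 obtain Kb where Kb: "!!x. \<bar>?K x\<bar> <= Kb" using test_bounded[OF K] by metis
 have pt: "(norm (moll ?K u x - u x))^2 <= (LBINT z. ?K z * (norm (u (x - z) - u x))^2)" (is ?A)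
  and pi: "L1 (\<lambda>z. ?K z * (norm (u (x - z) - u x))^2)" (is ?B) for x
 proof -
  have i1: "L1 (\<lambda>z. ?K z *\<^sub>R (u (x - z) - u x))"
   unfolding scaleR_diff_right using moll_alt(2)[OF K u] kern_integrable[OF e]
   by (intro Bochner_Integration.integrable_diff integrable_scaleR_left) auto
  have us: "L1 (\<lambda>z. (norm (u (x - z)))^2)"
   using integral_reflect_pt(1)[of "\<lambda>z. (norm (u z))^2" x] u by (simp add: ltwo_def)
  show i2: ?B
  proof (rule integrable_dom)
   show "L1 (\<lambda>z. Kb * (2 * (norm (u (x - z)))^2) + ?K z * (2 * (norm (u x))^2))"
    using us kern_integrable[OF e] by (intro Bochner_Integration.integrable_add integrable_mult_right integrable_mult_left)
   show "AE z in lborel. norm (?K z * (norm (u (x - z) - u x))^2) <= norm (Kb * (2 * (norm (u (x - z)))^2) + ?K z * (2 * (norm (u x))^2))"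
   proof (rule AE_I2)
    fix z
    have k: "0 <= ?K z" "?K z <= Kb" using Kb[of z] kern_nonneg[of \<epsilon> z] by auto
    have "?K z * (norm (u (x - z) - u x))^2 <= ?K z * (2 * (norm (u (x - z)))^2 + 2 * (norm (u x))^2)"
     using k norm_add_sq[of "u (x - z)" "- u x"] by (intro mult_left_mono) auto
    also have "\<dots> <= Kb * (2 * (norm (u (x - z)))^2) + ?K z * (2 * (norm (u x))^2)"
     unfolding distrib_left using k by (intro add_mono mult_right_mono) auto
    finally show "norm (?K z * (norm (u (x - z) - u x))^2) <= norm (Kb * (2 * (norm (u (x - z)))^2) + ?K z * (2 * (norm (u x))^2))"
     using k by simp
   qed
  qed measurable
  have "(LBINT z. ?K z *\<^sub>R (u (x - z) - u x)) = moll ?K u x - u x"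
   unfolding scaleR_diff_right using moll_alt[OF K u, of x] kern_integrable[OF e, where 'a='a] kern_integral[OF e, where 'a='a]
   by (subst Bochner_Integration.integral_diff) auto
  then show ?A using jensen_sq[OF kern_nonneg kern_integrable[OF e] kern_integral[OF e] i1 i2] by simp
 qed
 have "(\<integral>\<^sup>+x. ennreal ((norm (moll ?K u x - u x))^2) \<partial>lborel) <= (\<integral>\<^sup>+x. \<integral>\<^sup>+z. ennreal (?K z * (norm (u (x - z) - u x))^2) \<partial>lborel \<partial>lborel)"
  using pt pi by (intro nn_integral_mono) (auto simp: nn_integral_eq_integral kern_nonneg intro!: ennreal_leI)
 also have "\<dots> = (\<integral>\<^sup>+z. \<integral>\<^sup>+x. ennreal (?K z * (norm (u (x - z) - u x))^2) \<partial>lborel \<partial>lborel)"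
  by (rule lborel_pair.Fubini') measurable
 also have "\<dots> = (\<integral>\<^sup>+z. ennreal (?K z) * ennreal (msq (\<lambda>x. u (x - z) - u x)) \<partial>lborel)"
 proof (rule nn_integral_cong)
  fix z
  have "L1 (\<lambda>x. (norm (u (x - z) - u x))^2)"
   using ltwo_minus[OF ltwo_translate[OF u, of "-z"] u] by (simp add: ltwo_def)
  then show "(\<integral>\<^sup>+x. ennreal (?K z * (norm (u (x - z) - u x))^2) \<partial>lborel) = ennreal (?K z) * ennreal (msq (\<lambda>x. u (x - z) - u x))"
   by (simp add: ennreal_mult' kern_nonneg nn_integral_cmult nn_integral_eq_integral msq_def)
 qed
 also have "\<dots> <= (\<integral>\<^sup>+z. ennreal (?K z) * ennreal B \<partial>lborel)"
 proof (rule nn_integral_mono)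
  fix z :: 'a
  show "ennreal (?K z) * ennreal (msq (\<lambda>x. u (x - z) - u x)) <= ennreal (?K z) * ennreal B"
   using B[of "-z"] kern_0[OF e, of z] by (cases "norm z < \<epsilon>") (auto intro!: mult_left_mono ennreal_leI)
 qed
 also have "\<dots> = ennreal B"
 proof -
  have "(\<integral>\<^sup>+z. ennreal (?K z) \<partial>lborel) = 1"
   using kern_integral[OF e, where 'a='a] by (subst nn_integral_eq_integral[OF kern_integrable[OF e]]) (auto simp: kern_nonneg)
  then show ?thesis by (simp add: nn_integral_multc)
 qed
 finally have *: "(\<integral>\<^sup>+x. ennreal ((norm (moll ?K u x - u x))^2) \<partial>lborel) <= ennreal B" .
 have i: "L1 (\<lambda>x. (norm (moll ?K u x - u x))^2)"
  by (rule integrableI_nonneg) (use * in "auto simp: less_top[symmetric] top_unique")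
 then show "msq (\<lambda>x. moll ?K u x - u x) <= B"
  using * B0 unfolding msq_def by (simp add: nn_integral_eq_integral)
 have "ltwo (\<lambda>x. moll ?K u x - u x)" using i by (simp add: ltwo_def)
 from ltwo_add[OF this u] show "ltwo (moll ?K u)" by simp
qed

lemma moll_ltwo: "ltwo u ==> \<epsilon> > 0 ==> ltwo (moll (kern \<epsilon>) u)"
proof (rule moll_diff_bound(1))
 fix z assume u: "ltwo u"
 show "msq (\<lambda>x. u (x + z) - u x) <= 4 * msq u"
  using msq_minus_le[OF ltwo_translate[OF u] u, of z] msq_translate[OF u] by simp
qed

lemma moll_conv:
 fixes u :: "'a::euclidean_space => 'b::euclidean_space"
 assumes u: "ltwo u" shows "(\<lambda>n. msq (\<lambda>x. moll (kern (1 / real (Suc n))) u x - u x)) ----> 0"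
proof (rule LIMSEQ_I)
 fix e :: real assume e: "e > 0"
 have "\<exists>d>0. \<forall>z. norm z < d --> msq (\<lambda>x. u (x + z) - u x) <= e / 2"
 proof (rule ccontr)
  assume "\<not> ?thesis"
  then have "\<exists>z. norm z < 1 / real (Suc n) & msq (\<lambda>x. u (x + z) - u x) > e / 2" for n
   by (metis not_le of_nat_0_less_iff zero_less_Suc zero_less_divide_1_iff)
  then obtain z where z: "!!n. norm (z n) < 1 / real (Suc n)" "!!n. msq (\<lambda>x. u (x + z n) - u x) > e / 2" by metis
  have "z ----> 0"
   by (rule Lim_null_comparison[of _ "\<lambda>n. 1 / real (Suc n)"]) (use z(1) lim_const_over_n[THEN LIMSEQ_Suc, of 1] in "auto intro!: always_eventually less_imp_le")
  from LIMSEQ_D[OF translation_continuous[OF u this], of "e/2"] z(2) e show False by (auto dest: less_imp_not_less)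
 qed
 then obtain d where d: "d > 0" "!!z. norm z < d ==> msq (\<lambda>x. u (x + z) - u x) <= e / 2" by blast
 obtain N where N: "1 / real (Suc N) < d" using d nat_approx_posE by blast
 show "\<exists>no. \<forall>n\<ge>no. norm (msq (\<lambda>x. moll (kern (1 / real (Suc n))) u x - u x) - 0) < e"
 proof (intro exI[of _ N] allI impI)
  fix n assume "n >= N"
  then have "1 / real (Suc n) <= 1 / real (Suc N)" by (auto intro!: divide_left_mono)
  then have "msq (\<lambda>x. moll (kern (1 / real (Suc n))) u x - u x) <= e / 2"
   using N by (intro moll_diff_bound(2) u d) auto
  then show "norm (msq (\<lambda>x. moll (kern (1 / real (Suc n))) u x - u x) - 0) < e" using e by simp
 qed
qed

section \<open>Weak gradients\<close>

text \<open>The gradient is an explicit argument, which avoids the choice made in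
  \<open>weak_grad\<close> and lets sums, dilations and limits come with their gradients.
  \<open>H1_sob\<close> and \<open>sob_H1\<close> translate.\<close>

definition sob :: "('a::euclidean_space => real) => ('a => 'a) => bool" where
 "sob u g \<longleftrightarrow> ltwo u & ltwo g & (\<forall>\<phi>. \<forall>e\<in>Basis. test_function \<phi> -->
   (LBINT x. u x * pd e \<phi> x) = - (LBINT x. \<phi> x * (g x \<bullet> e)))"

lemma sob_ltwo: "sob u g ==> ltwo u" "sob u g ==> ltwo g" by (auto simp: sob_def)
lemma sob_borel [measurable_dest]: "sob u g ==> u \<in> BM" by (auto simp: sob_def ltwo_def)
lemma sob_borel' [measurable_dest]: "sob u g ==> g \<in> BM" by (auto simp: sob_def ltwo_def)
lemma sob_weak: "sob u g ==> test_function \<phi> ==> e \<in> Basis ==>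
  (LBINT x. u x * pd e \<phi> x) = - (LBINT x. \<phi> x * (g x \<bullet> e))" by (auto simp: sob_def)

lemma test_integrable_mult: "ltwo (u :: _ => real) ==> test_function \<phi> ==> L1 (\<lambda>x. u x * \<phi> x)"
 "ltwo (u :: _ => real) ==> test_function \<phi> ==> L1 (\<lambda>x. \<phi> x * u x)"
 using ltwo_mult test_ltwo by blast+

lemma sob_test: fixes \<phi> :: "'a::euclidean_space => real" assumes "test_function \<phi>" shows "sob \<phi> (grad \<phi>)"
 unfolding sob_def
proof (intro conjI allI ballI impI)
 fix \<psi> :: "'a => real" and e :: 'a assume \<psi>: "test_function \<psi>" and e: "e \<in> Basis"
 have "0 = (LBINT x. pd e (\<lambda>x. \<phi> x * \<psi> x) x)" using test_pd_integral_0[OF test_mult[OF assms \<psi>] e] by simp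
 also have "\<dots> = (LBINT x. \<phi> x * pd e \<psi> x + pd e \<phi> x * \<psi> x)"
  using assms \<psi> by (simp add: pd_mult test_differentiable)
 also have "\<dots> = (LBINT x. \<phi> x * pd e \<psi> x) + (LBINT x. \<psi> x * pd e \<phi> x)"
  using test_integrable[OF test_mult[OF assms test_pd[OF \<psi> e]]] test_integrable[OF test_mult[OF test_pd[OF assms e] \<psi>]]
  by (simp add: mult.commute)
 finally show "(LBINT x. \<phi> x * pd e \<psi> x) = - (LBINT x. \<psi> x * (grad \<phi> x \<bullet> e))"
  using e by (simp add: grad_inner_Basis)
qed (use assms test_ltwo grad_ltwo in auto)

lemma sob_add: fixes u :: "'a::euclidean_space => real" assumes "sob u g" "sob v h" shows "sob (\<lambda>x. u x + v x) (\<lambda>x. g x + h x)"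
 unfolding sob_def
proof (intro conjI allI ballI impI)
 note a = sob_ltwo[OF assms(1)] sob_ltwo[OF assms(2)]
 fix \<psi> :: "'a => real" and e :: 'a assume \<psi>: "test_function \<psi>" and e: "e \<in> Basis"
 show "(LBINT x. (u x + v x) * pd e \<psi> x) = - (LBINT x. \<psi> x * ((g x + h x) \<bullet> e))"
  using sob_weak[OF assms(1) \<psi> e] sob_weak[OF assms(2) \<psi> e]
   test_integrable_mult[OF a(1) test_pd[OF \<psi> e]] test_integrable_mult[OF a(3) test_pd[OF \<psi> e]]
   test_integrable_mult[OF ltwo_component[OF a(2), of e] \<psi>] test_integrable_mult[OF ltwo_component[OF a(4), of e] \<psi>]
  by (simp add: distrib_right distrib_left inner_add_left)
qed (use sob_ltwo[OF assms(1)] sob_ltwo[OF assms(2)] ltwo_add in auto)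

lemma sob_cmult: fixes u :: "'a::euclidean_space => real" assumes "sob u g" shows "sob (\<lambda>x. c * u x) (\<lambda>x. c *\<^sub>R g x)"
 unfolding sob_def
proof (intro conjI allI ballI impI)
 fix \<psi> :: "'a => real" and e :: 'a assume \<psi>: "test_function \<psi>" and e: "e \<in> Basis"
 have "(LBINT x. c * u x * pd e \<psi> x) = c * (LBINT x. u x * pd e \<psi> x)"
  by (simp add: mult.assoc)
 also have "\<dots> = - (c * (LBINT x. \<psi> x * (g x \<bullet> e)))" using sob_weak[OF assms(1) \<psi> e] by simp
 also have "c * (LBINT x. \<psi> x * (g x \<bullet> e)) = (LBINT x. \<psi> x * (c *\<^sub>R g x \<bullet> e))"
  by (simp add: mult.left_commute)
 finally show "(LBINT x. c * u x * pd e \<psi> x) = - (LBINT x. \<psi> x * (c *\<^sub>R g x \<bullet> e))" .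
qed (use sob_ltwo[OF assms(1)] ltwo_cmult ltwo_scale in auto)

lemma sob_minus: fixes u :: "'a::euclidean_space => real" assumes "sob u g" "sob v h" shows "sob (\<lambda>x. u x - v x) (\<lambda>x. g x - h x)"
 using sob_add[OF assms(1) sob_cmult[OF assms(2), of "-1"]] by simp

lemma ltwo_affine: assumes "ltwo f" "c \<noteq> 0" shows "ltwo (\<lambda>x. f (t + c *\<^sub>R x))"
 using ltwo_dilate(1)[OF ltwo_translate[OF assms(1), of t] assms(2)] by (simp add: add.commute)

lemma sob_affine:
 fixes u :: "'a::euclidean_space => real"
 assumes s: "sob u g" and c: "c \<noteq> 0" shows "sob (\<lambda>x. u (t + c *\<^sub>R x)) (\<lambda>x. c *\<^sub>R g (t + c *\<^sub>R x))"
 unfolding sob_def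
proof (intro conjI allI ballI impI)
 fix \<psi> :: "'a => real" and e :: 'a assume \<psi>: "test_function \<psi>" and e: "e \<in> Basis"
 have [measurable]: "u \<in> BM" "g \<in> BM" "\<psi> \<in> BM" "pd e \<psi> \<in> BM"
  using s sob_borel sob_borel' \<psi> test_pd[OF \<psi> e] by auto
 \<comment> \<open>The test function transported by the inverse affine map; the change of variables
   returns \<open>\<psi>\<close>, with a factor \<open>1/c\<close> in its derivative.\<close>
 define \<eta> where "\<eta> y = \<psi> ((- t /\<^sub>R c) + (1/c) *\<^sub>R y)" for y
 have \<eta>: "test_function \<eta>" unfolding \<eta>_def using c \<psi> by (intro test_affine) auto
 have inv: "(- t /\<^sub>R c) + (1/c) *\<^sub>R (t + c *\<^sub>R x) = x" for x using c by (simp add: scaleR_add_right divide_inverse)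
 have \<eta>x: "\<eta> (t + c *\<^sub>R x) = \<psi> x" for x unfolding \<eta>_def inv ..
 have "pd e \<eta> y = (1/c) * pd e \<psi> ((- t /\<^sub>R c) + (1/c) *\<^sub>R y)" for y
  unfolding \<eta>_def by (rule pd_affine) (rule test_differentiable[OF \<psi>])
 then have pdx: "pd e \<eta> (t + c *\<^sub>R x) = (1/c) * pd e \<psi> x" for x using inv by simp
 have [measurable]: "\<eta> \<in> BM" "pd e \<eta> \<in> BM" using \<eta> test_pd[OF \<eta> e] by auto
 let ?k = "\<bar>c\<bar> ^ DIM('a)"
 have k: "?k \<noteq> 0" using c by simp
 have "?k * (LBINT x. u (t + c *\<^sub>R x) * ((1/c) * pd e \<psi> x)) = (LBINT x. u x * pd e \<eta> x)"
  using has_bochner_integral_affine(2)[of "\<lambda>x. u x * pd e \<eta> x" c t] c by (simp add: pdx)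
 also have "\<dots> = - (LBINT x. \<eta> x * (g x \<bullet> e))" by (rule sob_weak[OF s \<eta> e])
 also have "(LBINT x. \<eta> x * (g x \<bullet> e)) = ?k * (LBINT x. \<psi> x * (g (t + c *\<^sub>R x) \<bullet> e))"
  using has_bochner_integral_affine(2)[of "\<lambda>x. \<eta> x * (g x \<bullet> e)" c t] c by (simp add: \<eta>x)
 finally have eqk: "?k * (LBINT x. u (t + c *\<^sub>R x) * ((1/c) * pd e \<psi> x)) = - (?k * (LBINT x. \<psi> x * (g (t + c *\<^sub>R x) \<bullet> e)))" .
 have eq: "(LBINT x. u (t + c *\<^sub>R x) * ((1/c) * pd e \<psi> x)) = - (LBINT x. \<psi> x * (g (t + c *\<^sub>R x) \<bullet> e))"
 proof -
  from eqk have "?k * (LBINT x. u (t + c *\<^sub>R x) * ((1/c) * pd e \<psi> x)) = ?k * - (LBINT x. \<psi> x * (g (t + c *\<^sub>R x) \<bullet> e))"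
   by (simp only: mult_minus_right)
  then show ?thesis using k by (simp only: mult_cancel_left) blast
 qed
 have "(LBINT x. u (t + c *\<^sub>R x) * pd e \<psi> x) = c * (LBINT x. u (t + c *\<^sub>R x) * ((1/c) * pd e \<psi> x))"
  unfolding integral_mult_right_zero[symmetric] using c by (intro bochner_cong refl) simp
 also have "\<dots> = - (c * (LBINT x. \<psi> x * (g (t + c *\<^sub>R x) \<bullet> e)))" unfolding eq by simp
 also have "c * (LBINT x. \<psi> x * (g (t + c *\<^sub>R x) \<bullet> e)) = (LBINT x. \<psi> x * (c *\<^sub>R g (t + c *\<^sub>R x) \<bullet> e))"
  unfolding integral_mult_right_zero[symmetric] by (intro bochner_cong refl) simp
 finally show "(LBINT x. u (t + c *\<^sub>R x) * pd e \<psi> x) = - (LBINT x. \<psi> x * (c *\<^sub>R g (t + c *\<^sub>R x) \<bullet> e))" .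
qed (intro ltwo_scale ltwo_affine sob_ltwo[OF s] c)+

lemma sob_dilate: "sob u g ==> c \<noteq> 0 ==> sob (\<lambda>x. u (c *\<^sub>R x)) (\<lambda>x. c *\<^sub>R g (c *\<^sub>R x))"
 using sob_affine[of u g c 0] by simp

lemma ltwo_bounded_scale:
 assumes "ltwo f" "K \<in> BM" "!!x. \<bar>K x\<bar> <= B" shows "ltwo (\<lambda>x. K x *\<^sub>R f x)"
 by (rule ltwo_dom[OF assms(1), of _ B]) (use assms in "auto simp: ltwo_def mult_right_mono intro!: borel_measurable_scaleR")

lemma ltwo_bounded_scale':
 assumes "ltwo u" "f \<in> BM" "!!x. norm (f x) <= B" shows "ltwo (\<lambda>x. u x *\<^sub>R f x)"
 by (rule ltwo_dom[OF assms(1), of _ B])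
  (use assms in "auto simp: ltwo_def mult.commute[of B] mult_left_mono intro!: borel_measurable_scaleR")

lemma sob_mult_test:
 fixes u :: "'a::euclidean_space => real"
 assumes s: "sob u g" and \<zeta>: "test_function \<zeta>" shows "sob (\<lambda>x. \<zeta> x * u x) (\<lambda>x. \<zeta> x *\<^sub>R g x + u x *\<^sub>R grad \<zeta> x)"
 unfolding sob_def
proof (intro conjI allI ballI impI)
 obtain B where B: "!!x. \<bar>\<zeta> x\<bar> <= B" using test_bounded[OF \<zeta>] by metis
 obtain C where C: "!!x. norm (grad \<zeta> x) <= C" using test_grad_bounded[OF \<zeta>] by metis
 note b = test_borel[OF \<zeta>] test_grad_borel[OF \<zeta>]
 have l1: "ltwo (\<lambda>x. \<zeta> x * u x)" using ltwo_bounded_scale[OF sob_ltwo(1)[OF s] b(1) B] by simp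
 have l2: "ltwo (\<lambda>x. \<zeta> x *\<^sub>R g x)" using ltwo_bounded_scale[OF sob_ltwo(2)[OF s] b(1) B] .
 have l3: "ltwo (\<lambda>x. u x *\<^sub>R grad \<zeta> x)" using ltwo_bounded_scale'[OF sob_ltwo(1)[OF s] b(2) C] .
 show "ltwo (\<lambda>x. \<zeta> x * u x)" "ltwo (\<lambda>x. \<zeta> x *\<^sub>R g x + u x *\<^sub>R grad \<zeta> x)" using l1 ltwo_add[OF l2 l3] by auto
 fix \<psi> :: "'a => real" and e :: 'a assume \<psi>: "test_function \<psi>" and e: "e \<in> Basis"
 have i1: "L1 (\<lambda>x. u x * pd e (\<lambda>x. \<zeta> x * \<psi> x) x)"
  using test_integrable_mult(1)[OF sob_ltwo(1)[OF s] test_pd[OF test_mult[OF \<zeta> \<psi>] e]] .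
 have i2: "L1 (\<lambda>x. u x * (\<psi> x * pd e \<zeta> x))"
  using test_integrable_mult(1)[OF sob_ltwo(1)[OF s] test_mult[OF \<psi> test_pd[OF \<zeta> e]]] .
 have i3: "L1 (\<lambda>x. (\<zeta> x * \<psi> x) * (g x \<bullet> e))"
  using test_integrable_mult(2)[OF ltwo_component[OF sob_ltwo(2)[OF s]] test_mult[OF \<zeta> \<psi>]] .
 have "(LBINT x. \<zeta> x * u x * pd e \<psi> x) = (LBINT x. u x * pd e (\<lambda>x. \<zeta> x * \<psi> x) x - u x * (\<psi> x * pd e \<zeta> x))"
  using \<zeta> \<psi> by (intro bochner_cong refl) (simp add: pd_mult test_differentiable algebra_simps)
 also have "\<dots> = (LBINT x. u x * pd e (\<lambda>x. \<zeta> x * \<psi> x) x) - (LBINT x. u x * (\<psi> x * pd e \<zeta> x))"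
  using i1 i2 by simp
 also have "(LBINT x. u x * pd e (\<lambda>x. \<zeta> x * \<psi> x) x) = - (LBINT x. (\<zeta> x * \<psi> x) * (g x \<bullet> e))"
  by (rule sob_weak[OF s test_mult[OF \<zeta> \<psi>] e])
 also have "\<dots> - (LBINT x. u x * (\<psi> x * pd e \<zeta> x)) = - (LBINT x. (\<zeta> x * \<psi> x) * (g x \<bullet> e) + u x * (\<psi> x * pd e \<zeta> x))"
  using i2 i3 by simp
 also have "(LBINT x. (\<zeta> x * \<psi> x) * (g x \<bullet> e) + u x * (\<psi> x * pd e \<zeta> x)) = (LBINT x. \<psi> x * ((\<zeta> x *\<^sub>R g x + u x *\<^sub>R grad \<zeta> x) \<bullet> e))"
  using e by (intro bochner_cong refl) (simp add: inner_add_left grad_inner_Basis algebra_simps)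
 finally show "(LBINT x. \<zeta> x * u x * pd e \<psi> x) = - (LBINT x. \<psi> x * ((\<zeta> x *\<^sub>R g x + u x *\<^sub>R grad \<zeta> x) \<bullet> e))" .
qed

text \<open>The weak formulation is applied to \<open>y \<mapsto> K (x - y)\<close>, whose
  derivative in \<open>y\<close> is opposite to that in \<open>x\<close>.\<close>

lemma sob_moll_grad:
 fixes u :: "'a::euclidean_space => real"
 assumes s: "sob u g" and K: "test_function K" shows "grad (moll K u) x = moll K g x"
proof (rule euclidean_eqI)
 fix e :: 'a assume e: "e \<in> Basis"
 have pdK: "pd e (\<lambda>y. K (x - y)) y = - pd e K (x - y)" for y
  using pd_affine[of K x "-1" y e] test_differentiable[OF K] by simp
 have "grad (moll K u) x \<bullet> e = moll (pd e K) u x"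
  using e by (simp add: grad_inner_Basis moll_pd[OF K sob_ltwo(1)[OF s] e])
 also have "\<dots> = - (LBINT y. u y * pd e (\<lambda>y. K (x - y)) y)" unfolding moll_def pdK by (simp add: mult.commute)
 also have "\<dots> = (LBINT y. K (x - y) * (g y \<bullet> e))" using sob_weak[OF s test_reflect[OF K] e, of x] by simp
 also have "\<dots> = moll K g x \<bullet> e" unfolding moll_component[OF K sob_ltwo(2)[OF s]] by (simp add: moll_def)
 finally show "grad (moll K u) x \<bullet> e = moll K g x \<bullet> e" .
qed

section \<open>Cut-offs and density of test functions in \<open>H^1\<close>\<close>

text \<open>A rescaled bump with value one at the origin. It is not constant there, but it tends to
  one pointwise within \<open>[0,1]\<close>, which suffices for dominated convergence, and each
  derivative gains a factor \<open>1 / (n + 1)\<close>.\<close>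

definition cut :: "nat => 'a::euclidean_space => real" where
 "cut n x = bump 1 ((1 / real (Suc n)) *\<^sub>R x) / bump 1 (0 :: 'a)"

lemma bump_0_pos: "bump 1 (0::'a::euclidean_space) > 0" by (rule bump_pos) auto

lemma cut_test: "test_function (cut n)"
proof -
 have "test_function (\<lambda>x::'a. inverse (bump 1 (0 :: 'a)) * bump 1 ((1 / real (Suc n)) *\<^sub>R x))"
  by (intro test_cmult test_scale bump_test) auto
 then show ?thesis by (simp add: cut_def[abs_def] field_simps)
qed

lemma cut_nonneg: "0 <= cut n x" by (simp add: cut_def bump_nonneg)
lemma cut_le1: "cut n (x::'a::euclidean_space) <= 1"
 using bump_0_pos[where 'a='a] bump_antimono[of "0::'a" "(1 / real (Suc n)) *\<^sub>R x" 1] by (simp add: cut_def)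
lemma cut_borel [measurable]: "cut n \<in> BM" using cut_test by (rule test_borel)

lemma cut_grad: "grad (cut n) (x::'a::euclidean_space) = (1 / real (Suc n)) *\<^sub>R grad (cut 0) ((1 / real (Suc n)) *\<^sub>R x)"
proof -
 have "cut n = (\<lambda>x::'a. cut 0 ((1 / real (Suc n)) *\<^sub>R x))" by (auto simp: cut_def)
 then have "pd e (cut n) x = (1 / real (Suc n)) * pd e (cut 0) ((1 / real (Suc n)) *\<^sub>R x)" for e
  using pd_affine[OF test_differentiable[OF cut_test[of 0]], of e 0 "1 / real (Suc n)" x] by simp
 then show ?thesis by (simp add: grad_pd scaleR_sum_right)
qed

lemma inv_Suc_lim: "(\<lambda>n. 1 / real (Suc n)) ----> 0"
 using lim_const_over_n[THEN LIMSEQ_Suc, of 1] by simp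

lemma cut_lim: "(\<lambda>n. cut n (x::'a::euclidean_space)) ----> 1"
proof -
 have "isCont (cut 0) (0::'a)" using test_continuous[OF cut_test[of 0], of "UNIV :: 'a set"] unfolding continuous_on_eq_continuous_at[OF open_UNIV] by blast
 moreover have "(\<lambda>n. (1 / real (Suc n)) *\<^sub>R x) ----> 0 *\<^sub>R x" by (intro tendsto_scaleR inv_Suc_lim tendsto_const)
 ultimately have "(\<lambda>n. cut 0 ((1 / real (Suc n)) *\<^sub>R x)) ----> cut 0 (0::'a)"
  using isCont_tendsto_compose[of "0::'a" "cut 0" "\<lambda>n. (1 / real (Suc n)) *\<^sub>R x" sequentially] by simp
 moreover have "cut 0 (0::'a) = 1" using bump_0_pos[where 'a='a] by (simp add: cut_def)
 ultimately show ?thesis by (simp add: cut_def)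
qed

lemma cut_grad_bound: obtains C where "C > 0" "!!n x. norm (grad (cut n) (x::'a::euclidean_space)) <= C / real (Suc n)"
proof -
 obtain C where C: "C > 0" "!!x. norm (grad (cut 0) (x::'a)) <= C" using test_grad_bounded[OF cut_test] by metis
 show ?thesis
 proof (rule that[OF C(1)])
  show "norm (grad (cut n) (x::'a)) <= C / real (Suc n)" for n x
   by (subst cut_grad) (use C(2)[of "(1 / real (Suc n)) *\<^sub>R x"] in "simp add: divide_right_mono")
 qed
qed

text \<open>Truncation precedes mollification, so that the result has compact support; mollification
  commutes with the gradient by \<open>sob_moll_grad\<close>. Two errors below \<open>e / 4\<close>
  add up to less than \<open>e\<close> because \<open>msq_triangle\<close> doubles each.\<close>

theorem sob_dense:
 fixes u :: "'a::euclidean_space => real"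
 assumes s: "sob u g" and e: "e > 0"
 obtains \<phi> where "test_function \<phi>" "msq (\<lambda>x. \<phi> x - u x) < e" "msq (\<lambda>x. grad \<phi> x - g x) < e"
proof -
 have [measurable]: "u \<in> BM" "g \<in> BM" using s sob_borel sob_borel' by auto
 obtain C where C: "C > 0" "!!n x. norm (grad (cut n) (x::'a)) <= C / real (Suc n)" using cut_grad_bound by blast
 have C': "norm (grad (cut n) (x::'a)) <= C" for n x
  using order_trans[OF C(2)[of n x], of C] C(1) by (simp add: field_simps)
 define w where "w n x = cut n x * u x" for n x
 define h where "h n x = cut n x *\<^sub>R g x + u x *\<^sub>R grad (cut n) x" for n x
 have wh: "sob (w n) (h n)" for n unfolding w_def h_def by (rule sob_mult_test[OF s cut_test])
 have gm[measurable]: "grad (cut n) \<in> borel_measurable (borel :: 'a measure)" for n using test_grad_borel[OF cut_test] .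
 have 1: "l2lim w u"
 proof (rule msq_dominated[OF _ sob_ltwo(1)[OF s] AE_I2])
  show "(\<lambda>n. w n x - u x) ----> 0" for x using tendsto_diff[OF tendsto_mult[OF cut_lim[of x] tendsto_const[of "u x"]] tendsto_const[of "u x"]] by (simp add: w_def)
  show "norm (w n x - u x) <= norm (u x)" for n x
  proof -
   have "\<bar>cut n x - 1\<bar> * \<bar>u x\<bar> <= 1 * \<bar>u x\<bar>"
    using cut_nonneg[of n x] cut_le1[of n x] by (intro mult_right_mono) auto
   then show ?thesis by (simp add: w_def left_diff_distrib abs_mult[symmetric])
  qed
 qed (simp add: w_def)
 have 2: "l2lim h g"
 proof (rule msq_dominated[where H="\<lambda>x. norm (g x) + C * \<bar>u x\<bar>", OF _ _ AE_I2])
  show "ltwo (\<lambda>x. norm (g x) + C * \<bar>u x\<bar>)" using sob_ltwo[OF s] by (intro ltwo_add ltwo_cmult) (auto simp: ltwo_def)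
  show "(\<lambda>n. h n x - g x) ----> 0" for x
  proof -
   have "(\<lambda>n. grad (cut n) x) ----> 0"
    by (rule Lim_null_comparison[of _ "\<lambda>n. C * (1 / real (Suc n))"]) (use C(2)[of _ x] tendsto_mult_right_zero[OF inv_Suc_lim, of C] in "simp_all del: of_nat_Suc")
   then have "(\<lambda>n. h n x - g x) ----> 1 *\<^sub>R g x + u x *\<^sub>R 0 - g x" unfolding h_def by (intro tendsto_intros cut_lim)
   then show ?thesis by simp
  qed
  show "norm (h n x - g x) <= norm (norm (g x) + C * \<bar>u x\<bar>)" for n x
  proof -
   have "h n x - g x = (cut n x - 1) *\<^sub>R g x + u x *\<^sub>R grad (cut n) x" by (simp add: h_def scaleR_diff_left)
   moreover have "\<bar>cut n x - 1\<bar> * norm (g x) <= 1 * norm (g x)"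
    using cut_nonneg[of n x] cut_le1[of n x] by (intro mult_right_mono) auto
   moreover have "\<bar>u x\<bar> * norm (grad (cut n) x) <= \<bar>u x\<bar> * C" using C' by (intro mult_left_mono) auto
   ultimately show ?thesis using norm_triangle_ineq[of "(cut n x - 1) *\<^sub>R g x" "u x *\<^sub>R grad (cut n) x"] C(1) by (simp add: mult.commute)
  qed
 qed (simp add: h_def)
 have "\<forall>\<^sub>F n in sequentially. msq (\<lambda>x. w n x - u x) < e / 4 & msq (\<lambda>x. h n x - g x) < e / 4"
  using order_tendstoD(2)[OF 1, of "e/4"] order_tendstoD(2)[OF 2, of "e/4"] e
  by (simp add: eventually_conj_iff)
 then obtain n where n: "msq (\<lambda>x. w n x - u x) < e / 4" "msq (\<lambda>x. h n x - g x) < e / 4"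
  using eventually_happens'[OF sequentially_bot] by blast
 note w2 = sob_ltwo[OF wh[of n]]
 have "\<forall>\<^sub>F k in sequentially. msq (\<lambda>x. moll (kern (1 / real (Suc k))) (w n) x - w n x) < e / 4
   & msq (\<lambda>x. moll (kern (1 / real (Suc k))) (h n) x - h n x) < e / 4"
  using order_tendstoD(2)[OF moll_conv[OF w2(1)], of "e/4"] order_tendstoD(2)[OF moll_conv[OF w2(2)], of "e/4"] e
  by (simp add: eventually_conj_iff)
 then obtain k where k: "msq (\<lambda>x. moll (kern (1 / real (Suc k))) (w n) x - w n x) < e / 4"
   "msq (\<lambda>x. moll (kern (1 / real (Suc k))) (h n) x - h n x) < e / 4"
  using eventually_happens'[OF sequentially_bot] by blast
 let ?K = "kern (1 / real (Suc k)) :: 'a => real"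
 have K: "test_function ?K" by (intro kern_test) simp
 obtain R where R: "!!x. norm x > R ==> cut n (x::'a) = 0" using cut_test[of n] by (auto simp: test_function_iff)
 have T: "test_function (moll ?K (w n))" by (rule moll_test[OF w2(1) _ K, of R]) (simp add: w_def R)
 have m2: "ltwo (moll ?K (w n))" "ltwo (moll ?K (h n))" by (intro moll_ltwo w2; simp)+
 show ?thesis
 proof (rule that[OF T])
  show "msq (\<lambda>x. moll ?K (w n) x - u x) < e"
   using msq_triangle[OF m2(1) w2(1) sob_ltwo(1)[OF s]] k(1) n(1) by simp
  have "grad (moll ?K (w n)) = moll ?K (h n)" using sob_moll_grad[OF wh K] by auto
  then show "msq (\<lambda>x. grad (moll ?K (w n)) x - g x) < e"
   using msq_triangle[OF m2(2) w2(2) sob_ltwo(2)[OF s]] k(2) n(2) by simp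
 qed
qed

text \<open>The geometric rate is what \<open>sob_dominated_approx\<close> needs for an integrable
  majorant.\<close>

lemma sob_approx:
 assumes s: "sob u g"
 obtains \<phi> where "!!n. test_function (\<phi> n)" "l2lim \<phi> u"
  "l2lim (\<lambda>n. grad (\<phi> n)) g"
  "!!n. msq (\<lambda>x. \<phi> n x - u x) < (1/4)^n" "!!n. msq (\<lambda>x. grad (\<phi> n) x - g x) < (1/4)^n"
proof -
 have "\<exists>\<phi>. test_function \<phi> & msq (\<lambda>x. \<phi> x - u x) < (1/4)^n & msq (\<lambda>x. grad \<phi> x - g x) < (1/4)^n" for n :: nat
  by (rule sob_dense[OF s, of "(1/4)^n"]) auto
 then obtain \<phi> where \<phi>: "!!n. test_function (\<phi> n)" "!!n. msq (\<lambda>x. \<phi> n x - u x) < (1/4)^n" "!!n. msq (\<lambda>x. grad (\<phi> n) x - g x) < (1/4)^n" by metis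
 have z: "(\<lambda>n. (1/4::real)^n) ----> 0" by (rule LIMSEQ_power_zero) simp
 show ?thesis
  by (rule that[OF \<phi>(1) _ _ \<phi>(2,3)]; rule Lim_null_comparison[OF _ z]) (use \<phi>(2,3) in "auto intro!: always_eventually less_imp_le")
qed

text \<open>Extends a weak equation from test functions to \<open>H^1\<close>; the case of interest
  is testing it with the solution itself.\<close>

lemma weak_eq_extend:
 assumes g: "ltwo g" and F: "ltwo F"
  and eq: "!!\<phi>. test_function \<phi> ==> (LBINT x. g x \<bullet> grad \<phi> x) = (LBINT x. F x * \<phi> x)"
  and s: "sob v h"
 shows "(LBINT x. g x \<bullet> h x) = (LBINT x. F x * v x)"
proof -
 obtain \<phi> where \<phi>: "!!n. test_function (\<phi> n)" "l2lim \<phi> v"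
  "l2lim (\<lambda>n. grad (\<phi> n)) h" by (rule sob_approx[OF s]) blast
 have "(\<lambda>n. LBINT x. grad (\<phi> n) x \<bullet> g x) ----> (LBINT x. h x \<bullet> g x)"
  by (intro inner_conv grad_ltwo \<phi> sob_ltwo(2)[OF s] g)
 moreover have "(\<lambda>n. LBINT x. \<phi> n x \<bullet> F x) ----> (LBINT x. v x \<bullet> F x)"
  by (intro inner_conv test_ltwo \<phi> sob_ltwo(1)[OF s] F)
 moreover have "(LBINT x. grad (\<phi> n) x \<bullet> g x) = (LBINT x. \<phi> n x \<bullet> F x)" for n
  using eq[OF \<phi>(1)] by (simp add: inner_commute mult.commute)
 ultimately have "(LBINT x. h x \<bullet> g x) = (LBINT x. v x \<bullet> F x)" using LIMSEQ_unique by auto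
 then show ?thesis by (simp add: inner_commute mult.commute)
qed

lemma AE_subseq:
 fixes f :: "nat => 'a::euclidean_space => 'b::euclidean_space"
 assumes "!!n. ltwo (f n)" "ltwo g" "l2lim f g"
 obtains r where "strict_mono (r::nat => nat)" "aelim (\<lambda>n. f (r n)) g"
proof -
 have "\<exists>r::nat=>nat. strict_mono r & (AE x in lborel. (\<lambda>n. (norm (f (r n) x - g x))^2) ----> 0)"
  by (rule tendsto_L1_AE_subseq) (use ltwo_int[OF ltwo_minus[OF assms(1,2)]] assms(3) in "auto simp: msq_def")
 then obtain r where r: "strict_mono (r::nat=>nat)" "AE x in lborel. (\<lambda>n. (norm (f (r n) x - g x))^2) ----> 0" by blast
 have "aelim (\<lambda>n. f (r n)) g"
  using r(2)
 proof eventually_elim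
  case (elim x)
  have "(\<lambda>n. sqrt ((norm (f (r n) x - g x))^2)) ----> sqrt 0" by (intro tendsto_real_sqrt elim)
  then have "(\<lambda>n. f (r n) x - g x) ----> 0" by (simp add: tendsto_norm_zero_iff)
  then show ?case by (simp add: LIM_zero_iff)
 qed
 with r(1) that show ?thesis by blast
qed

lemma msq_diff_conv:
 assumes "!!n. ltwo (f n)" "ltwo g" "l2lim f g"
  "!!n. ltwo (f' n)" "ltwo g'" "l2lim f' g'"
 shows "(\<lambda>n. msq (\<lambda>x. (f n x - f' n x) - (g x - g' x))) ----> 0"
proof (rule tendsto_sandwich[of "\<lambda>_. 0" _ _ "\<lambda>n. 2 * msq (\<lambda>x. f n x - g x) + 2 * msq (\<lambda>x. f' n x - g' x)"])
 show "(\<lambda>n. 2 * msq (\<lambda>x. f n x - g x) + 2 * msq (\<lambda>x. f' n x - g' x)) ----> 0"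
  using tendsto_add[OF tendsto_mult_right_zero[OF assms(3), of 2] tendsto_mult_right_zero[OF assms(6), of 2]] by simp
 have "msq (\<lambda>x. (f n x - f' n x) - (g x - g' x)) <= 2 * msq (\<lambda>x. f n x - g x) + 2 * msq (\<lambda>x. f' n x - g' x)" for n
  using msq_minus_le[OF ltwo_minus[OF assms(1,2)] ltwo_minus[OF assms(4,5)], of n n] by (simp add: algebra_simps)
 then show "\<forall>\<^sub>F n in sequentially. msq (\<lambda>x. (f n x - f' n x) - (g x - g' x)) <= 2 * msq (\<lambda>x. f n x - g x) + 2 * msq (\<lambda>x. f' n x - g' x)" by simp
qed auto

lemma translate_conv:
 assumes "!!n. ltwo (f n)" "ltwo g" "l2lim f g"
 shows "(\<lambda>n. msq (\<lambda>x. f n (x + t) - g (x + t))) ----> 0"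
 using assms(3) msq_translate[OF ltwo_minus[OF assms(1,2)], of _ t] by simp

lemma component_conv:
 assumes "!!n. ltwo (f n)" "ltwo g" "l2lim f g"
 shows "(\<lambda>n. msq (\<lambda>x. f n x \<bullet> h - g x \<bullet> h)) ----> 0"
proof (rule tendsto_sandwich[of "\<lambda>_. 0" _ _ "\<lambda>n. (norm h)^2 * msq (\<lambda>x. f n x - g x)"])
 show "(\<lambda>n. (norm h)^2 * msq (\<lambda>x. f n x - g x)) ----> 0" using tendsto_mult_right_zero[OF assms(3)] .
qed (use msq_inner_le[OF ltwo_minus[OF assms(1,2)], of _ h] in "auto simp: inner_diff_left")

theorem sob_translation_bound:
 fixes u :: "'a::euclidean_space => real"
 assumes s: "sob u g" shows "msq (\<lambda>x. u (x + h) - u x) <= msq (\<lambda>x. g x \<bullet> h)"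
proof -
 obtain \<phi> where \<phi>: "!!n. test_function (\<phi> n)" "l2lim \<phi> u"
  "l2lim (\<lambda>n. grad (\<phi> n)) g" by (rule sob_approx[OF s]) blast
 note l = test_ltwo[OF \<phi>(1)] sob_ltwo(1)[OF s]
 have "(\<lambda>n. msq (\<lambda>x. \<phi> n (x + h) - \<phi> n x)) ----> msq (\<lambda>x. u (x + h) - u x)"
  by (rule msq_conv[OF _ _ msq_diff_conv[OF _ _ translate_conv[OF l \<phi>(2), of h] l \<phi>(2)]]) (intro ltwo_minus ltwo_translate l)+
 moreover have "(\<lambda>n. msq (\<lambda>x. grad (\<phi> n) x \<bullet> h)) ----> msq (\<lambda>x. g x \<bullet> h)"
  by (rule msq_conv[OF _ _ component_conv[OF _ _ \<phi>(3)]]) (intro ltwo_component grad_ltwo \<phi> sob_ltwo(2)[OF s])+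
 ultimately show ?thesis by (rule LIMSEQ_le) (use test_translation_bound[OF \<phi>(1)] in auto)
qed

section \<open>Gagliardo inequalities in the plane\<close>

abbreviation "ex \<equiv> (axis 1 1 :: real^2)"
abbreviation "ey \<equiv> (axis 2 1 :: real^2)"

lemma Basis_R2: "(Basis :: (real^2) set) = {ex, ey}" "ex \<noteq> ey"
 by (auto simp: Basis_vec_def UNIV_2 axis_eq_axis)

lemma ex_ey_Basis [simp]: "ex \<in> Basis" "ey \<in> Basis" by (simp_all add: Basis_R2)

lemma ex_ey_inner [simp]: "ex \<bullet> ex = 1" "ey \<bullet> ey = 1" "ex \<bullet> ey = 0" "ey \<bullet> ex = 0"
 using Basis_R2(2) by (simp_all add: inner_Basis)

text \<open>Identifies the plane with a product of two lines, which makes iterated integrals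
  available for \<open>gagliardo\<close> and for the Gaussian.\<close>

lemma lborel_R2: "distr (lborel \<Otimes>\<^sub>M lborel) borel (\<lambda>(a, b). a *\<^sub>R ex + b *\<^sub>R ey) = lborel"
proof (rule lborel_eqI[symmetric])
 fix l u :: "real^2" assume le: "!!b. b \<in> Basis ==> l \<bullet> b <= u \<bullet> b"
 have [measurable]: "(\<lambda>(a, b). a *\<^sub>R ex + b *\<^sub>R ey) \<in> lborel \<Otimes>\<^sub>M lborel \<rightarrow>\<^sub>M borel" by measurable
 have eq: "(\<lambda>(a, b). a *\<^sub>R ex + b *\<^sub>R ey) -` box l u = {l \<bullet> ex<..<u \<bullet> ex} \<times> {l \<bullet> ey<..<u \<bullet> ey}"
  by (auto simp: box_def Basis_R2 inner_add_left)
 show "emeasure (distr (lborel \<Otimes>\<^sub>M lborel) borel (\<lambda>(a, b). a *\<^sub>R ex + b *\<^sub>R ey)) (box l u) = ennreal (\<Prod>b\<in>Basis. (u - l) \<bullet> b)"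
  using le[of ex] le[of ey] Basis_R2(2)
  by (simp add: emeasure_distr space_pair_measure eq lborel.emeasure_pair_measure_Times Basis_R2 inner_diff_left ennreal_mult)
qed simp

lemma nn_integral_R2:
 fixes f :: "real^2 => ennreal"
 assumes [measurable]: "f \<in> BM"
 shows "(\<integral>\<^sup>+x. f x \<partial>lborel) = (\<integral>\<^sup>+a. \<integral>\<^sup>+b. f (a *\<^sub>R ex + b *\<^sub>R ey) \<partial>lborel \<partial>lborel)"
 by (subst lborel_R2[symmetric], subst nn_integral_distr, measurable)
   (simp add: lborel.nn_integral_fst[symmetric])

lemma line_bound:
 fixes F f :: "real => real"
 assumes D: "!!t. (F has_real_derivative f t) (at t)" and c: "continuous_on UNIV f"
  and R: "!!t. t < - R ==> F t = 0"
 shows "ennreal \<bar>F a\<bar> <= (\<integral>\<^sup>+t. ennreal \<bar>f t\<bar> \<partial>lborel)"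
proof -
 define l where "l = min a (- R - 1)"
 have l: "l <= a" "F l = 0" using R[of l] by (auto simp: l_def)
 have FTC: "(LBINT t. indicator {l..a} t *\<^sub>R f t) = F a - F l"
  by (rule integral_FTC_Icc)
   (use l D c in "auto intro: continuous_on_subset has_vector_derivative_at_within simp: has_real_derivative_iff_has_vector_derivative")
 have i: "L1 (\<lambda>t. indicator {l..a} t *\<^sub>R f t)"
  by (rule borel_integrable_compact) (use c continuous_on_subset in auto)
 have "ennreal \<bar>F a\<bar> = ennreal (norm (LBINT t. indicator {l..a} t *\<^sub>R f t))" unfolding FTC using l by simp
 also have "\<dots> <= (\<integral>\<^sup>+t. ennreal (norm (indicator {l..a} t *\<^sub>R f t)) \<partial>lborel)" by (rule integral_norm_bound_ennreal[OF i])
 also have "\<dots> <= (\<integral>\<^sup>+t. ennreal \<bar>f t\<bar> \<partial>lborel)" by (intro nn_integral_mono) (auto split: split_indicator)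
 finally show ?thesis .
qed

text \<open>Along each horizontal line \<open>|w|\<close> is bounded by the integral of
  \<open>|pd ex w|\<close> over that line, and vertically likewise. The product of the two bounds
  separates into a function of \<open>a\<close> and a function of \<open>b\<close>, so its integral
  factors.\<close>

lemma gagliardo:
 assumes w: "test_function (w :: real^2 => real)"
 shows "(LBINT x. (w x)^2) <= (LBINT x. \<bar>pd ex w x\<bar>) * (LBINT x. \<bar>pd ey w x\<bar>)"
proof -
 note p = test_pd[OF w ex_ey_Basis(1)] test_pd[OF w ex_ey_Basis(2)]
 have [measurable]: "w \<in> BM" "pd ex w \<in> BM" "pd ey w \<in> BM"
  using w p by auto
 obtain R where R: "!!x. norm x > R ==> w x = 0" using w by (auto simp: test_function_iff)
 let ?P = "\<lambda>a b. a *\<^sub>R ex + b *\<^sub>R ey"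
 have supp: "w (?P a b) = 0" if "a < - R \<or> b < - R" for a b
 proof (rule R)
  have "\<bar>a\<bar> <= norm (?P a b)" "\<bar>b\<bar> <= norm (?P a b)"
   using Basis_le_norm[of ex "?P a b"] Basis_le_norm[of ey "?P a b"] by (auto simp: inner_add_left)
  then show "norm (?P a b) > R" using that by linarith
 qed
 have D: "((\<lambda>t. w (z + t *\<^sub>R e)) has_real_derivative pd e w (z + t *\<^sub>R e)) (at t)" if "e \<in> Basis" for z e t
 proof -
  have "((\<lambda>t. z + t *\<^sub>R e) has_derivative (\<lambda>s. s *\<^sub>R e)) (at t)" by (auto intro!: derivative_eq_intros)
  from has_derivative_compose[OF this test_has_derivative[OF w]]
  show ?thesis using that by (simp add: has_field_derivative_def grad_inner_Basis mult_commute_abs)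
 qed
 have C: "continuous_on UNIV (\<lambda>t. pd e w (z + t *\<^sub>R e))" if "e \<in> Basis" for z e
  by (rule continuous_on_compose2[OF test_continuous[OF test_pd[OF w that], of UNIV]]) (auto intro!: continuous_intros)
 define A where "A b = (\<integral>\<^sup>+s. ennreal \<bar>pd ex w (?P s b)\<bar> \<partial>lborel)" for b
 define B where "B a = (\<integral>\<^sup>+s. ennreal \<bar>pd ey w (?P a s)\<bar> \<partial>lborel)" for a
 have [measurable]: "A \<in> borel_measurable lborel" "B \<in> borel_measurable lborel" unfolding A_def B_def by measurable
 have bA: "ennreal \<bar>w (?P a b)\<bar> <= A b" for a b
  unfolding A_def using line_bound[of "\<lambda>t. w (b *\<^sub>R ey + t *\<^sub>R ex)" "\<lambda>t. pd ex w (b *\<^sub>R ey + t *\<^sub>R ex)" R a] D[of ex "b *\<^sub>R ey"] C[of ex "b *\<^sub>R ey"] supp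
  by (simp add: add.commute)
 have bB: "ennreal \<bar>w (?P a b)\<bar> <= B a" for a b
  unfolding B_def using line_bound[of "\<lambda>t. w (a *\<^sub>R ex + t *\<^sub>R ey)" "\<lambda>t. pd ey w (a *\<^sub>R ex + t *\<^sub>R ey)" R b] D[of ey "a *\<^sub>R ex"] C[of ey "a *\<^sub>R ex"] supp
  by simp
 have "(\<integral>\<^sup>+x. ennreal ((w x)^2) \<partial>lborel) = (\<integral>\<^sup>+a. \<integral>\<^sup>+b. ennreal \<bar>w (?P a b)\<bar> * ennreal \<bar>w (?P a b)\<bar> \<partial>lborel \<partial>lborel)"
  by (subst nn_integral_R2) (auto simp: power2_eq_square ennreal_mult'[symmetric])
 also have "\<dots> <= (\<integral>\<^sup>+a. \<integral>\<^sup>+b. B a * A b \<partial>lborel \<partial>lborel)"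
  by (intro nn_integral_mono mult_mono bA bB) auto
 also have "\<dots> = (\<integral>\<^sup>+a. B a \<partial>lborel) * (\<integral>\<^sup>+b. A b \<partial>lborel)"
  by (simp add: nn_integral_cmult nn_integral_multc)
 also have "(\<integral>\<^sup>+a. B a \<partial>lborel) = (\<integral>\<^sup>+x. ennreal \<bar>pd ey w x\<bar> \<partial>lborel)"
  unfolding B_def by (subst nn_integral_R2) auto
 also have "(\<integral>\<^sup>+b. A b \<partial>lborel) = (\<integral>\<^sup>+x. ennreal \<bar>pd ex w x\<bar> \<partial>lborel)"
  unfolding A_def by (subst nn_integral_R2, measurable) (rule lborel_pair.Fubini', measurable)
 finally show ?thesis
  using test_integrable[OF test_mult[OF w w]] integrable_abs[OF test_integrable[OF p(1)]] integrable_abs[OF test_integrable[OF p(2)]]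
  by (simp add: nn_integral_eq_integral power2_eq_square ennreal_mult'[symmetric] mult.commute)
qed

lemma ltwo_abs: "ltwo (f :: _ => real) ==> ltwo (\<lambda>x. \<bar>f x\<bar>)" by (auto simp: ltwo_def)

text \<open>Here \<open>w\<close> is a power of \<open>\<phi>\<close>, with gradient
  \<open>c * \<psi> * grad \<phi>\<close> for a lower power \<open>\<psi>\<close>; Cauchy-Schwarz
  turns the \<open>L^1\<close> norms of \<open>gagliardo\<close> into \<open>L^2\<close>
  norms.\<close>

lemma gagliardo_prod:
 fixes \<phi> \<psi> :: "real^2 => real"
 assumes \<phi>: "test_function \<phi>" and \<psi>: "test_function \<psi>" and w: "test_function w"
  and pdw: "!!e x. e \<in> Basis ==> pd e w x = c * \<psi> x * pd e \<phi> x"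
 shows "(LBINT x. (w x)^2) <= c^2 * msq \<psi> * msq (grad \<phi>)"
proof -
 have b: "(LBINT x. \<bar>pd e w x\<bar>) <= \<bar>c\<bar> * sqrt (msq \<psi> * msq (grad \<phi>))" if e: "e \<in> Basis" for e
 proof -
  have "(LBINT x. \<bar>pd e w x\<bar>) = \<bar>c\<bar> * (LBINT x. \<bar>\<psi> x\<bar> * \<bar>pd e \<phi> x\<bar>)"
   by (simp add: pdw[OF e] abs_mult mult.assoc)
  also have "(LBINT x. \<bar>\<psi> x\<bar> * \<bar>pd e \<phi> x\<bar>) <= sqrt (msq \<psi> * msq (pd e \<phi>))"
  proof -
   have l: "ltwo (\<lambda>x. \<bar>\<psi> x\<bar>)" "ltwo (\<lambda>x. \<bar>pd e \<phi> x\<bar>)" using \<psi> test_pd[OF \<phi> e] test_ltwo ltwo_abs by blast+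
   show ?thesis using cauchy_schwarz_abs[OF l] by (simp add: msq_def)
  qed
  also have "msq (pd e \<phi>) <= msq (grad \<phi>)"
   using msq_inner_le[OF grad_ltwo[OF \<phi>], of e] e by (simp add: grad_inner_Basis)
  finally show ?thesis by (simp add: mult_left_mono)
 qed
 have "(LBINT x. (w x)^2) <= (LBINT x. \<bar>pd ex w x\<bar>) * (LBINT x. \<bar>pd ey w x\<bar>)" by (rule gagliardo[OF w])
 also have "\<dots> <= (\<bar>c\<bar> * sqrt (msq \<psi> * msq (grad \<phi>))) * (\<bar>c\<bar> * sqrt (msq \<psi> * msq (grad \<phi>)))"
  by (intro mult_mono b) auto
 also have "\<dots> = c^2 * msq \<psi> * msq (grad \<phi>)"
  using real_sqrt_mult_self[of "msq \<psi> * msq (grad \<phi>)"] by (simp add: power2_eq_square mult_ac abs_mult_self_eq)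
 finally show ?thesis .
qed

lemma test_L4: assumes \<phi>: "test_function (\<phi> :: real^2 => real)"
 shows "(LBINT x. \<phi> x ^ 4) <= 4 * msq \<phi> * msq (grad \<phi>)"
proof -
 have "(LBINT x. (\<phi> x * \<phi> x)^2) <= 2^2 * msq \<phi> * msq (grad \<phi>)"
  by (rule gagliardo_prod[OF \<phi> \<phi> test_mult[OF \<phi> \<phi>]]) (simp add: pd_mult test_differentiable[OF \<phi>])
 then show ?thesis by (simp add: power2_eq_square power4_eq_xxxx mult.assoc)
qed

text \<open>The sixth power has two uses: it puts cubic nonlinearities into \<open>L^2\<close>, and
  being of higher order it gives uniform integrability of the quartic terms. The constant is
  \<open>3^2 * 4\<close>.\<close>

lemma test_L6: assumes \<phi>: "test_function (\<phi> :: real^2 => real)"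
 shows "(LBINT x. \<phi> x ^ 6) <= 36 * msq \<phi> * (msq (grad \<phi>))^2"
proof -
 note t = test_mult[OF \<phi> \<phi>]
 have "(LBINT x. (\<phi> x * (\<phi> x * \<phi> x))^2) <= 3^2 * msq (\<lambda>x. \<phi> x * \<phi> x) * msq (grad \<phi>)"
  by (rule gagliardo_prod[OF \<phi> t test_mult[OF \<phi> t]])
   (simp add: pd_mult test_differentiable[OF \<phi>] test_differentiable[OF t] algebra_simps)
 moreover have "msq (\<lambda>x. \<phi> x * \<phi> x) <= 4 * msq \<phi> * msq (grad \<phi>)"
  using test_L4[OF \<phi>] by (simp add: msq_def power2_eq_square power4_eq_xxxx mult.assoc)
 ultimately have "(LBINT x. (\<phi> x * (\<phi> x * \<phi> x))^2) <= 9 * (4 * msq \<phi> * msq (grad \<phi>)) * msq (grad \<phi>)"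
  using mult_right_mono[of "msq (\<lambda>x. \<phi> x * \<phi> x)" "4 * msq \<phi> * msq (grad \<phi>)" "9 * msq (grad \<phi>)"]
  by (simp add: mult_ac)
 then show ?thesis by (simp add: power2_eq_square eval_nat_numeral mult_ac)
qed

lemma sob_AE_approx:
 fixes u :: "'a::euclidean_space => real"
 assumes s: "sob u g"
 obtains \<phi> where "!!n. test_function (\<phi> n)" "l2lim \<phi> u"
  "l2lim (\<lambda>n. grad (\<phi> n)) g" "aelim \<phi> u"
proof -
 obtain \<phi> where \<phi>: "!!n. test_function (\<phi> n)" "l2lim \<phi> u"
  "l2lim (\<lambda>n. grad (\<phi> n)) g" by (rule sob_approx[OF s]) blast
 obtain r where r: "strict_mono r" "aelim (\<lambda>n. \<phi> (r n)) u"
  using AE_subseq[OF test_ltwo[OF \<phi>(1)] sob_ltwo(1)[OF s] \<phi>(2)] by blast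
 show ?thesis
  by (rule that[of "\<phi> \<circ> r"])
   (use \<phi> r LIMSEQ_subseq_LIMSEQ[OF \<phi>(2) r(1)] LIMSEQ_subseq_LIMSEQ[OF \<phi>(3) r(1)] in "auto simp: o_def")
qed

lemma sob_Lp:
 fixes u :: "real^2 => real"
 assumes s: "sob u g"
 shows "L1 (\<lambda>x. u x ^ 4)" "(LBINT x. u x ^ 4) <= 4 * msq u * msq g"
  "L1 (\<lambda>x. u x ^ 6)" "(LBINT x. u x ^ 6) <= 36 * msq u * (msq g)^2"
proof -
 obtain \<phi> where \<phi>: "!!n. test_function (\<phi> n)" "l2lim \<phi> u"
  "l2lim (\<lambda>n. grad (\<phi> n)) g" "aelim \<phi> u"
  by (rule sob_AE_approx[OF s]) blast
 have [measurable]: "u \<in> BM" "!!n. \<phi> n \<in> BM" using sob_borel[OF s] \<phi>(1) by auto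
 have m: "(\<lambda>n. msq (\<phi> n)) ----> msq u" "(\<lambda>n. msq (grad (\<phi> n))) ----> msq g"
  using msq_conv[OF test_ltwo[OF \<phi>(1)] sob_ltwo(1)[OF s] \<phi>(2)] msq_conv[OF grad_ltwo[OF \<phi>(1)] sob_ltwo(2)[OF s] \<phi>(3)] by auto
 have AE: "AE x in lborel. (\<lambda>n. \<phi> n x ^ k) ----> u x ^ k" for k
  using \<phi>(4) by eventually_elim (rule tendsto_power)
 have i: "L1 (\<lambda>x. \<phi> n x ^ Suc k)" for n k by (intro test_integrable test_power \<phi>)
 have i4: "L1 (\<lambda>x. \<phi> n x ^ 4)" and i6: "L1 (\<lambda>x. \<phi> n x ^ 6)" for n
  using i[of n 3] i[of n 5] by (simp_all add: eval_nat_numeral)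
 have 1: "(\<lambda>n. 4 * msq (\<phi> n) * msq (grad (\<phi> n))) ----> 4 * msq u * msq g" by (intro tendsto_intros m)
 have 2: "(\<lambda>n. 36 * msq (\<phi> n) * (msq (grad (\<phi> n)))^2) ----> 36 * msq u * (msq g)^2" by (intro tendsto_intros m)
 show "L1 (\<lambda>x. u x ^ 4)" "(LBINT x. u x ^ 4) <= 4 * msq u * msq g"
  by (rule fatou_real[OF _ _ _ AE i4 test_L4[OF \<phi>(1)] 1]; simp)+
 show "L1 (\<lambda>x. u x ^ 6)" "(LBINT x. u x ^ 6) <= 36 * msq u * (msq g)^2"
  by (rule fatou_real[OF _ _ _ AE i6 test_L6[OF \<phi>(1)] 2]; simp)+
qed

section \<open>Integrable majorants\<close>

text \<open>Geometric decay of the integrals makes the series integrable; its sum majorizes every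
  term, and its convergence sends the terms to zero.\<close>

lemma dominating_series:
 fixes d :: "nat => 'a => real"
 assumes i: "!!n. integrable M (d n)" and nn: "!!n x. d n x >= 0" and le: "!!n. (\<integral>x. d n x \<partial>M) <= c * (1/4)^n"
 obtains S where "integrable M S" "AE x in M. (\<forall>n. d n x <= S x) & (\<lambda>n. d n x) ----> 0"
proof -
 have [measurable]: "d n \<in> borel_measurable M" for n using i by auto
 have "0 <= (\<integral>x. d 0 x \<partial>M)" by (rule integral_nonneg_AE) (simp add: nn)
 then have c: "c >= 0" using le[of 0] by simp
 have "(\<integral>\<^sup>+x. (\<Sum>n. ennreal (d n x)) \<partial>M) = (\<Sum>n. \<integral>\<^sup>+x. ennreal (d n x) \<partial>M)" by (rule nn_integral_suminf) auto
 also have "\<dots> <= (\<Sum>n. ennreal (c * (1/4)^n))"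
  using nn le by (intro suminf_le allI) (auto simp: nn_integral_eq_integral[OF i] intro!: ennreal_leI)
 also have "\<dots> = ennreal (\<Sum>n. c * (1/4)^n)" using c by (intro suminf_ennreal2) auto
 finally have fin: "(\<integral>\<^sup>+x. (\<Sum>n. ennreal (d n x)) \<partial>M) \<noteq> \<infinity>" by (auto simp: top_unique)
 then have AE: "AE x in M. (\<Sum>n. ennreal (d n x)) \<noteq> \<infinity>" by (intro nn_integral_noteq_infinite) auto
 define S where "S x = enn2real (\<Sum>n. ennreal (d n x))" for x
 have [measurable]: "S \<in> borel_measurable M" unfolding S_def[abs_def] by measurable
 have "integrable M S"
 proof (rule integrableI_nonneg)
  show "S \<in> borel_measurable M" by measurable
  have "(\<integral>\<^sup>+x. ennreal (S x) \<partial>M) = (\<integral>\<^sup>+x. (\<Sum>n. ennreal (d n x)) \<partial>M)"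
   by (rule nn_integral_cong_AE) (use AE in "auto simp: S_def less_top")
  then show "(\<integral>\<^sup>+x. ennreal (S x) \<partial>M) < \<infinity>" using fin by (simp add: less_top)
 qed (auto simp: S_def)
 moreover have "AE x in M. (\<forall>n. d n x <= S x) & (\<lambda>n. d n x) ----> 0"
  using AE
 proof eventually_elim
  case (elim x)
  then have s: "summable (\<lambda>n. d n x)" using summable_iff_suminf_neq_top[of "\<lambda>n. d n x"] nn by auto
  then have "S x = (\<Sum>n. d n x)" unfolding S_def using nn suminf_nonneg[OF s] by (subst suminf_ennreal2) auto
  moreover have "d n x <= (\<Sum>n. d n x)" for n using sum_le_suminf[OF s, of "{n}"] nn by simp
  ultimately show ?case using summable_LIMSEQ_zero[OF s] by simp
 qed
 ultimately show ?thesis by (rule that)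
qed

lemma power6_add_le: "(a + b :: real) ^ 6 <= 64 * a ^ 6 + 64 * b ^ 6"
proof -
 define m where "m = max \<bar>a\<bar> \<bar>b\<bar>"
 have "\<bar>a + b\<bar> <= 2 * m" by (auto simp: m_def)
 then have "\<bar>a + b\<bar> ^ 6 <= (2 * m) ^ 6" by (intro power_mono) auto
 also have "\<dots> = 64 * m ^ 6" by (simp add: power_mult_distrib)
 also have "m ^ 6 <= a ^ 6 + b ^ 6" unfolding m_def by (auto simp: max_def power_even_abs)
 finally show ?thesis by (simp add: power_even_abs)
qed

text \<open>One integrable function dominates squares and sixth powers of the approximants and
  squares of their gradients. This allows nonlinear expressions in \<open>u\<close> and its gradient
  to pass to the limit in \<open>chain_rule\<close>.\<close>

theorem sob_dominated_approx:
 fixes u :: "real^2 => real"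
 assumes s: "sob u g"
 obtains \<phi> M where "!!n. test_function (\<phi> n)" "L1 M"
  "AE x in lborel. (\<lambda>n. \<phi> n x) ----> u x & (\<lambda>n. grad (\<phi> n) x) ----> g x &
    (\<forall>n. (\<phi> n x)^2 + (\<phi> n x)^6 + (norm (grad (\<phi> n) x))^2 <= M x)"
proof -
 obtain \<phi> where \<phi>: "!!n. test_function (\<phi> n)"
  "!!n. msq (\<lambda>x. \<phi> n x - u x) < (1/4)^n" "!!n. msq (\<lambda>x. grad (\<phi> n) x - g x) < (1/4)^n" by (rule sob_approx[OF s]) blast
 define d where "d n x = (\<phi> n x - u x)^2 + (\<phi> n x - u x)^6 + (norm (grad (\<phi> n) x - g x))^2" for n x
 have sd: "sob (\<lambda>x. \<phi> n x - u x) (\<lambda>x. grad (\<phi> n) x - g x)" for n by (intro sob_minus sob_test \<phi> s)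
 note i2 = ltwo_int_real[OF sob_ltwo(1)[OF sd]] sob_Lp(3)[OF sd] ltwo_int[OF sob_ltwo(2)[OF sd]]
 have id: "L1 (d n)" for n unfolding d_def[abs_def] by (intro Bochner_Integration.integrable_add i2)
 \<comment> \<open>\<open>38 = 1 + 36 + 1\<close>, where \<open>36\<close> comes from the sextic
   estimate of \<open>sob_Lp\<close>.\<close>
 have "(LBINT x. d n x) <= 38 * (1/4)^n" for n
 proof -
  let ?q = "(1/4::real)^n"
  have q: "0 <= ?q" "?q <= 1" by (auto simp: power_le_one)
  have "(LBINT x. d n x) = msq (\<lambda>x. \<phi> n x - u x) + (LBINT x. (\<phi> n x - u x)^6) + msq (\<lambda>x. grad (\<phi> n) x - g x)"
   unfolding d_def msq_def using i2 by simp
  also have "(LBINT x. (\<phi> n x - u x)^6) <= 36 * msq (\<lambda>x. \<phi> n x - u x) * (msq (\<lambda>x. grad (\<phi> n) x - g x))^2" by (rule sob_Lp(4)[OF sd])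
  also have "\<dots> <= 36 * ?q * 1^2" using \<phi>(2,3)[of n] q by (intro mult_mono power_mono) auto
  finally show ?thesis using \<phi>(2,3)[of n] by simp
 qed
 then obtain S where S: "L1 S" "AE x in lborel. (\<forall>n. d n x <= S x) & (\<lambda>n. d n x) ----> 0"
  using dominating_series[of lborel d 38] id by (auto simp: d_def)
 define M where "M x = 2 * (u x)^2 + 64 * u x ^ 6 + 2 * (norm (g x))^2 + 68 * S x" for x
 have iM: "L1 M" unfolding M_def[abs_def]
  using ltwo_int_real[OF sob_ltwo(1)[OF s]] sob_Lp(3)[OF s] ltwo_int[OF sob_ltwo(2)[OF s]] S(1) by simp
 show ?thesis
 proof (rule that[OF \<phi>(1) iM])
  show "AE x in lborel. (\<lambda>n. \<phi> n x) ----> u x & (\<lambda>n. grad (\<phi> n) x) ----> g x &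
    (\<forall>n. (\<phi> n x)^2 + (\<phi> n x)^6 + (norm (grad (\<phi> n) x))^2 <= M x)"
   using S(2)
  proof eventually_elim
   case (elim x)
   then have dz: "(\<lambda>n. sqrt (d n x)) ----> 0" using tendsto_real_sqrt[of "\<lambda>n. d n x" 0] by simp
   have 6: "(y::real)^6 >= 0" for y by simp
   have "(\<lambda>n. \<phi> n x - u x) ----> 0"
    by (rule Lim_null_comparison[OF _ dz]) (auto simp: d_def intro!: always_eventually real_le_rsqrt)
   moreover have "(\<lambda>n. grad (\<phi> n) x - g x) ----> 0"
    by (rule Lim_null_comparison[OF _ dz]) (auto simp: d_def intro!: always_eventually real_le_rsqrt)
   moreover have "(\<phi> n x)^2 + (\<phi> n x)^6 + (norm (grad (\<phi> n) x))^2 <= M x" for n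
   proof -
    have "(\<phi> n x)^2 <= 2 * (u x)^2 + 2 * (\<phi> n x - u x)^2" using norm_add_sq[of "u x" "\<phi> n x - u x"] by simp
    moreover have "(\<phi> n x)^6 <= 64 * (u x)^6 + 64 * (\<phi> n x - u x)^6" using power6_add_le[of "u x" "\<phi> n x - u x"] by simp
    moreover have "(norm (grad (\<phi> n) x))^2 <= 2 * (norm (g x))^2 + 2 * (norm (grad (\<phi> n) x - g x))^2"
     using norm_add_sq[of "g x" "grad (\<phi> n) x - g x"] by simp
    moreover have "2 * (\<phi> n x - u x)^2 + 64 * (\<phi> n x - u x)^6 + 2 * (norm (grad (\<phi> n) x - g x))^2 <= 68 * d n x"
     unfolding d_def distrib_left using 6[of "\<phi> n x - u x"] by (intro add_mono mult_right_mono) auto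
    moreover have "d n x <= S x" using elim by blast
    ultimately show ?thesis unfolding M_def by linarith
   qed
   ultimately show ?case by (auto simp: LIM_zero_iff)
  qed
 qed
qed

lemma power_between: fixes m :: real assumes "0 <= m" "2 <= k" "k <= 6" shows "m ^ k <= m^2 + m ^ 6"
proof (cases "m <= 1")
 case True
 then have "m ^ k <= m^2" using assms by (intro power_decreasing) auto
 then show ?thesis using assms by (simp add: add_increasing2)
next
 case False
 then have "m ^ k <= m ^ 6" using assms by (intro power_increasing) auto
 then show ?thesis by (simp add: add_increasing)
qed

text \<open>Dominates \<open>|t|^k\<close> for \<open>k\<close> from two to six and is integrable
  along functions of \<open>H^1\<close>; sums of \<open>wt\<close> are the common majorants of the
  products that occur.\<close>

definition wt :: "real => real" where "wt t = t^2 + t ^ 6"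

lemma wt_nonneg [simp]: "wt t >= 0" by (simp add: wt_def)
lemma wt_abs [simp]: "wt \<bar>t\<bar> = wt t" by (simp add: wt_def power_even_abs)
lemma sob_wt: fixes u :: "real^2 => real" shows "sob u g ==> L1 (\<lambda>x. wt (u x))"
 unfolding wt_def using ltwo_int_real[OF sob_ltwo(1)] sob_Lp(3) by (intro Bochner_Integration.integrable_add)

text \<open>The entry of largest modulus majorizes the product by its power of order
  \<open>length l * j\<close>. The formulation with lists covers all products of two to six factors
  at once.\<close>

lemma wt_prod_list:
 assumes l: "2 <= length l * j" "length l * j <= 6" shows "\<bar>prod_list l\<bar> ^ j <= (\<Sum>t\<leftarrow>l. wt t)"
proof -
 define m where "m = Max (abs ` set l)"
 have "l \<noteq> []" using l by auto
 then have "m \<in> abs ` set l" unfolding m_def by (intro Max_in) auto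
 then obtain s where s: "s \<in> set l" "m = \<bar>s\<bar>" by auto
 have "\<bar>prod_list k\<bar> <= m ^ length k" if "set k \<subseteq> set l" for k using that
 proof (induction k)
  case (Cons a k)
  then have "\<bar>a\<bar> <= m" by (simp add: m_def)
  then show ?case using Cons s mult_mono[of "\<bar>a\<bar>" m "\<bar>prod_list k\<bar>" "m ^ length k"] by (simp add: abs_mult)
 qed simp
 then have "\<bar>prod_list l\<bar> ^ j <= (m ^ length l) ^ j" by (intro power_mono) auto
 also have "\<dots> <= wt s" using power_between[of m "length l * j"] l s by (simp add: wt_def power_even_abs power_mult)
 also have "wt s <= (\<Sum>t\<leftarrow>l. wt t)"
 proof -
  have n: "0 <= (\<Sum>t\<leftarrow>k. wt t)" for k by (induction k) auto
  show ?thesis using s(1) by (induction l) (auto simp: n add_increasing add_increasing2)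
 qed
 finally show ?thesis .
qed

lemma wt_bound2: "\<bar>a * b\<bar> <= wt a + wt b"
 and wt_bound3: "\<bar>a * b * c\<bar> <= wt a + wt b + wt c"
 and wt_bound4: "\<bar>a * b * c * d\<bar> <= wt a + wt b + wt c + wt d"
 and wt_bound6: "(a * b * c)^2 <= wt a + wt b + wt c"
 and wt_bound44: "(a * b)^2 <= wt a + wt b"
 using wt_prod_list[of "[a,b]" 1] wt_prod_list[of "[a,b,c]" 1] wt_prod_list[of "[a,b,c,d]" 1] wt_prod_list[of "[a,b,c]" 2] wt_prod_list[of "[a,b]" 2]
 by (simp_all add: mult.assoc add.assoc)

section \<open>Polarization\<close>

text \<open>Orthogonal reflection in the line \<open>{x. x \<bullet> n = c}\<close>, for a unit vector \<open>n\<close>.\<close>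

definition refl :: "'a::real_inner => real => 'a => 'a" where
 "refl n c x = x - (2 * (x \<bullet> n - c)) *\<^sub>R n"

lemma refl_refl: "norm n = 1 ==> refl n c (refl n c x) = x"
 by (simp add: refl_def inner_diff_left norm_eq_1 algebra_simps flip: scaleR_add_left)

lemma refl_inner: "norm n = 1 ==> refl n c x \<bullet> n - c = - (x \<bullet> n - c)"
 by (simp add: refl_def inner_diff_left norm_eq_1)

lemma refl_borel [measurable]: "refl n c \<in> borel \<rightarrow>\<^sub>M (borel :: 'a::euclidean_space measure)"
 unfolding refl_def[abs_def] by measurable

text \<open>The affine reflection is the linear one followed by a translation, and both orthogonal
  maps and translations preserve the measure of boxes.\<close>

lemma lborel_refl:
 assumes n: "norm (n :: real^2) = 1" shows "distr lborel borel (refl n c) = lborel"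
proof (rule lborel_eqI[symmetric])
 fix l u :: "real^2" assume le: "!!b. b \<in> Basis ==> l \<bullet> b <= u \<bullet> b"
 have lin: "linear (refl n 0)" by (rule linearI) (simp_all add: refl_def inner_add_left algebra_simps)
 have orth: "orthogonal_transformation (refl n 0)"
  unfolding orthogonal_transformation_def using lin n
  by (auto simp: refl_def inner_diff_left inner_diff_right norm_eq_1 inner_commute algebra_simps)
 have split: "refl n c x = (2 * c) *\<^sub>R n + refl n 0 x" for x by (simp add: refl_def algebra_simps)
 have "refl n c -` box l u = refl n c ` box l u"
  using refl_refl[OF n, of c] by (auto simp: image_iff) metis
 also have "\<dots> = (+) ((2 * c) *\<^sub>R n) ` refl n 0 ` box l u" unfolding image_image by (simp add: split)
 finally have eq: "refl n c -` box l u = (+) ((2 * c) *\<^sub>R n) ` refl n 0 ` box l u" .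
 have lm: "refl n 0 ` box l u \<in> lmeasurable" by (rule measurable_orthogonal_image[OF orth]) simp
 then have lm2: "refl n c -` box l u \<in> lmeasurable" unfolding eq by (rule measurable_translation)
 have "measure lebesgue (refl n c -` box l u) = measure lebesgue (refl n 0 ` box l u)" unfolding eq by (rule measure_translation)
 also have "\<dots> = measure lebesgue (box l u)" by (rule measure_orthogonal_image[OF orth]) simp
 finally have m: "measure lebesgue (refl n c -` box l u) = measure lebesgue (box l u)" .
 have b: "refl n c -` box l u \<in> sets borel" using measurable_sets[OF refl_borel[of n c], of "box l u"] by simp
 have "emeasure (distr lborel borel (refl n c)) (box l u) = emeasure lebesgue (refl n c -` box l u)"
  using b by (simp add: emeasure_distr)
 also have "\<dots> = emeasure lebesgue (box l u)"
  using m lm2 by (simp add: emeasure_eq_measure2 fmeasurableD2)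
 also have "\<dots> = (\<Prod>b\<in>Basis. (u - l) \<bullet> b)" using le by simp
 finally show "emeasure (distr lborel borel (refl n c)) (box l u) = (\<Prod>b\<in>Basis. (u - l) \<bullet> b)" .
qed simp

lemma nn_integral_refl:
 assumes "norm (n :: real^2) = 1" "f \<in> BM" shows "(\<integral>\<^sup>+x. f (refl n c x) \<partial>lborel) = (\<integral>\<^sup>+x. f x \<partial>lborel)"
 using nn_integral_distr[of "refl n c" lborel borel f] lborel_refl[OF assms(1), of c] assms(2) by simp

lemma integral_refl:
 fixes f :: "real^2 => real"
 assumes "norm (n :: real^2) = 1" "f \<in> BM"
 shows "(LBINT x. f (refl n c x)) = (LBINT x. f x)" "L1 (\<lambda>x. f (refl n c x)) \<longleftrightarrow> L1 f"
 using integral_distr[of "refl n c" lborel borel f] integrable_distr_eq[of "refl n c" lborel borel f] lborel_refl[OF assms(1), of c] assms(2) by simp_all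

lemma AE_refl:
 assumes "norm (n :: real^2) = 1" "AE x in lborel. P x" shows "AE x in lborel. P (refl n c x)"
proof -
 obtain N where N: "{x. \<not> P x} \<subseteq> N" "emeasure lborel N = 0" and [measurable]: "N \<in> sets borel"
  using assms(2) by (auto elim!: AE_E)
 have "(\<integral>\<^sup>+x. indicator N (refl n c x) \<partial>lborel) = (\<integral>\<^sup>+x. indicator N x \<partial>lborel)"
  by (rule nn_integral_refl[OF assms(1)]) simp
 also have "\<dots> = 0" using N by simp
 finally have "AE x in lborel. indicator N (refl n c x) = (0::ennreal)" by (subst (asm) nn_integral_0_iff_AE) auto
 then show ?thesis using N(1) by (auto elim!: eventually_mono simp: indicator_def split: if_splits)
qed

section \<open>Passage to the limit under almost everywhere convergence\<close>

text \<open>A form of Vitali's theorem: the majorant consists of a fixed integrable \<open>D\<close>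
  and a varying part \<open>E n\<close> of small integral. This is how tightness and the sextic
  bound enter later.\<close>

lemma integral_conv_uniform:
 fixes h :: "nat => 'a => real"
 assumes hm[measurable]: "!!n. h n \<in> borel_measurable M" "v \<in> borel_measurable M"
  and AE: "AE x in M. (\<lambda>n. h n x) ----> v x"
  and D: "!!\<delta>. \<delta> > 0 ==> \<exists>D E. integrable M D & (\<forall>n. integrable M (E n) & (\<integral>x. E n x \<partial>M) <= \<delta> & (AE x in M. 0 <= D x & 0 <= E n x & \<bar>h n x\<bar> <= D x + E n x))"
 shows "integrable M v" "(\<lambda>n. \<integral>x. h n x \<partial>M) ----> (\<integral>x. v x \<partial>M)" "!!n. integrable M (h n)"
proof -
 have hi: "integrable M (h n)" for n
 proof -
  obtain D E where DE: "integrable M D" "!!n. integrable M (E n)" "!!n. AE x in M. 0 <= D x & 0 <= E n x & \<bar>h n x\<bar> <= D x + E n x"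
   using D[of 1] by auto
  have "integrable M (\<lambda>x. D x + E n x)" using DE by simp
  then show ?thesis by (rule integrable_dom) (simp, use DE(3)[of n] in eventually_elim, auto)
 qed
 then show "!!n. integrable M (h n)" .
 show vi: "integrable M v"
 proof -
  obtain D E where DE: "integrable M D" "!!n. integrable M (E n)" "!!n. (\<integral>x. E n x \<partial>M) <= 1" "!!n. AE x in M. \<bar>h n x\<bar> <= D x + E n x"
   using D[of 1] by auto
  have a: "AE x in M. (\<lambda>n. \<bar>h n x\<bar>) ----> \<bar>v x\<bar>" using AE by eventually_elim (intro tendsto_intros)
  have b: "(\<integral>x. \<bar>h n x\<bar> \<partial>M) <= (\<integral>x. D x \<partial>M) + 1" for n
  proof -
   have "(\<integral>x. \<bar>h n x\<bar> \<partial>M) <= (\<integral>x. D x + E n x \<partial>M)" by (rule integral_mono_AE) (use hi DE in auto)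
   then show ?thesis using DE(1,2) DE(3)[of n] by simp
  qed
  have "integrable M (\<lambda>x. \<bar>v x\<bar>)" by (rule fatou_real(1)[OF _ _ _ a integrable_abs[OF hi] b tendsto_const]) auto
  then show ?thesis by (simp add: integrable_abs_iff)
 qed
 show "(\<lambda>n. \<integral>x. h n x \<partial>M) ----> (\<integral>x. v x \<partial>M)"
 proof (rule LIMSEQ_I)
  fix e :: real assume e: "e > 0"
  obtain D E where DE: "integrable M D" "!!n. integrable M (E n)" "!!n. (\<integral>x. E n x \<partial>M) <= e / 2"
   "!!n. AE x in M. 0 <= D x & 0 <= E n x & \<bar>h n x\<bar> <= D x + E n x" using D[of "e / 2"] e by auto
  \<comment> \<open>Subtracting \<open>E n\<close> leaves functions dominated by
    \<open>D + |v|\<close>, to which ordinary dominated convergence applies.\<close>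
  define P where "P n x = max 0 (\<bar>h n x - v x\<bar> - E n x)" for n x
  have [measurable]: "E n \<in> borel_measurable M" for n using DE(2) by auto
  have [measurable]: "P n \<in> borel_measurable M" for n unfolding P_def by measurable
  have AEn: "AE x in M. \<forall>n. 0 <= E n x" unfolding AE_all_countable using DE(4) by auto
  have P0: "AE x in M. (\<lambda>n. P n x) ----> 0"
   using AE AEn
  proof eventually_elim
   case (elim x)
   have "(\<lambda>n. \<bar>h n x - v x\<bar>) ----> \<bar>v x - v x\<bar>" using elim(1) by (intro tendsto_intros)
   then show ?case by (intro Lim_null_comparison[of "\<lambda>n. P n x" "\<lambda>n. \<bar>h n x - v x\<bar>"]) (use elim(2) in "auto simp: P_def intro!: always_eventually")
  qed
  have Pb: "AE x in M. norm (P n x) <= D x + \<bar>v x\<bar>" for n using DE(4)[of n] by eventually_elim (auto simp: P_def)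
  have Di: "integrable M (\<lambda>x. D x + \<bar>v x\<bar>)" using DE(1) vi by simp
  have Pi: "integrable M (P n)" for n by (rule integrable_dom[OF Di]) (measurable, use Pb[of n] in eventually_elim, simp)
  have "(\<lambda>n. \<integral>x. P n x \<partial>M) ----> (\<integral>x. 0 \<partial>M)" by (rule integral_dominated_convergence[OF _ _ Di P0 Pb]) auto
  from LIMSEQ_D[OF this, of "e / 2"] e obtain N where N: "!!n. n >= N ==> (\<integral>x. P n x \<partial>M) < e / 2" by force
  have "norm ((\<integral>x. h n x \<partial>M) - (\<integral>x. v x \<partial>M)) < e" if "n >= N" for n
  proof -
   have "norm (\<integral>x. h n x - v x \<partial>M) <= (\<integral>x. P n x + E n x \<partial>M)"
    using hi vi Pi DE(2) by (intro order_trans[OF integral_norm_bound] integral_mono) (auto simp: P_def)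
   then show ?thesis using N[OF that] DE(3)[of n] hi vi Pi DE(2) by simp
  qed
  then show "\<exists>no. \<forall>n\<ge>no. norm ((\<integral>x. h n x \<partial>M) - (\<integral>x. v x \<partial>M)) < e" by blast
 qed
qed

lemma AE_limit_ltwo:
 fixes u :: "nat => 'a::euclidean_space => real"
 assumes l: "!!n. ltwo (u n)" and A: "!!n. msq (u n) <= A n" "A ----> a" and [measurable]: "v \<in> BM"
  and AE: "aelim u v"
 shows "ltwo v" "msq v <= a"
proof -
 note [measurable] = ltwo_borel[OF l]
 have AE2: "AE x in lborel. (\<lambda>n. (norm (u n x))^2) ----> (norm (v x))^2"
  using AE by eventually_elim (intro tendsto_intros)
 have "L1 (\<lambda>x. (norm (v x))^2)" "(LBINT x. (norm (v x))^2) <= a"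
  by (rule fatou_real[OF _ _ _ AE2 ltwo_int[OF l] _ A(2)]; use A(1) in "simp add: msq_def")+
 then show "ltwo v" "msq v <= a" by (simp_all add: ltwo_def msq_def)
qed

text \<open>The inequality \<open>|\<psi> W| \<le> \<psi>^2 / s + s W^2\<close> splits the product
  into a fixed integrable part and a part of integral at most \<delta>, as
  \<open>integral_conv_uniform\<close> requires.\<close>

lemma ltwo_weak_conv:
 fixes \<psi> :: "'a::euclidean_space => real"
 assumes \<psi>: "ltwo \<psi>" and l: "!!n. ltwo (W n)" and A: "!!n. msq (W n) <= A" and [measurable]: "w \<in> BM"
  and AE: "aelim W w"
 shows "(\<lambda>n. LBINT x. \<psi> x * W n x) ----> (LBINT x. \<psi> x * w x)"
proof (rule integral_conv_uniform(2))
 have [measurable]: "\<psi> \<in> BM" using \<psi> by (simp add: ltwo_def)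
 note [measurable] = ltwo_borel[OF l]
 show "(\<lambda>x. \<psi> x * W n x) \<in> borel_measurable lborel" for n by measurable
 show "(\<lambda>x. \<psi> x * w x) \<in> borel_measurable lborel" by measurable
 show "AE x in lborel. (\<lambda>n. \<psi> x * W n x) ----> \<psi> x * w x" using AE by eventually_elim (intro tendsto_intros)
 fix \<delta> :: real assume d: "\<delta> > 0"
 have A0: "A >= 0" using A[of 0] msq_nonneg[of "W 0"] by linarith
 define s where "s = \<delta> / (A + 1)"
 have s: "s > 0" "s * A <= \<delta>" using d A0 by (auto simp: s_def field_simps)
 show "\<exists>D E. L1 D & (\<forall>n. L1 (E n) & (LBINT x. E n x) <= \<delta> & (AE x in lborel. 0 <= D x & 0 <= E n x & \<bar>\<psi> x * W n x\<bar> <= D x + E n x))"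
 proof (intro exI[of _ "\<lambda>x. (\<psi> x)^2 / s"] exI[of _ "\<lambda>n x. s * (W n x)^2"] conjI allI)
  show "L1 (\<lambda>x. (\<psi> x)^2 / s)" using ltwo_int_real[OF \<psi>] by simp
  fix n
  show "L1 (\<lambda>x. s * (W n x)^2)" using ltwo_int_real[OF l] by simp
  show "(LBINT x. s * (W n x)^2) <= \<delta>"
   using order_trans[OF mult_left_mono[OF A[of n], of s] s(2)] s(1) by (simp add: msq_real)
  have "\<bar>\<psi> x * W n x\<bar> <= (\<psi> x)^2 / s + s * (W n x)^2" for x
  proof -
   have "0 <= (\<bar>\<psi> x\<bar> - s * \<bar>W n x\<bar>)^2 / s" using s by simp
   also have "\<dots> = (\<psi> x)^2 / s + s * (W n x)^2 - 2 * \<bar>\<psi> x * W n x\<bar>" using s by (simp add: power2_diff power_mult_distrib field_simps power2_eq_square abs_mult)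
   finally show ?thesis using abs_ge_zero[of "\<psi> x * W n x"] by linarith
  qed
  then show "AE x in lborel. 0 <= (\<psi> x)^2 / s & 0 <= s * (W n x)^2 & \<bar>\<psi> x * W n x\<bar> <= (\<psi> x)^2 / s + s * (W n x)^2" using s by simp
 qed
qed

lemma nn_msq: "ltwo f ==> (\<integral>\<^sup>+x. ennreal ((norm (f x))^2) \<partial>lborel) = ennreal (msq f)"
 by (simp add: msq_def nn_integral_eq_integral ltwo_int)

lemma nn_msq_real: "ltwo (f :: _ => real) ==> (\<integral>\<^sup>+x. ennreal ((f x)^2) \<partial>lborel) = ennreal (msq f)"
 using nn_msq[of f] by simp

text \<open>Lower semicontinuity of the Dirichlet integral. Integration by parts and weak
  convergence of \<open>u n\<close> bound the functional
  \<open>F \<mapsto> - \<integral> v div F\<close> on test fields by the limit of the gradient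
  norms; its Riesz representative is the weak gradient of \<open>v\<close> and inherits the
  bound.\<close>

theorem sob_AE_limit:
 fixes u :: "nat => real^2 => real"
 assumes s: "!!n. sob (u n) (g n)" and A: "!!n. msq (u n) <= A" and B: "!!n. msq (g n) <= B n" "B ----> b"
  and v: "v \<in> BM" and AE: "aelim u v"
 obtains h where "sob v h" "msq h <= b"
proof -
 have vl: "ltwo v" using AE_limit_ltwo(1)[OF sob_ltwo(1)[OF s] A tendsto_const v AE] .
 have "B n >= 0" for n using B(1)[of n] msq_nonneg[of "g n"] by linarith
 then have b0: "b >= 0" by (intro LIMSEQ_le_const[OF B(2)]) auto
 define l where "l F = - (\<Sum>i\<in>Basis. LBINT x. v x * pd i (\<lambda>x. F x \<bullet> i) x)" for F :: "real^2 => real^2"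
 have Fi: "test_function (\<lambda>x. F x \<bullet> i)" if "i \<in> Basis" "test_field F" for i and F :: "real^2 => real^2" using that by (auto simp: test_field_def)
 have ip: "L1 (\<lambda>x. v x * pd j (\<lambda>x. F x \<bullet> i) x)" if "i \<in> Basis" "j \<in> Basis" "test_field F" for i j and F :: "real^2 => real^2"
  using test_integrable_mult(1)[OF vl test_pd[OF Fi[OF that(1,3)] that(2)]] .
 have bound: "(l F)^2 <= b * msq F" if F: "test_field F" for F
 proof -
  have p: "(LBINT x. g n x \<bullet> F x) = - (\<Sum>i\<in>Basis. LBINT x. pd i (\<lambda>x. F x \<bullet> i) x * u n x)" for n
  proof -
   have i: "L1 (\<lambda>x. (g n x \<bullet> i) * (F x \<bullet> i))" for i
    by (intro ltwo_mult ltwo_component sob_ltwo(2)[OF s] test_field_ltwo[OF F])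
   have "(LBINT x. g n x \<bullet> F x) = (\<Sum>i\<in>Basis. LBINT x. (g n x \<bullet> i) * (F x \<bullet> i))"
    by (subst euclidean_inner) (simp add: Bochner_Integration.integral_sum[OF i])
   also have "\<dots> = (\<Sum>i\<in>Basis. - (LBINT x. pd i (\<lambda>x. F x \<bullet> i) x * u n x))"
    using sob_weak[OF s Fi[OF _ F], of _ _ n] by (intro sum.cong) (auto simp: mult.commute)
   finally show ?thesis by (simp add: sum_negf)
  qed
  have "(\<lambda>n. - (\<Sum>i\<in>Basis. LBINT x. pd i (\<lambda>x. F x \<bullet> i) x * u n x)) ----> - (\<Sum>i\<in>Basis. LBINT x. pd i (\<lambda>x. F x \<bullet> i) x * v x)"
   by (intro tendsto_minus tendsto_sum ltwo_weak_conv[OF test_ltwo[OF test_pd[OF Fi[OF _ F]]] sob_ltwo(1)[OF s] A v AE])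
  then have "(\<lambda>n. LBINT x. g n x \<bullet> F x) ----> l F" unfolding p by (simp add: l_def mult.commute)
  from tendsto_power[OF this, of 2] tendsto_mult[OF B(2) tendsto_const, of "msq F"] show ?thesis
   by (rule LIMSEQ_le)
    (intro exI[of _ 0] allI impI order_trans[OF cauchy_schwarz[OF sob_ltwo(2)[OF s] test_field_ltwo[OF F]]] mult_right_mono B(1) msq_nonneg)
 qed
have lneg: "l (\<lambda>x. c *\<^sub>R F x) = c * l F" if F: "test_field F" for c F
 proof -
  have "pd i (\<lambda>x. c *\<^sub>R F x \<bullet> i) x = c * pd i (\<lambda>x. F x \<bullet> i) x" if "i \<in> Basis" for i x
   using pd_cmul[OF test_differentiable[OF Fi[OF that F]]] by simp
  then show ?thesis unfolding l_def by (simp add: sum_distrib_left mult.left_commute)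
 qed
 obtain g where g: "ltwo g" "msq g <= b" and rep: "!!F. F \<in> Collect test_field ==> (LBINT x. g x \<bullet> F x) = l F"
 proof (rule riesz_subspace[of "Collect test_field" l b])
  show "l (\<lambda>x. F x + G x) = l F + l G" if "F \<in> Collect test_field" "G \<in> Collect test_field" for F G
  proof -
   have "pd i (\<lambda>x. (F x + G x) \<bullet> i) x = pd i (\<lambda>x. F x \<bullet> i) x + pd i (\<lambda>x. G x \<bullet> i) x" if i: "i \<in> Basis" for i x
    unfolding inner_add_left using Fi[OF i] \<open>F \<in> _\<close> \<open>G \<in> _\<close> by (intro pd_add test_differentiable) auto
   then show ?thesis unfolding l_def using ip that by (simp add: distrib_left sum.distrib)
  qed
 qed (use b0 in "auto simp: test_field_ltwo test_field_zero test_field_add test_field_scale lneg bound")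
 have "sob v g" unfolding sob_def
 proof (intro conjI allI ballI impI vl g(1))
  fix \<phi> :: "real^2 => real" and e :: "real^2" assume e: "e \<in> Basis" and \<phi>: "test_function \<phi>"
  have F: "test_field (\<lambda>x. \<phi> x *\<^sub>R e)" using \<phi> e by (auto simp: test_field_def inner_Basis test_zero)
  have "(\<Sum>i\<in>Basis. LBINT x. v x * pd i (\<lambda>x. \<phi> x *\<^sub>R e \<bullet> i) x) = (\<Sum>i\<in>Basis. if i = e then LBINT x. v x * pd e \<phi> x else 0)"
  proof (rule sum.cong[OF refl])
   fix i :: "real^2" assume i: "i \<in> Basis"
   have "pd i (\<lambda>x. 0) x = 0" for x :: "real^2" by (subst pd_eq[OF has_derivative_const]) simp
   then show "(LBINT x. v x * pd i (\<lambda>x. \<phi> x *\<^sub>R e \<bullet> i) x) = (if i = e then LBINT x. v x * pd e \<phi> x else 0)"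
    using i e by (auto simp: inner_Basis)
  qed
  then have "l (\<lambda>x. \<phi> x *\<^sub>R e) = - (LBINT x. v x * pd e \<phi> x)" using e by (simp add: l_def)
  then show "(LBINT x. v x * pd e \<phi> x) = - (LBINT x. \<phi> x * (g x \<bullet> e))"
   using rep[of "\<lambda>x. \<phi> x *\<^sub>R e"] F by simp
 qed
 then show ?thesis using that[of g] g(2) by blast
qed

section \<open>The modulus of a Sobolev function\<close>

lemma Ck_inverse: "Ck k f ==> (!!x. f x \<noteq> 0) ==> Ck k (\<lambda>x. inverse (f x))"
proof (induction k)
 case (Suc k)
 note d = Ck_Suc_has_derivative_grad[OF Suc.prems(1)]
 show ?case
 proof (rule Ck_SucI)
  show "((\<lambda>x. inverse (f x)) has_derivative (\<lambda>h. - (inverse (f x) * (grad f x \<bullet> h) * inverse (f x)))) (at x)" for x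
   by (rule Deriv.has_derivative_inverse[OF Suc.prems(2) d])
  fix e :: 'a assume e: "e \<in> Basis"
  have "Ck k (\<lambda>x. - 1 * (inverse (f x) * pd e f x * inverse (f x)))"
   using Suc e Ck_Suc_continuous[OF Suc.prems(1)] by (intro Ck_mult Ck_const Suc.IH) (auto simp: Ck_Suc_iff)
  then show "Ck k (\<lambda>x. - (inverse (f x) * (grad f x \<bullet> e) * inverse (f x)))" by (simp add: grad_inner_Basis[OF e])
 qed
qed (auto intro!: continuous_intros)

lemma Ck_sqrt: "Ck k f ==> (!!x. f x > 0) ==> Ck k (\<lambda>x. sqrt (f x))"
proof (induction k)
 case (Suc k)
 note d = Ck_Suc_has_derivative_grad[OF Suc.prems(1)]
 show ?case
 proof (rule Ck_SucI)
  show "((\<lambda>x. sqrt (f x)) has_derivative (\<lambda>h. (grad f x \<bullet> h) * (inverse (sqrt (f x)) / 2))) (at x)" for x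
   by (rule has_derivative_real_sqrt[OF Suc.prems(2) d])
  fix e :: 'a assume e: "e \<in> Basis"
  have p: "sqrt (f x) \<noteq> 0" for x using Suc.prems(2)[of x] by simp
  have "Ck k (\<lambda>x. pd e f x * (inverse (sqrt (f x)) * (1 / 2)))"
   using Suc e p Ck_Suc_continuous[OF Suc.prems(1)] by (intro Ck_mult Ck_const Ck_inverse Suc.IH) (auto simp: Ck_Suc_iff)
  then show "Ck k (\<lambda>x. (grad f x \<bullet> e) * (inverse (sqrt (f x)) / 2))" by (simp add: grad_inner_Basis[OF e])
 qed
qed (auto intro!: continuous_intros)

lemma grad_eq: "(f has_derivative (\<lambda>h. G \<bullet> h)) (at x) ==> grad f x = G"
 by (simp add: grad_pd pd_eq euclidean_representation)

text \<open>A smooth substitute for \<open>|y|\<close>. It is zero at zero, so that composition with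
  it preserves compact support.\<close>

definition sabs :: "real => real => real" where "sabs d y = sqrt (y^2 + d^2) - d"

lemma sabs_0 [simp]: "d > 0 ==> sabs d 0 = 0" by (simp add: sabs_def)

lemma sqrt_pos: "d > 0 ==> sqrt (y^2 + d^2) > 0" by (simp add: add_nonneg_pos)

lemma sabs_bound: assumes d: "d > 0" shows "\<bar>sabs d y\<bar> <= \<bar>y\<bar>" "\<bar>y / sqrt (y^2 + d^2)\<bar> <= 1"
proof -
 have "sqrt (y^2 + d^2) <= \<bar>y\<bar> + d" using d sqrt_add_le_add_sqrt[of "y^2" "d^2"] by simp
 moreover have "d <= sqrt (y^2 + d^2)" "\<bar>y\<bar> <= sqrt (y^2 + d^2)" using d by (auto intro: real_le_rsqrt)
 ultimately show "\<bar>sabs d y\<bar> <= \<bar>y\<bar>" "\<bar>y / sqrt (y^2 + d^2)\<bar> <= 1" using sqrt_pos[OF d, of y] by (auto simp: sabs_def abs_divide)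
qed

lemma sabs_test:
 fixes \<phi> :: "'a::euclidean_space => real"
 assumes t: "test_function \<phi>" and d: "d > 0"
 shows "test_function (\<lambda>x. sabs d (\<phi> x))" "((\<lambda>x. sabs d (\<phi> x)) has_derivative (\<lambda>h. ((\<phi> x / sqrt ((\<phi> x)^2 + d^2)) *\<^sub>R grad \<phi> x) \<bullet> h)) (at x)"
proof -
 have p: "\<phi> x * \<phi> x + d^2 > 0" for x using d by (simp add: add_nonneg_pos)
 have "Ck k (\<lambda>x. sqrt (\<phi> x * \<phi> x + d^2) + - d)" for k
  by (intro Ck_add Ck_sqrt Ck_mult Ck_const test_Ck t p)
 then have "Ck k (\<lambda>x. sabs d (\<phi> x))" for k by (simp add: sabs_def power2_eq_square)
 then show "test_function (\<lambda>x. sabs d (\<phi> x))" using t d unfolding test_function_iff by force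
 show "((\<lambda>x. sabs d (\<phi> x)) has_derivative (\<lambda>h. ((\<phi> x / sqrt ((\<phi> x)^2 + d^2)) *\<^sub>R grad \<phi> x) \<bullet> h)) (at x)"
  unfolding sabs_def using p[of x] by (auto intro!: derivative_eq_intros test_has_derivative[OF t] simp: power2_eq_square field_simps)
qed

text \<open>The smoothed moduli of approximating test functions have no larger norms and gradients;
  \<open>sob_AE_limit\<close> carries the gradient bound over to \<open>|u|\<close>.\<close>

lemma sob_abs: assumes s: "sob (u :: real^2 => real) g" obtains h where "sob (\<lambda>x. \<bar>u x\<bar>) h" "msq h <= msq g"
proof -
 obtain \<phi> where \<phi>: "!!n. test_function (\<phi> n)" "l2lim \<phi> u"
  "l2lim (\<lambda>n. grad (\<phi> n)) g" "aelim \<phi> u" by (rule sob_AE_approx[OF s]) blast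
 let ?d = "\<lambda>n. 1 / real (Suc n)"
 have d: "?d n > 0" for n by simp
 note T = sabs_test[OF \<phi>(1) d]
 have "convergent (\<lambda>n. msq (\<phi> n))" using msq_conv[OF test_ltwo[OF \<phi>(1)] sob_ltwo(1)[OF s] \<phi>(2)] by (auto simp: convergent_def)
 from convergentD[OF this] obtain A where A: "!!n. norm (msq (\<phi> n)) <= A" using convergent_imp_bounded by (fastforce simp: bounded_iff)
 show ?thesis
 proof (rule sob_AE_limit[of "\<lambda>n x. sabs (?d n) (\<phi> n x)" "\<lambda>n. grad (\<lambda>x. sabs (?d n) (\<phi> n x))" A "\<lambda>n. msq (grad (\<phi> n))" "msq g" "\<lambda>x. \<bar>u x\<bar>"])
  show "sob (\<lambda>x. sabs (?d n) (\<phi> n x)) (grad (\<lambda>x. sabs (?d n) (\<phi> n x)))" for n by (rule sob_test[OF T(1)])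
  have "msq (\<lambda>x. sabs (?d n) (\<phi> n x)) <= msq (\<phi> n)" for n by (intro msq_mono test_ltwo T \<phi>) (simp only: real_norm_def sabs_bound(1)[OF d])
  then show "msq (\<lambda>x. sabs (?d n) (\<phi> n x)) <= A" for n using A[of n] by (auto intro: order_trans)
  show "msq (grad (\<lambda>x. sabs (?d n) (\<phi> n x))) <= msq (grad (\<phi> n))" for n
   by (intro msq_mono grad_ltwo T(1) \<phi>(1)) (simp only: grad_eq[OF T(2)] norm_scaleR, intro mult_left_le_one_le sabs_bound(2)[OF d]; simp)
  show "(\<lambda>n. msq (grad (\<phi> n))) ----> msq g" by (intro msq_conv grad_ltwo \<phi> sob_ltwo(2)[OF s])
  show "(\<lambda>x. \<bar>u x\<bar>) \<in> BM" using sob_borel[OF s] by simp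
  show "AE x in lborel. (\<lambda>n. sabs (?d n) (\<phi> n x)) ----> \<bar>u x\<bar>"
   using \<phi>(4)
  proof eventually_elim
   case (elim x)
   have "(\<lambda>n. sabs (?d n) (\<phi> n x)) ----> sqrt ((u x)^2 + 0^2) - 0" unfolding sabs_def by (intro tendsto_intros elim inv_Suc_lim)
   then show ?case by simp
  qed
 qed (rule that)
qed

section \<open>Polarization of Sobolev functions\<close>

definition pol :: "real^2 => real => (real^2 => real) => real^2 => real" where
 "pol n c u x = (if x \<bullet> n <= c then max (u x) (u (refl n c x)) else min (u x) (u (refl n c x)))"

lemma refl_fix: "x \<bullet> n = c ==> refl n c x = x" by (simp add: refl_def)

lemma pol_borel [measurable]: assumes [measurable]: "u \<in> BM" shows "pol n c u \<in> BM"
 unfolding pol_def[abs_def] by measurable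

lemma pol_half: assumes n: "norm n = 1" and x: "x \<bullet> n <= c"
 shows "pol n c u x = max (u x) (u (refl n c x))" "pol n c u (refl n c x) = min (u x) (u (refl n c x))"
proof -
 show "pol n c u x = max (u x) (u (refl n c x))" using x by (simp add: pol_def)
 show "pol n c u (refl n c x) = min (u x) (u (refl n c x))"
 proof (cases "x \<bullet> n = c")
  case True then show ?thesis by (simp add: refl_fix pol_def)
 next
  case False
  then have "\<not> refl n c x \<bullet> n <= c" using refl_inner[OF n, of c x] x by auto
  then show ?thesis using refl_refl[OF n, of c x] by (simp add: pol_def min.commute)
 qed
qed

lemma refl_half: assumes n: "norm n = 1" and x: "\<not> x \<bullet> n <= c" shows "refl n c x \<bullet> n <= c"
 using refl_inner[OF n, of c x] x by auto

lemma norm_refl_sq: assumes n: "norm n = 1" shows "(norm (refl n c x))^2 = (norm x)^2 + 4 * (c * (c - x \<bullet> n))"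
 using n unfolding power2_norm_eq_inner refl_def
 by (simp add: inner_diff_left inner_diff_right norm_eq_1 inner_commute algebra_simps power2_eq_square)

lemma norm_refl_ge: assumes n: "norm n = 1" and "c >= 0" "x \<bullet> n <= c" shows "norm x <= norm (refl n c x)"
 by (rule power2_le_imp_le) (use norm_refl_sq[OF n, of c x] assms in auto)

lemma norm_refl_gt: assumes n: "norm n = 1" and "c > 0" "x \<bullet> n < c" shows "norm x < norm (refl n c x)"
 by (rule power2_less_imp_less) (use norm_refl_sq[OF n, of c x] assms in auto)

lemma refl_dist: assumes n: "norm n = 1" shows "norm (refl n c x - refl n c y) = norm (x - y)"
proof -
 have "refl n c x - refl n c y = refl n 0 (x - y)" by (simp add: refl_def inner_diff_left algebra_simps)
 moreover have "(norm (refl n 0 (x - y)))^2 = (norm (x - y))^2" using norm_refl_sq[OF n, of 0 "x - y"] by simp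
 ultimately show ?thesis by simp
qed

lemma refl_dist2: assumes n: "norm n = 1" shows "norm (refl n c x - y) = norm (x - refl n c y)"
 using refl_dist[OF n, of c x "refl n c y"] refl_refl[OF n, of c y] by simp

lemma refl_dist_le: assumes n: "norm n = 1" and "x \<bullet> n <= c" "y \<bullet> n <= c" shows "norm (x - y) <= norm (x - refl n c y)"
proof (rule power2_le_imp_le)
 have "(norm (x - refl n c y))^2 = (norm (x - y))^2 + 4 * ((c - x \<bullet> n) * (c - y \<bullet> n))"
  using n unfolding power2_norm_eq_inner refl_def
  by (simp add: inner_diff_left inner_diff_right inner_add_left inner_add_right norm_eq_1 inner_commute algebra_simps power2_eq_square)
 then show "(norm (x - y))^2 <= (norm (x - refl n c y))^2" using assms by simp
qed simp

lemma grad_refl: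
 fixes \<phi> :: "real^2 => real"
 assumes "(\<phi> has_derivative (\<lambda>h. G \<bullet> h)) (at (refl n c x))"
 shows "((\<lambda>x. \<phi> (refl n c x)) has_derivative (\<lambda>h. refl n 0 G \<bullet> h)) (at x)"
proof -
 have "(refl n c has_derivative (\<lambda>h. refl n 0 h)) (at x)"
  unfolding refl_def[abs_def] by (auto intro!: derivative_eq_intros)
 from has_derivative_compose[OF this assms] show ?thesis
  by (simp add: refl_def inner_diff_left inner_diff_right inner_commute mult_ac)
qed

lemma test_refl:
 fixes \<phi> :: "real^2 => real"
 assumes n: "norm n = 1" and t: "test_function \<phi>" shows "test_function (\<lambda>x. \<phi> (refl n c x))"
proof -
 have "Ck k (\<lambda>x. \<psi> (refl n c x))" if "!!k. Ck k \<psi>" for k and \<psi> :: "real^2 => real"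
  using that
 proof (induction k arbitrary: \<psi>)
  case 0
  have "continuous_on UNIV \<psi>" using 0[of 0] by simp
  then show ?case unfolding refl_def by (auto intro!: continuous_on_compose2[of UNIV \<psi>] continuous_intros)
 next
  case (Suc k)
  show ?case
  proof (rule Ck_SucI[OF grad_refl[OF Ck_Suc_has_derivative_grad[OF Suc.prems]]])
   fix e :: "real^2" assume e: "e \<in> Basis"
   have "Ck k (\<lambda>x. pd b \<psi> (refl n c x))" if "b \<in> Basis" for b
    using Suc.prems[of "Suc _"] that by (intro Suc.IH) (simp add: Ck_Suc_iff)
   then have "Ck k (\<lambda>x. \<Sum>b\<in>Basis. (refl n 0 e \<bullet> b) * pd b \<psi> (refl n c x))" by (intro Ck_sum Ck_mult Ck_const)
   then show "Ck k (\<lambda>x. refl n 0 (grad \<psi> (refl n c x)) \<bullet> e)"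
    unfolding grad_inner[symmetric] by (simp add: refl_def inner_diff_left inner_diff_right inner_commute mult_ac)
  qed
 qed
 moreover obtain R where R: "!!x. norm x >= R ==> \<phi> x = 0" using test_support[OF t] by blast
 have "\<phi> (refl n c x) = 0" if "norm x > R + norm (refl n c 0)" for x
 proof (rule R)
  have "norm x <= norm (refl n c x) + norm (refl n c 0)"
   using refl_dist[OF n, of c x 0] norm_triangle_ineq4[of "refl n c x" "refl n c 0"] by simp
  then show "R <= norm (refl n c x)" using that by simp
 qed
 ultimately show ?thesis using t unfolding test_function_iff by blast
qed

text \<open>On the half-plane \<open>\<tau> > 0\<close> polarization is \<open>s + \<bar>\<psi>\<bar>\<close> and on the other one \<open>s - \<bar>\<psi>\<bar>\<close>, where
 \<open>s\<close> and \<open>\<psi>\<close> are the symmetric and antisymmetric parts. The gradients of the two summands are orthogonal.\<close>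

lemma pol_test:
 fixes \<phi> :: "real^2 => real"
 assumes n: "norm n = 1" and t: "test_function \<phi>"
 obtains h where "sob (pol n c \<phi>) h" "msq h <= msq (grad \<phi>)"
proof -
 let ?\<sigma> = "refl n c" and ?r = "refl n 0"
 define s where "s x = 1/2 * (\<phi> x + \<phi> (?\<sigma> x))" for x
 define \<psi> where "\<psi> x = 1/2 * (\<phi> x - \<phi> (?\<sigma> x))" for x
 define \<tau> where "\<tau> x = c - x \<bullet> n" for x
 \<comment> \<open>A smooth replacement of \<open>sgn \<tau> * |\<psi>|\<close>, so that
   \<open>s + D d\<close> tends to the polarization as \<open>d\<close> tends to zero.\<close>
 define D where "D d x = \<tau> x / sqrt ((\<tau> x)^2 + d^2) * sabs d (\<psi> x)" for d x
 \<comment> \<open>The normal component of \<open>grad (D d)\<close> that stems from differentiating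
   the smoothed sign; it has to disappear in the limit.\<close>
 define b where "b d x = sabs d (\<psi> x) * (d^2 / sqrt ((\<tau> x)^2 + d^2) ^ 3)" for d x
 have sT: "test_function s" and pT: "test_function \<psi>"
  unfolding s_def[abs_def] \<psi>_def[abs_def] by (intro test_cmult test_add test_minus test_refl n t)+
 have p: "\<tau> x * \<tau> x + d * d > 0" "sqrt (\<tau> x * \<tau> x + d * d) \<noteq> 0" if "d > 0" for x and d :: real
  using sqrt_pos[OF that, of "\<tau> x"] by (auto simp: power2_eq_square)
 have DT: "test_function (D d)" if d: "d > 0" for d
 proof -
  have "test_function (\<lambda>x. ((c + (- 1) * (x \<bullet> n)) * inverse (sqrt ((c + (- 1) * (x \<bullet> n)) * (c + (- 1) * (x \<bullet> n)) + d * d))) * sabs d (\<psi> x))"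
   using p[OF d] by (intro test_smooth_mult sabs_test pT d Ck_mult Ck_inverse Ck_sqrt Ck_add Ck_const Ck_inner) (simp_all add: \<tau>_def)
  then show ?thesis by (simp add: D_def[abs_def] \<tau>_def power2_eq_square divide_inverse)
 qed
 have gD: "grad (D d) x = (\<tau> x / sqrt ((\<tau> x)^2 + d^2)) *\<^sub>R ((\<psi> x / sqrt ((\<psi> x)^2 + d^2)) *\<^sub>R grad \<psi> x) + b d x *\<^sub>R (- n)" if d: "d > 0" for d x
 proof (rule grad_eq)
  have q: "((\<lambda>x. \<tau> x / sqrt ((\<tau> x)^2 + d^2)) has_derivative (\<lambda>h. d^2 / sqrt ((\<tau> x)^2 + d^2) ^ 3 * ((- n) \<bullet> h))) (at x)"
  proof -
   have "((\<lambda>y. y / sqrt (y^2 + d^2)) has_real_derivative d\<^sup>2 / sqrt (y^2 + d^2) ^ 3) (at y)" for y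
   proof -
    have y: "y^2 + d^2 > 0" using d by (simp add: add_nonneg_pos)
    define w where "w = sqrt (y^2 + d^2)"
    have w: "w > 0" "w * w = y^2 + d^2" using y by (auto simp: w_def)
    have "((\<lambda>y. y / sqrt (y^2 + d^2)) has_real_derivative (w - y * (y * inverse w)) / (w * w)) (at y)"
     using y unfolding w_def by (auto intro!: derivative_eq_intros simp: field_simps)
    also have "(w - y * (y * inverse w)) / (w * w) = (w * w - y^2) / w ^ 3" using w(1) by (simp add: field_simps power2_eq_square power3_eq_cube)
    also have "\<dots> = d^2 / w ^ 3" unfolding w(2) by simp
    finally show ?thesis unfolding w_def .
   qed
   from has_derivative_compose[OF _ this[unfolded has_field_derivative_def], of \<tau>] show ?thesis
    unfolding \<tau>_def by (rule has_derivative_eq_rhs) (auto intro!: derivative_eq_intros simp: inner_commute)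
  qed
  show "(D d has_derivative (\<lambda>h. ((\<tau> x / sqrt ((\<tau> x)^2 + d^2)) *\<^sub>R ((\<psi> x / sqrt ((\<psi> x)^2 + d^2)) *\<^sub>R grad \<psi> x) + b d x *\<^sub>R (- n)) \<bullet> h)) (at x)"
   unfolding D_def[abs_def] by (rule has_derivative_eq_rhs[OF has_derivative_mult[OF q sabs_test(2)[OF pT d]]]) (auto simp: b_def inner_diff_left mult_ac intro!: ext)
 qed
 have hd: "(f has_derivative (\<lambda>h. grad f x \<bullet> h)) (at x)" if "test_function f" for f x by (rule test_has_derivative[OF that])
 have sig: "s (?\<sigma> x) = s x" "\<psi> (?\<sigma> x) = - \<psi> x" "\<tau> (?\<sigma> x) = - \<tau> x" for x
  using refl_inner[OF n, of c x] by (simp_all add: s_def \<psi>_def \<tau>_def refl_refl[OF n] field_simps)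
 have Dsig: "D d (?\<sigma> x) = - 1 * D d x" for d x by (simp add: D_def sig sabs_def)
 have gs: "?r (grad s (?\<sigma> x)) = grad s x" for x
  using grad_eq[OF grad_refl[OF hd[OF sT]], of n c x] by (simp add: sig)
 have gDs: "?r (grad (D d) (?\<sigma> x)) = - grad (D d) x" if d: "d > 0" for d x
 proof -
  have "grad (\<lambda>x. D d (?\<sigma> x)) x = - grad (D d) x" unfolding Dsig
   by (rule grad_eq) (use has_derivative_mult_right[OF hd[OF DT[OF d]], of "-1" x] in simp)
  then show ?thesis using grad_eq[OF grad_refl[OF hd[OF DT[OF d]]], of n c x] by simp
 qed
 have rr: "?r a \<bullet> ?r b = a \<bullet> b" for a b using n by (simp add: refl_def inner_diff_left inner_diff_right inner_commute norm_eq_1 algebra_simps)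
 \<comment> \<open>The integrand is odd under the reflection: \<open>grad s\<close> is carried to
   itself and \<open>grad (D d)\<close> to its negative.\<close>
 have orth: "(LBINT x. grad s x \<bullet> grad (D d) x) = 0" if d: "d > 0" for d
 proof -
  note [measurable] = test_grad_borel[OF sT] test_grad_borel[OF DT[OF d]]
  have "grad s (?\<sigma> x) \<bullet> grad (D d) (?\<sigma> x) = - (grad s x \<bullet> grad (D d) x)" for x
   unfolding rr[symmetric, of "grad s (?\<sigma> x)"] gs gDs[OF d] by simp
  then show ?thesis using integral_refl(1)[OF n, of "\<lambda>x. grad s x \<bullet> grad (D d) x" c] by simp
 qed
 have par: "msq (grad s) + msq (grad \<psi>) = msq (grad \<phi>)"
 proof -
  have e: "grad s x = (1/2) *\<^sub>R (grad \<phi> x + ?r (grad \<phi> (?\<sigma> x)))" "grad \<psi> x = (1/2) *\<^sub>R (grad \<phi> x - ?r (grad \<phi> (?\<sigma> x)))" for x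
   unfolding s_def[abs_def] \<psi>_def[abs_def]
   by (rule grad_eq; rule has_derivative_eq_rhs, rule has_derivative_mult_right, rule has_derivative_add has_derivative_diff, rule hd[OF t], rule grad_refl[OF hd[OF t]]; simp add: inner_add_left inner_diff_left)+
  have "(norm (grad s x))^2 + (norm (grad \<psi> x))^2 = 1/2 * ((norm (grad \<phi> x))^2 + (norm (grad \<phi> (?\<sigma> x)))^2)" for x
   unfolding e power2_norm_eq_inner by (simp add: inner_add_left inner_add_right inner_diff_left inner_diff_right inner_commute rr field_simps)
  then have "(LBINT x. (norm (grad s x))^2 + (norm (grad \<psi> x))^2) = (LBINT x. 1/2 * ((norm (grad \<phi> x))^2 + (norm (grad \<phi> (?\<sigma> x)))^2))" by (simp only:)
  then show ?thesis
   using ltwo_int[OF grad_ltwo[OF sT]] ltwo_int[OF grad_ltwo[OF pT]] ltwo_int[OF grad_ltwo[OF t]]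
    integral_refl[OF n, of "\<lambda>x. (norm (grad \<phi> x))^2" c] test_grad_borel[OF t] by (simp add: msq_def)
 qed
 obtain L where L: "L > 0" "!!x y. \<bar>\<phi> x - \<phi> y\<bar> <= L * norm (x - y)" using test_lipschitz[OF t] by metis
 have pL: "\<bar>\<psi> x\<bar> <= L * \<bar>\<tau> x\<bar>" for x
 proof -
  have "norm (x - ?\<sigma> x) = 2 * \<bar>\<tau> x\<bar>" using n abs_mult[of 2 "c - x \<bullet> n"] by (simp add: refl_def \<tau>_def abs_minus_commute)
  then show ?thesis using L(2)[of x "?\<sigma> x"] by (simp add: \<psi>_def)
 qed
 \<comment> \<open>\<open>\<psi>\<close> is at most \<open>L * |\<tau>|\<close>, which compensates
   the large derivative of the smoothed sign near the line; hence the bound does not depend on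
   \<open>d\<close>.\<close>
 have bL: "\<bar>b d x\<bar> <= L" if d: "d > 0" for d x
 proof -
  let ?w = "sqrt ((\<tau> x)^2 + d^2)"
  have w: "?w > 0" "\<bar>\<tau> x\<bar> <= ?w" "?w^2 = (\<tau> x)^2 + d^2" using sqrt_pos[OF d] by (auto intro: real_le_rsqrt)
  have e: "(L * y) * (y^2 / y ^ 3) = L" if "y > 0" for y using that by (simp add: field_simps power2_eq_square power3_eq_cube)
  have "\<bar>sabs d (\<psi> x)\<bar> <= L * ?w" using sabs_bound(1)[OF d, of "\<psi> x"] pL[of x] mult_left_mono[OF w(2), of L] L(1) by linarith
  moreover have "d^2 / ?w ^ 3 <= ?w^2 / ?w ^ 3" using w by (intro divide_right_mono) auto
  ultimately have "\<bar>sabs d (\<psi> x)\<bar> * (d^2 / ?w ^ 3) <= (L * ?w) * (?w^2 / ?w ^ 3)" using w L by (intro mult_mono) auto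
  also have "\<dots> = L" by (rule e[OF w(1)])
  finally show ?thesis using w(1) by (simp add: b_def abs_mult)
 qed
 obtain R where R: "!!x. norm x >= R ==> \<psi> x = 0" using test_support[OF pT] by blast
 let ?d = "\<lambda>j. 1 / real (Suc j)"
 have d: "?d j > 0" for j by simp
 note [measurable] = test_borel[OF pT] test_borel[OF sT] test_borel[OF t]
 have \<tau>m[measurable]: "\<tau> \<in> BM" unfolding \<tau>_def[abs_def] by measurable
 have bm[measurable]: "b d \<in> BM" for d unfolding b_def[abs_def] sabs_def by measurable
 let ?I = "indicator (cball 0 R) :: real^2 => real"
 have Ii: "L1 (\<lambda>x. L^2 * ?I x)"
  by (rule integrable_cball)
 have lI: "ltwo (\<lambda>x. L * ?I x)" by (rule ltwo_bound[OF _ Ii]) (measurable, auto split: split_indicator)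
 have bI: "norm (b (?d j) x) <= norm (L * ?I x)" for j x
 proof (cases "norm x <= R")
  case True then show ?thesis using bL[OF d[of j], of x] L(1) by simp
 next
  case False then show ?thesis using R[of x] by (simp add: b_def)
 qed
 have bl: "ltwo (b (?d j))" for j by (rule ltwo_dom[OF lI bm, where B=1]) (use bI in simp)
 have b0: "(\<lambda>j. msq (b (?d j))) ----> 0"
 proof (rule msq_dominated[OF bm lI AE_I2 bI])
  fix x
  show "(\<lambda>j. b (?d j) x) ----> 0"
  proof (cases "\<tau> x = 0")
   case True then have "\<psi> x = 0" using pL[of x] by simp
   then show ?thesis by (simp add: b_def)
  next
   case False
   have "(\<lambda>j. b (?d j) x) ----> (sqrt ((\<psi> x)^2 + 0^2) - 0) * (0^2 / sqrt ((\<tau> x)^2 + 0^2) ^ 3)"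
    unfolding b_def sabs_def using False by (intro tendsto_intros inv_Suc_lim) auto
   then show ?thesis by simp
  qed
 qed
 define B where "B j = msq (grad s) + (msq (grad \<psi>) + 2 * sqrt (msq (grad \<psi>) * msq (b (?d j))) + msq (b (?d j)))" for j
 have B: "msq (\<lambda>x. grad s x + grad (D (?d j)) x) <= B j" for j
 proof -
  let ?a = "\<lambda>x. (\<tau> x / sqrt ((\<tau> x)^2 + (?d j)^2)) *\<^sub>R ((\<psi> x / sqrt ((\<psi> x)^2 + (?d j)^2)) *\<^sub>R grad \<psi> x)"
  have na: "norm (?a x) <= norm (grad \<psi> x)" for x
   unfolding norm_scaleR using sabs_bound(2)[OF d[of j], of "\<tau> x"] sabs_bound(2)[OF d[of j], of "\<psi> x"]
   by (intro order_trans[OF mult_left_le_one_le] mult_left_le_one_le) (simp_all only: abs_ge_zero norm_ge_zero zero_le_mult_iff, auto)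
  have gm[measurable]: "grad \<psi> \<in> BM" by (rule test_grad_borel[OF pT])
  have al: "ltwo ?a"
  proof (rule ltwo_bound[OF _ ltwo_int[OF grad_ltwo[OF pT]]])
   show "?a \<in> BM" by measurable
   show "AE x in lborel. (norm (?a x))^2 <= (norm (grad \<psi> x))^2" by (intro AE_I2 power_mono na norm_ge_zero)
  qed
  have bl': "ltwo (\<lambda>x. b (?d j) x *\<^sub>R (- n))" "msq (\<lambda>x. b (?d j) x *\<^sub>R (- n)) = msq (b (?d j))"
   using bl[of j] n by (simp_all add: ltwo_def msq_def power_mult_distrib)
  have "msq (grad (D (?d j))) = msq ?a + 2 * (LBINT x. ?a x \<bullet> (b (?d j) x *\<^sub>R (- n))) + msq (b (?d j))"
   unfolding gD[OF d, abs_def] msq_add[OF al bl'(1)] bl'(2) ..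
  moreover have "(LBINT x. ?a x \<bullet> (b (?d j) x *\<^sub>R (- n))) <= sqrt (msq (grad \<psi>) * msq (b (?d j)))"
  proof -
   have "(LBINT x. ?a x \<bullet> (b (?d j) x *\<^sub>R (- n))) <= sqrt (msq ?a * msq (b (?d j)))"
    using cauchy_schwarz_abs[OF al bl'(1)] unfolding bl'(2) by linarith
   also have "\<dots> <= sqrt (msq (grad \<psi>) * msq (b (?d j)))" by (intro real_sqrt_le_mono mult_right_mono msq_mono al grad_ltwo pT na) simp
   finally show ?thesis .
  qed
  moreover have "msq ?a <= msq (grad \<psi>)" by (intro msq_mono al grad_ltwo pT na)
  ultimately show ?thesis unfolding B_def msq_add[OF grad_ltwo[OF sT] grad_ltwo[OF DT[OF d]]] orth[OF d] by linarith
 qed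
 have "B ----> msq (grad s) + (msq (grad \<psi>) + 2 * sqrt (msq (grad \<psi>) * 0) + 0)" unfolding B_def by (intro tendsto_intros b0)
 then have Bl: "B ----> msq (grad \<phi>)" using par by simp
 have Dp: "\<bar>D (?d j) x\<bar> <= \<bar>\<psi> x\<bar>" for j x
  unfolding D_def abs_mult using mult_mono[OF sabs_bound(2)[OF d[of j], of "\<tau> x"] sabs_bound(1)[OF d[of j], of "\<psi> x"]] by simp
 show ?thesis
 proof (rule sob_AE_limit[of "\<lambda>j x. s x + D (?d j) x" "\<lambda>j x. grad s x + grad (D (?d j)) x" "2 * msq s + 2 * msq \<psi>" B, OF _ _ B Bl])
  show "sob (\<lambda>x. s x + D (?d j) x) (\<lambda>x. grad s x + grad (D (?d j)) x)" for j by (intro sob_add sob_test sT DT d)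
  have "msq (D (?d j)) <= msq \<psi>" for j by (intro msq_mono test_ltwo DT d pT) (simp only: real_norm_def Dp)
  then show "msq (\<lambda>x. s x + D (?d j) x) <= 2 * msq s + 2 * msq \<psi>" for j
   using msq_add_le[OF test_ltwo[OF sT] test_ltwo[OF DT[OF d]], of j] by (auto intro: order_trans)
  show "pol n c \<phi> \<in> BM" by measurable
  show "AE x in lborel. (\<lambda>j. s x + D (?d j) x) ----> pol n c \<phi> x"
  proof (rule AE_I2)
   fix x
   show "(\<lambda>j. s x + D (?d j) x) ----> pol n c \<phi> x"
   proof (cases "\<tau> x = 0")
    case True then have "\<psi> x = 0" "?\<sigma> x = x" using pL[of x] by (auto simp: \<tau>_def refl_fix)
    then show ?thesis by (simp add: D_def s_def pol_def)
   next
    case False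
    have "(\<lambda>j. s x + D (?d j) x) ----> s x + \<tau> x / sqrt ((\<tau> x)^2 + 0^2) * (sqrt ((\<psi> x)^2 + 0^2) - 0)"
     unfolding D_def sabs_def using False by (intro tendsto_intros inv_Suc_lim) auto
    moreover have "s x + \<tau> x / sqrt ((\<tau> x)^2 + 0^2) * (sqrt ((\<psi> x)^2 + 0^2) - 0) = pol n c \<phi> x"
    proof -
     have m: "1/2 * (a + b) + 1/2 * \<bar>a - b\<bar> = max a b" "1/2 * (a + b) - 1/2 * \<bar>a - b\<bar> = min a b" for a b :: real by (auto simp: max_def min_def field_simps)
     have e: "\<bar>\<psi> x\<bar> = 1/2 * \<bar>\<phi> x - \<phi> (?\<sigma> x)\<bar>" by (simp add: \<psi>_def)
     have r: "\<tau> x / sqrt ((\<tau> x)^2 + 0^2) * (sqrt ((\<psi> x)^2 + 0^2) - 0) = sgn (\<tau> x) * \<bar>\<psi> x\<bar>" by (simp add: real_sgn_eq)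
     show ?thesis
     proof (cases "x \<bullet> n <= c")
      case True
      then have "sgn (\<tau> x) = 1" using False by (simp add: \<tau>_def)
      then show ?thesis unfolding r e using True m(1) by (simp only: s_def pol_def if_True mult_1)
     next
      case F: False
      then have "sgn (\<tau> x) = - 1" by (simp add: \<tau>_def)
      then show ?thesis unfolding r e using F m(2) by (simp only: s_def pol_def if_False mult_minus1 diff_conv_add_uminus)
     qed
    qed
    ultimately show ?thesis by simp
   qed
  qed
 qed (rule that)
qed

text \<open>Polarization commutes with almost everywhere limits, so the gradient bound passes from
  test functions to the limit by \<open>sob_AE_limit\<close>; for the masses any uniform bound is
  enough, hence the crude factor two.\<close>

lemma sob_pol:
 fixes u :: "real^2 => real"
 assumes n: "norm n = 1" and s: "sob u g"
 obtains h where "sob (pol n c u) h" "msq h <= msq g"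
proof -
 obtain \<phi> where \<phi>: "!!n. test_function (\<phi> n)" "l2lim \<phi> u"
  "l2lim (\<lambda>n. grad (\<phi> n)) g" "aelim \<phi> u" by (rule sob_AE_approx[OF s]) blast
 have "\<exists>h. sob (pol n c (\<phi> k)) h & msq h <= msq (grad (\<phi> k))" for k by (rule pol_test[OF n \<phi>(1)]) blast
 then obtain h where h: "!!k. sob (pol n c (\<phi> k)) (h k)" "!!k. msq (h k) <= msq (grad (\<phi> k))" by metis
 have "convergent (\<lambda>n. msq (\<phi> n))" using msq_conv[OF test_ltwo[OF \<phi>(1)] sob_ltwo(1)[OF s] \<phi>(2)] by (auto simp: convergent_def)
 from convergentD[OF this] obtain A where A: "!!n. norm (msq (\<phi> n)) <= A" using convergent_imp_bounded by (fastforce simp: bounded_iff)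
 note [measurable] = sob_borel[OF s]
 show ?thesis
 proof (rule sob_AE_limit[of "\<lambda>k. pol n c (\<phi> k)" h "2 * A" "\<lambda>k. msq (grad (\<phi> k))" "msq g" "pol n c u", OF h(1) _ h(2)])
  show "msq (pol n c (\<phi> k)) <= 2 * A" for k
  proof -
   note b = test_borel[OF \<phi>(1)[of k]] and i = ltwo_int_real[OF test_ltwo[OF \<phi>(1)[of k]]]
   have i2: "L1 (\<lambda>x. (\<phi> k (refl n c x))^2)" "(LBINT x. (\<phi> k (refl n c x))^2) = msq (\<phi> k)"
    using integral_refl[OF n, of "\<lambda>x. (\<phi> k x)^2" c] i b by (simp_all add: msq_real)
   have "msq (pol n c (\<phi> k)) <= (LBINT x. (\<phi> k x)^2 + (\<phi> k (refl n c x))^2)"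
    unfolding msq_real by (rule integral_mono[OF ltwo_int_real[OF sob_ltwo(1)[OF h(1)]]]) (use i i2 in "auto simp: pol_def max_def min_def")
   also have "\<dots> = 2 * msq (\<phi> k)" using i i2 by (simp add: msq_real)
   finally show ?thesis using A[of k] by simp
  qed
  show "(\<lambda>k. msq (grad (\<phi> k))) ----> msq g" by (intro msq_conv grad_ltwo \<phi> sob_ltwo(2)[OF s])
  show "pol n c u \<in> BM" by measurable
  show "AE x in lborel. (\<lambda>k. pol n c (\<phi> k) x) ----> pol n c u x"
   using \<phi>(4) AE_refl[OF n \<phi>(4), of c] by eventually_elim (auto simp: pol_def intro!: tendsto_max tendsto_min)
 qed (rule that)
qed

section \<open>Symmetrization\<close>

text \<open>Strict decrease in the norm is what lets equality in \<open>gam_pol\<close> detect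
  functions that are not polarized.\<close>

definition gam :: "real^2 => real" where "gam x = exp (- (x \<bullet> x))"

lemma gam_pos: "gam x > 0" and gam_le1: "gam x <= 1" by (simp_all add: gam_def)
lemma gam_borel [measurable]: "gam \<in> BM" unfolding gam_def[abs_def] by measurable
lemma gam_strict: "norm x < norm y ==> gam y < gam x"
 unfolding gam_def by (simp add: norm_lt)

lemma nn_arctan: "(\<integral>\<^sup>+t. ennreal (1 / (1 + t^2)) \<partial>lborel) < \<infinity>"
proof -
 let ?f = "\<lambda>t::real. 1 / (1 + t^2)"
 have h: "(\<integral>\<^sup>+t. ennreal (?f t) * indicator {0..} t \<partial>lborel) = ennreal (pi / 2 - arctan 0)"
  by (rule nn_integral_FTC_atLeast) (auto intro!: derivative_eq_intros tendsto_arctan_at_top simp: power2_eq_square inverse_eq_divide)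
 have "(\<integral>\<^sup>+t. ennreal (?f t) \<partial>lborel) <= (\<integral>\<^sup>+t. ennreal (?f t) * indicator {0..} t + ennreal (?f (- t)) * indicator {0..} (- t) \<partial>lborel)"
  by (intro nn_integral_mono) (auto split: split_indicator)
 also have "\<dots> = (\<integral>\<^sup>+t. ennreal (?f t) * indicator {0..} t \<partial>lborel) + (\<integral>\<^sup>+t. ennreal (?f (- t)) * indicator {0..} (- t) \<partial>lborel)"
  by (rule nn_integral_add) auto
 also have "(\<integral>\<^sup>+t. ennreal (?f (- t)) * indicator {0..} (- t) \<partial>lborel) = (\<integral>\<^sup>+t. ennreal (?f t) * indicator {0..} t \<partial>lborel)"
  using nn_integral_real_affine[of "\<lambda>t. ennreal (?f t) * indicator {0..} t" "-1" 0] by simp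
 finally show ?thesis unfolding h by (auto simp: top_unique less_top[symmetric])
qed

text \<open>The comparison \<open>exp (- t^2) \<le> 1 / (1 + t^2)\<close> reduces the claim to the
  arctangent in each variable.\<close>

lemma gam_integrable: "L1 gam"
proof (rule integrableI_nonneg)
 let ?f = "\<lambda>t::real. 1 / (1 + t^2)"
 let ?I = "\<integral>\<^sup>+t. ennreal (?f t) \<partial>lborel"
 have g: "gam (a *\<^sub>R ex + b *\<^sub>R ey) <= ?f a * ?f b" for a b
 proof -
  have e: "exp (- t\<^sup>2) <= ?f t" for t :: real
  proof -
   have "1 + t^2 <= exp (t^2)" by (rule exp_ge_add_one_self)
   then show ?thesis by (simp add: exp_minus field_simps add_pos_nonneg)
  qed
  have "gam (a *\<^sub>R ex + b *\<^sub>R ey) = exp (- a\<^sup>2) * exp (- b\<^sup>2)"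
   by (simp add: gam_def inner_add_left inner_add_right power2_eq_square flip: exp_add)
  also have "\<dots> <= ?f a * ?f b" by (intro mult_mono e) auto
  finally show ?thesis .
 qed
 have "(\<integral>\<^sup>+x. ennreal (gam x) \<partial>lborel) = (\<integral>\<^sup>+a. \<integral>\<^sup>+b. ennreal (gam (a *\<^sub>R ex + b *\<^sub>R ey)) \<partial>lborel \<partial>lborel)"
  by (rule nn_integral_R2) measurable
 also have "\<dots> <= (\<integral>\<^sup>+a. \<integral>\<^sup>+b. ennreal (?f a) * ennreal (?f b) \<partial>lborel \<partial>lborel)"
  using g by (intro nn_integral_mono) (simp add: ennreal_mult'[symmetric] ennreal_leI)
 also have "\<dots> = ?I * ?I" by (simp add: nn_integral_cmult nn_integral_multc)
 also have "\<dots> < \<infinity>" using nn_arctan by (simp add: ennreal_mult_less_top)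
 finally show "(\<integral>\<^sup>+x. ennreal (gam x) \<partial>lborel) < \<infinity>" .
qed (auto simp: gam_pos less_imp_le)

lemma gam_sq_le: "(gam x)^2 <= gam x"
 using mult_left_mono[OF gam_le1[of x], of "gam x"] gam_pos[of x] by (simp add: power2_eq_square)

lemma gam_ltwo: "ltwo gam"
 by (rule ltwo_bound[OF gam_borel gam_integrable]) (simp add: gam_sq_le)

lemma msq_reflect: fixes f :: "'a::euclidean_space => 'b::euclidean_space"
 assumes [measurable]: "f \<in> BM" shows "msq (\<lambda>z. f (t - z)) = msq f"
 unfolding msq_def by (rule integral_reflect_pt(2)[of "\<lambda>x. (norm (f x))^2" t]) measurable

section \<open>Local compactness in \<open>H^1\<close>\<close>

lemma moll_bound:
 fixes u :: "'a::euclidean_space => real"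
 assumes K: "test_function K" and u: "ltwo u" shows "\<bar>moll K u x\<bar> <= sqrt (msq K * msq u)"
 using cauchy_schwarz_abs[OF test_ltwo[OF test_reflect[OF K]] u, of x] msq_reflect[OF test_borel[OF K], of x]
 by (simp add: moll_def)

text \<open>For a fixed kernel the mollifications of an \<open>L^2\<close>-bounded family are
  equi-Lipschitz, because the translation bound is applied to the kernel and not to
  \<open>u\<close>.\<close>

lemma moll_lipschitz:
 fixes u :: "'a::euclidean_space => real"
 assumes K: "test_function K" and u: "ltwo u"
 shows "\<bar>moll K u x - moll K u y\<bar> <= norm (x - y) * sqrt (msq (grad K) * msq u)"
proof -
 have l: "ltwo (\<lambda>z. K (x - z) - K (y - z))" by (intro ltwo_minus test_ltwo test_reflect K)
 have eq: "moll K u x - moll K u y = (LBINT z. (K (x - z) - K (y - z)) \<bullet> u z)"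
  using moll_integrable[OF K u] by (simp add: moll_def left_diff_distrib)
 have [measurable]: "K \<in> BM" using K by auto
 have "msq (\<lambda>z. K (x - z) - K (y - z)) = msq (\<lambda>w. K (w + (x - y)) - K w)"
  using msq_reflect[of "\<lambda>w. K (w + (x - y)) - K w" y] by (simp add: algebra_simps)
 also have "\<dots> <= msq (\<lambda>w. grad K w \<bullet> (x - y))" by (rule test_translation_bound[OF K])
 also have "\<dots> <= (norm (x - y))^2 * msq (grad K)"
  by (rule msq_inner_le[OF grad_ltwo[OF K]])
 finally have "msq (\<lambda>z. K (x - z) - K (y - z)) * msq u <= (norm (x - y))^2 * msq (grad K) * msq u" by (rule mult_right_mono) simp
 then have "sqrt (msq (\<lambda>z. K (x - z) - K (y - z)) * msq u) <= sqrt ((norm (x - y))^2 * (msq (grad K) * msq u))"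
  by (simp add: mult.assoc)
 also have "\<dots> = norm (x - y) * sqrt (msq (grad K) * msq u)" by (simp add: real_sqrt_mult)
 finally show ?thesis unfolding eq using cauchy_schwarz_abs[OF l u] by linarith
qed

text \<open>At each scale \<open>1 / (j + 1)\<close> the mollified functions are bounded and
  equi-Lipschitz, so convergence on a countable dense set spreads to all points, and a diagonal
  argument handles all scales. The functions stay within \<open>B / (j + 1)^2\<close> of their
  mollifications in squared norm. The weight \<open>gam\<close> localizes: the weighted functions
  have a Cauchy subsequence in \<open>L^2\<close>, and division by \<open>gam\<close> recovers the
  limit.\<close>

theorem sob_AE_compact:
 fixes u :: "nat => real^2 => real"
 assumes s: "!!n. sob (u n) (g n)" and A: "!!n. msq (u n) <= A" and B: "!!n. msq (g n) <= B"
 obtains r v where "strict_mono (r::nat=>nat)" "v \<in> BM" "aelim (\<lambda>n. u (r n)) v"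
proof -
 note l = sob_ltwo(1)[OF s]
 define K where "K j = (kern (1 / real (Suc j)) :: real^2 => real)" for j
 have K: "test_function (K j)" for j unfolding K_def by (rule kern_test) simp
 have A0: "A >= 0" using A[of 0] msq_nonneg[of "u 0"] by linarith
 have B0: "B >= 0" using B[of 0] msq_nonneg[of "g 0"] by linarith
 define U where "U j n = moll (K j) (u n)" for j n
 define c where "c j = sqrt (msq (K j) * A)" for j
 define L where "L j = sqrt (msq (grad (K j)) * A)" for j
 have c0: "c j >= 0" "L j >= 0" for j using A0 by (auto simp: c_def L_def)
 have Ub: "\<bar>U j n x\<bar> <= c j" for j n x
  unfolding U_def c_def by (rule order_trans[OF moll_bound[OF K l]]) (intro real_sqrt_le_mono mult_left_mono A; simp)
 have UL: "\<bar>U j n x - U j n y\<bar> <= norm (x - y) * L j" for j n x y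
  unfolding U_def L_def by (rule order_trans[OF moll_lipschitz[OF K l]]) (intro mult_left_mono real_sqrt_le_mono A; simp)
 obtain D :: "(real^2) set" where D: "countable D" "!!X. open X ==> X \<noteq> {} ==> \<exists>d\<in>D. d \<in> X"
  using countable_dense_exists by blast
 obtain r where r: "strict_mono (r::nat=>nat)" "!!p. p \<in> UNIV \<times> D ==> \<exists>l. (\<lambda>n. U (fst p) (r n) (snd p) / (1 + c (fst p))) ----> l"
 \<comment> \<open>Diagonal extraction over all pairs of a scale and a dense point; division by
   \<open>1 + c\<close> normalizes the values to modulus at most one.\<close>
 proof (rule function_convergent_subsequence[of "UNIV \<times> D" "\<lambda>n p. U (fst p) n (snd p) / (1 + c (fst p))" 1])
  show "countable ((UNIV :: nat set) \<times> D)" using D(1) by auto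
  show "norm (U (fst p) n (snd p) / (1 + c (fst p))) <= 1" for n p
   using Ub[of "fst p" n "snd p"] c0(1)[of "fst p"] by (simp add: field_simps)
 qed blast
 have convD: "convergent (\<lambda>n. U j (r n) q)" if q: "q \<in> D" for j q
 proof -
  obtain l where "(\<lambda>n. U j (r n) q / (1 + c j)) ----> l" using r(2)[of "(j, q)"] q by auto
  then have "(\<lambda>n. U j (r n) q / (1 + c j) * (1 + c j)) ----> l * (1 + c j)" by (intro tendsto_intros)
  then show ?thesis using c0(1)[of j] by (auto simp: convergent_def)
 qed
 have conv: "convergent (\<lambda>n. U j (r n) x)" for j x
 proof (rule real_Cauchy_convergent, rule CauchyI)
  fix e :: real assume e: "e > 0"
  \<comment> \<open>Moving from \<open>x\<close> to a point within distance \<open>d\<close> costs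
    at most \<open>e / 4\<close> for each of the two functions compared.\<close>
  define d where "d = e / (4 * (1 + L j))"
  have d: "d > 0" using e c0(2)[of j] by (simp add: d_def)
  obtain q where q: "q \<in> D" "q \<in> ball x d" using D(2)[of "ball x d"] d by auto
  have "norm (x - q) * L j <= d * L j" using q c0(2) by (intro mult_right_mono) (auto simp: dist_norm)
  also have "\<dots> <= d * (1 + L j)" using d by simp
  also have "\<dots> = e / 4" using c0(2)[of j] by (simp add: d_def field_simps)
  finally have xq: "norm (x - q) * L j <= e / 4" .
  obtain N where N: "!!m n. m >= N ==> n >= N ==> norm (U j (r m) q - U j (r n) q) < e / 4"
   using CauchyD[OF convergent_Cauchy[OF convD[OF q(1), of j]], of "e/4"] e by auto
  show "\<exists>M. \<forall>m\<ge>M. \<forall>n\<ge>M. norm (U j (r m) x - U j (r n) x) < e"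
  proof (intro exI[of _ N] allI impI)
   fix m n assume "m >= N" "n >= N"
   from N[OF this] show "norm (U j (r m) x - U j (r n) x) < e"
     using UL[of j "r m" x q] UL[of j "r n" x q] xq unfolding real_norm_def by linarith
  qed
 qed
 define a where "a j x = lim (\<lambda>n. U j (r n) x)" for j x
 have Ua: "(\<lambda>n. U j (r n) x) ----> a j x" for j x using conv by (simp add: a_def convergent_LIMSEQ_iff)
 have [measurable]: "U j n \<in> BM" for j n unfolding U_def by (rule moll_borel[OF K l])
 have [measurable]: "a j \<in> BM" for j unfolding a_def[abs_def] by measurable
 note [measurable] = ltwo_borel[OF l]
 have ab: "\<bar>a j x\<bar> <= c j" for j x
  by (rule LIMSEQ_le_const2[OF tendsto_rabs[OF Ua]]) (use Ub in auto)
 have lg: "ltwo (\<lambda>x. gam x * f x)" if "f \<in> BM" "!!x. \<bar>f x\<bar> <= C" for f C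
  using ltwo_bounded_scale'[OF gam_ltwo that(1), of C] that(2) by simp
 have lgU: "ltwo (\<lambda>x. gam x * U j n x)" for j n by (rule lg[of _ "c j"]) (use Ub in auto)
 have lga: "ltwo (\<lambda>x. gam x * a j x)" for j by (rule lg[of _ "c j"]) (use ab in auto)
 have lgu: "ltwo (\<lambda>x. gam x * u n x)" for n
  using ltwo_bounded_scale[OF l gam_borel, of 1] gam_pos gam_le1 by (simp add: less_imp_le)
 have wconv: "(\<lambda>n. msq (\<lambda>x. gam x * U j (r n) x - gam x * a j x)) ----> 0" for j
 proof (rule msq_dominated[OF _ ltwo_cmult[OF gam_ltwo, of "2 * c j"] AE_I2])
  fix x
  show "(\<lambda>n. gam x * U j (r n) x - gam x * a j x) ----> 0"
   using tendsto_diff[OF tendsto_mult_left[OF Ua[of j x], of "gam x"] tendsto_const[of "gam x * a j x"]] by simp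
  fix n
  have "\<bar>U j (r n) x - a j x\<bar> <= 2 * c j" using Ub[of j "r n" x] ab[of j x] by linarith
  then have "\<bar>gam x\<bar> * \<bar>U j (r n) x - a j x\<bar> <= \<bar>gam x\<bar> * \<bar>2 * c j\<bar>" by (intro mult_left_mono) auto
  then show "norm (gam x * U j (r n) x - gam x * a j x) <= norm (2 * c j * gam x)" by (simp add: abs_mult mult_ac flip: right_diff_distrib)
 qed measurable
 \<comment> \<open>The rate is uniform in \<open>n\<close>, because translations shorter than the
   scale move \<open>u n\<close> by at most the gradient bound times the scale.\<close>
 have near: "msq (\<lambda>x. gam x * u n x - gam x * U j n x) <= B * (1 / real (Suc j))^2" for n j
 proof -
  let ?e = "1 / real (Suc j)"
  have bz: "msq (\<lambda>x. u n (x + z) - u n x) <= B * ?e^2" if z: "norm z < ?e" for z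
  proof -
   have "msq (\<lambda>x. u n (x + z) - u n x) <= msq (\<lambda>x. g n x \<bullet> z)" by (rule sob_translation_bound[OF s])
   also have "\<dots> <= (norm z)^2 * msq (g n)" by (rule msq_inner_le[OF sob_ltwo(2)[OF s]])
   also have "\<dots> <= ?e^2 * B" using z B by (intro mult_mono power_mono) auto
   finally show ?thesis by (simp add: mult.commute)
  qed
  have m: "ltwo (U j n)" "msq (\<lambda>x. U j n x - u n x) <= B * ?e^2"
   unfolding U_def K_def by (rule moll_diff_bound[OF l _ bz]; simp)+
  have "msq (\<lambda>x. gam x * u n x - gam x * U j n x) <= msq (\<lambda>x. U j n x - u n x)"
  proof (rule msq_mono[OF ltwo_minus[OF lgu lgU] ltwo_minus[OF m(1) l]])
   fix x
   have "\<bar>gam x\<bar> * \<bar>u n x - U j n x\<bar> <= 1 * \<bar>u n x - U j n x\<bar>"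
    using gam_pos[of x] gam_le1[of x] by (intro mult_right_mono) auto
   then show "norm (gam x * u n x - gam x * U j n x) <= norm (U j n x - u n x)" by (simp add: abs_mult abs_minus_commute flip: right_diff_distrib)
  qed
  with m(2) show ?thesis by linarith
 qed
 have cauchy: "\<exists>N. \<forall>m\<ge>N. \<forall>n\<ge>N. msq (\<lambda>x. gam x * u (r m) x - gam x * u (r n) x) < e" if e: "e > 0" for e
 proof -
  have "(\<lambda>j. B * (1 / real (Suc j))^2) ----> B * 0^2" by (intro tendsto_intros inv_Suc_lim)
  then have "\<forall>\<^sub>F j in sequentially. B * (1 / real (Suc j))^2 < e / 16" by (rule order_tendstoD(2)) (use e in simp)
  then obtain j where j: "B * (1 / real (Suc j))^2 < e / 16" using eventually_happens'[OF sequentially_bot] by blast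
  have "\<forall>\<^sub>F n in sequentially. msq (\<lambda>x. gam x * U j (r n) x - gam x * a j x) < e / 16" using order_tendstoD(2)[OF wconv, of "e/16"] e by auto
  then obtain N where N: "!!n. n >= N ==> msq (\<lambda>x. gam x * U j (r n) x - gam x * a j x) < e / 16" by (auto simp: eventually_sequentially)
  have half: "msq (\<lambda>x. gam x * u (r n) x - gam x * a j x) < e / 4" if "n >= N" for n
   using msq_triangle[OF lgu lgU lga, of "r n" j j "r n"] near[of "r n" j] j N[OF that] by linarith
  show ?thesis
  proof (intro exI[of _ N] allI impI)
   fix m n assume mn: "m >= N" "n >= N"
   have "msq (\<lambda>x. gam x * a j x - gam x * u (r n) x) < e / 4" using half[OF mn(2)] by (simp add: msq_minus_commute)
   then show "msq (\<lambda>x. gam x * u (r m) x - gam x * u (r n) x) < e"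
    using msq_triangle[OF lgu lga lgu, of "r m" "r n" j] half[OF mn(1)] by linarith
  qed
 qed
 obtain w q where w: "ltwo w" "strict_mono (q::nat=>nat)" "AE x in lborel. (\<lambda>n. gam x * u (r (q n)) x) ----> w x"
  by (rule ltwo_complete[of "\<lambda>n x. gam x * u (r n) x", OF lgu cauchy]) blast
 have [measurable]: "w \<in> BM" using w(1) by (simp add: ltwo_def)
 show ?thesis
 proof (rule that[of "r \<circ> q" "\<lambda>x. w x / gam x"])
  show "strict_mono (r \<circ> q)" using r(1) w(2) by (rule strict_mono_o)
  show "AE x in lborel. (\<lambda>n. u ((r \<circ> q) n) x) ----> w x / gam x"
   using w(3)
  proof eventually_elim
   case (elim x)
   have "(\<lambda>n. gam x * u (r (q n)) x / gam x) ----> w x / gam x" using gam_pos[of x] by (intro tendsto_intros elim) auto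
   then show ?case using gam_pos[of x] by (simp add: o_def)
  qed
 qed measurable
qed

section \<open>Two-point inequalities\<close>

text \<open>Twice the integral is the integral of \<open>A x + A (refl n c x)\<close>. This sum is
  symmetric under the reflection, so an inequality on one half-plane is enough.\<close>

lemma two_point_nn:
 fixes A B :: "real^2 => ennreal"
 assumes n: "norm n = 1" and [measurable]: "A \<in> BM" "B \<in> BM"
  and le: "!!x. x \<bullet> n <= c ==> A x + A (refl n c x) <= B x + B (refl n c x)"
 shows "(\<integral>\<^sup>+x. A x \<partial>lborel) <= (\<integral>\<^sup>+x. B x \<partial>lborel)"
proof (rule ennreal_mult_le_mult_iff[of 2, THEN iffD1])
 have all: "A x + A (refl n c x) <= B x + B (refl n c x)" for x
 proof (cases "x \<bullet> n <= c")
  case False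
  from le[OF refl_half[OF n this]] show ?thesis using refl_refl[OF n, of c x] by (simp add: add.commute)
 qed (rule le)
 have two: "2 * (\<integral>\<^sup>+x. C x \<partial>lborel) = (\<integral>\<^sup>+x. C x + C (refl n c x) \<partial>lborel)" if [measurable]: "C \<in> BM" for C :: "real^2 => ennreal"
  using nn_integral_refl[OF n that, of c] by (simp add: nn_integral_add mult_2)
 show "2 * (\<integral>\<^sup>+x. A x \<partial>lborel) <= 2 * (\<integral>\<^sup>+x. B x \<partial>lborel)"
  unfolding two[OF assms(2)] two[OF assms(3)] by (rule nn_integral_mono) (rule all)
qed simp_all

text \<open>The potential density. The energy uses the coefficients \<open>\<mu>1/4\<close>,
  \<open>\<mu>2/4\<close>, \<open>\<rho>/2\<close>, \<open>\<beta>/2\<close>; other choices isolate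
  single terms, such as \<open>0 0 0 1\<close> for the coupling \<open>u^2 v\<close>, so that one
  set of estimates serves all.\<close>

definition Fq :: "real => real => real => real => real => real => real" where
 "Fq a1 a2 r b s t = a1 * s^4 + a2 * t^4 + r * s^2 * t^2 + b * s^2 * t"

lemma Fq_nonneg: "a1 >= 0 ==> a2 >= 0 ==> r >= 0 ==> b >= 0 ==> t >= 0 ==> Fq a1 a2 r b s t >= 0"
 by (simp add: Fq_def)

text \<open>The pure powers cancel. For the mixed terms the gain factors into increments of the
  squares in \<open>s\<close> and increments in \<open>t\<close>, which have the same sign exactly
  when the original order was mixed.\<close>

lemma Fq_supermodular:
 assumes co: "r >= 0" "b >= 0" and nn: "s >= 0" "s' >= 0" "t >= 0" "t' >= 0"
 shows "Fq a1 a2 r b s t + Fq a1 a2 r b s' t' <= Fq a1 a2 r b (max s s') (max t t') + Fq a1 a2 r b (min s s') (min t t')"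
proof -
 have id: "Fq a1 a2 r b s t' + Fq a1 a2 r b s' t - (Fq a1 a2 r b s t + Fq a1 a2 r b s' t')
   = r * ((s^2 - s'^2) * (t'^2 - t^2)) + b * ((s^2 - s'^2) * (t' - t))"
  by (simp add: Fq_def algebra_simps)
 consider "s' <= s" "t' <= t" | "s' <= s" "t < t'" | "s < s'" "t' <= t" | "s < s'" "t < t'" by linarith
 then show ?thesis
 proof cases
  case 2
  then have "0 <= (s^2 - s'^2) * (t'^2 - t^2)" "0 <= (s^2 - s'^2) * (t' - t)"
   using nn by (auto intro!: mult_nonneg_nonneg simp: power_mono)
  then have "0 <= r * ((s^2 - s'^2) * (t'^2 - t^2)) + b * ((s^2 - s'^2) * (t' - t))" using co by simp
  then show ?thesis using 2 id by (simp add: max_def min_def)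
 next
  case 3
  then have "0 <= (s^2 - s'^2) * (t'^2 - t^2)" "0 <= (s^2 - s'^2) * (t' - t)"
   using nn by (auto intro!: mult_nonpos_nonpos simp: power_mono)
  then have "0 <= r * ((s^2 - s'^2) * (t'^2 - t^2)) + b * ((s^2 - s'^2) * (t' - t))" using co by simp
  then show ?thesis using 3 id by (simp add: max_def min_def)
 qed (auto simp: max_def min_def)
qed

lemma Fq_borel [measurable]: assumes [measurable]: "u \<in> BM" "v \<in> BM"
 shows "(\<lambda>x. Fq a1 a2 r b (u x) (v x)) \<in> BM"
 unfolding Fq_def by measurable

text \<open>Values in \<open>ennreal\<close> ask for no integrability. Polarization does not
  increase this quantity, so competitors obtained from it are uniformly tight.\<close>

definition tail :: "real => (real^2 => real) => ennreal" where
 "tail R u = (\<integral>\<^sup>+x. ennreal (indicator {x. R <= norm x} x * (u x)^2) \<partial>lborel)"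

text \<open>The reflected point is at least as far from the origin and receives the smaller value,
  so the smaller value gets the larger weight.\<close>

lemma tail_pol:
 assumes n: "norm n = 1" and c: "c >= 0" and [measurable]: "u \<in> BM" and nn: "!!x. u x >= 0"
 shows "tail R (pol n c u) <= tail R u"
 unfolding tail_def
proof (rule two_point_nn[OF n, of _ _ c])
 fix x assume x: "x \<bullet> n <= c"
 let ?I = "indicator {x. R <= norm x} :: real^2 => real"
 have I: "?I x <= ?I (refl n c x)" using norm_refl_ge[OF n c x] by (auto split: split_indicator)
 have key: "i * (max a b)^2 + j * (min a b)^2 <= i * a^2 + j * b^2" if "i <= j" "0 <= a" "0 <= b" for i j a b :: real
 proof (cases "b <= a")
  case False
  then have "0 <= (j - i) * (b^2 - a^2)" using that by (intro mult_nonneg_nonneg) (auto simp: power_mono)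
  then show ?thesis using False by (simp add: max_def min_def algebra_simps)
 qed (simp add: max_def min_def)
 show "ennreal (?I x * (pol n c u x)^2) + ennreal (?I (refl n c x) * (pol n c u (refl n c x))^2) <= ennreal (?I x * (u x)^2) + ennreal (?I (refl n c x) * (u (refl n c x))^2)"
  unfolding pol_half[OF n x] by (simp add: ennreal_plus[symmetric] key[OF I nn nn] ennreal_leI del: ennreal_plus)
qed measurable

lemma Fq_pol:
 assumes n: "norm n = 1" and [measurable]: "u \<in> BM" "v \<in> BM"
  and nn: "!!x. u x >= 0" "!!x. v x >= 0" and co: "a1 >= 0" "a2 >= 0" "r >= 0" "b >= 0"
 shows "(\<integral>\<^sup>+x. ennreal (Fq a1 a2 r b (u x) (v x)) \<partial>lborel) <= (\<integral>\<^sup>+x. ennreal (Fq a1 a2 r b (pol n c u x) (pol n c v x)) \<partial>lborel)"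
proof (rule two_point_nn[OF n, of _ _ c])
 fix x assume x: "x \<bullet> n <= c"
 have F0: "Fq a1 a2 r b s t >= 0" if "t >= 0" for s t by (rule Fq_nonneg[OF co that])
 show "ennreal (Fq a1 a2 r b (u x) (v x)) + ennreal (Fq a1 a2 r b (u (refl n c x)) (v (refl n c x)))
  <= ennreal (Fq a1 a2 r b (pol n c u x) (pol n c v x)) + ennreal (Fq a1 a2 r b (pol n c u (refl n c x)) (pol n c v (refl n c x)))"
  unfolding pol_half[OF n x] using nn
  by (simp add: ennreal_plus[symmetric] F0 Fq_supermodular[OF co(3,4)] ennreal_leI le_max_iff_disj del: ennreal_plus)
qed measurable

lemma tail_0: "ltwo u ==> tail 0 u = ennreal (msq u)"
 unfolding tail_def using nn_msq_real[of u] by (simp add: indicator_def)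

text \<open>Competitors for \<open>u\<close> with gradient bound \<open>m\<close> that are at least as tight; the class is stable under
 polarization by half-planes containing the origin.\<close>

definition better :: "(real^2 => real) => real => (real^2 => real) => bool" where
 "better u m u' \<longleftrightarrow> (\<forall>x. 0 <= u' x) & (\<exists>g. sob u' g & msq g <= m) & (\<forall>R. tail R u' <= tail R u)"

lemma better_pol:
 assumes n: "norm n = 1" and c: "c >= 0" and w: "better u m w" shows "better u m (pol n c w)"
proof -
 obtain g where g: "sob w g" "msq g <= m" and nn: "!!x. 0 <= w x" using w by (auto simp: better_def)
 obtain h where "sob (pol n c w) h" "msq h <= msq g" by (rule sob_pol[OF n g(1)]) blast
 then have "\<exists>h. sob (pol n c w) h & msq h <= m" using g(2) order_trans by blast
 moreover have "0 <= pol n c w x" for x using nn by (auto simp: pol_def le_max_iff_disj)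
 moreover have "tail R (pol n c w) <= tail R u" for R
  using w tail_pol[where u=w and R=R, OF n c sob_borel[OF g(1)] nn] by (auto simp: better_def intro: order_trans)
 ultimately show ?thesis by (simp add: better_def)
qed

lemma better_msq: assumes u: "ltwo u" and w: "better u m w" shows "msq w <= msq u"
proof -
 obtain g where g: "sob w g" using w by (auto simp: better_def)
 have "tail 0 w <= tail 0 u" using w by (simp add: better_def)
 then show ?thesis unfolding tail_0[OF u] tail_0[OF sob_ltwo(1)[OF g]] by simp
qed

section \<open>From invariance under polarization to radial monotonicity\<close>

text \<open>A single null set of points excludes all bad pairs. This survives countable unions in
  limits and leaves an exact radial profile outside the set.\<close>

definition radial_dec :: "(real^2 => real) => bool" where
 "radial_dec w \<longleftrightarrow> (\<exists>N\<in>null_sets lborel. \<forall>x y. x \<notin> N --> y \<notin> N --> norm x <= norm y --> w y <= w x)"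

text \<open>The difference of the two averages is an integral of \<open>D * w\<close>, where
  \<open>D\<close> is odd under the reflection and nonnegative on the half-plane since the kernel
  decreases with the distance. Folding the integral leaves \<open>D\<close> times the excess of
  \<open>w\<close> over its reflection. Thus almost everywhere invariance becomes an inequality at
  every point.\<close>

lemma pol_moll:
 assumes e: "\<epsilon> > 0" and w: "ltwo w" and n: "norm n = 1" and P: "AE x in lborel. pol n c w x = w x" and x: "x \<bullet> n <= c"
 shows "moll (kern \<epsilon>) w (refl n c x) <= moll (kern \<epsilon>) w x"
proof -
 let ?s = "refl n c" and ?K = "kern \<epsilon> :: real^2 => real"
 note K = kern_test[OF e, where 'a="real^2"]
 note [measurable] = ltwo_borel[OF w]
 define D where "D y = ?K (x - y) - ?K (?s x - y)" for y
 have [measurable]: "D \<in> BM" unfolding D_def[abs_def] by measurable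
 have i: "L1 (\<lambda>y. D y * w y)"
  unfolding D_def left_diff_distrib using moll_integrable[OF K w] by simp
 have eq: "moll ?K w x - moll ?K w (?s x) = (LBINT y. D y * w y)"
  unfolding D_def left_diff_distrib moll_def using moll_integrable[OF K w] by simp
 have Ds: "D (?s y) = - D y" for y
 proof -
  have "?K (x - ?s y) = ?K (?s x - y)" by (rule kern_eq) (rule refl_dist2[OF n, symmetric])
  moreover have "?K (?s x - ?s y) = ?K (x - y)" by (rule kern_eq) (rule refl_dist[OF n])
  ultimately show ?thesis by (simp add: D_def)
 qed
 have i2: "L1 (\<lambda>y. D (?s y) * w (?s y))" using integral_refl(2)[OF n, of "\<lambda>y. D y * w y" c] i by simp
 have "2 * (LBINT y. D y * w y) = (LBINT y. D y * w y) + (LBINT y. D (?s y) * w (?s y))"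
  using integral_refl(1)[OF n, of "\<lambda>y. D y * w y" c] by simp
 also have "\<dots> = (LBINT y. D y * w y + D (?s y) * w (?s y))" using i i2 by simp
 also have "\<dots> >= 0"
 proof (rule integral_nonneg_AE)
  show "AE y in lborel. 0 <= D y * w y + D (?s y) * w (?s y)"
   using P AE_refl[OF n P, of c]
  proof eventually_elim
   case (elim y)
   have pos: "0 <= D z * w z + D (?s z) * w (?s z)" if z: "z \<bullet> n <= c" and wz: "w z = max (w z) (w (?s z))" for z
   proof -
    have "D z >= 0" unfolding D_def
    proof (simp, rule kern_antimono)
     show "norm (x - z) <= norm (?s x - z)" using refl_dist_le[OF n x z] refl_dist2[OF n, of c x z] by simp
    qed
    moreover have "w (?s z) <= w z" using wz by (metis max.cobounded2)
    ultimately have "0 <= D z * (w z - w (?s z))" by simp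
    then show ?thesis by (simp add: Ds algebra_simps)
   qed
   show ?case
   proof (cases "y \<bullet> n <= c")
    case True
    then show ?thesis using pos[OF True] elim(1) pol_half(1)[OF n True, of w] by simp
   next
    case False
    note h = refl_half[OF n False]
    show ?thesis using pos[OF h] elim(2) pol_half(1)[OF n h, of w] by (simp add: refl_refl[OF n] add.commute)
   qed
  qed
 qed
 finally show ?thesis using eq by simp
qed

text \<open>For the continuous mollifications monotonicity is checked at every pair: if
  \<open>|x| < |y|\<close>, a single reflection takes \<open>x\<close> to \<open>y\<close>. Equal
  norms follow by shrinking \<open>x\<close> slightly, and a subsequence of the mollifications
  converges to \<open>w\<close> almost everywhere.\<close>

theorem polarized_radial:
 assumes w: "ltwo w" and P: "!!n c. norm n = 1 ==> c > 0 ==> AE x in lborel. pol n c w x = w x"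
 shows "radial_dec w"
proof -
 define A where "A j = moll (kern (1 / real (Suc j))) w" for j
 have lt: "A j y <= A j x" if xy: "norm x < norm y" for j x y
 proof -
  \<comment> \<open>The line \<open>x \<bullet> n = c\<close> of these parameters is the
    perpendicular bisector of the two points; \<open>c > 0\<close> places the origin on the side of
    \<open>x\<close>.\<close>
  define n where "n = (y - x) /\<^sub>R norm (y - x)"
  define c where "c = ((norm y)^2 - (norm x)^2) / (2 * norm (y - x))"
  have ne: "norm (y - x) > 0" using xy by auto
  have n: "norm n = 1" using ne by (simp add: n_def)
  have "(norm x)^2 < (norm y)^2" using xy by (intro power_strict_mono) auto
  then have c: "c > 0" using ne by (simp add: c_def)
  have xn: "c - x \<bullet> n = norm (y - x) / 2"
  proof -
   have "x \<bullet> n = (x \<bullet> (y - x)) / norm (y - x)" by (simp add: n_def divide_inverse mult.commute)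
   then have "c - x \<bullet> n = ((norm y)^2 - (norm x)^2 - 2 * (x \<bullet> (y - x))) / (2 * norm (y - x))" using ne by (simp add: c_def field_simps)
   also have "(norm y)^2 - (norm x)^2 - 2 * (x \<bullet> (y - x)) = (norm (y - x))^2"
    by (simp add: power2_norm_eq_inner inner_diff_left inner_diff_right inner_commute)
   finally show ?thesis using ne by (simp add: power2_eq_square)
  qed
  have "refl n c x = x + (2 * (c - x \<bullet> n)) *\<^sub>R n" by (simp add: refl_def algebra_simps)
  also have "\<dots> = y" unfolding xn using ne by (simp add: n_def)
  finally have "refl n c x = y" .
  moreover have "x \<bullet> n <= c" using xn ne by linarith
  ultimately show ?thesis using pol_moll[OF _ w n P[OF n c], of "1 / real (Suc j)" x] by (simp add: A_def)
 qed
 have cont: "isCont (A j) x" for j x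
 proof -
  have "continuous_on UNIV (A j)"
   unfolding A_def using Ck_moll[OF kern_test w, of "1 / real (Suc j)" 0] by simp
  then show ?thesis by (simp add: continuous_on_eq_continuous_at)
 qed
 have le: "A j y <= A j x" if xy: "norm x <= norm y" for j x y
 proof (cases "norm x < norm y \<or> x = 0")
  case True
  then show ?thesis using lt[of x y j] xy by (cases "y = 0") auto
 next
  case False
  then have eq: "norm x = norm y" and x0: "norm x > 0" using xy by auto
  have t: "(\<lambda>k. (1 - 1 / real (Suc k)) *\<^sub>R x) ----> (1 - 0) *\<^sub>R x" by (intro tendsto_intros inv_Suc_lim)
  have "(\<lambda>k. A j ((1 - 1 / real (Suc k)) *\<^sub>R x)) ----> A j x"
   using isCont_tendsto_compose[OF cont t] by simp
  moreover have "A j y <= A j ((1 - 1 / real (Suc k)) *\<^sub>R x)" for k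
  proof (rule lt)
   have "norm ((1 - 1 / real (Suc k)) *\<^sub>R x) = (1 - 1 / real (Suc k)) * norm x" by simp
   also have "\<dots> < 1 * norm x" using x0 by (intro mult_strict_right_mono) auto
   finally show "norm ((1 - 1 / real (Suc k)) *\<^sub>R x) < norm y" using eq by simp
  qed
  ultimately show ?thesis by (intro LIMSEQ_le_const) auto
 qed
 obtain r where "strict_mono (r::nat=>nat)" and r: "aelim (\<lambda>k. A (r k)) w"
 proof (rule AE_subseq[of A w])
  show "ltwo (A n)" for n unfolding A_def by (rule moll_ltwo[OF w]) simp
  show "l2lim A w" unfolding A_def by (rule moll_conv[OF w])
 qed (use w in auto)
 then obtain N where N: "{x. \<not> (\<lambda>k. A (r k) x) ----> w x} \<subseteq> N" "N \<in> null_sets lborel"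
  by (auto elim!: AE_E simp: null_sets_def)
 have "w y <= w x" if "x \<notin> N" "y \<notin> N" "norm x <= norm y" for x y
 proof -
  have "(\<lambda>k. A (r k) x) ----> w x" "(\<lambda>k. A (r k) y) ----> w y" using N(1) that by auto
  from this(2,1) show ?thesis by (rule LIMSEQ_le) (use le[OF that(3)] in auto)
 qed
 then show ?thesis unfolding radial_dec_def using N(2) by blast
qed

section \<open>Convergence of the potential energy\<close>

lemma Fq_le:
 assumes co: "a1 >= 0" "a2 >= 0" "r >= 0" "b >= 0" and st: "s >= 0" "t >= 0" "s <= m" "t <= m"
 shows "Fq a1 a2 r b s t <= (a1 + a2 + r + b) * (m^4 + m^3)"
proof -
 have m: "0 <= m" using st by linarith
 have s: "s^4 <= m^4" "t^4 <= m^4" "s^2 <= m^2" "t^2 <= m^2" using st by (auto intro: power_mono)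
 have 1: "a1 * s^4 <= a1 * (m^4 + m^3)" "a2 * t^4 <= a2 * (m^4 + m^3)"
  using s m co by (intro mult_left_mono; simp add: add_increasing2)+
 have "s^2 * t^2 <= m^2 * m^2" "s^2 * t <= m^2 * m" using s st m by (intro mult_mono; simp)+
 then have "s^2 * t^2 <= m^4 + m^3" "s^2 * t <= m^4 + m^3"
 proof -
  have "m^2 * m^2 = m^4" "m^2 * m = m^3" by (simp_all add: power2_eq_square power3_eq_cube power4_eq_xxxx)
  moreover assume "s^2 * t^2 <= m^2 * m^2" "s^2 * t <= m^2 * m"
  ultimately show "s^2 * t^2 <= m^4 + m^3" "s^2 * t <= m^4 + m^3"
   using zero_le_power[OF m, of 3] zero_le_power[OF m, of 4] by linarith+
 qed
 then have 2: "r * (s^2 * t^2) <= r * (m^4 + m^3)" "b * (s^2 * t) <= b * (m^4 + m^3)" using co by (auto intro: mult_left_mono)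
 show ?thesis using 1 2 by (simp add: Fq_def algebra_simps)
qed

text \<open>Interpolation of the orders three and four between two and six with a free parameter: a
  large \<open>K\<close> makes the sextic part small, and the quadratic part is then left to the
  mass outside a ball.\<close>

lemma Fq_tail_bound:
 assumes co: "a1 >= 0" "a2 >= 0" "r >= 0" "b >= 0" and st: "s >= 0" "t >= 0" and K: "K > 0"
 shows "Fq a1 a2 r b s t <= (a1 + a2 + r + b) * ((1 + K) * (s^2 + t^2) + (s^6 + t^6) / K)"
proof -
 define m where "m = max s t"
 have m: "s <= m" "t <= m" "m >= 0" using st by (auto simp: m_def)
 have A: "a1 + a2 + r + b >= 0" using co by simp
 have "0 <= (m - m^2)^2 / 2" by simp
 then have 3: "2 * m^3 <= m^2 + m^4" by (simp add: power2_diff power2_eq_square power3_eq_cube power4_eq_xxxx algebra_simps)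
 have "0 <= (K * m - m^3)^2 / K" using K by simp
 also have "\<dots> = K * m^2 + m^6 / K - 2 * m^4"
  using K by (simp add: power2_diff field_simps power_mult_distrib eval_nat_numeral)
 finally have 4: "2 * m^4 <= K * m^2 + m^6 / K" by simp
 have m0: "0 <= m^3" "0 <= m^4" "0 <= m^2" "0 <= m^6" using m by auto
 have "m^4 + m^3 <= (1 + K) * m^2 + m^6 / K" using 3 4 m0 unfolding distrib_right by linarith
 also have "\<dots> <= (1 + K) * (s^2 + t^2) + (s^6 + t^6) / K"
  using K by (intro add_mono mult_left_mono divide_right_mono) (auto simp: m_def max_def)
 finally show ?thesis
  by (intro order_trans[OF Fq_le[OF co st m(1,2)]] mult_left_mono A)
qed

text \<open>On a bounded region the constant \<open>C\<close> is integrable, so it may be large;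
  only the sextic excess needs the small factor.\<close>

lemma Fq_inside_bound:
 assumes co: "a1 >= 0" "a2 >= 0" "r >= 0" "b >= 0" and e: "\<eta> > 0"
 obtains C where "C >= 0" "!!s t. s >= 0 ==> t >= 0 ==> Fq a1 a2 r b s t <= C + \<eta> * (s^6 + t^6)"
proof -
 define A where "A = a1 + a2 + r + b"
 have A: "A >= 0" using co by (simp add: A_def)
 define K where "K = 2 * A / \<eta> + 1"
 have K: "K > 0" "A / K <= \<eta> / 2" using A e by (auto simp: K_def field_simps add_nonneg_pos)
 \<comment> \<open>Beyond \<open>x^2 = L\<close> the sextic term dominates the quadratic one; below,
   the quadratic term is absorbed by the constant.\<close>
 define L where "L = 1 + 2 * (A * (1 + K)) / \<eta>"
 have AK: "A * (1 + K) >= 0" using A K by simp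
 have L: "L >= 1" "A * (1 + K) <= \<eta> / 2 * L" using AK e by (auto simp: L_def field_simps)
 show ?thesis
 proof (rule that[of "2 * (A * (1 + K)) * L"])
  show "0 <= 2 * (A * (1 + K)) * L" using AK L by simp
  fix s t :: real assume st: "s >= 0" "t >= 0"
  have sq: "A * (1 + K) * x^2 <= A * (1 + K) * L + \<eta> / 2 * x^6" if "x >= 0" for x
  proof (cases "x^2 <= L")
   case True
   have "A * (1 + K) * x^2 <= A * (1 + K) * L" using True AK by (rule mult_left_mono)
   moreover have "0 <= \<eta> / 2 * x^6" using e by simp
   ultimately show ?thesis by linarith
  next
   case False
   then have "L * 1 <= x^2 * x^2" using L by (intro mult_mono) auto
   then have "(\<eta> / 2 * L) * x^2 <= (\<eta> / 2 * (x^2 * x^2)) * x^2" using e by (intro mult_right_mono mult_left_mono) auto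
   moreover have "A * (1 + K) * x^2 <= (\<eta> / 2 * L) * x^2" using L by (intro mult_right_mono) auto
   moreover have "(\<eta> / 2 * (x^2 * x^2)) * x^2 = \<eta> / 2 * x^6" by (simp add: eval_nat_numeral)
   moreover have "0 <= A * (1 + K) * L" using AK L by simp
   ultimately show ?thesis by linarith
  qed
  have "Fq a1 a2 r b s t <= A * ((1 + K) * (s^2 + t^2) + (s^6 + t^6) / K)"
   unfolding A_def by (rule Fq_tail_bound[OF co st K(1)])
  also have "\<dots> = A * (1 + K) * s^2 + A * (1 + K) * t^2 + A / K * (s^6 + t^6)" by (simp add: algebra_simps add_divide_distrib)
  also have "\<dots> <= (A * (1 + K) * L + \<eta> / 2 * s^6) + (A * (1 + K) * L + \<eta> / 2 * t^6) + \<eta> / 2 * (s^6 + t^6)"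
   using sq[OF st(1)] sq[OF st(2)] K(2) st by (intro add_mono mult_right_mono) auto
  also have "\<dots> = 2 * (A * (1 + K)) * L + \<eta> * (s^6 + t^6)" by (simp add: algebra_simps)
  finally show "Fq a1 a2 r b s t <= 2 * (A * (1 + K)) * L + \<eta> * (s^6 + t^6)" .
 qed
qed

text \<open>Inside a ball the sextic bound gives uniform integrability. The hypothesis
  \<open>T\<close> is the control outside, supplied by tightness in \<open>better_Fq_limit\<close>
  and by radial decay in \<open>radial_compact\<close>.\<close>

lemma Fq_conv:
 fixes u v :: "nat => real^2 => real"
 assumes co: "a1 >= 0" "a2 >= 0" "r >= 0" "b >= 0"
  and s: "!!n. sob (u n) (g n)" "!!n. sob (v n) (h n)" and nn: "!!n x. u n x >= 0" "!!n x. v n x >= 0"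
  and bd: "!!n. msq (u n) <= A" "!!n. msq (v n) <= A" "!!n. msq (g n) <= B" "!!n. msq (h n) <= B"
  and m[measurable]: "u' \<in> BM" "v' \<in> BM"
  and AE: "aelim u u'" "aelim v v'"
  and T: "!!\<delta>. \<delta> > 0 ==> \<exists>R E. \<forall>n. L1 (E n) & (LBINT x. E n x) <= \<delta> & (\<forall>x. 0 <= E n x) &
    (AE x in lborel. R <= norm x --> Fq a1 a2 r b (u n x) (v n x) <= E n x)"
 shows "L1 (\<lambda>x. Fq a1 a2 r b (u' x) (v' x))"
  "(\<lambda>n. LBINT x. Fq a1 a2 r b (u n x) (v n x)) ----> (LBINT x. Fq a1 a2 r b (u' x) (v' x))"
  "!!n. L1 (\<lambda>x. Fq a1 a2 r b (u n x) (v n x))"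
proof -
 have [measurable]: "u n \<in> BM" "v n \<in> BM" for n using s sob_borel by auto
 have A0: "A >= 0" using bd(1)[of 0] msq_nonneg[of "u 0"] by linarith
 have B0: "B >= 0" using bd(3)[of 0] msq_nonneg[of "g 0"] by linarith
 define M where "M = 36 * A * B^2"
 have M0: "M >= 0" using A0 by (simp add: M_def)
 have L6: "(LBINT x. u n x ^ 6) <= M" "(LBINT x. v n x ^ 6) <= M" for n
 proof -
  have "36 * msq (u n) * (msq (g n))^2 <= M" "36 * msq (v n) * (msq (h n))^2 <= M"
   unfolding M_def using bd[of n] A0 by (intro mult_mono power_mono; simp)+
  then show "(LBINT x. u n x ^ 6) <= M" "(LBINT x. v n x ^ 6) <= M"
   using sob_Lp(4)[OF s(1), of n] sob_Lp(4)[OF s(2), of n] by linarith+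
 qed
 have AEF: "AE x in lborel. (\<lambda>n. Fq a1 a2 r b (u n x) (v n x)) ----> Fq a1 a2 r b (u' x) (v' x)"
  using AE by eventually_elim (auto simp: Fq_def intro!: tendsto_intros)
 have dom: "\<exists>D E. L1 D & (\<forall>n. L1 (E n) & (LBINT x. E n x) <= \<delta> &
   (AE x in lborel. 0 <= D x & 0 <= E n x & \<bar>Fq a1 a2 r b (u n x) (v n x)\<bar> <= D x + E n x))" if d: "\<delta> > 0" for \<delta>
 proof -
  obtain R E where E: "!!n. L1 (E n)" "!!n. (LBINT x. E n x) <= \<delta> / 2" "!!n x. 0 <= E n x"
   "!!n. AE x in lborel. R <= norm x --> Fq a1 a2 r b (u n x) (v n x) <= E n x"
   using T[of "\<delta> / 2"] d by auto
  define \<eta> where "\<eta> = \<delta> / (4 * (M + 1))"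
  have e: "\<eta> > 0" "\<eta> * (2 * M) <= \<delta> / 2" using d M0 by (auto simp: \<eta>_def field_simps)
  obtain C where C: "C >= 0" "!!s t. s >= 0 ==> t >= 0 ==> Fq a1 a2 r b s t <= C + \<eta> * (s^6 + t^6)"
   using Fq_inside_bound[OF co e(1)] by blast
  let ?D = "\<lambda>x::real^2. C * indicator (cball 0 R) x"
  let ?E = "\<lambda>n x. \<eta> * (u n x ^ 6 + v n x ^ 6) + E n x"
  have i6: "L1 (\<lambda>x. u n x ^ 6)" "L1 (\<lambda>x. v n x ^ 6)" for n using sob_Lp(3)[OF s(1)] sob_Lp(3)[OF s(2)] by auto
  show ?thesis
  proof (intro exI[of _ ?D] exI[of _ ?E] conjI allI)
   show "L1 ?D"
    by (rule integrable_cball)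
   fix n
   show "L1 (?E n)" using i6 E(1) by simp
   have "(LBINT x. ?E n x) = \<eta> * ((LBINT x. u n x ^ 6) + (LBINT x. v n x ^ 6)) + (LBINT x. E n x)" using i6 E(1) by simp
   also have "\<dots> <= \<eta> * (M + M) + \<delta> / 2" using L6 e E(2) by (intro add_mono mult_left_mono) auto
   also have "\<dots> <= \<delta>" using e(2) by simp
   finally show "(LBINT x. ?E n x) <= \<delta>" .
   show "AE x in lborel. 0 <= ?D x & 0 <= ?E n x & \<bar>Fq a1 a2 r b (u n x) (v n x)\<bar> <= ?D x + ?E n x"
    using E(4)[of n]
   proof eventually_elim
    case (elim x)
    have F0: "0 <= Fq a1 a2 r b (u n x) (v n x)" by (rule Fq_nonneg[OF co nn(2)])
    have e0: "0 <= \<eta> * (u n x ^ 6 + v n x ^ 6)" using e by simp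
    show ?case
    proof (cases "R <= norm x")
     case True
     then have "Fq a1 a2 r b (u n x) (v n x) <= E n x" using elim by simp
     moreover have "0 <= ?D x" using C by simp
     ultimately show ?thesis using F0 e0 E(3)[of n x] by auto
    next
     case False
     then have "?D x = C" by simp
     then show ?thesis using C(2)[OF nn, of n x n x] F0 e0 E(3)[of n x] C(1) by auto
    qed
   qed
  qed
 qed
 note c = integral_conv_uniform[OF _ _ AEF dom]
 show "L1 (\<lambda>x. Fq a1 a2 r b (u' x) (v' x))"
  "(\<lambda>n. LBINT x. Fq a1 a2 r b (u n x) (v n x)) ----> (LBINT x. Fq a1 a2 r b (u' x) (v' x))"
  "!!n. L1 (\<lambda>x. Fq a1 a2 r b (u n x) (v n x))"
  by (rule c; simp)+
qed

lemma tail_fin: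
 assumes u: "ltwo u" shows "tail R u = ennreal (LBINT x. indicator {x. R <= norm x} x * (u x)^2)"
  and "L1 (\<lambda>x. indicator {x. R <= norm x} x * (u x)^2)"
proof -
 note [measurable] = ltwo_borel[OF u]
 show i: "L1 (\<lambda>x. indicator {x. R <= norm x} x * (u x)^2)"
  by (rule integrable_dom[OF ltwo_int_real[OF u]]) (auto split: split_indicator)
 show "tail R u = ennreal (LBINT x. indicator {x. R <= norm x} x * (u x)^2)"
  unfolding tail_def by (rule nn_integral_eq_integral[OF i]) simp
qed

lemma tail_small:
 assumes u: "ltwo (u :: real^2 => real)" and e: "e > 0" obtains R where "(LBINT x. indicator {x. R <= norm x} x * (u x)^2) < e"
proof -
 note [measurable] = ltwo_borel[OF u]
 have "(\<lambda>n. LBINT x. indicator {x. real n <= norm x} x * (u x)^2) ----> (\<integral>x. 0 \<partial>(lborel :: (real^2) measure))"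
 proof (rule integral_dominated_convergence[where w="\<lambda>x. (u x)^2"])
  show "AE x in lborel. (\<lambda>n. indicator {x. real n <= norm x} x * (u x)^2) ----> 0"
  proof (rule AE_I2)
   fix x :: "real^2"
   obtain N where N: "norm x < real N" using reals_Archimedean2 by blast
   have "\<forall>\<^sub>F n in sequentially. indicator {x. real n <= norm x} x * (u x)^2 = 0"
    using eventually_ge_at_top[of N] by eventually_elim (use N in "auto split: split_indicator")
   then show "(\<lambda>n. indicator {x. real n <= norm x} x * (u x)^2) ----> 0" by (rule tendsto_eventually)
  qed
 qed (use ltwo_int_real[OF u] in "auto split: split_indicator")
 from order_tendstoD(2)[OF this, of e] e obtain n where "(LBINT x. indicator {x. real n <= norm x} x * (u x)^2) < e"
  using eventually_happens'[OF sequentially_bot] by auto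
 then show ?thesis by (rule that)
qed

lemma better_limit:
 assumes s: "sob u g" and w: "!!k. better u (msq g) (U k)"
  and [measurable]: "u' \<in> BM" and n': "!!x. u' x >= 0" and AE: "aelim U u'"
 shows "better u (msq g) u'"
proof -
 have "\<forall>k. \<exists>g'. sob (U k) g' & msq g' <= msq g" using w by (simp add: better_def)
 then obtain G where G: "!!k. sob (U k) (G k)" "!!k. msq (G k) <= msq g" by metis
 note [measurable] = sob_borel[OF G(1)]
 obtain h where "sob u' h" "msq h <= msq g"
  by (rule sob_AE_limit[of U G "msq u" "\<lambda>_. msq g" "msq g" u', OF G(1) better_msq[OF sob_ltwo(1)[OF s] w] G(2) tendsto_const _ AE]) (simp, blast)
 moreover have "tail R u' <= tail R u" for R
 proof -
  have "tail R u' = (\<integral>\<^sup>+x. liminf (\<lambda>n. ennreal (indicator {x. R <= norm x} x * (U n x)^2)) \<partial>lborel)"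
   unfolding tail_def
  proof (rule nn_integral_cong_AE)
   show "AE x in lborel. ennreal (indicator {x. R <= norm x} x * (u' x)^2) = liminf (\<lambda>n. ennreal (indicator {x. R <= norm x} x * (U n x)^2))"
    using AE
   proof eventually_elim
    case (elim x)
    then have "(\<lambda>n. ennreal (indicator {x. R <= norm x} x * (U n x)^2)) ----> ennreal (indicator {x. R <= norm x} x * (u' x)^2)"
     by (intro tendsto_ennrealI tendsto_intros)
    from lim_imp_Liminf[OF _ this] show ?case by simp
   qed
  qed
  also have "\<dots> <= liminf (\<lambda>n. tail R (U n))" unfolding tail_def by (rule nn_integral_liminf) measurable
  also have "\<dots> <= tail R u" using w by (intro Liminf_le) (auto simp: better_def)
  finally show ?thesis .
 qed
 ultimately show ?thesis using n' by (auto simp: better_def)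
qed

text \<open>The tails of all competitors lie below those of \<open>u\<close> and \<open>v\<close>,
  so no mass escapes to infinity and the potential energies converge, although the competitors need
  not be radial.\<close>

lemma better_Fq_limit:
 assumes co: "a1 >= 0" "a2 >= 0" "r >= 0" "b >= 0" and s: "sob u g" "sob v h"
  and w: "!!k. better u (msq g) (U k)" "!!k. better v (msq h) (V k)"
  and le: "!!k. (\<integral>\<^sup>+x. ennreal (Fq a1 a2 r b (u x) (v x)) \<partial>lborel) <= (\<integral>\<^sup>+x. ennreal (Fq a1 a2 r b (U k x) (V k x)) \<partial>lborel)"
  and m[measurable]: "u' \<in> BM" "v' \<in> BM" and n': "!!x. u' x >= 0" "!!x. v' x >= 0"
  and AE: "aelim U u'" "aelim V v'"
 shows "(\<integral>\<^sup>+x. ennreal (Fq a1 a2 r b (u x) (v x)) \<partial>lborel) <= (\<integral>\<^sup>+x. ennreal (Fq a1 a2 r b (u' x) (v' x)) \<partial>lborel)"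
proof -
 have "\<forall>k. \<exists>g'. sob (U k) g' & msq g' <= msq g" "\<forall>k. \<exists>h'. sob (V k) h' & msq h' <= msq h" using w by (simp_all add: better_def)
 then obtain G H where G: "!!k. sob (U k) (G k)" "!!k. msq (G k) <= msq g" and H: "!!k. sob (V k) (H k)" "!!k. msq (H k) <= msq h" by metis
 have Unn: "U k x >= 0" "V k x >= 0" for k x using w[of k] by (auto simp: better_def)
 have mm: "msq (U k) <= msq u" "msq (V k) <= msq v" for k
  using better_msq[OF sob_ltwo(1)[OF s(1)] w(1)] better_msq[OF sob_ltwo(1)[OF s(2)] w(2)] by auto
 have F: "L1 (\<lambda>x. Fq a1 a2 r b (u' x) (v' x))"
  "(\<lambda>n. LBINT x. Fq a1 a2 r b (U n x) (V n x)) ----> (LBINT x. Fq a1 a2 r b (u' x) (v' x))"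
  "!!n. L1 (\<lambda>x. Fq a1 a2 r b (U n x) (V n x))"
 proof -
  let ?A = "max (msq u) (msq v)" and ?B = "max (msq g) (msq h)"
  let ?M = "36 * ?A * ?B^2"
  have M0: "?M >= 0" by (simp add: le_max_iff_disj)
  have L6: "(LBINT x. U n x ^ 6) <= ?M" "(LBINT x. V n x ^ 6) <= ?M" for n
  proof -
   have "36 * msq (U n) * (msq (G n))^2 <= ?M" "36 * msq (V n) * (msq (H n))^2 <= ?M"
    using mm[of n] G(2)[of n] H(2)[of n] by (intro mult_mono power_mono; simp add: le_max_iff_disj)+
   then show "(LBINT x. U n x ^ 6) <= ?M" "(LBINT x. V n x ^ 6) <= ?M"
    using sob_Lp(4)[OF G(1), of n] sob_Lp(4)[OF H(1), of n] by linarith+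
  qed
  have T: "\<exists>R E. \<forall>n. L1 (E n) & (LBINT x. E n x) <= \<delta> & (\<forall>x. 0 <= E n x) &
    (AE x in lborel. R <= norm x --> Fq a1 a2 r b (U n x) (V n x) <= E n x)" if d: "\<delta> > 0" for \<delta>
  proof -
   define Aa where "Aa = a1 + a2 + r + b"
   have A0: "Aa >= 0" using co by (simp add: Aa_def)
   \<comment> \<open>The order of choices matters: \<open>K\<close> first makes the sextic part at
     most \<open>\<delta> / 2\<close>; then \<open>e\<close>, which may depend on \<open>K\<close>,
     fixes how small the tails must be.\<close>
   define K where "K = 4 * Aa * ?M / \<delta> + 1"
   have K: "K > 0"
   proof -
    have "0 <= 4 * (Aa * ?M)" using mult_nonneg_nonneg[OF A0 M0] by linarith
    then show ?thesis unfolding K_def using d by (intro add_nonneg_pos divide_nonneg_pos) (simp_all only: mult.assoc zero_less_one)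
   qed
   have KM: "Aa * ((?M + ?M) / K) <= \<delta> / 2"
   proof -
    have "4 * Aa * ?M <= \<delta> * K" using d by (simp add: K_def distrib_left)
    then show ?thesis using K by (simp add: field_simps)
   qed
   define e where "e = \<delta> / (4 * (Aa * (1 + K) + 1))"
   have AK: "Aa * (1 + K) >= 0" using A0 K by simp
   have e: "e > 0" "Aa * (1 + K) * (e + e) <= \<delta> / 2"
   proof -
    show e0: "e > 0" using d AK by (simp add: e_def)
    have "e * (4 * (Aa * (1 + K) + 1)) = \<delta>" unfolding e_def using AK by simp
    then have "2 * (Aa * (1 + K) * (e + e)) + 4 * e = \<delta>" by (simp add: algebra_simps)
    then show "Aa * (1 + K) * (e + e) <= \<delta> / 2" using e0 by simp
   qed
   obtain R1 where R1: "(LBINT x. indicator {x. R1 <= norm x} x * (u x)^2) < e" using tail_small[OF sob_ltwo(1)[OF s(1)] e(1)] .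
   obtain R2 where R2: "(LBINT x. indicator {x. R2 <= norm x} x * (v x)^2) < e" using tail_small[OF sob_ltwo(1)[OF s(2)] e(1)] .
   define R where "R = max R1 R2"
   let ?I = "indicator {x. R <= norm x} :: real^2 => real"
   have mono: "(LBINT x. ?I x * (w x)^2) < e" if l: "ltwo w" and RR: "R' <= R" and le: "(LBINT x. indicator {x. R' <= norm x} x * (w x)^2) < e" for w R'
    using le integral_mono[OF tail_fin(2)[OF l, of R] tail_fin(2)[OF l, of R']] RR by (force split: split_indicator)
   have uv: "(LBINT x. ?I x * (u x)^2) < e" "(LBINT x. ?I x * (v x)^2) < e"
    using mono[OF sob_ltwo(1)[OF s(1)] _ R1] mono[OF sob_ltwo(1)[OF s(2)] _ R2] by (auto simp: R_def)
   have UV: "(LBINT x. ?I x * (U n x)^2) <= e" "(LBINT x. ?I x * (V n x)^2) <= e" for n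
   proof -
    have "tail R (U n) <= tail R u" "tail R (V n) <= tail R v" using w[of n] by (auto simp: better_def)
    then have "ennreal (LBINT x. ?I x * (U n x)^2) <= ennreal (LBINT x. ?I x * (u x)^2)"
      "ennreal (LBINT x. ?I x * (V n x)^2) <= ennreal (LBINT x. ?I x * (v x)^2)"
     using tail_fin(1)[OF sob_ltwo(1)[OF G(1)], of R n] tail_fin(1)[OF sob_ltwo(1)[OF H(1)], of R n]
      tail_fin(1)[OF sob_ltwo(1)[OF s(1)], of R] tail_fin(1)[OF sob_ltwo(1)[OF s(2)], of R] by simp_all
    then show "(LBINT x. ?I x * (U n x)^2) <= e" "(LBINT x. ?I x * (V n x)^2) <= e"
     using uv by (subst (asm) ennreal_le_iff; simp)+
   qed
   let ?E = "\<lambda>n x. Aa * ((1 + K) * (?I x * (U n x)^2 + ?I x * (V n x)^2) + (U n x ^ 6 + V n x ^ 6) / K)"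
   have ii: "L1 (\<lambda>x. ?I x * (U n x)^2)" "L1 (\<lambda>x. ?I x * (V n x)^2)"
     "L1 (\<lambda>x. U n x ^ 6)" "L1 (\<lambda>x. V n x ^ 6)" for n
    using tail_fin(2)[OF sob_ltwo(1)[OF G(1)]] tail_fin(2)[OF sob_ltwo(1)[OF H(1)]] sob_Lp(3)[OF G(1)] sob_Lp(3)[OF H(1)] by auto
   show ?thesis
   proof (intro exI[of _ R] exI[of _ ?E] allI conjI)
    fix n
    show "L1 (?E n)" using ii by simp
    have "(LBINT x. ?E n x) = Aa * ((1 + K) * ((LBINT x. ?I x * (U n x)^2) + (LBINT x. ?I x * (V n x)^2)) + ((LBINT x. U n x ^ 6) + (LBINT x. V n x ^ 6)) / K)"
     using ii by simp
    also have "\<dots> <= Aa * ((1 + K) * (e + e) + (?M + ?M) / K)"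
     using A0 K UV[of n] L6[of n] by (intro mult_left_mono add_mono divide_right_mono) auto
    also have "\<dots> = Aa * (1 + K) * (e + e) + Aa * ((?M + ?M) / K)" by (simp only: distrib_left[of Aa "(1 + K) * (e + e)"] mult.assoc)
    also have "\<dots> <= \<delta>" using e(2) KM by linarith
    finally show "(LBINT x. ?E n x) <= \<delta>" .
    show "0 <= ?E n x" for x using A0 K by (intro mult_nonneg_nonneg add_nonneg_nonneg divide_nonneg_nonneg) auto
    show "AE x in lborel. R <= norm x --> Fq a1 a2 r b (U n x) (V n x) <= ?E n x"
     using Fq_tail_bound[OF co Unn K] by (auto simp: Aa_def)
   qed
  qed
  show "L1 (\<lambda>x. Fq a1 a2 r b (u' x) (v' x))"
   "(\<lambda>n. LBINT x. Fq a1 a2 r b (U n x) (V n x)) ----> (LBINT x. Fq a1 a2 r b (u' x) (v' x))"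
   "!!n. L1 (\<lambda>x. Fq a1 a2 r b (U n x) (V n x))"
   by (rule Fq_conv[where A="?A" and B="?B", OF co G(1) H(1) Unn _ _ _ _ m AE T];
     use mm G(2) H(2) in "simp add: le_max_iff_disj")+
 qed
 have 1: "(\<integral>\<^sup>+x. ennreal (Fq a1 a2 r b (U n x) (V n x)) \<partial>lborel) = ennreal (LBINT x. Fq a1 a2 r b (U n x) (V n x))" for n
  by (rule nn_integral_eq_integral[OF F(3)]) (simp add: Fq_nonneg co Unn)
 have 2: "(\<integral>\<^sup>+x. ennreal (Fq a1 a2 r b (u' x) (v' x)) \<partial>lborel) = ennreal (LBINT x. Fq a1 a2 r b (u' x) (v' x))"
  by (rule nn_integral_eq_integral[OF F(1)]) (simp add: Fq_nonneg co n')
 have "(\<integral>\<^sup>+x. ennreal (Fq a1 a2 r b (u x) (v x)) \<partial>lborel) <= ennreal (LBINT x. Fq a1 a2 r b (U n x) (V n x))" for n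
  using le[of n] unfolding 1[symmetric] .
 then show ?thesis unfolding 2 by (intro LIMSEQ_le_const[OF tendsto_ennrealI[OF F(2)]]) auto
qed

lemma pol_ltwo: assumes n: "norm n = 1" and w: "ltwo w" shows "ltwo (pol n c w)"
proof -
 have m[measurable]: "w \<in> BM" using w by (simp add: ltwo_def)
 show ?thesis
 proof (rule ltwo_bound)
  show "pol n c w \<in> BM" by measurable
  show "L1 (\<lambda>x. (w x)^2 + (w (refl n c x))^2)"
   using ltwo_int_real[OF w] integral_refl(2)[OF n, of "\<lambda>x. (w x)^2" c] by simp
  have "(norm (pol n c w x))^2 <= (w x)^2 + (w (refl n c x))^2" for x by (auto simp: pol_def max_def min_def)
  then show "AE x in lborel. (norm (pol n c w x))^2 <= (w x)^2 + (w (refl n c x))^2" by simp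
 qed
qed

section \<open>Maximizing the Gaussian integral\<close>

text \<open>Folding the integral of \<open>gam\<close> times the change \<open>d\<close> by the
  reflection yields \<open>(gam x - gam (refl n c x)) * d x\<close> on the half-plane, a product of
  nonnegative factors. Off the line the first factor is positive because \<open>c > 0\<close>, so a
  zero integral forces \<open>d = 0\<close>.\<close>

lemma gam_pol:
 assumes n: "norm n = 1" and c: "c > 0" and w: "ltwo w"
 shows "(LBINT x. gam x * w x) <= (LBINT x. gam x * pol n c w x)"
  and "(LBINT x. gam x * pol n c w x) <= (LBINT x. gam x * w x) ==> AE x in lborel. pol n c w x = w x"
proof -
 let ?s = "refl n c"
 note [measurable] = ltwo_borel[OF w]
 define d where "d x = pol n c w x - w x" for x
 have [measurable]: "d \<in> BM" unfolding d_def by measurable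
 have dl: "ltwo d" unfolding d_def using pol_ltwo[OF n w] w by (rule ltwo_minus)
 have i: "L1 (\<lambda>x. gam x * d x)" by (rule ltwo_mult[OF gam_ltwo dl])
 have i2: "L1 (\<lambda>x. gam (?s x) * d (?s x))" using integral_refl(2)[OF n, of "\<lambda>x. gam x * d x" c] i by simp
 define e where "e x = gam x * d x + gam (?s x) * d (?s x)" for x
 have ie: "L1 e" unfolding e_def using i i2 by simp
 have ee: "(LBINT x. e x) = 2 * (LBINT x. gam x * d x)"
  unfolding e_def using i i2 integral_refl(1)[OF n, of "\<lambda>x. gam x * d x" c] by simp
 have de: "(LBINT x. gam x * d x) = (LBINT x. gam x * pol n c w x) - (LBINT x. gam x * w x)"
  unfolding d_def right_diff_distrib using ltwo_mult[OF gam_ltwo pol_ltwo[OF n w]] ltwo_mult[OF gam_ltwo w] by simp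
 have es: "e (?s x) = e x" for x unfolding e_def refl_refl[OF n] by simp
 have half: "e x = (gam x - gam (?s x)) * d x & 0 <= d x & d (?s x) = - d x" if x: "x \<bullet> n <= c" for x
 proof -
  have "d (?s x) = - d x" unfolding d_def pol_half[OF n x] by (auto simp: max_def min_def)
  moreover have "0 <= d x" unfolding d_def pol_half[OF n x] by simp
  ultimately show ?thesis by (simp add: e_def algebra_simps)
 qed
 have gle: "gam (?s x) <= gam x" if "x \<bullet> n <= c" for x
  using norm_refl_ge[OF n less_imp_le[OF c] that] gam_strict[of x "?s x"]
  by (cases "norm x = norm (?s x)") (auto simp: gam_def dot_square_norm)
 have enn: "0 <= e x" for x
 proof (cases "x \<bullet> n <= c")
  case True then show ?thesis using half[OF True] gle[OF True] by simp
 next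
  case False
  note h = refl_half[OF n False]
  have "0 <= e (?s x)" using half[OF h] gle[OF h] by simp
  then show ?thesis unfolding es .
 qed
 have "0 <= (LBINT x. e x)" by (rule integral_nonneg_AE) (simp add: enn)
 then show "(LBINT x. gam x * w x) <= (LBINT x. gam x * pol n c w x)" using ee de by simp
 assume "(LBINT x. gam x * pol n c w x) <= (LBINT x. gam x * w x)"
 then have "(LBINT x. e x) = 0" using ee de \<open>0 <= (LBINT x. e x)\<close> by simp
 then have AE: "AE x in lborel. e x = 0" using integral_nonneg_eq_0_iff_AE[OF ie] enn by simp
 have zero: "d x = 0" if x: "x \<bullet> n <= c" and e0: "e x = 0" for x
 proof (cases "x \<bullet> n = c")
  case True then show ?thesis using refl_fix[OF True] by (simp add: d_def pol_def)
 next
  case False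
  then have "gam (?s x) < gam x" using x by (intro gam_strict norm_refl_gt[OF n c]) auto
  then show ?thesis using half[OF x] e0 by simp
 qed
 show "AE x in lborel. pol n c w x = w x"
  using AE
 proof eventually_elim
  case (elim x)
  have "d x = 0"
  proof (cases "x \<bullet> n <= c")
   case True then show ?thesis using zero elim by simp
  next
   case False
   note h = refl_half[OF n False]
   have "e (?s x) = 0" using elim es by simp
   then have "d (?s x) = 0" by (rule zero[OF h])
   then show ?thesis using half[OF h] by (simp add: refl_refl[OF n])
  qed
  then show ?case by (simp add: d_def)
 qed
qed

text \<open>The positive part is a version of the limit that is nonnegative everywhere, as
  membership in \<open>better\<close> demands.\<close>

lemma AE_nonneg_limit:
 fixes w :: "'a => real"
 assumes "!!n x. W n x >= 0" "AE x in M. (\<lambda>n. W n x) ----> w x"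
 shows "AE x in M. (\<lambda>n. W n x) ----> max 0 (w x)"
 using assms(2)
proof eventually_elim
 case (elim x)
 have "0 <= w x" by (rule LIMSEQ_le_const[OF elim]) (use assms(1) in auto)
 then show ?case using elim by simp
qed

lemma AE_conv_subseq: "AE x in M. (\<lambda>n. W n x) ----> w x ==> strict_mono (r :: nat => nat) ==> AE x in M. (\<lambda>n. W (r n) x) ----> w x"
 by (auto elim!: eventually_mono dest: LIMSEQ_subseq_LIMSEQ simp: o_def)

lemma pair_AE_compact:
 fixes u v :: "nat => real^2 => real"
 assumes s: "!!n. sob (u n) (g n)" "!!n. sob (v n) (h n)"
  and bd: "!!n. msq (u n) <= A" "!!n. msq (v n) <= A" "!!n. msq (g n) <= B" "!!n. msq (h n) <= B"
  and nn: "!!n x. u n x >= 0" "!!n x. v n x >= 0"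
 obtains r u' v' where "strict_mono (r::nat=>nat)" "u' \<in> BM" "v' \<in> BM"
  "!!x. u' x >= 0" "!!x. v' x >= 0"
  "aelim (\<lambda>n. u (r n)) u'" "aelim (\<lambda>n. v (r n)) v'"
proof -
 obtain r1 u1 where 1: "strict_mono (r1::nat=>nat)" "u1 \<in> BM" "aelim (\<lambda>n. u (r1 n)) u1"
  by (rule sob_AE_compact[of u g A B]) (use s bd in auto)
 obtain r2 v1 where 2: "strict_mono (r2::nat=>nat)" "v1 \<in> BM" "aelim (\<lambda>n. v (r1 (r2 n))) v1"
  by (rule sob_AE_compact[of "\<lambda>n. v (r1 n)" "\<lambda>n. h (r1 n)" A B]) (use s bd in auto)
 have [measurable]: "u1 \<in> BM" "v1 \<in> BM" by fact+
 show ?thesis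
 proof (rule that[of "r1 \<circ> r2" "\<lambda>x. max 0 (u1 x)" "\<lambda>x. max 0 (v1 x)"])
  show "AE x in lborel. (\<lambda>n. u ((r1 \<circ> r2) n) x) ----> max 0 (u1 x)"
   unfolding o_def by (rule AE_nonneg_limit[OF nn(1) AE_conv_subseq[OF 1(3) 2(1)]])
  show "AE x in lborel. (\<lambda>n. v ((r1 \<circ> r2) n) x) ----> max 0 (v1 x)"
   unfolding o_def by (rule AE_nonneg_limit[OF nn(2) 2(3)])
 qed (use 1 2 strict_mono_o in auto)
qed

text \<open>The class \<open>D\<close> is closed under the limits provided by
  \<open>pair_AE_compact\<close> and \<Phi> is continuous along them, so \<Phi> has a maximizer in
  \<open>D\<close>. Both components are polarized with the same half-plane; only then does
  \<open>Fq_pol\<close> keep the new pair in \<open>D\<close>.\<close>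

theorem symmetrize:
 fixes u v :: "real^2 => real"
 assumes co: "a1 >= 0" "a2 >= 0" "r >= 0" "b >= 0" and s: "sob u g" "sob v h" and nn: "!!x. u x >= 0" "!!x. v x >= 0"
 obtains u' g' v' h' where "sob u' g'" "sob v' h'" "!!x. u' x >= 0" "!!x. v' x >= 0" "radial_dec u'" "radial_dec v'"
  "msq u' <= msq u" "msq v' <= msq v" "msq g' <= msq g" "msq h' <= msq h"
  "(\<integral>\<^sup>+x. ennreal (Fq a1 a2 r b (u x) (v x)) \<partial>lborel) <= (\<integral>\<^sup>+x. ennreal (Fq a1 a2 r b (u' x) (v' x)) \<partial>lborel)"
proof -
 let ?F = "\<lambda>u v. \<integral>\<^sup>+x. ennreal (Fq a1 a2 r b (u x) (v x)) \<partial>lborel"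
 define D where "D = {(u', v'). better u (msq g) u' & better v (msq h) v' & ?F u v <= ?F u' v'}"
 define \<Phi> where "\<Phi> p = (LBINT x. gam x * fst p x) + (LBINT x. gam x * snd p x)" for p :: "(real^2 => real) \<times> (real^2 => real)"
 have uvD: "(u, v) \<in> D" using s nn by (auto simp: D_def better_def)
 have gb: "(LBINT x. gam x * w x) <= sqrt (msq gam * A)" if "ltwo w" "msq w <= A" for w A
 proof -
  have "(LBINT x. gam x * w x) <= sqrt (msq gam * msq w)" using cauchy_schwarz_abs[OF gam_ltwo that(1)] by simp
  also have "\<dots> <= sqrt (msq gam * A)" using that(2) by (intro real_sqrt_le_mono mult_left_mono) auto
  finally show ?thesis .
 qed
 have bs: "\<exists>g'. sob (fst p) g' & msq g' <= msq g" "\<exists>h'. sob (snd p) h' & msq h' <= msq h" "msq (fst p) <= msq u" "msq (snd p) <= msq v" if "p \<in> D" for p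
 proof -
  have b: "better u (msq g) (fst p)" "better v (msq h) (snd p)" using that by (auto simp: D_def)
  show "\<exists>g'. sob (fst p) g' & msq g' <= msq g" "\<exists>h'. sob (snd p) h' & msq h' <= msq h" using b by (simp_all add: better_def)
  show "msq (fst p) <= msq u" "msq (snd p) <= msq v" using b better_msq sob_ltwo(1)[OF s(1)] sob_ltwo(1)[OF s(2)] by blast+
 qed
 have bdd: "bdd_above (\<Phi> ` D)"
 proof (rule bdd_aboveI2)
  fix p assume p: "p \<in> D"
  have "ltwo (fst p)" "ltwo (snd p)" using bs(1,2)[OF p] sob_ltwo(1) by blast+
  then show "\<Phi> p <= sqrt (msq gam * msq u) + sqrt (msq gam * msq v)"
   unfolding \<Phi>_def using bs(3,4)[OF p] by (intro add_mono gb)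
 qed
 define S where "S = Sup (\<Phi> ` D)"
 have S: "\<Phi> p <= S" if "p \<in> D" for p unfolding S_def using that bdd by (auto intro: cSup_upper)
 have "\<exists>p\<in>D. S - 1 / real (Suc n) < \<Phi> p" for n
 proof -
  have "S - 1 / real (Suc n) < Sup (\<Phi> ` D)" by (simp add: S_def)
  then show ?thesis using uvD bdd by (subst (asm) less_cSup_iff) auto
 qed
 then have "\<forall>n. \<exists>p. p \<in> D & S - 1 / real (Suc n) < \<Phi> p" by blast
 from choice[OF this] obtain p where p: "!!n. p n \<in> D" "!!n. S - 1 / real (Suc n) < \<Phi> (p n)" by blast
 define U V where "U n = fst (p n)" and "V n = snd (p n)" for n
 have UV: "(U n, V n) \<in> D" for n using p(1) by (simp add: U_def V_def)
 have "\<forall>n. \<exists>g'. sob (U n) g' & msq g' <= msq g" "\<forall>n. \<exists>h'. sob (V n) h' & msq h' <= msq h" using bs p(1) by (auto simp: U_def V_def)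
 then obtain G H where G: "!!k. sob (U k) (G k)" "!!k. msq (G k) <= msq g" and H: "!!k. sob (V k) (H k)" "!!k. msq (H k) <= msq h" by metis
 have mUV: "msq (U n) <= msq u" "msq (V n) <= msq v" for n using bs(3,4)[OF p(1)] by (auto simp: U_def V_def)
 have Unn: "U k x >= 0" "V k x >= 0" for k x using UV[of k] by (auto simp: D_def better_def)
 obtain q u' v' where q: "strict_mono (q::nat=>nat)" and m: "u' \<in> BM" "v' \<in> BM"
  and n': "!!x. u' x >= 0" "!!x. v' x >= 0"
  and AE: "aelim (\<lambda>n. U (q n)) u'" "aelim (\<lambda>n. V (q n)) v'"
  by (rule pair_AE_compact[of U G V H "max (msq u) (msq v)" "max (msq g) (msq h)"])
   (use G H mUV Unn in "auto simp: le_max_iff_disj")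
 have D': "(u', v') \<in> D"
 proof -
  have w: "better u (msq g) (U (q n))" "better v (msq h) (V (q n))" and le: "?F u v <= ?F (U (q n)) (V (q n))" for n using UV[of "q n"] by (auto simp: D_def)
  show ?thesis using better_limit[OF s(1) w(1) m(1) n'(1) AE(1)] better_limit[OF s(2) w(2) m(2) n'(2) AE(2)]
   better_Fq_limit[OF co s w le m n' AE] by (simp add: D_def)
 qed
 have lU: "ltwo (U n)" "ltwo (V n)" for n using sob_ltwo(1) G(1) H(1) by auto
 have lim: "(\<lambda>n. \<Phi> (U (q n), V (q n))) ----> \<Phi> (u', v')"
  unfolding \<Phi>_def fst_conv snd_conv
  by (intro tendsto_add ltwo_weak_conv[OF gam_ltwo lU(1) mUV(1) m(1) AE(1)] ltwo_weak_conv[OF gam_ltwo lU(2) mUV(2) m(2) AE(2)])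
 have "(\<lambda>n. S - 1 / real (Suc n)) ----> S - 0" by (intro tendsto_intros inv_Suc_lim)
 moreover have "S - 1 / real (Suc n) <= \<Phi> (U (q n), V (q n))" for n
 proof -
  have "1 / real (Suc (q n)) <= 1 / real (Suc n)" using seq_suble[OF q, of n] by (intro divide_left_mono) auto
  then show ?thesis using p(2)[of "q n"] by (simp add: U_def V_def)
 qed
 ultimately have "S - 0 <= \<Phi> (u', v')" using lim by (intro LIMSEQ_le) auto
 then have max: "\<Phi> p <= \<Phi> (u', v')" if "p \<in> D" for p using S[OF that] by simp
 obtain g' h' where g': "sob u' g'" "msq g' <= msq g" and h': "sob v' h'" "msq h' <= msq h" using bs(1,2)[OF D'] by auto
 have l': "ltwo u'" "ltwo v'" using g' h' sob_ltwo by auto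
 have P: "(AE x in lborel. pol n c u' x = u' x) & (AE x in lborel. pol n c v' x = v' x)" if n: "norm n = 1" and c: "c > 0" for n c
 proof -
  have "\<Phi> (pol n c u', pol n c v') <= \<Phi> (u', v')"
  proof (rule max)
   have w: "better u (msq g) u'" "better v (msq h) v'" and le: "?F u v <= ?F u' v'" using D' by (auto simp: D_def)
   show "(pol n c u', pol n c v') \<in> D"
    using better_pol[OF n less_imp_le[OF c] w(1)] better_pol[OF n less_imp_le[OF c] w(2)] order_trans[OF le Fq_pol[OF n m n' co]] by (simp add: D_def)
  qed
  \<comment> \<open>Neither of the two integrals can decrease and their sum does not increase, so
    each is unchanged and both components are fixed.\<close>
  then show ?thesis using gam_pol[OF n c l'(1)] gam_pol[OF n c l'(2)] unfolding \<Phi>_def fst_conv snd_conv by linarith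
 qed
 have "radial_dec u'" "radial_dec v'" using polarized_radial l' P by blast+
 moreover have "msq u' <= msq u" "msq v' <= msq v" using bs(3,4)[OF D'] by auto
 moreover have "(\<integral>\<^sup>+x. ennreal (Fq a1 a2 r b (u x) (v x)) \<partial>lborel) <= (\<integral>\<^sup>+x. ennreal (Fq a1 a2 r b (u' x) (v' x)) \<partial>lborel)"
  using D' by (simp add: D_def)
 ultimately show ?thesis using that[of u' g' v' h'] g' h' n' by blast
qed

section \<open>Compactness of radially decreasing sequences\<close>

text \<open>On the disc of radius \<open>|y|\<close> the function is at least \<open>w y\<close>, so
  its mass is at least the area of the disc times \<open>(w y)^2\<close>;
  \<open>unit_ball_vol 2\<close> is the area of the unit disc.\<close>

lemma radial_decay:
 assumes w: "ltwo w" and nn: "!!x. w x >= 0" and r: "radial_dec w"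
 shows "AE y in lborel. unit_ball_vol 2 * (norm y)^2 * (w y)^2 <= msq w"
proof -
 obtain N where N: "N \<in> null_sets lborel" "!!x y. x \<notin> N ==> y \<notin> N ==> norm x <= norm y ==> w y <= w x"
  using r by (auto simp: radial_dec_def)
 have "unit_ball_vol 2 * (norm y)^2 * (w y)^2 <= msq w" if y: "y \<notin> N" for y
 proof -
  let ?B = "ball (0::real^2) (norm y)"
  have mB: "measure lborel ?B = unit_ball_vol 2 * (norm y)^2" using content_ball[of "norm y" "0::real^2"] by simp
  have "(LBINT x. (w y)^2 * indicator ?B x) <= (LBINT x. (w x)^2)"
  proof (rule integral_mono_AE)
   show "L1 (\<lambda>x. (w y)^2 * indicator ?B x)"
    using emeasure_lborel_ball_finite[of "0::real^2" "norm y"] by (intro integrable_mult_right integrable_real_indicator) auto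
   show "L1 (\<lambda>x. (w x)^2)" by (rule ltwo_int_real[OF w])
   have "AE x in lborel. x \<notin> N" using N(1) by (rule AE_not_in)
   then show "AE x in lborel. (w y)^2 * indicator ?B x <= (w x)^2"
   proof eventually_elim
    case (elim x)
    then show ?case using N(2)[OF elim y] nn[of y] by (cases "x \<in> ?B") (auto intro: power_mono)
   qed
  qed
  then show ?thesis using mB emeasure_lborel_ball_finite[of "0::real^2" "norm y"] by (simp add: msq_real mult.commute)
 qed
 then show ?thesis using N(1) by (auto intro: AE_I'[of N])
qed

lemma radial_dec_limit:
 assumes r: "!!n. radial_dec (u n)" and AE: "aelim u v"
 shows "radial_dec v"
proof -
 have "\<forall>n. \<exists>N\<in>null_sets lborel. \<forall>x y. x \<notin> N --> y \<notin> N --> norm x <= norm y --> u n y <= u n x" using r by (simp add: radial_dec_def)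
 then obtain N where N: "!!n. N n \<in> null_sets lborel" "!!n x y. x \<notin> N n ==> y \<notin> N n ==> norm x <= norm y ==> u n y <= u n x" by metis
 obtain N0 where N0: "{x. \<not> (\<lambda>n. u n x) ----> v x} \<subseteq> N0" "N0 \<in> null_sets lborel"
  using AE by (auto elim!: AE_E simp: null_sets_def)
 show ?thesis unfolding radial_dec_def
 proof (rule bexI[of _ "N0 \<union> (\<Union>n. N n)"], intro allI impI)
  fix x y assume *: "x \<notin> N0 \<union> (\<Union>n. N n)" "y \<notin> N0 \<union> (\<Union>n. N n)" "norm x <= norm y"
  then have "(\<lambda>n. u n y) ----> v y" "(\<lambda>n. u n x) ----> v x" using N0 by auto
  then show "v y <= v x" by (rule LIMSEQ_le) (use N(2) * in auto)
 qed (use N(1) N0(2) in "auto intro!: null_sets_UN")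
qed

text \<open>By \<open>radial_decay\<close> the functions are below \<eta> outside a common ball,
  where the potential is at most a multiple of \<open>\<eta> * (u^2 + v^2)\<close>; this is the tail
  control for \<open>Fq_conv\<close>. The norms satisfy only inequalities in the limit, hence the
  separate limits \<open>m1\<close>, \<open>m2\<close>, \<open>l1\<close>,
  \<open>l2\<close>.\<close>

theorem radial_compact:
 fixes u v :: "nat => real^2 => real"
 assumes co: "a1 >= 0" "a2 >= 0" "r >= 0" "b >= 0"
  and s: "!!n. sob (u n) (g n)" "!!n. sob (v n) (h n)"
  and bd: "!!n. msq (u n) <= A" "!!n. msq (v n) <= A" "!!n. msq (g n) <= B" "!!n. msq (h n) <= B"
  and nn: "!!n x. u n x >= 0" "!!n x. v n x >= 0" and rad: "!!n. radial_dec (u n)" "!!n. radial_dec (v n)"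
 obtains q u' v' g' h' m1 m2 l1 l2 where "strict_mono (q::nat=>nat)" "sob u' g'" "sob v' h'" "!!x. u' x >= 0" "!!x. v' x >= 0"
  "radial_dec u'" "radial_dec v'" "(\<lambda>n. msq (u (q n))) ----> m1" "(\<lambda>n. msq (v (q n))) ----> m2"
  "(\<lambda>n. msq (g (q n))) ----> l1" "(\<lambda>n. msq (h (q n))) ----> l2"
  "msq u' <= m1" "msq v' <= m2" "msq g' <= l1" "msq h' <= l2"
  "(\<lambda>n. LBINT x. Fq a1 a2 r b (u (q n) x) (v (q n) x)) ----> (LBINT x. Fq a1 a2 r b (u' x) (v' x))"
proof -
 have "bounded ({0..A} \<times> {0..A} \<times> {0..B} \<times> {0..B})" by (intro bounded_Times compact_imp_bounded compact_Icc)
 then have "bounded (range (\<lambda>n. (msq (u n), msq (v n), msq (g n), msq (h n))))" by (rule bounded_subset) (use bd in auto)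
 from bounded_imp_convergent_subsequence[OF this] obtain L p
  where p: "strict_mono (p::nat=>nat)" "(\<lambda>n. (msq (u (p n)), msq (v (p n)), msq (g (p n)), msq (h (p n)))) ----> L" unfolding o_def by blast
 obtain m1 m2 l1 l2 where L: "L = (m1, m2, l1, l2)" by (cases L)
 have l0: "(\<lambda>n. msq (u (p n))) ----> m1" "(\<lambda>n. msq (v (p n))) ----> m2" "(\<lambda>n. msq (g (p n))) ----> l1" "(\<lambda>n. msq (h (p n))) ----> l2"
  using tendsto_fst[OF p(2)] tendsto_fst[OF tendsto_snd[OF p(2)]] tendsto_fst[OF tendsto_snd[OF tendsto_snd[OF p(2)]]]
   tendsto_snd[OF tendsto_snd[OF tendsto_snd[OF p(2)]]] by (simp_all add: L)
 obtain q5 u' v' where q5: "strict_mono (q5::nat=>nat)" and m: "u' \<in> BM" "v' \<in> BM"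
  and n': "!!x. u' x >= 0" "!!x. v' x >= 0"
  and AE: "aelim (\<lambda>n. u (p (q5 n))) u'" "aelim (\<lambda>n. v (p (q5 n))) v'"
  by (rule pair_AE_compact[of "\<lambda>n. u (p n)" "\<lambda>n. g (p n)" "\<lambda>n. v (p n)" "\<lambda>n. h (p n)" A B])
   (use s bd nn in auto)
 define q where "q n = p (q5 n)" for n
 have qm: "strict_mono q" unfolding q_def using p(1) q5 by (simp add: strict_mono_def)
 have l: "(\<lambda>n. msq (u (q n))) ----> m1" "(\<lambda>n. msq (v (q n))) ----> m2" "(\<lambda>n. msq (g (q n))) ----> l1" "(\<lambda>n. msq (h (q n))) ----> l2"
  using l0[THEN LIMSEQ_subseq_LIMSEQ, OF q5] by (simp_all add: o_def q_def)
 note AE = AE[folded q_def]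
 obtain g' where g': "sob u' g'" "msq g' <= l1"
  by (rule sob_AE_limit[of "\<lambda>n. u (q n)" "\<lambda>n. g (q n)" A "\<lambda>n. msq (g (q n))" l1 u', OF s(1) bd(1) order_refl l(3) m(1) AE(1)]) blast
 obtain h' where h': "sob v' h'" "msq h' <= l2"
  by (rule sob_AE_limit[of "\<lambda>n. v (q n)" "\<lambda>n. h (q n)" A "\<lambda>n. msq (h (q n))" l2 v', OF s(2) bd(2) order_refl l(4) m(2) AE(2)]) blast
 have mu: "msq u' <= m1" by (rule AE_limit_ltwo(2)[OF sob_ltwo(1)[OF s(1)] order_refl l(1) m(1) AE(1)])
 have mv: "msq v' <= m2" by (rule AE_limit_ltwo(2)[OF sob_ltwo(1)[OF s(2)] order_refl l(2) m(2) AE(2)])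
 have r': "radial_dec u'" "radial_dec v'" using radial_dec_limit[OF rad(1) AE(1)] radial_dec_limit[OF rad(2) AE(2)] by auto
 have A0: "A >= 0" using bd(1)[of 0] msq_nonneg[of "u 0"] by linarith
 have F: "(\<lambda>n. LBINT x. Fq a1 a2 r b (u (q n) x) (v (q n) x)) ----> (LBINT x. Fq a1 a2 r b (u' x) (v' x))"
 proof (rule Fq_conv(2)[where A=A and B=B, OF co s(1) s(2) nn bd m AE])
  fix \<delta> :: real assume d: "\<delta> > 0"
  define Aa where "Aa = a1 + a2 + r + b"
  have Aa: "Aa >= 0" using co by (simp add: Aa_def)
  \<comment> \<open>Chosen so that the tail integral is at most
    \<open>\<eta> * (4 * (Aa * A)) \<le> \<delta>\<close>; the bound by one gives
    \<open>\<eta>^2 \<le> \<eta>\<close>.\<close>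
  define \<eta> where "\<eta> = min 1 (\<delta> / (4 * (Aa * A) + 1))"
  have den: "4 * (Aa * A) + 1 > 0" using Aa A0 by (simp add: add_nonneg_pos)
  have e: "\<eta> > 0" "\<eta> <= 1" using d den by (auto simp: \<eta>_def)
  have e3: "\<eta> * (4 * (Aa * A)) <= \<delta>"
  proof -
   have "\<eta> * (4 * (Aa * A) + 1) <= \<delta> / (4 * (Aa * A) + 1) * (4 * (Aa * A) + 1)"
    using den by (intro mult_right_mono) (auto simp: \<eta>_def)
   also have "\<dots> = \<delta>" using den by simp
   finally show ?thesis using e by (simp add: distrib_left)
  qed
  have vol: "unit_ball_vol 2 > (0::real)" by simp
  obtain R where R: "R >= 1" "A <= unit_ball_vol 2 * \<eta>^2 * R"
  proof
   show "max 1 (A / (unit_ball_vol 2 * \<eta>^2)) >= 1" by simp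
   have "unit_ball_vol 2 * \<eta>^2 > 0" using vol e by simp
   then show "A <= unit_ball_vol 2 * \<eta>^2 * max 1 (A / (unit_ball_vol 2 * \<eta>^2))"
    by (metis max.cobounded2 mult.commute pos_divide_le_eq)
  qed
  let ?E = "\<lambda>n x. Aa * (2 * \<eta>) * ((u (q n) x)^2 + (v (q n) x)^2)"
  have small: "AE x in lborel. R <= norm x --> w x <= \<eta>" if l: "ltwo w" and nw: "!!x. w x >= 0" and rw: "radial_dec w" and mw: "msq w <= A" for w
   using radial_decay[OF l nw rw]
  proof eventually_elim
   case (elim x)
   show ?case
   proof
    assume Rx: "R <= norm x"
    have "R * 1 <= norm x * norm x" using Rx R(1) by (intro mult_mono) auto
    then have "unit_ball_vol 2 * R * (w x)^2 <= unit_ball_vol 2 * (norm x)^2 * (w x)^2"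
     using vol by (intro mult_right_mono mult_left_mono) (auto simp: power2_eq_square)
    also have "\<dots> <= unit_ball_vol 2 * \<eta>^2 * R" using elim mw R(2) by linarith
    finally have "(unit_ball_vol 2 * R) * (w x)^2 <= (unit_ball_vol 2 * R) * \<eta>^2" by (simp add: mult_ac)
    moreover have "unit_ball_vol 2 * R > 0" using vol R(1) by simp
    ultimately have "(w x)^2 <= \<eta>^2" by (simp only: mult_le_cancel_left_pos)
    then show "w x <= \<eta>" by (rule power2_le_imp_le) (use e in simp)
   qed
  qed
  show "\<exists>R E. \<forall>n. L1 (E n) & (LBINT x. E n x) <= \<delta> & (\<forall>x. 0 <= E n x) &
    (AE x in lborel. R <= norm x --> Fq a1 a2 r b (u (q n) x) (v (q n) x) <= E n x)"
  proof (intro exI[of _ R] exI[of _ ?E] allI conjI)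
   fix n
   have i: "L1 (\<lambda>x. (u (q n) x)^2)" "L1 (\<lambda>x. (v (q n) x)^2)"
    using ltwo_int_real[OF sob_ltwo(1)[OF s(1)]] ltwo_int_real[OF sob_ltwo(1)[OF s(2)]] by auto
   show "L1 (?E n)" using i by simp
   have "(LBINT x. ?E n x) = Aa * (2 * \<eta>) * (msq (u (q n)) + msq (v (q n)))" using i by (simp add: msq_real)
   also have "\<dots> <= Aa * (2 * \<eta>) * (A + A)" using Aa e bd by (intro mult_left_mono add_mono) auto
   also have "\<dots> <= \<delta>" using e3 by (simp add: mult_ac)
   finally show "(LBINT x. ?E n x) <= \<delta>" .
   show "0 <= ?E n x" for x using Aa e by simp
   show "AE x in lborel. R <= norm x --> Fq a1 a2 r b (u (q n) x) (v (q n) x) <= ?E n x"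
    using small[OF sob_ltwo(1)[OF s(1)] nn(1) rad(1) bd(1), of "q n"] small[OF sob_ltwo(1)[OF s(2)] nn(2) rad(2) bd(2), of "q n"]
   proof eventually_elim
    case (elim x)
    show ?case
    proof
     assume "R <= norm x"
     with elim have le: "u (q n) x <= \<eta>" "v (q n) x <= \<eta>" by auto
     define mm where "mm = max (u (q n) x) (v (q n) x)"
     have mm: "u (q n) x <= mm" "v (q n) x <= mm" "0 <= mm" "mm <= \<eta>" using le nn(1)[of "q n" x] by (auto simp: mm_def)
     have "mm^4 + mm^3 = mm^2 * (mm * mm + mm)" by (simp add: power2_eq_square power3_eq_cube power4_eq_xxxx algebra_simps)
     also have "\<dots> <= mm^2 * (2 * \<eta>)"
     proof (rule mult_left_mono)
      have "mm * mm <= \<eta> * 1" using mm e by (intro mult_mono) auto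
      then show "mm * mm + mm <= 2 * \<eta>" using mm by simp
     qed simp
     also have "mm^2 * (2 * \<eta>) <= ((u (q n) x)^2 + (v (q n) x)^2) * (2 * \<eta>)"
      using e by (intro mult_right_mono) (auto simp: mm_def max_def)
     finally have "Aa * (mm^4 + mm^3) <= Aa * (((u (q n) x)^2 + (v (q n) x)^2) * (2 * \<eta>))" using Aa by (rule mult_left_mono)
     then show "Fq a1 a2 r b (u (q n) x) (v (q n) x) <= ?E n x"
      using Fq_le[OF co nn(1) nn(2) mm(1,2)] unfolding Aa_def[symmetric] by (simp add: mult_ac)
    qed
   qed
  qed
 qed
 show ?thesis by (rule that[OF qm g'(1) h'(1) n' r' l mu mv g'(2) h'(2) F])
qed

section \<open>Strict positivity\<close>

definition lap :: "(real^2 => real) => real^2 => real" where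
 "lap \<phi> x = pd ex (pd ex \<phi>) x + pd ey (pd ey \<phi>) x"

lemma lap_test: "test_function \<phi> ==> test_function (lap \<phi>)"
 unfolding lap_def[abs_def] by (intro test_add test_pd) auto

lemma sob_lap:
 assumes s: "sob u g" and t: "test_function \<phi>"
 shows "(LBINT x. g x \<bullet> grad \<phi> x) = - (LBINT x. u x * lap \<phi> x)"
proof -
 note p = test_pd[OF t ex_ey_Basis(1)] test_pd[OF t ex_ey_Basis(2)]
 note q = test_pd[OF p(1) ex_ey_Basis(1)] test_pd[OF p(2) ex_ey_Basis(2)]
 have "g x \<bullet> grad \<phi> x = pd ex \<phi> x * (g x \<bullet> ex) + pd ey \<phi> x * (g x \<bullet> ey)" for x
  by (simp add: grad_pd Basis_R2 inner_add_right)
 then show ?thesis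
  using sob_weak[OF s p(1) ex_ey_Basis(1)] sob_weak[OF s p(2) ex_ey_Basis(2)]
   ltwo_mult[OF test_ltwo[OF p(1)] ltwo_component[OF sob_ltwo(2)[OF s]]] ltwo_mult[OF test_ltwo[OF p(2)] ltwo_component[OF sob_ltwo(2)[OF s]]]
   test_integrable_mult[OF sob_ltwo(1)[OF s] q(1)] test_integrable_mult[OF sob_ltwo(1)[OF s] q(2)]
  by (simp add: lap_def distrib_left)
qed

lemma cut_pd:
 fixes x :: "real^2" shows "pd e (cut n) x = (1 / real (Suc n)) * pd e (cut 0) ((1 / real (Suc n)) *\<^sub>R x)"
proof -
 have "cut n = (\<lambda>x::real^2. cut 0 (0 + (1 / real (Suc n)) *\<^sub>R x))" by (auto simp: cut_def)
 then show ?thesis using pd_affine[OF test_differentiable[OF cut_test[of 0]], of e 0 "1 / real (Suc n)" x] by simp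
qed

lemma cut_lap: "lap (cut n) x = (1 / real (Suc n))^2 * lap (cut 0) ((1 / real (Suc n)) *\<^sub>R x)"
proof -
 let ?c = "1 / real (Suc n)"
 have "pd e (pd e (cut n)) x = ?c^2 * pd e (pd e (cut 0)) (?c *\<^sub>R x)" if e: "e \<in> Basis" for e :: "real^2"
 proof -
  have d: "pd e (cut 0) differentiable at (0 + ?c *\<^sub>R x)" by (rule test_differentiable[OF test_pd[OF cut_test e]])
  have d': "(\<lambda>x. pd e (cut 0) (0 + ?c *\<^sub>R x)) differentiable at x"
   using test_differentiable[OF test_affine[OF test_pd[OF cut_test[of 0] e], of ?c 0]] by simp
  have "pd e (cut n) = (\<lambda>x. ?c * pd e (cut 0) (0 + ?c *\<^sub>R x))" using cut_pd[of e n] by auto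
  then show ?thesis using pd_cmul[OF d', of e ?c] pd_affine[OF d, of e] by (simp add: power2_eq_square)
 qed
 then show ?thesis by (simp add: lap_def distrib_left)
qed

lemma cut_pd_lim:
 fixes x :: "real^2" assumes e: "e \<in> Basis" shows "(\<lambda>n. pd e (cut n) x) ----> 0"
proof -
 obtain B where B: "!!x. \<bar>pd e (cut 0) x\<bar> <= B" using test_bounded[OF test_pd[OF cut_test e]] by metis
 have l: "(\<lambda>n. (1 / real (Suc n)) * B) ----> 0 * B" by (intro tendsto_intros inv_Suc_lim)
 have b: "norm (pd e (cut n) x) <= (1 / real (Suc n)) * B" for n
  unfolding cut_pd[of e n] real_norm_def abs_mult by (intro mult_mono B) auto
 show ?thesis by (rule Lim_null_comparison[OF always_eventually[OF allI[OF b]]]) (use l in simp)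
qed

lemma cut_lap_lim: "(\<lambda>n. lap (cut n) x) ----> 0"
proof -
 obtain B where B: "!!x. \<bar>lap (cut 0) x\<bar> <= B" using test_bounded[OF lap_test[OF cut_test]] by metis
 have l: "(\<lambda>n. (1 / real (Suc n))^2 * B) ----> 0^2 * B" by (intro tendsto_intros inv_Suc_lim)
 have b: "norm (lap (cut n) x) <= (1 / real (Suc n))^2 * B" for n
  unfolding cut_lap[of n] real_norm_def abs_mult by (intro mult_mono B) auto
 show ?thesis by (rule Lim_null_comparison[OF always_eventually[OF allI[OF b]]]) (use l in simp)
qed

text \<open>Otherwise \<open>u\<close> has compact support; testing with \<open>exp (K * (x \<bullet> ex))\<close>, \<open>K\<close> large, makes
 the left side negative.\<close>

lemma radial_dec_positive:
 assumes s: "sob u g" and nn: "!!x. u x >= 0" and rad: "radial_dec u" and nz: "msq u > 0" and f: "!!x. f x >= 0"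
  and eq: "!!\<phi>. test_function \<phi> ==> (LBINT x. g x \<bullet> grad \<phi> x) + lam * (LBINT x. u x * \<phi> x) = (LBINT x. f x * \<phi> x)"
 shows "AE x in lborel. u x > 0"
proof (rule ccontr)
 assume nAE: "\<not> ?thesis"
 obtain N where N: "N \<in> null_sets lborel" "!!x y. x \<notin> N ==> y \<notin> N ==> norm x <= norm y ==> u y <= u x"
  using rad by (auto simp: radial_dec_def)
 have "\<exists>z. z \<notin> N & u z = 0"
 proof (rule ccontr)
  assume "\<not> (\<exists>z. z \<notin> N & u z = 0)"
  then have "u z > 0" if "z \<notin> N" for z using nn[of z] that by (simp add: order_less_le) metis
  with AE_not_in[OF N(1)] have "AE x in lborel. u x > 0" by (auto elim: eventually_mono)
  with nAE show False by simp
 qed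
 \<comment> \<open>Failure of positivity provides a zero outside the exceptional set; by
   monotonicity \<open>u\<close> vanishes almost everywhere beyond its radius.\<close>
 then obtain z where z: "z \<notin> N" "u z = 0" by blast
 have out: "AE x in lborel. norm z <= norm x --> u x = 0"
  using AE_not_in[OF N(1)] by (rule eventually_mono) (use N(2)[OF z(1)] z(2) nn in "auto intro: antisym")
 \<comment> \<open>Large enough for \<open>K^2 > lam\<close>, which makes
   \<open>- \<Delta> E + lam * E = (lam - K^2) * E\<close> negative for the exponential
   \<open>E\<close> below.\<close>
 define K where "K = 1 + \<bar>lam\<bar>"
 have K: "lam - K^2 < 0"
 proof -
  have "K * 1 <= K * K" unfolding K_def by (intro mult_left_mono) auto
  then show ?thesis by (simp add: K_def power2_eq_square)
 qed
 define E where "E x = exp (K * (x \<bullet> ex))" for x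
 have EC: "Ck k E" for k unfolding E_def[abs_def] by (intro Ck_exp Ck_mult Ck_const Ck_inner)
 have Ed: "E differentiable at x" for x using EC[of 1] by (simp add: Ck_Suc_iff)
 have dE: "pd e E x = K * (e \<bullet> ex) * E x" for e x
  unfolding E_def[abs_def] by (rule pd_eq) (auto intro!: derivative_eq_intros)
 have Em[measurable]: "E \<in> BM" unfolding E_def[abs_def] by measurable
 have T: "test_function (\<lambda>x. E x * cut n x)" for n by (intro test_smooth_mult EC cut_test)
 \<comment> \<open>Applying \<open>- \<Delta> + lam\<close> to \<open>E * cut n\<close> gives
   \<open>E * Y n\<close>; only the first term of \<open>Y n\<close> survives as the cut-off tends
   to one.\<close>
 define Y where "Y n x = (lam - K^2) * cut n x - 2 * K * pd ex (cut n) x - lap (cut n) x" for n x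
 have lapE: "lap (\<lambda>x. E x * cut n x) x = E x * (lam * cut n x - Y n x)" for n x
 proof -
  note c = test_differentiable[OF cut_test]
  have 2: "pd e (pd e (\<lambda>x. E x * cut n x)) x = E x * (pd e (pd e (cut n)) x + 2 * (K * (e \<bullet> ex)) * pd e (cut n) x + (K * (e \<bullet> ex))^2 * cut n x)"
   if e: "e \<in> Basis" for e
  proof -
   note p = test_differentiable[OF test_pd[OF cut_test e]]
   have "pd e (\<lambda>x. E x * cut n x) = (\<lambda>x. E x * (pd e (cut n) x + K * (e \<bullet> ex) * cut n x))"
    by (auto simp: pd_mult[OF Ed c] dE algebra_simps)
   moreover have d: "(\<lambda>x. (K * (e \<bullet> ex)) * cut n x) differentiable at x" "(\<lambda>x. pd e (cut n) x + (K * (e \<bullet> ex)) * cut n x) differentiable at x"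
    using c p by (auto intro!: differentiable_add differentiable_mult)
   ultimately show ?thesis
    by (simp add: pd_mult[OF Ed d(2)] pd_add[OF p d(1)] pd_cmul[OF c] dE power2_eq_square) (simp add: algebra_simps)
  qed
  show ?thesis unfolding lap_def Y_def using 2[of ex] 2[of ey] by (simp add: algebra_simps lap_def)
 qed
 have ge: "0 <= (LBINT x. u x * (E x * Y n x))" for n
 proof -
  have "(LBINT x. u x * (E x * Y n x)) = (LBINT x. lam * (u x * (E x * cut n x)) - u x * lap (\<lambda>x. E x * cut n x) x)"
   unfolding lapE by (rule bochner_cong) (auto simp: algebra_simps)
  also have "\<dots> = (LBINT x. f x * (E x * cut n x))"
   using eq[OF T] sob_lap[OF s T] test_integrable_mult[OF sob_ltwo(1)[OF s] T] test_integrable_mult[OF sob_ltwo(1)[OF s] lap_test[OF T]] by simp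
  also have "\<dots> >= 0" using f cut_nonneg by (intro integral_nonneg_AE AE_I2 mult_nonneg_nonneg) (auto simp: E_def)
  finally show ?thesis .
 qed
 obtain B1 where B1: "!!x. \<bar>pd ex (cut 0) x\<bar> <= B1" using test_bounded[OF test_pd[OF cut_test ex_ey_Basis(1)]] by metis
 obtain B2 where B2: "!!x. \<bar>lap (cut 0) x\<bar> <= B2" using test_bounded[OF lap_test[OF cut_test]] by metis
 define D where "D = \<bar>lam - K^2\<bar> + 2 * \<bar>K\<bar> * B1 + B2"
 have YD: "\<bar>Y n x\<bar> <= D" for n x
 proof -
  let ?c = "1 / real (Suc n)"
  have c: "0 <= ?c" "?c <= 1" by auto
  have "\<bar>pd ex (cut n) x\<bar> <= 1 * B1" unfolding cut_pd[of ex n] abs_mult by (intro mult_mono B1) (use c in auto)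
  moreover have "\<bar>lap (cut n) x\<bar> <= 1 * B2" unfolding cut_lap[of n] abs_mult by (intro mult_mono B2) (use c in "auto intro!: power_le_one simp: power_abs")
  moreover have "\<bar>cut n x\<bar> <= 1" using cut_nonneg[of n x] cut_le1[of n x] by simp
  ultimately have "\<bar>(lam - K^2) * cut n x\<bar> <= \<bar>lam - K^2\<bar> * 1" "\<bar>2 * K * pd ex (cut n) x\<bar> <= 2 * \<bar>K\<bar> * B1" "\<bar>lap (cut n) x\<bar> <= B2"
   unfolding abs_mult using mult_left_mono[of "\<bar>cut n x\<bar>" 1 "\<bar>lam - K^2\<bar>"] by (auto intro!: mult_left_mono)
  then show ?thesis unfolding Y_def D_def
   by (intro order_trans[OF abs_triangle_ineq4] add_mono) simp_all
 qed
 let ?I = "indicator (cball 0 (norm z)) :: real^2 => real"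
 let ?M = "exp (K * norm z) * D"
 have D0: "0 <= D" using YD[of 0 0] by linarith
 have Ei: "E x <= exp (K * norm z)" if "norm x <= norm z" for x
  using that norm_cauchy_schwarz[of x ex] by (auto simp: E_def K_def norm_axis_1 intro!: mult_left_mono)
 have dom: "AE x in lborel. norm (u x * (E x * Y n x)) <= ?M * (?I x *\<^sub>R u x)" for n
  using out
 proof (rule eventually_mono)
  fix x assume o: "norm z <= norm x --> u x = 0"
  show "norm (u x * (E x * Y n x)) <= ?M * (?I x *\<^sub>R u x)"
  proof (cases "u x = 0")
   case False
   then have i: "norm x <= norm z" using o by force
   have "E x * \<bar>Y n x\<bar> <= exp (K * norm z) * D" by (intro mult_mono Ei[OF i] YD) (auto simp: E_def)
   then have "u x * (E x * \<bar>Y n x\<bar>) <= u x * ?M" by (rule mult_left_mono) (rule nn)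
   then show ?thesis using i nn[of x] by (simp add: abs_mult E_def mult.commute)
  qed simp
 qed
 have lim: "(\<lambda>n. LBINT x. u x * (E x * Y n x)) ----> (LBINT x. u x * (E x * (lam - K^2)))"
 proof (rule integral_dominated_convergence[where w="\<lambda>x. ?M * (?I x *\<^sub>R u x)"])
  note [measurable] = sob_borel[OF s]
  note [measurable] = test_borel[OF test_pd[OF cut_test ex_ey_Basis(1)]] test_borel[OF lap_test[OF cut_test]]
  show "(\<lambda>x. u x * (E x * (lam - K^2))) \<in> borel_measurable lborel" by measurable
  show "(\<lambda>x. u x * (E x * Y n x)) \<in> borel_measurable lborel" for n unfolding Y_def by measurable
  show "L1 (\<lambda>x. ?M * (?I x *\<^sub>R u x))" using ltwo_locally_integrable[OF sob_ltwo(1)[OF s]] by (rule integrable_mult_right)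
  have "(\<lambda>n. Y n x) ----> (lam - K^2) * 1 - 2 * K * 0 - 0" for x unfolding Y_def by (intro tendsto_intros cut_lim cut_pd_lim cut_lap_lim) auto
  then show "AE x in lborel. (\<lambda>n. u x * (E x * Y n x)) ----> u x * (E x * (lam - K^2))" by (intro AE_I2 tendsto_intros) simp
 qed (rule dom)
 have "0 <= (LBINT x. u x * (E x * (lam - K^2)))" by (rule LIMSEQ_le_const[OF lim]) (use ge in auto)
 also have "(LBINT x. u x * (E x * (lam - K^2))) = (lam - K^2) * (LBINT x. u x * E x)"
  by (simp add: mult_ac flip: Bochner_Integration.integral_mult_right_zero)
 finally have "(LBINT x. u x * E x) <= 0" using K by (simp add: zero_le_mult_iff)
 moreover have uE: "0 <= u x * E x" for x using nn by (simp add: E_def)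
 ultimately have z0: "(LBINT x. u x * E x) = 0" using Bochner_Integration.integral_nonneg[of lborel "\<lambda>x. u x * E x"] by (intro antisym) auto
 have int: "L1 (\<lambda>x. u x * E x)"
 proof (rule integrable_dom[OF integrable_mult_right[OF ltwo_locally_integrable[OF sob_ltwo(1)[OF s], of "norm z"], of "exp (K * norm z)"]])
  note [measurable] = sob_borel[OF s]
  show "(\<lambda>x. u x * E x) \<in> borel_measurable lborel" by measurable
  show "AE x in lborel. norm (u x * E x) <= norm (exp (K * norm z) * (?I x *\<^sub>R u x))"
   using out
  proof (rule eventually_mono)
   fix x assume o: "norm z <= norm x --> u x = 0"
   show "norm (u x * E x) <= norm (exp (K * norm z) * (?I x *\<^sub>R u x))"
    using o Ei[of x] nn[of x] by (cases "norm x <= norm z") (auto simp: abs_mult E_def mult.commute intro!: mult_left_mono)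
  qed
 qed
 have "AE x in lborel. u x * E x = 0" using integral_nonneg_eq_0_iff_AE[OF int] uE z0 by simp
 then have "AE x in lborel. (u x)^2 = 0" by (auto simp: E_def elim!: eventually_mono)
 then have "(LBINT x. (u x)^2) = 0" by (rule integral_eq_zero_AE)
 then show False using nz by (simp add: msq_real)
qed

section \<open>First variations\<close>

text \<open>First-order condition for variations that are admissible for \<open>t > 0\<close> only:
  divide by \<open>t\<close> and let it tend to zero. The right side has the shape of the remainder
  in \<open>Fq_expand\<close>.\<close>

lemma one_sided:
 assumes "!!t. 0 < t ==> t <= 1 ==> t * L <= t^2 * (c2 + t * c3 + t^2 * c4)" shows "L <= (0::real)"
proof -
 have "L <= t * (c2 + t * c3 + t^2 * c4)" if "0 < t" "t <= 1" for t
  using assms[OF that] that by (simp add: power2_eq_square mult.assoc)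
 then have "\<forall>\<^sub>F t in at_right 0. L <= t * (c2 + t * c3 + t^2 * c4)" by (intro eventually_at_rightI[of 0 1]) auto
 moreover have "((\<lambda>t. t * (c2 + t * c3 + t^2 * c4)) \<longlongrightarrow> 0 * (c2 + 0 * c3 + 0^2 * c4)) (at_right 0)" by (intro tendsto_intros)
 ultimately show ?thesis using tendsto_lowerbound[of _ _ "at_right (0::real)" L] by simp
qed

lemma sob_int2: fixes a b :: "real^2 => real" assumes "sob a a'" "sob b b'" shows "L1 (\<lambda>x. a x * b x)"
 using ltwo_mult[OF sob_ltwo(1) sob_ltwo(1)] assms by blast

lemma sob_int34:
 fixes a b c d :: "real^2 => real"
 assumes s: "sob a a'" "sob b b'" "sob c c'" "sob d d'"
 shows "L1 (\<lambda>x. a x * b x * c x)" "L1 (\<lambda>x. a x * b x * c x * d x)"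
  "ltwo (\<lambda>x. a x * b x)" "ltwo (\<lambda>x. a x * b x * c x)"
proof -
 note w = s[THEN sob_wt] note [measurable] = s[THEN sob_borel]
 have i2: "L1 (\<lambda>x. wt (a x) + wt (b x))" and i3: "L1 (\<lambda>x. wt (a x) + wt (b x) + wt (c x))"
  and i4: "L1 (\<lambda>x. wt (a x) + wt (b x) + wt (c x) + wt (d x))" using w by simp_all
 show "L1 (\<lambda>x. a x * b x * c x)"
  by (rule integrable_dom[OF i3]) (auto intro: order_trans[OF wt_bound3])
 show "L1 (\<lambda>x. a x * b x * c x * d x)"
  by (rule integrable_dom[OF i4]) (auto intro: order_trans[OF wt_bound4])
 show "ltwo (\<lambda>x. a x * b x)" by (rule ltwo_bound[OF _ i2]) (auto simp: wt_bound44)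
 show "ltwo (\<lambda>x. a x * b x * c x)" by (rule ltwo_bound[OF _ i3]) (auto simp: wt_bound6)
qed

text \<open>The derivative of \<open>Fq\<close> at \<open>(s, v)\<close> in direction
  \<open>(p, q)\<close>, with powers written as products to match \<open>sob_int34\<close>.\<close>

definition dFq :: "real => real => real => real => real => real => real => real => real" where
 "dFq a1 a2 r b s v p q = 4 * a1 * (s * s * s * p) + 4 * a2 * (v * v * v * q)
   + 2 * r * (s * v * v * p + s * s * v * q) + b * (2 * (s * v * p) + s * s * q)"

lemma Fq_int: fixes u v :: "real^2 => real" assumes "sob u g" "sob v h" shows "L1 (\<lambda>x. Fq a1 a2 r b (u x) (v x))"
proof -
 note i4 = sob_int34(2) and i3 = sob_int34(1)
 have "L1 (\<lambda>x. a1 * (u x * u x * u x * u x) + a2 * (v x * v x * v x * v x) + r * (u x * u x * v x * v x) + b * (u x * u x * v x))"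
  by (intro Bochner_Integration.integrable_add integrable_mult_right i4[OF assms(1,1,1,1)] i4[OF assms(2,2,2,2)] i4[OF assms(1,1,2,2)] i3[OF assms(1,1,2,2)])
 then show ?thesis by (simp add: Fq_def power4_eq_xxxx power2_eq_square mult_ac)
qed

text \<open>\<open>Fq\<close> is a polynomial, so the expansion in \<open>t\<close> is exact and
  integration is done coefficient by coefficient; \<open>c2\<close>, \<open>c3\<close>,
  \<open>c4\<close> are the integrals of the higher coefficients.\<close>

lemma Fq_expand:
 fixes u v p q :: "real^2 => real"
 assumes s: "sob u g" "sob v h" "sob p p'" "sob q q'"
 obtains c2 c3 c4 where "L1 (\<lambda>x. dFq a1 a2 r b (u x) (v x) (p x) (q x))"
  "!!t. (LBINT x. Fq a1 a2 r b (u x + t * p x) (v x + t * q x)) =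
   (LBINT x. Fq a1 a2 r b (u x) (v x)) + t * (LBINT x. dFq a1 a2 r b (u x) (v x) (p x) (q x)) + t^2 * (c2 + t * c3 + t^2 * c4)"
proof -
 note u = s(1) and v = s(2) and p = s(3) and q = s(4)
 note i4 = sob_int34(2) and i3 = sob_int34(1)
 let ?F = "\<lambda>x. Fq a1 a2 r b (u x) (v x)" and ?D = "\<lambda>x. dFq a1 a2 r b (u x) (v x) (p x) (q x)"
 let ?c = "\<lambda>x. 6 * a1 * (u x * u x * p x * p x) + 6 * a2 * (v x * v x * q x * q x)
  + r * (p x * p x * v x * v x + 4 * (u x * p x * v x * q x) + u x * u x * q x * q x) + b * (p x * p x * v x + 2 * (u x * p x * q x))"
 let ?d = "\<lambda>x. 4 * a1 * (u x * p x * p x * p x) + 4 * a2 * (v x * q x * q x * q x)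
  + 2 * r * (p x * p x * v x * q x + u x * p x * q x * q x) + b * (p x * p x * q x)"
 have i: "L1 ?F" "L1 ?D" "L1 ?c" "L1 ?d" "L1 (\<lambda>x. Fq a1 a2 r 0 (p x) (q x))"
  subgoal by (rule Fq_int[OF u v])
  subgoal unfolding dFq_def by (intro Bochner_Integration.integrable_add integrable_mult_right i4[OF u u u p] i4[OF v v v q] i4[OF u v v p] i4[OF u u v q] i3[OF u v p p] i3[OF u u q q])
  subgoal by (intro Bochner_Integration.integrable_add integrable_mult_right i4[OF u u p p] i4[OF v v q q] i4[OF p p v v] i4[OF u p v q] i4[OF u u q q] i3[OF p p v v] i3[OF u p q q])
  subgoal by (intro Bochner_Integration.integrable_add integrable_mult_right i4[OF u p p p] i4[OF v q q q] i4[OF p p v q] i4[OF u p q q] i3[OF p p q q])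
  subgoal by (rule Fq_int[OF p q])
  done
 show ?thesis
 proof (rule that[OF i(2)])
  fix t
  have e: "Fq a1 a2 r b (u x + t * p x) (v x + t * q x) = ?F x + t * ?D x + t^2 * (?c x + t * ?d x + t^2 * Fq a1 a2 r 0 (p x) (q x))" for x
   unfolding Fq_def dFq_def power4_eq_xxxx power2_eq_square by algebra
  show "(LBINT x. Fq a1 a2 r b (u x + t * p x) (v x + t * q x)) = (LBINT x. ?F x) + t * (LBINT x. ?D x)
    + t^2 * ((LBINT x. ?c x) + t * (LBINT x. ?d x) + t^2 * (LBINT x. Fq a1 a2 r 0 (p x) (q x)))"
   unfolding e using i by (simp only: Bochner_Integration.integral_add Bochner_Integration.integrable_add integrable_mult_right integral_mult_right_zero)
 qed
qed

section \<open>The sharp inequality and the ground state\<close>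

text \<open>Modulus, symmetrization and radial compactness in one statement. Approximation up to
  \<open>e\<close> at arbitrarily large \<open>n\<close> hides the subsequence and is all that an
  extremal sequence requires.\<close>

theorem compact_limit:
 fixes u v :: "nat => real^2 => real"
 assumes co: "a1 >= 0" "a2 >= 0" "r >= 0" "b >= 0" and s: "!!n. sob (u n) (g n)" "!!n. sob (v n) (h n)"
  and bd: "!!n. msq (u n) <= A" "!!n. msq (v n) <= A" "!!n. msq (g n) <= B" "!!n. msq (h n) <= B"
 obtains u' g' v' h' where "sob u' g'" "sob v' h'" "!!x. u' x >= 0" "!!x. v' x >= 0" "radial_dec u'" "radial_dec v'"
  "!!e N. e > 0 ==> \<exists>n\<ge>N. msq u' <= msq (u n) + e & msq v' <= msq (v n) + e & msq g' <= msq (g n) + e & msq h' <= msq (h n) + e &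
    (LBINT x. Fq a1 a2 r b (u n x) (v n x)) <= (LBINT x. Fq a1 a2 r b (u' x) (v' x)) + e"
proof -
 define P where "P n u' g' v' h' \<longleftrightarrow> sob u' g' & sob v' h' & (\<forall>x. u' x >= 0 & v' x >= 0) & radial_dec u' & radial_dec v' &
  msq u' <= msq (u n) & msq v' <= msq (v n) & msq g' <= msq (g n) & msq h' <= msq (h n) &
    (LBINT x. Fq a1 a2 r b (u n x) (v n x)) <= (LBINT x. Fq a1 a2 r b (u' x) (v' x))" for n u' g' v' h'
 have "\<exists>u' g' v' h'. P n u' g' v' h'" for n
 proof -
  obtain k where k: "sob (\<lambda>x. \<bar>u n x\<bar>) k" "msq k <= msq (g n)" using sob_abs[OF s(1)] by blast
  obtain l where l: "sob (\<lambda>x. \<bar>v n x\<bar>) l" "msq l <= msq (h n)" using sob_abs[OF s(2)] by blast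
  obtain u' g' v' h' where *: "sob u' g'" "sob v' h'" "!!x. u' x >= 0" "!!x. v' x >= 0" "radial_dec u'" "radial_dec v'"
   "msq u' <= msq (\<lambda>x. \<bar>u n x\<bar>)" "msq v' <= msq (\<lambda>x. \<bar>v n x\<bar>)" "msq g' <= msq k" "msq h' <= msq l"
   "(\<integral>\<^sup>+x. ennreal (Fq a1 a2 r b \<bar>u n x\<bar> \<bar>v n x\<bar>) \<partial>lborel) <= (\<integral>\<^sup>+x. ennreal (Fq a1 a2 r b (u' x) (v' x)) \<partial>lborel)"
   by (rule symmetrize[OF co k(1) l(1)]) auto
  have "(LBINT x. Fq a1 a2 r b (u n x) (v n x)) <= (LBINT x. Fq a1 a2 r b \<bar>u n x\<bar> \<bar>v n x\<bar>)"
  proof (rule integral_mono[OF Fq_int[OF s] Fq_int[OF k(1) l(1)]])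
   show "Fq a1 a2 r b (u n x) (v n x) <= Fq a1 a2 r b \<bar>u n x\<bar> \<bar>v n x\<bar>" for x
    using co by (simp add: Fq_def power_even_abs mult_left_mono)
  qed
  also have "\<dots> <= (LBINT x. Fq a1 a2 r b (u' x) (v' x))"
  proof -
   have nn: "AE x in lborel. 0 <= Fq a1 a2 r b \<bar>u n x\<bar> \<bar>v n x\<bar>" "AE x in lborel. 0 <= Fq a1 a2 r b (u' x) (v' x)"
    using Fq_nonneg[OF co] *(4) by auto
   show ?thesis
    using *(11) unfolding nn_integral_eq_integral[OF Fq_int[OF k(1) l(1)] nn(1)] nn_integral_eq_integral[OF Fq_int[OF *(1,2)] nn(2)]
    using integral_nonneg_AE[OF nn(2)] by (simp add: ennreal_le_iff)
  qed
  finally have F: "(LBINT x. Fq a1 a2 r b (u n x) (v n x)) <= (LBINT x. Fq a1 a2 r b (u' x) (v' x))" .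
  have "msq u' <= msq (u n)" "msq v' <= msq (v n)" using *(7,8) by (simp_all add: msq_real)
  then show ?thesis using *(1-6) order_trans[OF *(9) k(2)] order_trans[OF *(10) l(2)] F unfolding P_def by blast
 qed
 then obtain U G V H where "!!n. P n (U n) (G n) (V n) (H n)" by metis
 then have 1: "!!n. sob (U n) (G n)" "!!n. sob (V n) (H n)" "!!n x. U n x >= 0" "!!n x. V n x >= 0"
  "!!n. radial_dec (U n)" "!!n. radial_dec (V n)"
  and 2: "!!n. msq (U n) <= msq (u n)" "!!n. msq (V n) <= msq (v n)" "!!n. msq (G n) <= msq (g n)" "!!n. msq (H n) <= msq (h n)"
  "!!n. (LBINT x. Fq a1 a2 r b (u n x) (v n x)) <= (LBINT x. Fq a1 a2 r b (U n x) (V n x))" unfolding P_def by blast+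
 note bd' = order_trans[OF 2(1) bd(1)] order_trans[OF 2(2) bd(2)] order_trans[OF 2(3) bd(3)] order_trans[OF 2(4) bd(4)]
 obtain q u' v' g' h' m1 m2 l1 l2 where q: "strict_mono (q::nat=>nat)" and p: "sob u' g'" "sob v' h'" "!!x. u' x >= 0" "!!x. v' x >= 0"
  "radial_dec u'" "radial_dec v'" and L: "(\<lambda>n. msq (U (q n))) ----> m1" "(\<lambda>n. msq (V (q n))) ----> m2"
  "(\<lambda>n. msq (G (q n))) ----> l1" "(\<lambda>n. msq (H (q n))) ----> l2"
  and le: "msq u' <= m1" "msq v' <= m2" "msq g' <= l1" "msq h' <= l2"
  and F: "(\<lambda>n. LBINT x. Fq a1 a2 r b (U (q n) x) (V (q n) x)) ----> (LBINT x. Fq a1 a2 r b (u' x) (v' x))"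
  by (rule radial_compact[where u=U and g=G and v=V and h=H, OF co 1(1,2) bd' 1(3-6)]) blast
 show ?thesis
 proof (rule that[OF p])
  fix e :: real and N :: nat assume e: "e > 0"
  have "\<forall>\<^sub>F n in sequentially. m1 - e < msq (U (q n)) & m2 - e < msq (V (q n)) & l1 - e < msq (G (q n)) & l2 - e < msq (H (q n)) &
   (LBINT x. Fq a1 a2 r b (U (q n) x) (V (q n) x)) < (LBINT x. Fq a1 a2 r b (u' x) (v' x)) + e & N <= n"
   using e by (intro eventually_conj order_tendstoD(1)[OF L(1)] order_tendstoD(1)[OF L(2)] order_tendstoD(1)[OF L(3)] order_tendstoD(1)[OF L(4)] order_tendstoD(2)[OF F] eventually_ge_at_top) auto
  then obtain n where n: "m1 - e < msq (U (q n))" "m2 - e < msq (V (q n))" "l1 - e < msq (G (q n))" "l2 - e < msq (H (q n))"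
   "(LBINT x. Fq a1 a2 r b (U (q n) x) (V (q n) x)) < (LBINT x. Fq a1 a2 r b (u' x) (v' x)) + e" "N <= n"
   using eventually_happens'[OF sequentially_bot] by blast
  have "N <= q n" using seq_suble[OF q, of n] n(6) by linarith
  then show "\<exists>n\<ge>N. msq u' <= msq (u n) + e & msq v' <= msq (v n) + e & msq g' <= msq (g n) + e & msq h' <= msq (h n) + e &
    (LBINT x. Fq a1 a2 r b (u n x) (v n x)) <= (LBINT x. Fq a1 a2 r b (u' x) (v' x)) + e"
   using n(1-5) le 2(1-5)[of "q n"] by (intro exI[of _ "q n"] conjI) linarith+
 qed
qed

text \<open>In dimension two a dilation divides the mass by \<open>c^2\<close> and leaves the
  Dirichlet integral unchanged; this freedom separates the two quantities in the inequalities
  below.\<close>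

lemma dilate_facts:
 fixes u :: "real^2 => real"
 assumes s: "sob u g" and c: "c > 0"
 shows "sob (\<lambda>x. u (c *\<^sub>R x)) (\<lambda>x. c *\<^sub>R g (c *\<^sub>R x))" "msq (\<lambda>x. u (c *\<^sub>R x)) = msq u / c^2" "msq (\<lambda>x. c *\<^sub>R g (c *\<^sub>R x)) = msq g"
  and "f \<in> BM ==> (LBINT x. f (c *\<^sub>R x)) = (\<integral>x. (f x :: real) \<partial>(lborel :: (real^2) measure)) / c^2"
proof -
 show "sob (\<lambda>x. u (c *\<^sub>R x)) (\<lambda>x. c *\<^sub>R g (c *\<^sub>R x))" using sob_dilate[OF s] c by simp
 show "msq (\<lambda>x. u (c *\<^sub>R x)) = msq u / c^2" using ltwo_dilate(2)[OF sob_ltwo(1)[OF s], of c] c by simp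
 show "msq (\<lambda>x. c *\<^sub>R g (c *\<^sub>R x)) = msq g" using ltwo_dilate(2)[OF sob_ltwo(2)[OF s], of c] c by (simp add: msq_scale)
 assume "f \<in> BM"
 from has_bochner_integral_affine(2)[OF this, of c 0] c
 show "(LBINT x. f (c *\<^sub>R x)) = (LBINT x. f x) / c^2" by simp
qed

text \<open>The quartic integral is maximized under \<open>msq u + msq g \<le> 1\<close>, and
  homogeneity of degree four extends the bound to all functions. A maximizer saturates the
  constraint by this same bound, and comparison with its dilation forces the equal split.\<close>

theorem gn_maximizer:
 obtains w h C where "sob w h" "!!x. w x >= 0" "radial_dec w" "C > 0" "msq w = 1/2" "msq h = 1/2" "(LBINT x. w x ^ 4) = C"
  "!!u g. sob (u :: real^2 => real) g ==> (LBINT x. u x ^ 4) <= C * (msq u + msq g)^2"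
proof -
 let ?q = "\<lambda>u :: real^2 => real. LBINT x. u x ^ 4"
 define S where "S = {?q u | u g. sob u g & msq u + msq g <= 1}"
 have bdd: "bdd_above S"
 proof (rule bdd_aboveI[of _ 4])
  fix y assume "y \<in> S"
  then obtain u g where *: "sob u g" "msq u + msq g <= 1" "y = ?q u" by (auto simp: S_def)
  have "msq u * msq g <= 1 * 1" using *(2) msq_nonneg[of u] msq_nonneg[of g] by (intro mult_mono) linarith+
  then show "y <= 4" using sob_Lp(2)[OF *(1)] *(3) by simp
 qed
 define C where "C = Sup S"
 have up: "?q u <= C" if "sob u g" "msq u + msq g <= 1" for u g
  unfolding C_def using that bdd by (intro cSup_upper) (auto simp: S_def)
 have GN: "?q u <= C * (msq u + msq g)^2" if s: "sob u g" for u g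
 proof (cases "msq u + msq g = 0")
  case True
  then have "msq u = 0" using msq_nonneg[of u] msq_nonneg[of g] by linarith
  then show ?thesis using sob_Lp(2)[OF s] True by simp
 next
  case False
  define N where "N = msq u + msq g"
  have N: "N > 0" using False msq_nonneg[of u] msq_nonneg[of g] unfolding N_def by linarith
  define c where "c = 1 / sqrt N"
  have c: "c^2 = 1 / N" "c ^ 4 = 1 / N^2" using N power_mult[of c 2 2] by (simp_all add: c_def power_divide)
  have "msq (\<lambda>x. c * u x) + msq (\<lambda>x. c *\<^sub>R g x) = c^2 * N" by (simp add: msq_cmult msq_scale N_def distrib_left)
  then have "?q (\<lambda>x. c * u x) <= C" using N c by (intro up[OF sob_cmult[OF s]]) simp
  moreover have "?q (\<lambda>x. c * u x) = ?q u / N^2" by (simp add: power_mult_distrib c)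
  ultimately have "?q u / N^2 <= C" by simp
  then show ?thesis using N unfolding N_def[symmetric] by (simp add: pos_divide_le_eq)
 qed
 have C: "C > 0"
 proof (rule ccontr)
  let ?k = "kern 1 :: real^2 => real"
  have s: "sob ?k (grad ?k)" by (intro sob_test kern_test) simp
  assume "\<not> 0 < C"
  then have "?q ?k <= 0" using GN[OF s] mult_nonpos_nonneg[of C "(msq ?k + msq (grad ?k))^2"] by simp
  moreover have "?q ?k >= 0" by (intro Bochner_Integration.integral_nonneg) simp
  ultimately have "AE x in lborel. ?k x ^ 4 = 0" using integral_nonneg_eq_0_iff_AE[OF sob_Lp(1)[OF s]] by simp
  then have "(LBINT x. ?k x) = 0" by (intro integral_eq_zero_AE) simp
  then show False using kern_integral[of 1, where 'a="real^2"] by simp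
 qed
 have ex: "\<exists>u g. sob u g & msq u + msq g <= 1 & C - 1 / real (Suc n) < ?q u" for n
 proof -
  have "(0::real) \<in> S" unfolding S_def using sob_cmult[OF sob_test[OF kern_test[of 1]], of 0, where 'a="real^2"]
   by (intro CollectI exI[of _ "\<lambda>x. 0"]) (auto simp: msq_def)
  then have "\<exists>y\<in>S. C - 1 / real (Suc n) < y" using less_cSup_iff[OF _ bdd, of "C - 1 / real (Suc n)"] by (auto simp: C_def)
  then show ?thesis by (auto simp: S_def)
 qed
 then obtain u g where u: "!!n. sob (u n) (g n)" "!!n. msq (u n) + msq (g n) <= 1" "!!n. C - 1 / real (Suc n) < ?q (u n)" by metis
 have b: "msq (u n) <= 1" "msq (g n) <= 1" for n using u(2)[of n] msq_nonneg[of "u n"] msq_nonneg[of "g n"] by linarith+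
 obtain w h where w: "sob w h" "!!x. w x >= 0" "radial_dec w"
  and ap: "!!e N. e > 0 ==> \<exists>n\<ge>N. msq w <= msq (u n) + e & msq h <= msq (g n) + e & ?q (u n) <= ?q w + e"
 proof (rule compact_limit[of 1 0 0 0 u g u g 1 1, OF _ _ _ _ u(1) u(1) b(1) b(1) b(2) b(2)])
  fix w h v' h' assume *: "sob w h" "!!x. w x >= (0::real)" "radial_dec w"
   and a: "!!e N. e > 0 ==> \<exists>n\<ge>N. msq w <= msq (u n) + e & msq v' <= msq (u n) + e & msq h <= msq (g n) + e & msq h' <= msq (g n) + e &
    (LBINT x. Fq 1 0 0 0 (u n x) (u n x)) <= (LBINT x. Fq 1 0 0 0 (w x) (v' x)) + e"
  show thesis by (rule that[OF *]) (use a in "fastforce simp: Fq_def")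
 qed auto
 have N1: "msq w + msq h <= 1"
 proof (rule field_le_epsilon)
  fix e :: real assume "e > 0"
  then obtain n where "msq w <= msq (u n) + e / 2" "msq h <= msq (g n) + e / 2" using ap[of "e / 2" 0] by auto
  then show "msq w + msq h <= 1 + e" using u(2)[of n] by linarith
 qed
 have qC: "?q w = C"
 proof (rule antisym[OF up[OF w(1) N1]], rule field_le_epsilon)
  fix e :: real assume e: "e > 0"
  obtain N where N: "1 / real (Suc N) < e / 2" using e nat_approx_posE[of "e / 2"] by auto
  obtain n where n: "n >= N" "?q (u n) <= ?q w + e / 2" using ap[of "e / 2" N] e by auto
  have "1 / real (Suc n) <= 1 / real (Suc N)" using n(1) by (intro divide_left_mono) auto
  then show "C <= ?q w + e" using u(3)[of n] n(2) N by linarith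
 qed
 have m0: "msq w > 0" "msq h > 0" using sob_Lp(2)[OF w(1)] qC C msq_nonneg[of w] msq_nonneg[of h] by (auto simp: order_less_le)
 let ?m = "msq w" and ?d = "msq h"
 have sum1: "?m + ?d = 1"
 proof (rule antisym[OF N1])
  have "C * 1 <= C * (?m + ?d)^2" using GN[OF w(1)] qC by simp
  then have "1^2 <= (?m + ?d)^2" using C by simp
  then show "1 <= ?m + ?d" by (rule power2_le_imp_le) simp
 qed
 have half: "?m = 1/2"
 proof -
  \<comment> \<open>This dilation makes mass and Dirichlet integral equal; comparison gives
    \<open>1 \<le> 4 * ?d * ?m\<close>, which together with \<open>?m + ?d = 1\<close> leaves only
    one half.\<close>
  define c where "c = sqrt (?m / ?d)"
  have c: "c > 0" "c^2 = ?m / ?d" using m0 by (auto simp: c_def)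
  have [measurable]: "w \<in> BM" using w(1) by (rule sob_borel)
  have "?q (\<lambda>x. w (c *\<^sub>R x)) = C / c^2" using dilate_facts(4)[OF w(1) c(1), of "\<lambda>x. w x ^ 4"] qC by simp
  then have "C / c^2 <= C * (?m / c^2 + ?d)^2" using GN[OF dilate_facts(1)[OF w(1) c(1)]] by (simp add: dilate_facts[OF w(1) c(1)])
  then have "C * (?d / ?m) <= C * (?d + ?d)^2" unfolding c(2) using m0 by simp
  then have "?d / ?m <= (?d + ?d)^2" using C by (simp only: mult_le_cancel_left_pos)
  then have "?d * 1 <= ?d * (4 * ?d * ?m)" using m0 by (simp add: pos_divide_le_eq power2_eq_square algebra_simps)
  then have "1 <= 4 * ?d * ?m" using m0 by simp
  moreover have "?d = 1 - ?m" using sum1 by simp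
  ultimately have "(2 * ?m - 1)^2 <= 0" by (simp add: power2_eq_square algebra_simps)
  then show ?thesis by simp
 qed
 show ?thesis by (rule that[OF w C half _ qC GN]) (use sum1 half in simp)
qed

section \<open>Transfer between the given notions and Borel representatives\<close>

text \<open>Completeness of the measure makes any function that agrees almost everywhere with a
  Borel function measurable; every passage between the two levels rests on this.\<close>

lemma leb_eq:
 fixes f f' :: "'a::euclidean_space => 'b::euclidean_space"
 assumes m: "f' \<in> BM" and AE: "AE x in lborel. f x = f' x"
 shows "f \<in> borel_measurable lebesgue" "(\<integral>x. f x \<partial>lebesgue) = (LBINT x. f' x)" "integrable lebesgue f \<longleftrightarrow> L1 f'"
proof -
 have m': "f' \<in> borel_measurable lebesgue" using m by (simp add: measurable_completion)
 obtain N where N: "{x. f x \<noteq> f' x} \<subseteq> N" "N \<in> null_sets lborel" using AE by (auto elim!: AE_E simp: null_sets_def)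
 have Nl: "N \<in> null_sets lebesgue" using N(2) by (rule null_sets_completionI)
 show fm: "f \<in> borel_measurable lebesgue"
 proof (rule measurableI)
  fix A :: "'b set" assume A: "A \<in> sets borel"
  have "f -` A \<inter> space lebesgue = (f' -` A \<inter> space lebesgue - N) \<union> (f -` A \<inter> N)" using N(1) by auto
  moreover have "f -` A \<inter> N \<in> sets lebesgue" by (rule completion.complete[OF _ Nl]) auto
  ultimately show "f -` A \<inter> space lebesgue \<in> sets lebesgue" using measurable_sets[OF m' A] null_setsD2[OF Nl] by (metis sets.Diff sets.Un)
 qed simp
 have AE': "AE x in lebesgue. f x = f' x" using AE by (rule AE_completion)
 show "(\<integral>x. f x \<partial>lebesgue) = (LBINT x. f' x)" using integral_cong_AE[OF fm m' AE'] m by (simp add: integral_completion)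
 show "integrable lebesgue f \<longleftrightarrow> L1 f'" using integrable_cong_AE[OF fm m' AE'] m by (simp add: integrable_completion)
qed

lemma borel_version:
 fixes f :: "'a::euclidean_space => 'b::euclidean_space"
 assumes "f \<in> borel_measurable lebesgue"
 obtains f' where "f' \<in> BM" "AE x in lborel. f x = f' x"
proof -
 have "\<exists>k\<in>borel_measurable lborel. AE x in lborel. f x \<bullet> e = k x" for e
  by (rule completion_ex_borel_measurable_real) (use assms in measurable)
 then obtain k where k: "!!e. k e \<in> borel_measurable lborel" "!!e. AE x in lborel. f x \<bullet> e = k e x" by metis
 show ?thesis
 proof (rule that[of "\<lambda>x. \<Sum>e\<in>Basis. k e x *\<^sub>R e"])
  show "(\<lambda>x. \<Sum>e\<in>Basis. k e x *\<^sub>R e) \<in> BM" using k(1) by simp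
  have "AE x in lborel. \<forall>e\<in>Basis. f x \<bullet> e = k e x" using k(2) by (intro AE_finite_allI) auto
  then show "AE x in lborel. f x = (\<Sum>e\<in>Basis. k e x *\<^sub>R e)"
  proof eventually_elim
   case (elim x) then show ?case using euclidean_representation[of "f x"] by simp
  qed
 qed
qed

lemma locally_integrable_iff:
 fixes f f' :: "'a::euclidean_space => 'b::euclidean_space"
 assumes m[measurable]: "f' \<in> BM" and AE: "AE x in lborel. f x = f' x"
 shows "locally_integrable f \<longleftrightarrow> (\<forall>R. L1 (\<lambda>x. indicator (cball 0 R) x *\<^sub>R f' x))"
proof -
 have eq: "set_integrable lebesgue (cball 0 R) f \<longleftrightarrow> L1 (\<lambda>x. indicator (cball 0 R) x *\<^sub>R f' x)" for R
  unfolding set_integrable_def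
 proof (rule leb_eq(3))
  have [measurable]: "cball (0::'a) R \<in> sets borel" by simp
  show "(\<lambda>x. indicator (cball 0 R) x *\<^sub>R f' x) \<in> BM" by measurable
  show "AE x in lborel. indicator (cball 0 R) x *\<^sub>R f x = indicator (cball 0 R) x *\<^sub>R f' x" using AE by eventually_elim simp
 qed
 have "f absolutely_integrable_on K" if c: "compact K" and h: "\<forall>R. set_integrable lebesgue (cball 0 R) f" for K
 proof -
  obtain R where "\<forall>x\<in>K. norm x <= R" using compact_imp_bounded[OF c] by (auto simp: bounded_iff)
  then have K: "K \<subseteq> cball 0 R" by auto
  have "K \<in> sets lebesgue" using borel_compact[OF c] by simp
  then show ?thesis by (rule set_integrable_subset[OF spec[OF h]]) (rule K)
 qed
 then show ?thesis unfolding locally_integrable_def eq[symmetric] using compact_cball by blast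
qed

lemma locally_integrable_version:
 fixes f :: "'a::euclidean_space => 'b::euclidean_space"
 assumes "locally_integrable f"
 obtains f' where "f' \<in> BM" "AE x in lborel. f x = f' x" "!!R. L1 (\<lambda>x. indicator (cball 0 R) x *\<^sub>R f' x)"
proof -
 have m: "(\<lambda>x. indicator (cball 0 (real n)) x *\<^sub>R f x) \<in> borel_measurable lebesgue" for n
  using assms by (auto simp: locally_integrable_def set_integrable_def dest!: spec[of _ "cball 0 (real n)"])
 have "f \<in> borel_measurable lebesgue"
 proof (rule borel_measurable_LIMSEQ_metric[OF m])
  fix x :: 'a
  obtain N where "norm x <= real N" using real_arch_simple by blast
  then have "\<forall>\<^sub>F n in sequentially. indicator (cball 0 (real n)) x *\<^sub>R f x = f x"
   by (intro eventually_sequentiallyI[of N]) auto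
  then show "(\<lambda>n. indicator (cball 0 (real n)) x *\<^sub>R f x) ----> f x" by (rule tendsto_eventually)
 qed
 then obtain f' where f': "f' \<in> BM" "AE x in lborel. f x = f' x" by (rule borel_version)
 then show ?thesis using that[OF f'] assms locally_integrable_iff[OF f'] by blast
qed

lemma test_loc_integrable:
 fixes w :: "'a::euclidean_space => 'b::euclidean_space"
 assumes t: "test_function \<phi>" and [measurable]: "w \<in> BM" and i: "!!R. L1 (\<lambda>x. indicator (cball 0 R) x *\<^sub>R w x)"
 shows "L1 (\<lambda>x. \<phi> x *\<^sub>R w x)"
proof -
 note [measurable] = test_borel[OF t]
 obtain R where R: "R > 0" "!!x. norm x >= R ==> \<phi> x = 0" using test_support[OF t] by blast
 obtain B where B: "B > 0" "!!x. \<bar>\<phi> x\<bar> <= B" using test_bounded[OF t] by blast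
 show ?thesis
 proof (rule integrable_dom[OF integrable_mult_right[OF integrable_norm[OF i[of R]], of B]])
  have "norm (\<phi> x *\<^sub>R w x) <= norm (B * norm (indicator (cball 0 R) x *\<^sub>R w x))" for x
   using B(1) mult_right_mono[OF B(2)[of x] norm_ge_zero[of "w x"]] R(2)[of x] by (cases "norm x <= R") (auto simp: abs_mult)
  then show "AE x in lborel. norm (\<phi> x *\<^sub>R w x) <= norm (B * norm (indicator (cball 0 R) x *\<^sub>R w x))" by simp
 qed measurable
qed

lemma weak_pairing:
 fixes u u' :: "'a::euclidean_space => real" and g g' :: "'a => 'a"
 assumes u: "u' \<in> BM" "AE x in lborel. u x = u' x" "!!R. L1 (\<lambda>x. indicator (cball 0 R) x *\<^sub>R u' x)"
  and g: "g' \<in> BM" "AE x in lborel. g x = g' x" "!!R. L1 (\<lambda>x. indicator (cball 0 R) x *\<^sub>R g' x)"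
  and t: "test_function \<phi>"
 shows "(\<integral>x. u x *\<^sub>R grad \<phi> x \<partial>lebesgue) \<bullet> e = (LBINT x. u' x * (grad \<phi> x \<bullet> e))"
  "(\<integral>x. \<phi> x *\<^sub>R g x \<partial>lebesgue) \<bullet> e = (LBINT x. \<phi> x * (g' x \<bullet> e))"
  "L1 (\<lambda>x. \<phi> x * (g' x \<bullet> e))"
proof -
 note [measurable] = u(1) g(1) test_borel[OF t] test_grad_borel[OF t]
 have "L1 (\<lambda>x. \<Sum>e\<in>Basis. (pd e \<phi> x *\<^sub>R u' x) *\<^sub>R e)"
  by (intro Bochner_Integration.integrable_sum integrable_scaleR_left test_loc_integrable[OF test_pd[OF t]] u)
 then have i1: "L1 (\<lambda>x. u' x *\<^sub>R grad \<phi> x)" by (simp add: grad_pd scaleR_sum_right mult.commute)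
 have i2: "L1 (\<lambda>x. \<phi> x *\<^sub>R g' x)" by (rule test_loc_integrable[OF t g(1,3)])
 have "(\<integral>x. u x *\<^sub>R grad \<phi> x \<partial>lebesgue) = (LBINT x. u' x *\<^sub>R grad \<phi> x)"
  by (rule leb_eq(2)) (measurable, rule eventually_mono[OF u(2)], simp)
 then show "(\<integral>x. u x *\<^sub>R grad \<phi> x \<partial>lebesgue) \<bullet> e = (LBINT x. u' x * (grad \<phi> x \<bullet> e))" using integral_inner_left[OF i1, of e] by simp
 have "(\<integral>x. \<phi> x *\<^sub>R g x \<partial>lebesgue) = (LBINT x. \<phi> x *\<^sub>R g' x)"
  by (rule leb_eq(2)) (measurable, rule eventually_mono[OF g(2)], simp)
 then show "(\<integral>x. \<phi> x *\<^sub>R g x \<partial>lebesgue) \<bullet> e = (LBINT x. \<phi> x * (g' x \<bullet> e))" using integral_inner_left[OF i2, of e] by simp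
 show "L1 (\<lambda>x. \<phi> x * (g' x \<bullet> e))" using integrable_inner_left[OF i2, of e] by simp
qed

text \<open>\<open>weak_grad\<close> picks some locally integrable weak gradient, not necessarily
  the square-integrable one from \<open>H1\<close>. The fundamental lemma for locally integrable
  functions identifies the two.\<close>

lemma weak_gradient_unique:
 fixes u :: "'a::euclidean_space => real"
 assumes "has_weak_gradient u g" "has_weak_gradient u h"
 shows "AE x in lborel. g x = h x"
proof -
 have l: "locally_integrable u" "locally_integrable g" "locally_integrable h" using assms by (auto simp: has_weak_gradient_def)
 obtain u' where u': "u' \<in> BM" "AE x in lborel. u x = u' x" "!!R. L1 (\<lambda>x. indicator (cball 0 R) x *\<^sub>R u' x)"
  using locally_integrable_version[OF l(1)] by blast
 obtain g' where g': "g' \<in> BM" "AE x in lborel. g x = g' x" "!!R. L1 (\<lambda>x. indicator (cball 0 R) x *\<^sub>R g' x)"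
  using locally_integrable_version[OF l(2)] by blast
 obtain h' where h': "h' \<in> BM" "AE x in lborel. h x = h' x" "!!R. L1 (\<lambda>x. indicator (cball 0 R) x *\<^sub>R h' x)"
  using locally_integrable_version[OF l(3)] by blast
 have "AE x in lborel. (g' x - h' x) \<bullet> e = 0" for e
 proof (rule fundamental_lemma)
  note [measurable] = g'(1) h'(1)
  show "(\<lambda>x. (g' x - h' x) \<bullet> e) \<in> BM" by measurable
  show "L1 (\<lambda>x. indicator (cball 0 R) x * ((g' x - h' x) \<bullet> e))" for R
   using integrable_inner_left[OF g'(3)[of R], of e] integrable_inner_left[OF h'(3)[of R], of e] by (simp add: inner_diff_left right_diff_distrib)
  fix \<phi> :: "'a => real" assume t: "test_function \<phi>"
  have "(\<integral>x. \<phi> x *\<^sub>R g x \<partial>lebesgue) = (\<integral>x. \<phi> x *\<^sub>R h x \<partial>lebesgue)" using assms t by (simp add: has_weak_gradient_def)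
  then show "(LBINT x. \<phi> x * ((g' x - h' x) \<bullet> e)) = 0"
   using weak_pairing(2,3)[OF u' g' t, of e] weak_pairing(2,3)[OF u' h' t, of e] by (simp add: inner_diff_left right_diff_distrib)
 qed
 then have "AE x in lborel. \<forall>e\<in>Basis. (g' x - h' x) \<bullet> e = 0" by (intro AE_finite_allI) auto
 with g'(2) h'(2) show ?thesis
 proof eventually_elim
  case (elim x) then show ?case using euclidean_all_zero_iff[of "g' x - h' x"] by simp
 qed
qed

lemma sob_weak_gradient:
 fixes u :: "'a::euclidean_space => real"
 assumes m: "u' \<in> BM" "AE x in lborel. u x = u' x" "ltwo u'" "g' \<in> BM" "AE x in lborel. g x = g' x" "ltwo g'"
 shows "has_weak_gradient u g \<longleftrightarrow> sob u' g'"
proof -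
 note iu = ltwo_locally_integrable[OF m(3)] and ig = ltwo_locally_integrable[OF m(6)]
 have "((\<integral>x. u x *\<^sub>R grad \<phi> x \<partial>lebesgue) = - (\<integral>x. \<phi> x *\<^sub>R g x \<partial>lebesgue)) \<longleftrightarrow>
  (\<forall>e\<in>Basis. (LBINT x. u' x * pd e \<phi> x) = - (LBINT x. \<phi> x * (g' x \<bullet> e)))" if t: "test_function \<phi>" for \<phi>
 proof -
  note w = weak_pairing(1,2)[OF m(1,2) iu m(4,5) ig t]
  show ?thesis unfolding euclidean_eq_iff[where 'a='a] inner_minus_left w by (simp add: grad_inner_Basis cong: ball_cong)
 qed
 then show ?thesis
  using m(3,6) iu ig unfolding has_weak_gradient_def sob_def locally_integrable_iff[OF m(1,2)] locally_integrable_iff[OF m(4,5)] by blast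
qed

lemma L2_iff:
 fixes f :: "'a::euclidean_space => 'b::euclidean_space"
 assumes "f' \<in> BM" "AE x in lborel. f x = f' x"
 shows "f \<in> L2 \<longleftrightarrow> ltwo f'" "(\<integral>x. (norm (f x))^2 \<partial>lebesgue) = msq f'"
proof -
 have a: "(\<lambda>x. (norm (f' x))^2) \<in> BM" "AE x in lborel. (norm (f x))^2 = (norm (f' x))^2" using assms(1) by (simp, intro eventually_mono[OF assms(2)]) simp
 show "f \<in> L2 \<longleftrightarrow> ltwo f'" "(\<integral>x. (norm (f x))^2 \<partial>lebesgue) = msq f'"
  using leb_eq(2,3)[OF a] leb_eq(1)[OF assms] assms(1) by (auto simp: L2_def ltwo_def msq_def)
qed

theorem H1_sob:
 fixes u :: "'a::euclidean_space => real"
 assumes "u \<in> H1"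
 obtains u' g' where "sob u' g'" "AE x in lborel. u x = u' x" "AE x in lborel. weak_grad u x = g' x"
proof -
 obtain g where g: "has_weak_gradient u g" "g \<in> L2" and u: "u \<in> L2" using assms by (auto simp: H1_def)
 obtain u' where u': "u' \<in> BM" "AE x in lborel. u x = u' x" using u by (auto simp: L2_def elim: borel_version)
 obtain g' where g': "g' \<in> BM" "AE x in lborel. g x = g' x" using g by (auto simp: L2_def elim: borel_version)
 have s: "sob u' g'" using g u L2_iff(1)[OF u'] L2_iff(1)[OF g'] sob_weak_gradient[OF u' _ g'] by simp
 have w: "AE x in lborel. weak_grad u x = g x"
  unfolding weak_grad_def by (rule weak_gradient_unique[OF someI[of "has_weak_gradient u", OF g(1)] g(1)])
 have "AE x in lborel. weak_grad u x = g' x" using w g'(2) by eventually_elim simp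
 then show ?thesis using that[OF s u'(2)] by blast
qed

theorem sob_H1:
 fixes u :: "'a::euclidean_space => real"
 assumes s: "sob u g" shows "u \<in> H1" "AE x in lborel. weak_grad u x = g x"
proof -
 note b = sob_borel[OF s] sob_borel'[OF s] sob_ltwo[OF s]
 have w: "has_weak_gradient u g" using sob_weak_gradient[OF b(1) _ b(3) b(2) _ b(4)] s by simp
 show "u \<in> H1" using w L2_iff(1)[OF b(1)] L2_iff(1)[OF b(2)] b by (auto simp: H1_def)
 show "AE x in lborel. weak_grad u x = g x" unfolding weak_grad_def by (rule weak_gradient_unique[OF someI[of "has_weak_gradient u", OF w] w])
qed

lemma weakly_solves_iff:
 fixes u0 :: "real^2 => real"
 assumes s: "sob u g" and AE: "AE x in lborel. u0 x = u x" "AE x in lborel. weak_grad u0 x = g x"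
  and f: "f \<in> BM" "AE x in lborel. f0 x = f x"
 shows "weakly_solves lam u0 f0 \<longleftrightarrow>
  (\<forall>\<phi>. test_function \<phi> --> (LBINT x. g x \<bullet> grad \<phi> x) + lam * (LBINT x. u x * \<phi> x) = (LBINT x. f x * \<phi> x))"
proof -
 have "(\<integral>x. weak_grad u0 x \<bullet> grad \<phi> x \<partial>lebesgue) = (LBINT x. g x \<bullet> grad \<phi> x)"
  "(\<integral>x. u0 x * \<phi> x \<partial>lebesgue) = (LBINT x. u x * \<phi> x)" "(\<integral>x. f0 x * \<phi> x \<partial>lebesgue) = (LBINT x. f x * \<phi> x)"
  if t: "test_function \<phi>" for \<phi>
 proof -
  note [measurable] = sob_borel[OF s] sob_borel'[OF s] f(1) test_borel[OF t] test_grad_borel[OF t]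
  show "(\<integral>x. weak_grad u0 x \<bullet> grad \<phi> x \<partial>lebesgue) = (LBINT x. g x \<bullet> grad \<phi> x)"
   by (rule leb_eq(2)) (measurable, rule eventually_mono[OF AE(2)], simp)
  show "(\<integral>x. u0 x * \<phi> x \<partial>lebesgue) = (LBINT x. u x * \<phi> x)"
   by (rule leb_eq(2)) (measurable, rule eventually_mono[OF AE(1)], simp)
  show "(\<integral>x. f0 x * \<phi> x \<partial>lebesgue) = (LBINT x. f x * \<phi> x)"
   by (rule leb_eq(2)) (measurable, rule eventually_mono[OF f(2)], simp)
 qed
 then show ?thesis unfolding weakly_solves_def by auto
qed

lemma energy_sob:
 assumes s: "sob u g" "sob v h" and AE: "AE x in lborel. u0 x = u x" "AE x in lborel. weak_grad u0 x = g x"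
  "AE x in lborel. v0 x = v x" "AE x in lborel. weak_grad v0 x = h x"
 shows "energy \<mu>1 \<mu>2 \<rho> \<beta> u0 v0 = 1/2 * (msq g + msq h) - (LBINT x. Fq (\<mu>1/4) (\<mu>2/4) (\<rho>/2) (\<beta>/2) (u x) (v x))"
proof -
 note [measurable] = s[THEN sob_borel] s[THEN sob_borel']
 have 1: "(\<integral>x. (norm (weak_grad u0 x))^2 + (norm (weak_grad v0 x))^2 \<partial>lebesgue) = (LBINT x. (norm (g x))^2 + (norm (h x))^2)"
  by (rule leb_eq(2)) (measurable, use AE(2,4) in eventually_elim, simp)
 have 2: "(\<integral>x. \<mu>1 * u0 x ^ 4 + \<mu>2 * v0 x ^ 4 + 2 * \<rho> * (u0 x)^2 * (v0 x)^2 \<partial>lebesgue) = (LBINT x. Fq \<mu>1 \<mu>2 (2 * \<rho>) 0 (u x) (v x))"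
  by (rule leb_eq(2)) (measurable, use AE(1,3) in eventually_elim, simp add: Fq_def)
 have 3: "(\<integral>x. (u0 x)^2 * v0 x \<partial>lebesgue) = (LBINT x. Fq 0 0 0 1 (u x) (v x))"
  by (rule leb_eq(2)) (measurable, use AE(1,3) in eventually_elim, simp add: Fq_def)
 have "Fq (\<mu>1/4) (\<mu>2/4) (\<rho>/2) (\<beta>/2) a b = 1/4 * Fq \<mu>1 \<mu>2 (2 * \<rho>) 0 a b + \<beta>/2 * Fq 0 0 0 1 a b" for a b
  by (simp add: Fq_def algebra_simps)
 then show ?thesis unfolding energy_def 1 2 3 using Fq_int[OF s] ltwo_int[OF sob_ltwo(2)[OF s(1)]] ltwo_int[OF sob_ltwo(2)[OF s(2)]]
  by (simp add: msq_def)
qed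

lemma mass_sob:
 assumes "sob u g" and "AE x in lborel. u0 x = (u x :: real)" shows "(\<integral>x. (u0 x)^2 \<partial>lebesgue) = msq u"
 using L2_iff(2)[OF sob_borel[OF assms(1)] assms(2)] by simp

text \<open>The profile at radius \<open>r\<close> is the value at a chosen point of norm
  \<open>r\<close> outside the exceptional set; points of equal norm have equal values because
  monotonicity applies both ways.\<close>

lemma radial_dec_radial: assumes "radial_dec w" shows "radial w"
proof -
 obtain N where N: "N \<in> null_sets lborel" "!!x y. x \<notin> N ==> y \<notin> N ==> norm x <= norm y ==> w y <= w x"
  using assms by (auto simp: radial_dec_def)
 have "w x = w (SOME y. y \<notin> N & norm y = norm x)" if x: "x \<notin> N" for x
 proof -
  have *: "(SOME y. y \<notin> N & norm y = norm x) \<notin> N & norm (SOME y. y \<notin> N & norm y = norm x) = norm x"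
   by (rule someI[where x=x]) (use x in simp)
  show ?thesis by (rule antisym) (use N(2) x * in simp_all)
 qed
 then have "AE x in lborel. w x = (\<lambda>r. w (SOME y. y \<notin> N & norm y = r)) (norm x)"
  using AE_not_in[OF N(1)] by (auto elim: eventually_mono)
 then show ?thesis unfolding radial_def by (intro exI AE_completion)
qed

text \<open>The rescaled maximizer \<open>R\<close> has mass \<open>1 / (2 * C)\<close>, so its
  identification with \<open>Q\<close> turns the constant \<open>4 * C\<close> into
  \<open>2 / |Q|^2\<close>. The Borel version \<open>R\<close>, nonnegative everywhere, is returned
  for later use as a competitor.\<close>

theorem ground_state:
 assumes Q: "is_unique_positive_radial_solution Q"
 obtains R :: "real^2 => real" and k where "sob R k" "!!x. R x >= 0" "(L2_norm Q)^2 > 0" "msq R = (L2_norm Q)^2" "msq k = (L2_norm Q)^2"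
  "(LBINT x. R x ^ 4) = 2 * (L2_norm Q)^2" "!!u g. sob (u :: real^2 => real) g ==> (LBINT x. u x ^ 4) <= 2 / (L2_norm Q)^2 * msq u * msq g"
proof -
 obtain w h C where w: "sob w h" "!!x. w x >= 0" "radial_dec w" and C: "C > 0" and mw: "msq w = 1/2" "msq h = 1/2"
  and qw: "(LBINT x. w x ^ 4) = C" and GN: "!!u g. sob (u :: real^2 => real) g ==> (LBINT x. u x ^ 4) <= C * (msq u + msq g)^2"
  by (rule gn_maximizer) blast
 have le: "(LBINT x. w x * w x * w x * p x) <= C * ((LBINT x. h x \<bullet> p' x) + (LBINT x. w x * p x))" if p: "sob p p'" for p p'
 proof -
  let ?M = "LBINT x. w x * w x * w x * p x"
  define B D where "B = (LBINT x. h x \<bullet> p' x) + (LBINT x. w x * p x)" and "D = msq p + msq p'"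
  obtain c2 c3 c4 where e: "!!t. (LBINT x. Fq 1 0 0 0 (w x + t * p x) (w x + t * p x)) = (LBINT x. Fq 1 0 0 0 (w x) (w x)) +
    t * (LBINT x. dFq 1 0 0 0 (w x) (w x) (p x) (p x)) + t^2 * (c2 + t * c3 + t^2 * c4)"
   by (rule Fq_expand[OF w(1) w(1) p p, of 1 0 0 0]) blast
  have 4: "4 * ?M - 4 * C * B <= 0"
  proof (rule one_sided)
   fix t :: real
   have s: "sob (\<lambda>x. w x + t * p x) (\<lambda>x. h x + t *\<^sub>R p' x)" by (rule sob_add[OF w(1) sob_cmult[OF p]])
   have "msq (\<lambda>x. w x + t * p x) + msq (\<lambda>x. h x + t *\<^sub>R p' x) = 1 + 2 * t * B + t^2 * D"
    using msq_add_scale[OF sob_ltwo(1)[OF w(1)] sob_ltwo(1)[OF p], of t] msq_add_scale[OF sob_ltwo(2)[OF w(1)] sob_ltwo(2)[OF p], of t] mw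
    by (simp add: B_def D_def algebra_simps)
   with GN[OF s] have "C + t * (4 * ?M) + t^2 * (c2 + t * c3 + t^2 * c4) <= C * (1 + 2 * t * B + t^2 * D)^2"
    using e[of t] qw by (simp add: Fq_def dFq_def)
   then show "t * (4 * ?M - 4 * C * B) <= t^2 * ((C * (4 * B^2 + 2 * D) - c2) + t * (4 * C * B * D - c3) + t^2 * (C * D^2 - c4))"
    by (simp add: power2_eq_square algebra_simps)
  qed
  then show ?thesis by (simp add: B_def)
 qed
 \<comment> \<open>The direction \<open>- p\<close> is admissible too, since \<open>GN\<close> holds
   for all functions; the inequality becomes an equality.\<close>
 have EL: "(LBINT x. w x * w x * w x * p x) = C * ((LBINT x. h x \<bullet> p' x) + (LBINT x. w x * p x))" if p: "sob p p'" for p p'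
  using le[OF p] le[OF sob_cmult[OF p, of "-1"]] by (simp add: algebra_simps)
 \<comment> \<open>Fixed by \<open>c^2 = 1 / C\<close>, which removes the factor in front of the
   linear terms of the equation.\<close>
 define c where "c = 1 / sqrt C"
 have c: "c > 0" "c^2 = 1 / C" "c ^ 4 = 1 / C^2" using C power_mult[of c 2 2] by (simp_all add: c_def power_divide)
 define R where "R x = c * w x" for x
 define k where "k x = c *\<^sub>R h x" for x
 have R: "sob R k" unfolding R_def k_def by (rule sob_cmult[OF w(1)])
 have Rm[measurable]: "R \<in> BM" using R by (rule sob_borel)
 have R0: "R x >= 0" for x using w(2) c(1) by (simp add: R_def)
 have mR: "msq R = 1 / (2 * C)" "msq k = 1 / (2 * C)" unfolding R_def k_def by (simp_all add: msq_cmult msq_scale mw c)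
 have rad: "radial_dec R" using w(3) c(1) unfolding radial_dec_def R_def by (auto intro!: mult_left_mono bexI)
 have eq: "(LBINT x. k x \<bullet> grad \<phi> x) + 1 * (LBINT x. R x * \<phi> x) = (LBINT x. R x ^ 3 * \<phi> x)" if t: "test_function \<phi>" for \<phi>
 proof -
  have "(LBINT x. R x ^ 3 * \<phi> x) = (LBINT x. c ^ 3 * (w x * w x * w x * \<phi> x))"
   by (rule bochner_cong) (auto simp: R_def power3_eq_cube)
  also have "\<dots> = c ^ 3 * (C * ((LBINT x. h x \<bullet> grad \<phi> x) + (LBINT x. w x * \<phi> x)))" using EL[OF sob_test[OF t]] by simp
  also have "c ^ 3 * (C * ((LBINT x. h x \<bullet> grad \<phi> x) + (LBINT x. w x * \<phi> x))) = (c^2 * C) * (c * (LBINT x. h x \<bullet> grad \<phi> x) + c * (LBINT x. w x * \<phi> x))"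
   by (simp add: power2_eq_square power3_eq_cube algebra_simps)
  also have "\<dots> = (LBINT x. k x \<bullet> grad \<phi> x) + 1 * (LBINT x. R x * \<phi> x)" using C by (simp add: c k_def R_def mult.assoc)
  finally show ?thesis by simp
 qed
 have pos: "AE x in lborel. R x > 0"
  by (rule radial_dec_positive[OF R R0 rad _ _ eq]) (use mR C R0 in auto)
 have "positive_radial_solution R"
  unfolding positive_radial_solution_def ae_positive_def
 proof (intro conjI)
  show "weakly_solves 1 R (\<lambda>x. R x ^ 3)"
   by (subst weakly_solves_iff[OF R _ sob_H1(2)[OF R], of _ "\<lambda>x. R x ^ 3"]) (use eq in auto)
 qed (use sob_H1(1)[OF R] AE_completion[OF pos] radial_dec_radial[OF rad] in auto)
 then have "AE x in lebesgue. R x = Q x" using Q by (simp add: is_unique_positive_radial_solution_def)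
 then have "AE x in lborel. Q x = R x" by (auto simp: AE_completion_iff eq_commute elim: eventually_mono)
 then have mQ: "(L2_norm Q)^2 = msq R" using mass_sob[OF R, of Q] by (simp add: L2_norm_def)
 have qR: "(LBINT x. R x ^ 4) = 1 / C" using qw C by (simp add: R_def power_mult_distrib c power2_eq_square)
 have G: "(LBINT x. u x ^ 4) <= 4 * C * msq u * msq g" if s: "sob u g" for u :: "real^2 => real" and g
 proof (cases "msq u = 0 \<or> msq g = 0")
  case True then show ?thesis using sob_Lp(2)[OF s] by auto
 next
  case False
  then have m0: "msq u > 0" "msq g > 0" by (simp_all add: order_less_le)
  \<comment> \<open>The dilation that equalizes mass and Dirichlet integral; undoing it turns the
    square of the sum into \<open>4 * msq u * msq g\<close>.\<close>
  define a where "a = sqrt (msq u / msq g)"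
  have a: "a > 0" "a^2 = msq u / msq g" using m0 by (auto simp: a_def)
  note [measurable] = sob_borel[OF s]
  have "(LBINT x. u x ^ 4) / a^2 <= C * (msq u / a^2 + msq g)^2"
   using GN[OF dilate_facts(1)[OF s a(1)]] dilate_facts(4)[OF s a(1), of "\<lambda>x. u x ^ 4"] by (simp add: dilate_facts(2,3)[OF s a(1)])
  then have "(LBINT x. u x ^ 4) / (msq u / msq g) <= C * (msq g + msq g)^2" unfolding a(2) using m0 by simp
  then show ?thesis using m0 by (simp add: pos_divide_le_eq power2_eq_square algebra_simps)
 qed
 show ?thesis
 proof (rule that[OF R R0])
  show "(LBINT x. u x ^ 4) <= 2 / (L2_norm Q)^2 * msq u * msq g" if "sob u g" for u :: "real^2 => real" and g using G[OF that] C mR mQ by simp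
 qed (use mQ mR C qR in auto)
qed

section \<open>Minimizers\<close>

text \<open>Admissible variations stay in the ball: those pointing inward (\<open>B p < 0\<close>),
  or all of them if the constraint is inactive. Tangential directions \<open>B p = 0\<close> are
  reached by tilting \<open>p\<close> inward with \<open>- t u\<close> and letting \<open>t\<close>
  tend to zero. Every direction is a tangential one plus a multiple of \<open>u\<close>, which
  determines \<open>lam\<close>.\<close>

lemma el_multiplier:
 fixes u :: "real^2 => real"
 assumes s: "sob u g" and f: "ltwo f" and u: "msq u > 0" "msq u <= m"
  and hyp: "!!p p'. sob p p' ==> (!!t. 0 < t ==> t <= 1 ==> msq (\<lambda>x. u x + t * p x) <= m) ==> (LBINT x. f x * p x) <= (LBINT x. g x \<bullet> p' x)"
 obtains lam where "!!p p'. sob p p' ==> (LBINT x. g x \<bullet> p' x) + lam * (LBINT x. u x * p x) = (LBINT x. f x * p x)" "lam = 0 \<or> msq u = m"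
proof -
 define L where "L p p' = (LBINT x. g x \<bullet> p' x) - (LBINT x. f x * p x)" for p p'
 define B where "B p = (LBINT x. u x * p x)" for p
 have Lin: "L (\<lambda>x. p x + c * p2 x) (\<lambda>x. p' x + c *\<^sub>R p2' x) = L p p' + c * L p2 p2'" "B (\<lambda>x. p x + c * p2 x) = B p + c * B p2"
  if p: "sob p p'" "sob p2 p2'" for p p' p2 p2' c
  using ltwo_inner[OF sob_ltwo(2)[OF s] sob_ltwo(2)[OF p(1)]] ltwo_inner[OF sob_ltwo(2)[OF s] sob_ltwo(2)[OF p(2)]]
   ltwo_mult[OF f sob_ltwo(1)[OF p(1)]] ltwo_mult[OF f sob_ltwo(1)[OF p(2)]] sob_int2[OF s p(1)] sob_int2[OF s p(2)]
  by (simp_all add: L_def B_def inner_add_right distrib_left right_diff_distrib mult.left_commute[of _ c])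
 have Bu: "B u = msq u" by (simp add: B_def msq_real power2_eq_square)
 have nonneg: "0 <= L p p'" if p: "sob p p'" and d: "B p < 0 \<or> msq u < m" for p p'
 proof -
  have ex: "\<exists>c>0. \<forall>t. 0 <= t --> t <= c --> msq u + 2 * t * B p + t^2 * msq p <= m"
   using d
  proof
   assume b: "B p < 0"
   define c where "c = - B p / (msq p + 1)"
   have den: "msq p + 1 > 0" by (simp add: add_nonneg_pos)
   then have c0: "c > 0" "c * (msq p + 1) = - B p" using b divide_pos_pos[of "- B p" "msq p + 1"] by (simp_all add: c_def)
   then have c: "c > 0" "c * msq p <= - B p" by (simp_all add: distrib_left)
   have "msq u + 2 * t * B p + t^2 * msq p <= m" if t: "0 <= t" "t <= c" for t
   proof -
    have "t * msq p <= c * msq p" using t by (intro mult_right_mono) auto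
    then have "t * (2 * B p + t * msq p) <= 0" using c b t by (intro mult_nonneg_nonpos) linarith+
    then show ?thesis using u(2) by (simp add: power2_eq_square algebra_simps)
   qed
   with c show ?thesis by blast
  next
   assume b: "msq u < m"
   define c where "c = min 1 ((m - msq u) / (2 * \<bar>B p\<bar> + msq p + 1))"
   have den: "2 * \<bar>B p\<bar> + msq p + 1 > 0" by (simp add: add_nonneg_pos)
   have c: "c > 0" "c <= 1" using b den by (auto simp: c_def)
   have c3: "c * (2 * \<bar>B p\<bar> + msq p) <= m - msq u"
   proof -
    have "c * (2 * \<bar>B p\<bar> + msq p + 1) <= (m - msq u) / (2 * \<bar>B p\<bar> + msq p + 1) * (2 * \<bar>B p\<bar> + msq p + 1)"
     using den by (intro mult_right_mono) (auto simp: c_def)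
    also have "\<dots> = m - msq u" using den by simp
    finally show ?thesis using c(1) by (simp add: distrib_left)
   qed
   have "msq u + 2 * t * B p + t^2 * msq p <= m" if t: "0 <= t" "t <= c" for t
   proof -
    have "t * t <= c * 1" using t c by (intro mult_mono) auto
    then have 1: "t^2 * msq p <= c * msq p" by (intro mult_right_mono) (auto simp: power2_eq_square)
    have "t * B p <= t * \<bar>B p\<bar>" using t by (intro mult_left_mono) auto
    also have "\<dots> <= c * \<bar>B p\<bar>" using t by (intro mult_right_mono) auto
    finally show ?thesis using 1 c3 by (simp add: distrib_left)
   qed
   with c show ?thesis by blast
  qed
  then obtain c where c: "c > 0" "!!t. 0 <= t ==> t <= c ==> msq u + 2 * t * B p + t^2 * msq p <= m" by blast
  have "(LBINT x. f x * (c * p x)) <= (LBINT x. g x \<bullet> (c *\<^sub>R p' x))"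
  proof (rule hyp[OF sob_cmult[OF p]])
   fix t :: real assume t: "0 < t" "t <= 1"
   have "t * c <= 1 * c" using t c by (intro mult_right_mono) auto
   then have "msq u + 2 * (t * c) * B p + (t * c)^2 * msq p <= m" using t c by (intro c(2)) auto
   then show "msq (\<lambda>x. u x + t * (c * p x)) <= m"
    using msq_add_scale[OF sob_ltwo(1)[OF s] sob_ltwo(1)[OF p], of "t * c"] by (simp add: B_def mult.assoc)
  qed
  then have "c * (LBINT x. f x * p x) <= c * (LBINT x. g x \<bullet> p' x)" by (simp add: mult.left_commute[of _ c])
  then show ?thesis using c(1) by (simp add: L_def)
 qed
 have ge0: "0 <= L p p'" if p: "sob p p'" and b: "B p = 0" for p p'
 proof -
  have "- (L p p') <= 0"
  proof (rule one_sided[of _ "- L u g" 0 0])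
   fix t :: real assume t: "0 < t" "t <= 1"
   have "0 <= L (\<lambda>x. p x + (- t) * u x) (\<lambda>x. p' x + (- t) *\<^sub>R g x)"
   proof (rule nonneg[OF sob_add[OF p sob_cmult[OF s]]])
    have "B (\<lambda>x. p x + (- t) * u x) < 0" unfolding Lin(2)[OF p s] b Bu using t u by simp
    then show "B (\<lambda>x. p x + (- t) * u x) < 0 \<or> msq u < m" ..
   qed
   then have "t * (t * L u g) <= t * L p p'" unfolding Lin(1)[OF p s] using t by (intro mult_left_mono) auto
   then show "t * - L p p' <= t^2 * (- L u g + t * 0 + t^2 * 0)" by (simp add: power2_eq_square mult.assoc)
  qed
  then show ?thesis by simp
 qed
 have eq0: "L p p' = 0" if p: "sob p p'" and b: "B p = 0" for p p'
 proof -
  have z: "sob (\<lambda>x. 0 * u x) (\<lambda>x. 0 *\<^sub>R g x)" by (rule sob_cmult[OF s])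
  have "L (\<lambda>x. 0 * u x + (-1) * p x) (\<lambda>x. 0 *\<^sub>R g x + (-1) *\<^sub>R p' x) = - L p p'" unfolding Lin(1)[OF z p] by (simp add: L_def)
  moreover have "0 <= L (\<lambda>x. 0 * u x + (-1) * p x) (\<lambda>x. 0 *\<^sub>R g x + (-1) *\<^sub>R p' x)"
   by (rule ge0[OF sob_add[OF z sob_cmult[OF p]]]) (unfold Lin(2)[OF z p], use b in "simp add: B_def")
  ultimately show ?thesis using ge0[OF p b] by simp
 qed
 define lam where "lam = - L u g / msq u"
 show ?thesis
 proof (rule that[of lam])
  fix p :: "real^2 => real" and p' assume p: "sob p p'"
  let ?c = "- B p / msq u"
  have "L (\<lambda>x. p x + ?c * u x) (\<lambda>x. p' x + ?c *\<^sub>R g x) = 0"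
   by (rule eq0[OF sob_add[OF p sob_cmult[OF s]]]) (unfold Lin(2)[OF p s] Bu, use u in simp)
  then have "L p p' + ?c * L u g = 0" unfolding Lin(1)[OF p s] .
  then show "(LBINT x. g x \<bullet> p' x) + lam * (LBINT x. u x * p x) = (LBINT x. f x * p x)"
   unfolding B_def[symmetric] using u by (simp add: L_def lam_def field_simps)
 next
  have "L u g = 0" if "msq u < m"
  proof -
   have z: "sob (\<lambda>x. 0 * u x) (\<lambda>x. 0 *\<^sub>R g x)" by (rule sob_cmult[OF s])
   have "0 <= L (\<lambda>x. 0 * u x + (-1) * u x) (\<lambda>x. 0 *\<^sub>R g x + (-1) *\<^sub>R g x)"
    by (rule nonneg[OF sob_add[OF z sob_cmult[OF s]]]) (use that in simp)
   then have "0 <= - L u g" unfolding Lin(1)[OF z s] by (simp add: L_def)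
   then show ?thesis using nonneg[OF s] that by simp
  qed
  then show "lam = 0 \<or> msq u = m" using u(2) by (auto simp: lam_def)
 qed
qed

text \<open>Testing with the cut-off puts two derivatives on it. In dimension two the
  \<open>L^2\<close> norm of \<open>lap (cut n)\<close> is of order \<open>1 / (n + 1)\<close>, so
  the integral of \<open>f\<close> is zero; since \<open>f\<close> dominates \<open>c * u^3\<close>,
  so does \<open>u\<close> vanish almost everywhere.\<close>

lemma liouville:
 fixes u :: "real^2 => real"
 assumes s: "sob u g" and nn: "!!x. u x >= 0" and [measurable]: "f \<in> BM" and f: "!!x. c * u x ^ 3 <= f x" and c: "c > 0"
  and eq: "!!\<phi>. test_function \<phi> ==> (LBINT x. g x \<bullet> grad \<phi> x) = (LBINT x. f x * \<phi> x)"
  and i: "!!\<phi>. test_function \<phi> ==> L1 (\<lambda>x. f x * \<phi> x)"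
 shows "msq u = 0"
proof -
 have f0: "f x >= 0" for x by (rule order_trans[OF _ f]) (use c nn[of x] in simp)
 have lt: "ltwo (lap (cut n))" for n by (rule test_ltwo[OF lap_test[OF cut_test]])
 have m: "msq (lap (cut n)) = (1 / real (Suc n))^2 * msq (lap (cut 0))" for n
 proof -
  let ?c = "1 / real (Suc n)"
  have "lap (cut n) = (\<lambda>x. ?c^2 * lap (cut 0) (?c *\<^sub>R x))" by (rule ext) (rule cut_lap)
  then have "msq (lap (cut n)) = (?c^2)^2 * msq (\<lambda>x. lap (cut 0) (?c *\<^sub>R x))" by (simp only: msq_cmult)
  moreover have "msq (lap (cut 0)) = ?c^2 * msq (\<lambda>x. lap (cut 0) (?c *\<^sub>R x))" using ltwo_dilate(2)[OF lt[of 0], of ?c] by simp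
  ultimately show ?thesis by (simp only: power2_eq_square mult.assoc)
 qed
 have le: "(LBINT x. f x * cut n x) <= (1 / real (Suc n)) * sqrt (msq u * msq (lap (cut 0)))" for n
 proof -
  have "(LBINT x. f x * cut n x) = - (LBINT x. u x \<bullet> lap (cut n) x)" using eq[OF cut_test] sob_lap[OF s cut_test] by simp
  also have "\<dots> <= sqrt (msq u * msq (lap (cut n)))" using cauchy_schwarz_abs[OF sob_ltwo(1)[OF s] lt[of n]] by linarith
  also have "\<dots> = sqrt ((1 / real (Suc n))^2 * (msq u * msq (lap (cut 0))))" unfolding m[of n] by (simp only: mult_ac)
  finally show ?thesis by (simp add: real_sqrt_mult)
 qed
 have a: "AE x in lborel. (\<lambda>k. f x * cut k x) ----> f x"
 proof (rule AE_I2)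
  fix x have "(\<lambda>k. f x * cut k x) ----> f x * 1" by (intro tendsto_intros cut_lim)
  then show "(\<lambda>k. f x * cut k x) ----> f x" by simp
 qed
 have b: "AE x in lborel. 0 <= f x * cut k x" for k by (intro AE_I2 mult_nonneg_nonneg f0 cut_nonneg)
 have l: "(\<lambda>n. (1 / real (Suc n)) * sqrt (msq u * msq (lap (cut 0)))) ----> 0 * sqrt (msq u * msq (lap (cut 0)))"
  by (intro tendsto_intros inv_Suc_lim)
 have m1: "(\<lambda>x. f x * cut k x) \<in> borel_measurable lborel" for k by measurable
 have m2: "f \<in> borel_measurable lborel" by simp
 note fat = fatou_real[OF m1 m2 b a i[OF cut_test] le l]
 have "(LBINT x. f x) = 0" using fat(2) Bochner_Integration.integral_nonneg[of lborel f] f0 by (intro antisym) auto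
 then have "AE x in lborel. f x = 0" using integral_nonneg_eq_0_iff_AE[OF fat(1)] f0 by simp
 then have "AE x in lborel. (u x)^2 = 0"
 proof eventually_elim
  case (elim x)
  then have "u x ^ 3 <= 0" using f[of x] c by (simp add: mult_le_0_iff)
  then show ?case using nn[of x] zero_less_power[of "u x" 3] by (cases "u x = 0") auto
 qed
 then show ?thesis unfolding msq_real by (rule integral_eq_zero_AE)
qed

text \<open>The inequality \<open>2 s^2 t^2 \<le> s^4 + t^4\<close> distributes the coupling \<rho>
  over the quartic terms, which \<open>GN\<close> keeps strictly below half the Dirichlet integrals;
  the cubic term is absorbed by a weighted square. Its remainder is kept proportional to
  \<open>\<beta> * msq v\<close>, because it must vanish both for \<open>\<beta> = 0\<close> and for
  \<open>v = 0\<close>.\<close>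

lemma coercive:
 fixes q \<mu>1 \<mu>2 \<rho> \<beta> m1 m2 :: real
 assumes q: "q > 0" and GN: "!!u g. sob (u :: real^2 => real) g ==> (LBINT x. u x ^ 4) <= 2 / q * msq u * msq g"
  and c: "\<mu>1 > 0" "\<mu>2 > 0" "\<rho> > 0" "\<beta> >= 0" "m1 > 0" "m2 > 0" "(\<mu>1 + \<rho>) * m1 < q" "(\<mu>2 + \<rho>) * m2 < q"
 obtains k K where "k > 0" "!!u g v h. sob (u :: real^2 => real) g ==> sob v h ==> msq u <= m1 ==> msq v <= m2 ==>
  k * (msq g + msq h) <= 1/2 * (msq g + msq h) - (LBINT x. Fq (\<mu>1/4) (\<mu>2/4) (\<rho>/2) (\<beta>/2) (u x) (v x)) + \<beta> * K * msq v"
proof -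
 \<comment> \<open>The gap in the mass conditions is \<open>4 * q * k\<close>. It leaves a surplus
   of \<open>2 * k\<close> times the Dirichlet integrals; the cubic term consumes one
   \<open>k\<close>, for which \<open>e\<close> is chosen small, and the other remains.\<close>
 define k where "k = (q - max ((\<mu>1 + \<rho>) * m1) ((\<mu>2 + \<rho>) * m2)) / (4 * q)"
 define e where "e = q * k / (\<beta> * m1 + 1)"
 have b: "\<beta> * m1 + 1 > 0" using c by (simp add: add_nonneg_pos)
 have k: "k > 0" and e: "e > 0" using c q b by (auto simp: k_def e_def)
 have max: "max ((\<mu>1 + \<rho>) * m1) ((\<mu>2 + \<rho>) * m2) = q - 4 * q * k" using q by (simp add: k_def)
 have eb: "\<beta> * e * m1 <= q * k"
 proof -
  have "e * (\<beta> * m1 + 1) = q * k" using b by (simp add: e_def)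
  then show ?thesis using e by (simp add: algebra_simps)
 qed
 show ?thesis
 proof (rule that[OF k])
  fix u v :: "real^2 => real" and g h assume s: "sob u g" "sob v h" and m: "msq u <= m1" "msq v <= m2"
  let ?A = "msq g" and ?B = "msq h" and ?U = "LBINT x. u x ^ 4" and ?V = "LBINT x. v x ^ 4" and ?W = "LBINT x. (v x)^2"
  have i: "L1 (\<lambda>x. (\<mu>1 + \<rho>) / 4 * u x ^ 4 + (\<mu>2 + \<rho>) / 4 * v x ^ 4 + \<beta> / 2 * (e * u x ^ 4) + \<beta> / 2 * ((v x)^2 / e))"
   using sob_Lp(1)[OF s(1)] sob_Lp(1)[OF s(2)] ltwo_int_real[OF sob_ltwo(1)[OF s(2)]] by simp
  have "(LBINT x. Fq (\<mu>1/4) (\<mu>2/4) (\<rho>/2) (\<beta>/2) (u x) (v x)) <=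
   (LBINT x. (\<mu>1 + \<rho>) / 4 * u x ^ 4 + (\<mu>2 + \<rho>) / 4 * v x ^ 4 + \<beta> / 2 * (e * u x ^ 4) + \<beta> / 2 * ((v x)^2 / e))"
  proof (rule integral_mono[OF Fq_int[OF s] i])
   fix x
   have "0 <= \<rho> / 4 * ((u x)^2 - (v x)^2)^2" using c by simp
   moreover have "\<beta> / 2 * ((u x)^2 * v x) <= \<beta> / 2 * (e * u x ^ 4 + (v x)^2 / e)"
   proof (rule mult_left_mono)
    have "0 <= (e * (u x)^2 - v x)^2 / e + (e * u x ^ 4 + (v x)^2 / e)" using e by (simp add: add_nonneg_nonneg)
    also have "\<dots> = 2 * (e * u x ^ 4 + (v x)^2 / e) - 2 * ((u x)^2 * v x)" using e by (simp add: power2_eq_square power4_eq_xxxx field_simps)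
    finally show "(u x)^2 * v x <= e * u x ^ 4 + (v x)^2 / e" by simp
   qed (use c in simp)
   ultimately show "Fq (\<mu>1/4) (\<mu>2/4) (\<rho>/2) (\<beta>/2) (u x) (v x) <= (\<mu>1 + \<rho>) / 4 * u x ^ 4 + (\<mu>2 + \<rho>) / 4 * v x ^ 4 + \<beta> / 2 * (e * u x ^ 4) + \<beta> / 2 * ((v x)^2 / e)"
    by (simp add: Fq_def power2_eq_square power4_eq_xxxx algebra_simps add_divide_distrib)
  qed
  also have "\<dots> = (\<mu>1 + \<rho>) / 4 * ?U + (\<mu>2 + \<rho>) / 4 * ?V + \<beta> / 2 * (e * ?U) + \<beta> / 2 * (?W / e)"
   using sob_Lp(1)[OF s(1)] sob_Lp(1)[OF s(2)] ltwo_int_real[OF sob_ltwo(1)[OF s(2)]] by simp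
  also have "\<dots> <= (q - 4 * q * k) / 4 * (2 / q * ?A) + (q - 4 * q * k) / 4 * (2 / q * ?B) + q * k / 2 * (2 / q * ?A) + \<beta> / 2 * (?W / e)"
  proof (intro add_mono)
   have bd: "a * (LBINT x. w x ^ 4) <= z * (2 / q * msq l)" if w: "sob w l" "msq w <= m" "a * m <= z" "a >= 0" for a z m l and w :: "real^2 => real"
   proof -
    have "a * (LBINT x. w x ^ 4) <= a * (2 / q * msq w * msq l)" using GN[OF w(1)] w(4) by (rule mult_left_mono)
    also have "\<dots> = (a * msq w) * (2 / q * msq l)" by simp
    also have "\<dots> <= z * (2 / q * msq l)" using order_trans[OF mult_left_mono[OF w(2,4)] w(3)] q by (intro mult_right_mono) auto
    finally show ?thesis .
   qed
   show "(\<mu>1 + \<rho>) / 4 * ?U <= (q - 4 * q * k) / 4 * (2 / q * ?A)" by (rule bd[OF s(1) m(1)]) (use max c in "simp_all")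
   show "(\<mu>2 + \<rho>) / 4 * ?V <= (q - 4 * q * k) / 4 * (2 / q * ?B)" by (rule bd[OF s(2) m(2)]) (use max c in "simp_all")
   show "\<beta> / 2 * (e * ?U) <= q * k / 2 * (2 / q * ?A)" using bd[OF s(1) m(1), of "\<beta> / 2 * e" "q * k / 2"] eb c e by (simp add: mult.assoc)
  qed simp
  also have "\<dots> = (1/2 - 2 * k) * (?A + ?B) + k * ?A + \<beta> / 2 * (?W / e)" using q by (simp add: field_simps)
  also have "\<dots> <= (1/2 - k) * (?A + ?B) + \<beta> * (1 / (2 * e)) * msq v" using k by (simp add: msq_real algebra_simps)
  finally show "k * (?A + ?B) <= 1/2 * (?A + ?B) - (LBINT x. Fq (\<mu>1/4) (\<mu>2/4) (\<rho>/2) (\<beta>/2) (u x) (v x)) + \<beta> * (1 / (2 * e)) * msq v"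
   by (simp add: algebra_simps)
 qed
qed

text \<open>Mass-preserving dilations multiply the Dirichlet integral and the quartic term by
  \<open>s^2\<close> and the cubic term by \<open>s\<close>: for small \<open>s\<close> the cubic
  term wins, for large \<open>s\<close> the two quadratic orders decide.\<close>

lemma dilated_pair:
 fixes R :: "real^2 => real"
 assumes R: "sob R k" and s: "s > 0"
 defines "w \<equiv> \<lambda>c x. (c * s) * R (s *\<^sub>R x)" and "dw \<equiv> \<lambda>c x. (c * s) *\<^sub>R (s *\<^sub>R k (s *\<^sub>R x))"
 shows "sob (w c) (dw c)" "msq (w c) = c^2 * msq R" "msq (dw c) = s^2 * (c^2 * msq k)"
  "(LBINT x. Fq a1 a2 r b (w c1 x) (w c2 x)) = s^2 * (Fq a1 a2 r 0 c1 c2 * (LBINT x. R x ^ 4)) + s * (Fq 0 0 0 b c1 c2 * (LBINT x. R x ^ 3))"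
proof -
 note d = dilate_facts[OF R s]
 note [measurable] = sob_borel[OF R]
 show "sob (w c) (dw c)" unfolding w_def dw_def by (rule sob_cmult[OF d(1)])
 show "msq (w c) = c^2 * msq R" unfolding w_def msq_cmult d(2) using s by (simp add: power_mult_distrib)
 show "msq (dw c) = s^2 * (c^2 * msq k)" unfolding dw_def msq_scale[of "c * s"] d(3) by (simp add: power_mult_distrib)
 let ?a = "Fq a1 a2 r 0 c1 c2 * s ^ 4" and ?b = "Fq 0 0 0 b c1 c2 * s ^ 3"
 have key: "(A * s ^ 4 * I + B * s ^ 3 * J) / s^2 = s^2 * (A * I) + s * (B * J)" for A B I J
  using s by (simp add: field_simps power2_eq_square power3_eq_cube power4_eq_xxxx)
 have p: "R x ^ 4 = R x * R x * R x * R x" "R x ^ 3 = R x * R x * R x" for x by (simp_all add: power4_eq_xxxx power3_eq_cube)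
 have "(LBINT x. Fq a1 a2 r b (w c1 x) (w c2 x)) = (LBINT x. ?a * R (s *\<^sub>R x) ^ 4 + ?b * R (s *\<^sub>R x) ^ 3)"
  by (rule bochner_cong) (auto simp: w_def Fq_def power2_eq_square power3_eq_cube power4_eq_xxxx algebra_simps)
 also have "\<dots> = (LBINT x. ?a * R x ^ 4 + ?b * R x ^ 3) / s^2" using d(4)[of "\<lambda>x. ?a * R x ^ 4 + ?b * R x ^ 3"] by simp
 also have "(LBINT x. ?a * R x ^ 4 + ?b * R x ^ 3) = ?a * (LBINT x. R x ^ 4) + ?b * (LBINT x. R x ^ 3)"
  using sob_int34(1,2)[OF R R R R] unfolding p by simp
 finally show "(LBINT x. Fq a1 a2 r b (w c1 x) (w c2 x)) = s^2 * (Fq a1 a2 r 0 c1 c2 * (LBINT x. R x ^ 4)) + s * (Fq 0 0 0 b c1 c2 * (LBINT x. R x ^ 3))"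
  unfolding key .
qed

text \<open>The Lagrange multiplier vanishes if a mass constraint is not active, which is excluded by \<open>liouville\<close>.
 Hence minimizing over the balls of \<open>L\<^sup>2\<close> gives a minimizer on the spheres.\<close>

theorem minimizer:
 fixes q \<mu>1 \<mu>2 \<rho> \<beta> m1 m2 :: real and R :: "real^2 => real"
 defines "I \<equiv> \<lambda>u v. LBINT x. Fq (\<mu>1/4) (\<mu>2/4) (\<rho>/2) (\<beta>/2) (u x) (v x)"
 defines "f1 \<equiv> \<lambda>u v x. \<beta> * u x * v x + \<mu>1 * u x ^ 3 + \<rho> * (v x)^2 * u (x :: real^2)"
 defines "f2 \<equiv> \<lambda>u v x. \<beta>/2 * (u x)^2 + \<mu>2 * v x ^ 3 + \<rho> * (u x)^2 * v (x :: real^2)"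
 assumes q: "q > 0" and GN: "!!u g. sob (u :: real^2 => real) g ==> (LBINT x. u x ^ 4) <= 2 / q * msq u * msq g"
  and R: "sob R r" "!!x. R x >= 0" "msq R = q" "msq r = q"
  and c: "\<mu>1 > 0" "\<mu>2 > 0" "\<rho> > 0" "\<beta> > 0" "m1 > 0" "m2 > 0" "(\<mu>1 + \<rho>) * m1 < q" "(\<mu>2 + \<rho>) * m2 < q"
 obtains u g v h l1 l2 where "sob u g" "sob v h" "msq u = m1" "msq v = m2" "AE x in lborel. u x > 0" "AE x in lborel. v x > 0"
  "1/2 * (msq g + msq h) - I u v < 0"
  "!!u' g' v' h'. sob u' g' ==> sob v' h' ==> msq u' = m1 ==> msq v' = m2 ==> 1/2 * (msq g + msq h) - I u v <= 1/2 * (msq g' + msq h') - I u' v'"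
  "!!\<phi>. test_function \<phi> ==> (LBINT x. g x \<bullet> grad \<phi> x) + l1 * (LBINT x. u x * \<phi> x) = (LBINT x. f1 u v x * \<phi> x)"
  "!!\<phi>. test_function \<phi> ==> (LBINT x. h x \<bullet> grad \<phi> x) + l2 * (LBINT x. v x * \<phi> x) = (LBINT x. f2 u v x * \<phi> x)"
proof -
 define J where "J u g v h = 1/2 * (msq g + msq h) - I u v" for u v :: "real^2 => real" and g h :: "real^2 => real^2"
 define Adm where "Adm u g v h \<longleftrightarrow> sob u g & sob v h & msq u <= m1 & msq v <= m2" for u v :: "real^2 => real" and g h
 obtain k K where k: "k > 0" and co: "!!u g v h. Adm u g v h ==> k * (msq g + msq h) <= J u g v h + \<beta> * K * msq v"
  unfolding J_def I_def Adm_def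
  apply (rule coercive[OF q GN c(1-3) less_imp_le[OF c(4)] c(5-8)], assumption)
  subgoal premises p for k K by (rule p(1)[OF p(2), of K]) (use p(3) in "auto simp: Adm_def J_def I_def")
  done
 \<comment> \<open>The estimate for the energy without its cubic term, which will exclude
   \<open>u = 0\<close>.\<close>
 obtain k' where k': "k' > 0" and co': "!!u g v h. Adm u g v h ==> k' * (msq g + msq h) <=
   1/2 * (msq g + msq h) - (LBINT x. Fq (\<mu>1/4) (\<mu>2/4) (\<rho>/2) 0 (u x) (v x))"
  unfolding Adm_def
  apply (rule coercive[OF q GN c(1-3) order_refl c(5-8)], assumption)
  subgoal premises p for k K by (rule p(1)[OF p(2)]) (use p(3) in "auto simp: Adm_def")
  done
 define E where "E = \<beta> * \<bar>K\<bar> * m2"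
 have low: "k * (msq g + msq h) <= J u g v h + E" if a: "Adm u g v h" for u g v h
 proof -
  have "\<beta> * K * msq v <= E" unfolding E_def using a c by (intro mult_mono mult_left_mono) (auto simp: Adm_def)
  then show ?thesis using co[OF a] by linarith
 qed
 define S where "S = {J u g v h | u g v h. Adm u g v h}"
 have bdd: "bdd_below S"
 proof (rule bdd_belowI[of _ "- E"])
  fix y assume "y \<in> S"
  then obtain u g v h where a: "Adm u g v h" "y = J u g v h" by (auto simp: S_def)
  have "0 <= k * (msq g + msq h)" using k by simp
  then show "- E <= y" using low[OF a(1)] a(2) by linarith
 qed
 define m0 where "m0 = Inf S"
 have m0: "m0 <= J u g v h" if "Adm u g v h" for u g v h unfolding m0_def using that bdd by (intro cInf_lower) (auto simp: S_def)
 have neg: "\<exists>u g v h. Adm u g v h & J u g v h < 0"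
 proof -
  \<comment> \<open>\<open>c1\<close> and \<open>c2\<close> give \<open>R\<close> the masses
    \<open>m1\<close> and \<open>m2\<close>; \<open>s\<close> minimizes the quadratic
    \<open>1/2 * (m1 + m2) * s^2 - s * D\<close>, whose minimum is negative.\<close>
  define c1 c2 T D s where "c1 = sqrt (m1 / q)" and "c2 = sqrt (m2 / q)" and "T = (LBINT x. R x ^ 3)"
   and "D = Fq 0 0 0 (\<beta>/2) c1 c2 * T" and "s = D / (m1 + m2)"
  have c12: "c1 > 0" "c2 > 0" "c1^2 = m1 / q" "c2^2 = m2 / q" using c q by (auto simp: c1_def c2_def)
  have T: "T > 0"
  proof (rule ccontr)
   assume "\<not> 0 < T"
   moreover have "0 <= T" unfolding T_def using R(2) by (intro Bochner_Integration.integral_nonneg zero_le_power)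
   ultimately have "T = 0" by linarith
   then have "AE x in lborel. R x ^ 3 = 0"
    using integral_nonneg_eq_0_iff_AE[of lborel "\<lambda>x. R x ^ 3"] sob_int34(1)[OF R(1,1,1,1)] R(2) by (simp add: T_def power3_eq_cube)
   then have "(LBINT x. (R x)^2) = 0" by (intro integral_eq_zero_AE) simp
   then show False using R(3) q by (simp add: msq_real)
  qed
  have D: "D > 0" and s: "s > 0" using c(4-6) c12 T q by (auto simp: D_def s_def Fq_def)
  note w = dilated_pair[OF R(1) s]
  let ?u = "\<lambda>x. (c1 * s) * R (s *\<^sub>R x)" and ?v = "\<lambda>x. (c2 * s) * R (s *\<^sub>R x)"
  let ?g = "\<lambda>x. (c1 * s) *\<^sub>R (s *\<^sub>R r (s *\<^sub>R x))" and ?h = "\<lambda>x. (c2 * s) *\<^sub>R (s *\<^sub>R r (s *\<^sub>R x))"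
  have ms: "msq ?u = m1" "msq ?v = m2" "msq ?g = s^2 * m1" "msq ?h = s^2 * m2" unfolding w(2,3) R c12 using q by simp_all
  have "0 <= s^2 * (Fq (\<mu>1/4) (\<mu>2/4) (\<rho>/2) 0 c1 c2 * (LBINT x. R x ^ 4))" using c c12 by (simp add: Fq_def)
  then have "J ?u ?g ?v ?h <= 1/2 * (s^2 * m1 + s^2 * m2) - s * D" unfolding J_def ms I_def w(4) D_def T_def by linarith
  also have "\<dots> = s * (1/2 * ((m1 + m2) * s) - D)" by (simp add: power2_eq_square algebra_simps)
  also have "\<dots> = s * (- D / 2)" using c by (simp add: s_def)
  also have "\<dots> < 0" using s D by simp
  finally have "J ?u ?g ?v ?h < 0" .
  moreover have "Adm ?u ?g ?v ?h" unfolding Adm_def ms using w(1) by simp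
  ultimately show ?thesis by blast
 qed
 then have m0neg: "m0 < 0" using m0 by fastforce
 have "\<exists>u g v h. Adm u g v h & J u g v h < m0 + 1 / real (Suc n)" for n
 proof -
  have "\<exists>y\<in>S. y < m0 + 1 / real (Suc n)" using cInf_less_iff[OF _ bdd, of "m0 + 1 / real (Suc n)"] neg by (auto simp: m0_def S_def)
  then show ?thesis by (auto simp: S_def)
 qed
 then obtain U G V H where UV: "!!n. Adm (U n) (G n) (V n) (H n)" "!!n. J (U n) (G n) (V n) (H n) < m0 + 1 / real (Suc n)" by metis
 define Bd where "Bd = (m0 + 1 + E) / k"
 have GH: "msq (G n) <= Bd" "msq (H n) <= Bd" for n
 proof -
  have "1 / real (Suc n) <= 1" by simp
  then have "k * (msq (G n) + msq (H n)) <= m0 + 1 + E" using low[OF UV(1)[of n]] UV(2)[of n] by linarith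
  then have "msq (G n) + msq (H n) <= Bd" using k by (simp add: Bd_def pos_le_divide_eq mult.commute)
  then show "msq (G n) <= Bd" "msq (H n) <= Bd" using msq_nonneg[of "G n"] msq_nonneg[of "H n"] by linarith+
 qed
 have UVs: "sob (U n) (G n)" "sob (V n) (H n)" "msq (U n) <= m1" "msq (V n) <= m2" for n using UV(1)[of n] by (auto simp: Adm_def)
 obtain u g v h where s: "sob u g" "sob v h" and nn: "!!x. u x >= 0" "!!x. v x >= 0" and rad: "radial_dec u" "radial_dec v"
  and ap: "!!e N. e > 0 ==> \<exists>n\<ge>N. msq u <= msq (U n) + e & msq v <= msq (V n) + e & msq g <= msq (G n) + e & msq h <= msq (H n) + e &
    I (U n) (V n) <= I u v + e"
  unfolding I_def
  by (rule compact_limit[where u=U and v=V and g=G and h=H and A="max m1 m2" and B=Bd and ?a1.0="\<mu>1/4" and ?a2.0="\<mu>2/4" and r="\<rho>/2" and b="\<beta>/2", OF _ _ _ _ UVs(1,2) _ _ GH])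
   (use c UVs(3,4) in "auto simp: le_max_iff_disj")
 have mm: "msq u <= m1" "msq v <= m2"
 proof -
  show "msq u <= m1"
  proof (rule field_le_epsilon)
   fix e :: real assume "e > 0" then show "msq u <= m1 + e" using ap[of e 0] UVs(3) by (meson add_right_mono order_trans)
  qed
  show "msq v <= m2"
  proof (rule field_le_epsilon)
   fix e :: real assume "e > 0" then show "msq v <= m2 + e" using ap[of e 0] UVs(4) by (meson add_right_mono order_trans)
  qed
 qed
 have adm: "Adm u g v h" using s mm by (simp add: Adm_def)
 have Jm: "J u g v h <= m0"
 proof (rule field_le_epsilon)
  fix e :: real assume e: "e > 0"
  obtain N where N: "1 / real (Suc N) < e / 2" using e nat_approx_posE[of "e / 2"] by auto
  obtain n where n: "n >= N" "msq g <= msq (G n) + e / 4" "msq h <= msq (H n) + e / 4" "I (U n) (V n) <= I u v + e / 4" using ap[of "e / 4" N] e by auto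
  have "1 / real (Suc n) <= 1 / real (Suc N)" using n(1) by (intro divide_left_mono) auto
  then show "J u g v h <= m0 + e" using UV(2)[of n] n N unfolding J_def distrib_left by linarith
 qed
 have min: "J u g v h <= J u' g' v' h'" if "Adm u' g' v' h'" for u' g' v' h' using Jm m0[OF that] by linarith
 have Jneg: "J u g v h < 0" using Jm m0neg by linarith
 \<comment> \<open>If \<open>v\<close> had mass zero, the remainder in \<open>co\<close> would
   vanish and the energy would be nonnegative.\<close>
 have v0: "msq v > 0"
 proof (rule ccontr)
  assume "\<not> 0 < msq v"
  then have "msq v = 0" using msq_nonneg[of v] by linarith
  moreover have "0 <= k * (msq g + msq h)" using k by simp
  ultimately show False using co[OF adm] Jneg by simp
 qed
 \<comment> \<open>If \<open>u\<close> had mass zero, the cubic term would vanish and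
   \<open>co'\<close> would make the energy nonnegative.\<close>
 have u0: "msq u > 0"
 proof (rule ccontr)
  assume "\<not> 0 < msq u"
  then have "(LBINT x. (u x)^2) = 0" using msq_nonneg[of u] unfolding msq_real by linarith
  then have "AE x in lborel. (u x)^2 = 0" using integral_nonneg_eq_0_iff_AE[OF ltwo_int_real[OF sob_ltwo(1)[OF s(1)]]] by simp
  then have "AE x in lborel. Fq (\<mu>1/4) (\<mu>2/4) (\<rho>/2) (\<beta>/2) (u x) (v x) = Fq (\<mu>1/4) (\<mu>2/4) (\<rho>/2) 0 (u x) (v x)"
   by eventually_elim (simp add: Fq_def)
  then have "I u v = (LBINT x. Fq (\<mu>1/4) (\<mu>2/4) (\<rho>/2) 0 (u x) (v x))"
   unfolding I_def by (rule integral_cong_AE[rotated 2]) (use s[THEN sob_borel] in measurable)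
  moreover have "0 <= k' * (msq g + msq h)" using k' by simp
  ultimately show False using co'[OF adm] Jneg unfolding J_def by linarith
 qed
 note i2 = sob_int34(3) and i3 = sob_int34(4)
 have "ltwo (\<lambda>x. \<beta> * (u x * v x) + \<mu>1 * (u x * u x * u x) + \<rho> * (v x * v x * u x))"
  by (intro ltwo_add ltwo_cmult i2[OF s s] i3[OF s(1,1,1,1)] i3[OF s(2,2,1,1)])
 then have F1: "ltwo (f1 u v)" by (simp add: f1_def[abs_def] power2_eq_square power3_eq_cube mult_ac)
 have "ltwo (\<lambda>x. \<beta>/2 * (u x * u x) + \<mu>2 * (v x * v x * v x) + \<rho> * (u x * u x * v x))"
  by (intro ltwo_add ltwo_cmult i2[OF s(1,1,1,1)] i3[OF s(2,2,2,2)] i3[OF s(1,1,2,2)])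
 then have F2: "ltwo (f2 u v)" by (simp add: f2_def[abs_def] power2_eq_square power3_eq_cube mult_ac)
 have var: "(LBINT x. f1 u v x * p x) + (LBINT x. f2 u v x * w x) <= (LBINT x. g x \<bullet> p' x) + (LBINT x. h x \<bullet> w' x)"
  if p: "sob p p'" "sob w w'" and t: "!!t. 0 < t ==> t <= 1 ==> msq (\<lambda>x. u x + t * p x) <= m1 & msq (\<lambda>x. v x + t * w x) <= m2" for p p' w w'
 proof -
  define X where "X = (LBINT x. dFq (\<mu>1/4) (\<mu>2/4) (\<rho>/2) (\<beta>/2) (u x) (v x) (p x) (w x))"
  obtain d2 d3 d4 where e: "!!t. I (\<lambda>x. u x + t * p x) (\<lambda>x. v x + t * w x) = I u v + t * X + t^2 * (d2 + t * d3 + t^2 * d4)"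
   unfolding I_def X_def by (rule Fq_expand[OF s p, of "\<mu>1/4" "\<mu>2/4" "\<rho>/2" "\<beta>/2"]) blast
  have "X = (LBINT x. f1 u v x * p x + f2 u v x * w x)" unfolding X_def dFq_def f1_def f2_def
   by (rule bochner_cong) (auto simp: power2_eq_square power3_eq_cube algebra_simps)
  then have X: "X = (LBINT x. f1 u v x * p x) + (LBINT x. f2 u v x * w x)"
   using ltwo_mult[OF F1 sob_ltwo(1)[OF p(1)]] ltwo_mult[OF F2 sob_ltwo(1)[OF p(2)]] by simp
  let ?P = "(LBINT x. g x \<bullet> p' x) + (LBINT x. h x \<bullet> w' x)"
  have "X - ?P <= 0"
  proof (rule one_sided)
   fix t :: real assume t': "0 < t" "t <= 1"
   have "J u g v h <= J (\<lambda>x. u x + t * p x) (\<lambda>x. g x + t *\<^sub>R p' x) (\<lambda>x. v x + t * w x) (\<lambda>x. h x + t *\<^sub>R w' x)"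
    unfolding Adm_def by (rule min) (use t[OF t'] sob_add[OF s(1) sob_cmult[OF p(1)]] sob_add[OF s(2) sob_cmult[OF p(2)]] in "simp add: Adm_def")
   then show "t * (X - ?P) <= t^2 * ((1/2 * (msq p' + msq w') - d2) + t * (- d3) + t^2 * (- d4))"
    unfolding J_def e msq_add_scale[OF sob_ltwo(2)[OF s(1)] sob_ltwo(2)[OF p(1)]] msq_add_scale[OF sob_ltwo(2)[OF s(2)] sob_ltwo(2)[OF p(2)]]
    by (simp add: algebra_simps add_divide_distrib)
  qed
  then show ?thesis using X by simp
 qed
 \<comment> \<open>The zero direction, which allows varying one component at a time.\<close>
 have z: "sob (\<lambda>x. 0 * R x) (\<lambda>x. 0 *\<^sub>R r x)" by (rule sob_cmult[OF R(1)])
 obtain l1 where l1: "!!p p'. sob p p' ==> (LBINT x. g x \<bullet> p' x) + l1 * (LBINT x. u x * p x) = (LBINT x. f1 u v x * p x)" "l1 = 0 \<or> msq u = m1"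
 proof (rule el_multiplier[OF s(1) F1 u0 mm(1)])
  fix p p' assume p: "sob p p'" and "!!t. 0 < t ==> t <= 1 ==> msq (\<lambda>x. u x + t * p x) <= m1"
  then show "(LBINT x. f1 u v x * p x) <= (LBINT x. g x \<bullet> p' x)" using var[OF p z] mm by simp
 qed blast
 obtain l2 where l2: "!!p p'. sob p p' ==> (LBINT x. h x \<bullet> p' x) + l2 * (LBINT x. v x * p x) = (LBINT x. f2 u v x * p x)" "l2 = 0 \<or> msq v = m2"
 proof (rule el_multiplier[OF s(2) F2 v0 mm(2)])
  fix p p' assume p: "sob p p'" and "!!t. 0 < t ==> t <= 1 ==> msq (\<lambda>x. v x + t * p x) <= m2"
  then show "(LBINT x. f2 u v x * p x) <= (LBINT x. h x \<bullet> p' x)" using var[OF z p] mm by simp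
 qed blast
 have f1: "\<mu>1 * u x ^ 3 <= f1 u v x" "0 <= f1 u v x" and f2: "\<mu>2 * v x ^ 3 <= f2 u v x" "0 <= f2 u v x" for x
  using c nn[of x] by (auto simp: f1_def f2_def)
 have lt: "L1 (\<lambda>x. f x * \<phi> x)" if "ltwo f" "test_function \<phi>" for f \<phi> :: "real^2 => real" using that by (rule test_integrable_mult)
 have l1': "msq u = m1"
 proof (rule ccontr)
  assume "msq u \<noteq> m1" then have "l1 = 0" using l1(2) by simp
  then have "msq u = 0" using l1(1)[OF sob_test] F1 by (intro liouville[OF s(1) nn(1) _ f1(1) c(1)]) (auto intro: lt simp: ltwo_borel)
  then show False using u0 by simp
 qed
 have l2': "msq v = m2"
 proof (rule ccontr)
  assume "msq v \<noteq> m2" then have "l2 = 0" using l2(2) by simp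
  then have "msq v = 0" using l2(1)[OF sob_test] F2 by (intro liouville[OF s(2) nn(2) _ f2(1) c(2)]) (auto intro: lt simp: ltwo_borel)
  then show False using v0 by simp
 qed
 show ?thesis
 proof (rule that[OF s l1' l2'])
  show "AE x in lborel. u x > 0" by (rule radial_dec_positive[OF s(1) nn(1) rad(1) u0 f1(2) l1(1)[OF sob_test]])
  show "AE x in lborel. v x > 0" by (rule radial_dec_positive[OF s(2) nn(2) rad(2) v0 f2(2) l2(1)[OF sob_test]])
  show "1/2 * (msq g + msq h) - I u v < 0" using Jneg by (simp add: J_def)
  show "1/2 * (msq g + msq h) - I u v <= 1/2 * (msq g' + msq h') - I u' v'" if "sob u' g'" "sob v' h'" "msq u' = m1" "msq v' = m2" for u' g' v' h'
   using min[of u' g' v' h'] that by (simp add: J_def Adm_def)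
 qed (use l1(1)[OF sob_test] l2(1)[OF sob_test] in auto)
qed

section \<open>The Pohozaev identity\<close>

lemma inner_conv2:
 fixes f g :: "nat => 'a::euclidean_space => 'b::euclidean_space"
 assumes l: "!!n. ltwo (f n)" "ltwo f'" "!!n. ltwo (g n)" "ltwo g'"
  and c: "l2lim f f'" "l2lim g g'"
 shows "(\<lambda>n. LBINT x. f n x \<bullet> g n x) ----> (LBINT x. f' x \<bullet> g' x)"
proof -
 have a: "(\<lambda>n. sqrt (msq (f n) * msq (\<lambda>x. g n x - g' x))) ----> sqrt (msq f' * 0)"
  by (intro tendsto_intros msq_conv l c)
 have b: "norm (LBINT x. f n x \<bullet> (g n x - g' x)) <= sqrt (msq (f n) * msq (\<lambda>x. g n x - g' x))" for n
  using cauchy_schwarz_abs[OF l(1) ltwo_minus[OF l(3,4)]] by simp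
 have "(\<lambda>n. LBINT x. f n x \<bullet> (g n x - g' x)) ----> 0"
  by (rule Lim_null_comparison[OF always_eventually[OF allI[OF b]]]) (use a in simp)
 from tendsto_add[OF this inner_conv[OF l(1,2,4) c(1)]] show ?thesis
  using ltwo_inner[OF l(1,3)] ltwo_inner[OF l(1,4)] by (simp add: inner_diff_right)
qed

text \<open>A second derivative is computed with one derivative on the kernel and the other on
  \<open>u\<close>; both orders lead to the same convolution, which is the symmetry used in
  \<open>smooth_pohozaev\<close>.\<close>

lemma moll_mixed:
 fixes u :: "real^2 => real"
 assumes s: "sob u g" and K: "test_function K" and e: "e \<in> Basis" "e' \<in> Basis"
 shows "pd e' (pd e (moll K u)) x = pd e (pd e' (moll K u)) x" "pd e (pd e (moll K u)) x = moll (pd e K) (\<lambda>y. g y \<bullet> e) x"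
proof -
 have 1: "pd b (moll L u) x = moll L (\<lambda>y. g y \<bullet> b) x" if "test_function L" "b \<in> Basis" for L b x
  using sob_moll_grad[OF s that(1), of x] grad_inner_Basis[OF that(2), of "moll L u" x] moll_component[OF that(1) sob_ltwo(2)[OF s], of x b] by simp
 have 2: "pd a (moll L u) = moll (pd a L) u" if "test_function L" "a \<in> Basis" for L a
  using moll_pd[OF that(1) sob_ltwo(1)[OF s] that(2)] by auto
 have 3: "pd a (pd b (moll K u)) x = moll (pd a K) (\<lambda>y. g y \<bullet> b) x" if "a \<in> Basis" "b \<in> Basis" for a b
 proof -
  have "pd b (moll K u) = moll K (\<lambda>y. g y \<bullet> b)" using 1[OF K that(2)] by auto
  then show ?thesis using moll_pd[OF K ltwo_component[OF sob_ltwo(2)[OF s]] that(1)] by simp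
 qed
 show "pd e' (pd e (moll K u)) x = pd e (pd e' (moll K u)) x"
  unfolding 3[OF e] 2[OF K e(1)] 1[OF test_pd[OF K e(1)] e(2)] ..
 show "pd e (pd e (moll K u)) x = moll (pd e K) (\<lambda>y. g y \<bullet> e) x" by (rule 3[OF e(1) e(1)])
qed

text \<open>The weak equation tested with the reflected kernel is the pointwise equation of the
  mollification.\<close>

lemma moll_equation:
 fixes u :: "real^2 => real"
 assumes s: "sob u g" and K: "test_function K"
  and eq: "!!\<phi>. test_function \<phi> ==> (LBINT x. g x \<bullet> grad \<phi> x) = (LBINT x. F x * \<phi> x)"
 shows "lap (moll K u) x = - moll K F x"
proof -
 have pdK: "pd e (\<lambda>y. K (x - y)) y = - pd e K (x - y)" for e y
  using pd_affine[of K x "-1" y e] test_differentiable[OF K] by simp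
 have i: "L1 (\<lambda>y. pd e K (x - y) * (g y \<bullet> e))" if "e \<in> Basis" for e
  using moll_integrable[OF test_pd[OF K that] ltwo_component[OF sob_ltwo(2)[OF s], of e], of x] by simp
 have "lap (moll K u) x = (LBINT y. pd ex K (x - y) * (g y \<bullet> ex) + pd ey K (x - y) * (g y \<bullet> ey))"
  unfolding lap_def moll_mixed(2)[OF s K ex_ey_Basis(1) ex_ey_Basis(1)] moll_mixed(2)[OF s K ex_ey_Basis(2) ex_ey_Basis(2)]
  using i by (simp add: moll_def)
 also have "\<dots> = - (LBINT y. g y \<bullet> grad (\<lambda>y. K (x - y)) y)"
  by (simp add: grad_pd Basis_R2 pdK inner_diff_right inner_add_right add.commute flip: Bochner_Integration.integral_minus)
 also have "\<dots> = - moll K F x" unfolding eq[OF test_reflect[OF K]] by (simp add: moll_def mult.commute)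
 finally show ?thesis .
qed

text \<open>Integrating the derivatives of \<open>pd b w * pd d w * X\<close> relates the integrals
  \<open>?A\<close>, with a derivative on \<open>X\<close>, to \<open>?B\<close>, with a second
  derivative on \<open>w\<close>. By symmetry of mixed derivatives the latter combine to
  \<open>lap w * pd e w\<close>. This is the divergence identity of the stress tensor of
  \<open>w\<close>.\<close>

lemma smooth_pohozaev:
 fixes w :: "real^2 => real"
 assumes w: "!!k. Ck k w" and mix: "!!e e' x. e \<in> Basis ==> e' \<in> Basis ==> pd e' (pd e w) x = pd e (pd e' w) x"
  and X: "test_function X" and e: "e \<in> Basis"
 shows "(LBINT x. (grad w x \<bullet> grad X x) * (grad w x \<bullet> e)) - 1/2 * (LBINT x. pd e X x * (norm (grad w x))^2)
  = - (LBINT x. (lap w x * X x) * (grad w x \<bullet> e))"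
proof -
 have wC: "Ck k (pd b w)" if "b \<in> Basis" for b k using w[of "Suc k"] that by (simp add: Ck_Suc_iff)
 have wd: "pd b w differentiable at x" if "b \<in> Basis" for b x using wC[OF that, of "Suc 0"] by (simp add: Ck_Suc_iff)
 have wCC: "Ck k (pd b (pd a w))" if "a \<in> Basis" "b \<in> Basis" for a b k using wC[OF that(1), of "Suc k"] that by (simp add: Ck_Suc_iff)
 have Xp: "test_function (pd b X)" if "b \<in> Basis" for b by (rule test_pd[OF X that])
 have T: "test_function (\<lambda>x. (pd a w x * pd b w x) * X x)" if "a \<in> Basis" "b \<in> Basis" for a b
  by (intro test_smooth_mult Ck_mult wC that X)
 have P: "pd a (\<lambda>x. (pd b w x * pd d w x) * X x) x = pd b w x * pd d w x * pd a X x + (pd b w x * pd a (pd d w) x + pd a (pd b w) x * pd d w x) * X x"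
  if "b \<in> Basis" "d \<in> Basis" for a b d x
  using wd[OF that(1)] wd[OF that(2)] by (simp add: pd_mult test_differentiable[OF X] differentiable_mult)
 have Z: "(LBINT x. pd b w x * pd d w x * pd a X x + (pd b w x * pd a (pd d w) x + pd a (pd b w) x * pd d w x) * X x) = 0"
  if "a \<in> Basis" "b \<in> Basis" "d \<in> Basis" for a b d
  using test_pd_integral_0[OF T[OF that(2,3)] that(1)] unfolding P[OF that(2,3)] .
 have I1: "L1 (\<lambda>x. pd b w x * pd d w x * pd a X x)" if "a \<in> Basis" "b \<in> Basis" "d \<in> Basis" for a b d
  using test_integrable[OF test_smooth_mult[OF _ Xp[OF that(1)], of "\<lambda>x. pd b w x * pd d w x"]] Ck_mult wC that by blast
 have I2: "L1 (\<lambda>x. (pd b w x * pd a (pd d w) x + pd a (pd b w) x * pd d w x) * X x)" if "a \<in> Basis" "b \<in> Basis" "d \<in> Basis" for a b d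
  by (intro test_integrable test_smooth_mult Ck_add Ck_mult wC wCC that X)
 have I3: "L1 (\<lambda>x. (pd b (pd a w) x * pd d w x) * X x)" if "a \<in> Basis" "b \<in> Basis" "d \<in> Basis" for a b d
  by (intro test_integrable test_smooth_mult Ck_mult wC wCC that X)
 let ?A = "\<lambda>a b d. LBINT x. pd b w x * pd d w x * pd a X x"
 let ?B = "\<lambda>a b d. LBINT x. (pd a (pd b w) x * pd d w x) * X x"
 have Z': "?A a b d + ?B a d b + ?B a b d = 0" if b: "a \<in> Basis" "b \<in> Basis" "d \<in> Basis" for a b d
  using Z[OF b] I1[OF b] I3[OF b(3,1,2)] I3[OF b(2,1,3)] by (simp add: algebra_simps)
 have gw: "grad w x \<bullet> v = pd ex w x * (v \<bullet> ex) + pd ey w x * (v \<bullet> ey)" for x v by (simp add: grad_pd Basis_R2 inner_add_right inner_commute)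
 note E = ex_ey_Basis
 have 1: "(LBINT x. (grad w x \<bullet> grad X x) * (grad w x \<bullet> e)) = ?A ex ex e + ?A ey ey e"
 proof -
  have "(grad w x \<bullet> grad X x) * (grad w x \<bullet> e) = pd ex w x * pd e w x * pd ex X x + pd ey w x * pd e w x * pd ey X x" for x
   unfolding grad_inner_Basis[OF e] by (simp add: gw grad_inner_Basis algebra_simps)
  then show ?thesis using I1[OF E(1) E(1) e] I1[OF E(2) E(2) e] by simp
 qed
 have 2: "(LBINT x. pd e X x * (norm (grad w x))^2) = ?A e ex ex + ?A e ey ey"
 proof -
  have "pd e X x * (norm (grad w x))^2 = pd ex w x * pd ex w x * pd e X x + pd ey w x * pd ey w x * pd e X x" for x
   unfolding power2_norm_eq_inner by (simp add: gw grad_inner_Basis algebra_simps)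
  then show ?thesis using I1[OF e E(1) E(1)] I1[OF e E(2) E(2)] by simp
 qed
 have 3: "(LBINT x. (lap w x * X x) * (grad w x \<bullet> e)) = ?B ex ex e + ?B ey ey e"
  using I3[OF E(1) E(1) e] I3[OF E(2) E(2) e] unfolding grad_inner_Basis[OF e] by (simp add: lap_def algebra_simps)
 have m: "?B a e a = ?B e a a" if "a \<in> Basis" for a using mix[OF e that] by simp
 show ?thesis unfolding 1 2 3 distrib_left
  using Z'[OF E(1) E(1) e] Z'[OF E(2) E(2) e] Z'[OF e E(1) E(1)] Z'[OF e E(2) E(2)] m[OF E(1)] m[OF E(2)] by linarith
qed

text \<open>After integration by parts the identity contains only the gradient and the right side
  \<open>F\<close>, which converge in \<open>L^2\<close> under mollification; second derivatives
  occur only for the mollified function.\<close>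

theorem local_pohozaev:
 fixes u :: "real^2 => real"
 assumes s: "sob u g" and F: "ltwo F"
  and eq: "!!\<phi>. test_function \<phi> ==> (LBINT x. g x \<bullet> grad \<phi> x) = (LBINT x. F x * \<phi> x)"
  and X: "test_function X" and e: "e \<in> Basis"
 shows "(LBINT x. (g x \<bullet> grad X x) * (g x \<bullet> e)) - 1/2 * (LBINT x. pd e X x * (norm (g x))^2) = (LBINT x. (F x * X x) * (g x \<bullet> e))"
proof -
 define K where "K n = (kern (1 / real (Suc n)) :: real^2 => real)" for n
 have K: "test_function (K n)" for n unfolding K_def by (rule kern_test) simp
 note g = sob_ltwo(2)[OF s]
 have Gl: "ltwo (moll (K n) g)" "ltwo (moll (K n) F)" for n unfolding K_def by (intro moll_ltwo kern_test g F; simp)+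
 have Gc: "(\<lambda>n. msq (\<lambda>x. moll (K n) g x - g x)) ----> 0" "(\<lambda>n. msq (\<lambda>x. moll (K n) F x - F x)) ----> 0"
  unfolding K_def by (rule moll_conv[OF g] moll_conv[OF F])+
 obtain B where B: "!!x. \<bar>X x\<bar> <= B" using test_bounded[OF X] by metis
 obtain C where C: "!!x. norm (grad X x) <= C" using test_grad_bounded[OF X] by metis
 obtain D where D: "!!x. \<bar>pd e X x\<bar> <= D" using test_bounded[OF test_pd[OF X e]] by metis
 note [measurable] = test_borel[OF X] test_grad_borel[OF X] test_borel[OF test_pd[OF X e]]
 have dom: "ltwo (\<lambda>x. T (f x) x)" if f: "ltwo f" and m: "(\<lambda>x. T (f x) x) \<in> BM" and T: "!!y x. norm (T y x) <= M * norm y"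
  for f :: "real^2 => 'b::euclidean_space" and T :: "'b => real^2 => 'c::euclidean_space" and M
 proof (rule ltwo_bound[OF m])
  show "L1 (\<lambda>x. M^2 * (norm (f x))^2)" using ltwo_int[OF f] by simp
  have "(norm (T (f x) x))^2 <= (M * norm (f x))^2" for x by (intro power_mono T) auto
  then show "AE x in lborel. (norm (T (f x) x))^2 <= M^2 * (norm (f x))^2" by (simp add: power_mult_distrib)
 qed
 \<comment> \<open>\<open>T\<close> stands for multiplication by a bounded coefficient; linearity
   and one bound give convergence of all four factors below.\<close>
 have conv: "(\<lambda>n. msq (\<lambda>x. T (f n x) x - T (f' x) x)) ----> 0"
  if f: "!!n. ltwo (f n)" "ltwo f'" "l2lim f f'"
   and m: "!!h. ltwo h ==> (\<lambda>x. T (h x) x) \<in> BM" and T: "!!y x. norm (T y x) <= M * norm y"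
   and lin: "!!y z x. T (y - z) x = T y x - T z x"
  for f :: "nat => real^2 => 'b::euclidean_space" and f' and T :: "'b => real^2 => 'c::euclidean_space" and M
 proof (rule Lim_null_comparison)
  show "(\<lambda>n. M^2 * msq (\<lambda>x. f n x - f' x)) ----> 0" using tendsto_mult[OF tendsto_const f(3), of "M^2"] by simp
  show "\<forall>\<^sub>F n in sequentially. norm (msq (\<lambda>x. T (f n x) x - T (f' x) x)) <= M^2 * msq (\<lambda>x. f n x - f' x)"
  proof (intro always_eventually allI)
   fix n
   note d = ltwo_minus[OF f(1,2), of n]
   have "msq (\<lambda>x. T (f n x - f' x) x) <= (LBINT x. M^2 * (norm (f n x - f' x))^2)" unfolding msq_def
   proof (rule integral_mono)
    show "L1 (\<lambda>x. (norm (T (f n x - f' x) x))^2)" by (rule ltwo_int[OF dom[OF d m[OF d] T]])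
    show "L1 (\<lambda>x. M^2 * (norm (f n x - f' x))^2)" using ltwo_int[OF d] by simp
    show "(norm (T (f n x - f' x) x))^2 <= M^2 * (norm (f n x - f' x))^2" for x
     unfolding power_mult_distrib[symmetric] by (intro power_mono T) auto
   qed
   then show "norm (msq (\<lambda>x. T (f n x) x - T (f' x) x)) <= M^2 * msq (\<lambda>x. f n x - f' x)" by (simp add: lin msq_def)
  qed
 qed
 have ne: "norm e = 1" using e by simp
 have t1: "norm (y \<bullet> grad X x) <= C * norm y" for y x
  using Cauchy_Schwarz_ineq2[of y "grad X x"] mult_left_mono[OF C[of x] norm_ge_zero[of y]] by (simp add: mult.commute)
 have t2: "norm (y \<bullet> e) <= 1 * norm y" for y using Cauchy_Schwarz_ineq2[of y e] ne by simp
 have t3: "norm (pd e X x *\<^sub>R y) <= D * norm y" for x and y :: "real^2" using mult_right_mono[OF D[of x] norm_ge_zero[of y]] by simp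
 have t4: "norm (y * X x) <= B * norm y" for x and y :: real using mult_right_mono[OF B[of x] abs_ge_zero[of y]] by (simp add: abs_mult mult.commute)
 note m = ltwo_borel[measurable_dest]
 have m1: "(\<lambda>x. h x \<bullet> grad X x) \<in> BM" "(\<lambda>x. h x \<bullet> e) \<in> BM" "(\<lambda>x. pd e X x *\<^sub>R h x) \<in> BM"
  if "ltwo h" for h :: "real^2 => real^2" using ltwo_borel[OF that] by measurable
 have m4: "(\<lambda>x. h x * X x) \<in> BM" if "ltwo h" for h using ltwo_borel[OF that] by measurable

 note c1 = conv[of _ _ "\<lambda>y x. y \<bullet> grad X x", OF Gl(1) g Gc(1) m1(1) t1 inner_diff_left]
 have l1: "ltwo (\<lambda>x. h x \<bullet> grad X x)" if "ltwo h" for h by (rule dom[of _ "\<lambda>y x. y \<bullet> grad X x", OF that m1(1)[OF that] t1])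
 note c2 = conv[of _ _ "\<lambda>y x. y \<bullet> e", OF Gl(1) g Gc(1) m1(2) t2 inner_diff_left]
 have l2: "ltwo (\<lambda>x. h x \<bullet> e)" if "ltwo h" for h :: "real^2 => real^2" by (rule dom[of _ "\<lambda>y x. y \<bullet> e", OF that m1(2)[OF that] t2])
 note c3 = conv[of _ _ "\<lambda>y x. pd e X x *\<^sub>R y", OF Gl(1) g Gc(1) m1(3) t3 scaleR_diff_right]
 have l3: "ltwo (\<lambda>x. pd e X x *\<^sub>R h x)" if "ltwo h" for h :: "real^2 => real^2" by (rule dom[of _ "\<lambda>y x. pd e X x *\<^sub>R y", OF that m1(3)[OF that] t3])
 note c4 = conv[of _ _ "\<lambda>y x. y * X x", OF Gl(2) F Gc(2) m4 t4 left_diff_distrib]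
 have l4: "ltwo (\<lambda>x. h x * X x)" if "ltwo h" for h by (rule dom[of _ "\<lambda>y x. y * X x", OF that m4[OF that] t4])
 have L1: "(\<lambda>n. LBINT x. (moll (K n) g x \<bullet> grad X x) \<bullet> (moll (K n) g x \<bullet> e)) ----> (LBINT x. (g x \<bullet> grad X x) \<bullet> (g x \<bullet> e))"
  by (intro inner_conv2 l1 l2 Gl g c1 c2)
 have L2: "(\<lambda>n. LBINT x. (pd e X x *\<^sub>R moll (K n) g x) \<bullet> moll (K n) g x) ----> (LBINT x. (pd e X x *\<^sub>R g x) \<bullet> g x)"
  by (intro inner_conv2 l3 Gl g c3 Gc)
 have L3: "(\<lambda>n. LBINT x. (moll (K n) F x * X x) \<bullet> (moll (K n) g x \<bullet> e)) ----> (LBINT x. (F x * X x) \<bullet> (g x \<bullet> e))"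
  by (intro inner_conv2 l4 l2 Gl g F c4 c2)
 have lp: "lap (moll (K n) u) x = - moll (K n) F x" for n x by (rule moll_equation[OF s K]) (rule eq)
 have id: "(LBINT x. (moll (K n) g x \<bullet> grad X x) * (moll (K n) g x \<bullet> e)) - 1/2 * (LBINT x. pd e X x * (norm (moll (K n) g x))^2)
  = (LBINT x. (moll (K n) F x * X x) * (moll (K n) g x \<bullet> e))" for n
  using smooth_pohozaev[OF Ck_moll[OF K sob_ltwo(1)[OF s]] moll_mixed(1)[OF s K] X e, of n]
  unfolding sob_moll_grad[OF s K] lp by simp
 have "(LBINT x. (g x \<bullet> grad X x) \<bullet> (g x \<bullet> e)) - 1/2 * (LBINT x. (pd e X x *\<^sub>R g x) \<bullet> g x) = (LBINT x. (F x * X x) \<bullet> (g x \<bullet> e))"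
  by (rule LIMSEQ_unique[OF tendsto_diff[OF L1 tendsto_mult[OF tendsto_const L2]]]) (use L3 id in "simp add: power2_norm_eq_inner")
 then show ?thesis by (simp add: power2_norm_eq_inner)
qed

text \<open>For test functions this is the product rule; the majorants of
  \<open>sob_dominated_approx\<close> carry it to the limit. \<open>GG\<close> includes multiplier
  terms so that \<open>dG\<close> along the gradients becomes the full right side of the
  system.\<close>

lemma chain_rule:
 fixes u v :: "real^2 => real" and a1 a2 r b l1 l2 :: real
 assumes s: "sob u g" "sob v h" and X: "test_function X" and e: "e \<in> Basis"
 defines "GG \<equiv> \<lambda>s t. Fq a1 a2 r b s t + l1 * (s * s) + l2 * (t * t)"
  and "dG \<equiv> \<lambda>s t p q. dFq a1 a2 r b s t p q + 2 * l1 * (s * p) + 2 * l2 * (t * q)"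
 shows "(LBINT x. pd e X x * GG (u x) (v x)) = - (LBINT x. X x * dG (u x) (v x) (g x \<bullet> e) (h x \<bullet> e))"
proof -
 obtain P M where P: "!!n. test_function (P n)" "L1 M"
  "AE x in lborel. (\<lambda>n. P n x) ----> u x & (\<lambda>n. grad (P n) x) ----> g x & (\<forall>n. (P n x)^2 + (P n x)^6 + (norm (grad (P n) x))^2 <= M x)"
  by (rule sob_dominated_approx[OF s(1)]) blast
 obtain S N where S: "!!n. test_function (S n)" "L1 N"
  "AE x in lborel. (\<lambda>n. S n x) ----> v x & (\<lambda>n. grad (S n) x) ----> h x & (\<forall>n. (S n x)^2 + (S n x)^6 + (norm (grad (S n) x))^2 <= N x)"
  by (rule sob_dominated_approx[OF s(2)]) blast
 obtain B where B: "!!x. \<bar>X x\<bar> <= B" using test_bounded[OF X] by metis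
 obtain D where D: "!!x. \<bar>pd e X x\<bar> <= D" using test_bounded[OF test_pd[OF X e]] by metis
 define c where "c = \<bar>a1\<bar> + \<bar>a2\<bar> + \<bar>r\<bar> + \<bar>b\<bar> + \<bar>l1\<bar> + \<bar>l2\<bar>"
 have co: "\<bar>a1\<bar> <= c" "\<bar>a2\<bar> <= c" "\<bar>r\<bar> <= c" "\<bar>b\<bar> <= c" "\<bar>l1\<bar> <= c" "\<bar>l2\<bar> <= c" "0 <= c" by (simp_all add: c_def)
 have m: "\<bar>a * y\<bar> <= c * (k * W)" if "\<bar>a\<bar> <= c" "\<bar>y\<bar> <= k * W" for a y k W
  unfolding abs_mult using that co(7) by (intro mult_mono) auto
 \<comment> \<open>Six terms, three with the factor four and three with the factor two:
   \<open>3 * 4 + 3 * 2 = 18\<close>.\<close>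
 have Gb: "\<bar>GG p q\<bar> <= c * (18 * (wt p + wt q))" for p q
 proof -
  have w: "0 <= wt p" "0 <= wt q" by simp_all
  have "\<bar>p * p * p * p\<bar> <= 4 * (wt p + wt q)" "\<bar>q * q * q * q\<bar> <= 4 * (wt p + wt q)" "\<bar>p * p * q * q\<bar> <= 4 * (wt p + wt q)"
   "\<bar>p * p * q\<bar> <= 2 * (wt p + wt q)" "\<bar>p * p\<bar> <= 2 * (wt p + wt q)" "\<bar>q * q\<bar> <= 2 * (wt p + wt q)"
   using wt_bound4[of p p p p] wt_bound4[of q q q q] wt_bound4[of p p q q] wt_bound3[of p p q] wt_bound2[of p p] wt_bound2[of q q] w
   unfolding distrib_left by linarith+
  note b = m[OF co(1) this(1)] m[OF co(2) this(2)] m[OF co(3) this(3)] m[OF co(4) this(4)] m[OF co(5) this(5)] m[OF co(6) this(6)]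
  have "GG p q = a1 * (p * p * p * p) + a2 * (q * q * q * q) + r * (p * p * q * q) + b * (p * p * q) + l1 * (p * p) + l2 * (q * q)"
   by (simp add: GG_def Fq_def power2_eq_square power4_eq_xxxx mult.assoc)
  moreover have "c * (18 * (wt p + wt q)) = 3 * (c * (4 * (wt p + wt q))) + 3 * (c * (2 * (wt p + wt q)))" by (simp add: algebra_simps)
  ultimately show ?thesis using b by linarith
 qed
 \<comment> \<open>Each product is linear in \<open>y\<close> or \<open>z\<close>, so squares of
   these suffice. With their coefficients the eight products contribute \<open>31\<close>;
   \<open>50\<close> is a round upper bound.\<close>
 have dGb: "\<bar>dG p q y z\<bar> <= c * (50 * (wt p + wt q + y^2 + z^2))" for p q y z
 proof -
  let ?W = "wt p + wt q + y^2 + z^2"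
  have w: "0 <= wt p" "0 <= wt q" "0 <= y^2" "0 <= z^2" by simp_all
  have w2: "p^2 <= wt p" "q^2 <= wt q" by (simp_all add: wt_def)
  have ab: "\<bar>a * t\<bar> <= k / 2 * ?W" if "a^2 <= k * (wt p + wt q)" "t^2 <= y^2 + z^2" "k >= 1" for a t k
  proof -
   have "1 * (y^2 + z^2) <= k * (y^2 + z^2)" using that(3) by (intro mult_right_mono) auto
   then have "2 * (\<bar>a\<bar> * \<bar>t\<bar>) <= k * (wt p + wt q) + k * (y^2 + z^2)" using sum_squares_bound[of "\<bar>a\<bar>" "\<bar>t\<bar>"] that(1,2) by simp
   then show ?thesis by (simp add: abs_mult algebra_simps)
  qed
  have "\<bar>p * p * p * y\<bar> <= 4 / 2 * ?W" "\<bar>q * q * q * z\<bar> <= 4 / 2 * ?W" "\<bar>p * q * q * y\<bar> <= 4 / 2 * ?W" "\<bar>p * p * q * z\<bar> <= 4 / 2 * ?W"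
   "\<bar>p * q * y\<bar> <= 2 / 2 * ?W" "\<bar>p * p * z\<bar> <= 2 / 2 * ?W" "\<bar>p * y\<bar> <= 2 / 2 * ?W" "\<bar>q * z\<bar> <= 2 / 2 * ?W"
   using wt_bound6[of p p p] wt_bound6[of q q q] wt_bound6[of p q q] wt_bound6[of p p q] wt_bound44[of p q] wt_bound44[of p p] w w2
   by - (rule ab; (unfold distrib_left)?; linarith)+
  note b = m[OF co(1) this(1)] m[OF co(2) this(2)] m[OF co(3) this(3)] m[OF co(3) this(4)] m[OF co(4) this(5)] m[OF co(4) this(6)] m[OF co(5) this(7)] m[OF co(6) this(8)]
  have "dG p q y z = 4 * (a1 * (p * p * p * y)) + 4 * (a2 * (q * q * q * z)) + 2 * (r * (p * q * q * y)) + 2 * (r * (p * p * q * z))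
   + 2 * (b * (p * q * y)) + b * (p * p * z) + 2 * (l1 * (p * y)) + 2 * (l2 * (q * z))"
   by (simp add: dG_def dFq_def distrib_left)
  moreover have "0 <= c * ?W" using co(7) w by simp
  moreover note b[THEN abs_le_D1] b[THEN abs_le_D2]
  moreover have "c * (4 / 2 * ?W) = 2 * (c * ?W)" "c * (50 * ?W) = 50 * (c * ?W)" "c * (2 / 2 * ?W) = c * ?W" by simp_all
  ultimately show ?thesis by (intro abs_leI; linarith)
 qed
 have der: "pd e (\<lambda>x. X x * GG (P n x) (S n x)) x = pd e X x * GG (P n x) (S n x) + X x * dG (P n x) (S n x) (grad (P n) x \<bullet> e) (grad (S n) x \<bullet> e)" for n x
 proof (rule pd_eq[THEN trans])
  note d = test_has_derivative[OF X, of x] test_has_derivative[OF P(1), of n x] test_has_derivative[OF S(1), of n x]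
  show "((\<lambda>x. X x * GG (P n x) (S n x)) has_derivative (\<lambda>k. (grad X x \<bullet> k) * GG (P n x) (S n x) + X x * dG (P n x) (S n x) (grad (P n) x \<bullet> k) (grad (S n) x \<bullet> k))) (at x)"
   unfolding GG_def dG_def Fq_def dFq_def power4_eq_xxxx power2_eq_square
   by (rule derivative_eq_intros d refl | simp add: algebra_simps)+
 qed (simp add: grad_inner_Basis[OF e])
 have T: "test_function (\<lambda>x. X x * GG (P n x) (S n x))" for n
 proof -
  have "test_function (\<lambda>x. a1 * (P n x * P n x * P n x * P n x) + a2 * (S n x * S n x * S n x * S n x) + r * (P n x * P n x * (S n x * S n x)) + b * (P n x * P n x * S n x) + l1 * (P n x * P n x) + l2 * (S n x * S n x))"
   by (intro test_add test_cmult test_mult P S)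
  then show ?thesis using test_mult[OF X] by (simp add: GG_def Fq_def power4_eq_xxxx power2_eq_square mult.assoc)
 qed
 let ?h = "\<lambda>n x. pd e X x * GG (P n x) (S n x) + X x * dG (P n x) (S n x) (grad (P n) x \<bullet> e) (grad (S n) x \<bullet> e)"
 let ?l = "\<lambda>x. pd e X x * GG (u x) (v x) + X x * dG (u x) (v x) (g x \<bullet> e) (h x \<bullet> e)"
 have z: "(LBINT x. ?h n x) = 0" for n using test_pd_integral_0[OF T e] unfolding der .
 have BD: "0 <= B" "0 <= D" using B[of 0] D[of 0] by linarith+
 have lim: "aelim ?h ?l"
  using P(3) S(3)
 proof eventually_elim
  case (elim x)
  then show ?case unfolding GG_def dG_def Fq_def dFq_def by (intro tendsto_intros) auto
 qed
 have dom: "AE x in lborel. norm (?h n x) <= (D * (c * 18) + B * (c * 50)) * (M x + N x)" for n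
  using P(3) S(3)
 proof eventually_elim
  case (elim x)
  let ?p = "P n x" and ?q = "S n x" and ?y = "grad (P n) x \<bullet> e" and ?z = "grad (S n) x \<bullet> e"
  have "(?y)^2 <= (norm (grad (P n) x))^2" "(?z)^2 <= (norm (grad (S n) x))^2" using Basis_le_norm[OF e] by (simp_all add: abs_le_square_iff[symmetric])
  moreover have "(?p)^2 + ?p^6 + (norm (grad (P n) x))^2 <= M x" "(?q)^2 + ?q^6 + (norm (grad (S n) x))^2 <= N x" using elim by auto
  ultimately have W: "wt ?p + wt ?q + ?y^2 + ?z^2 <= M x + N x" by (simp add: wt_def)
  moreover have "0 <= ?y^2" "0 <= ?z^2" by simp_all
  ultimately have W': "wt ?p + wt ?q <= M x + N x" by linarith
  have "\<bar>pd e X x * GG ?p ?q\<bar> <= D * (c * (18 * (M x + N x)))" unfolding abs_mult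
   by (intro mult_mono D order_trans[OF Gb] mult_left_mono W' BD co(7)) auto
  moreover have "\<bar>X x * dG ?p ?q ?y ?z\<bar> <= B * (c * (50 * (M x + N x)))" unfolding abs_mult
   by (intro mult_mono B order_trans[OF dGb] mult_left_mono W BD co(7)) auto
  ultimately show ?case by (simp add: algebra_simps)
 qed
 note [measurable] = sob_borel[OF s(1)] sob_borel[OF s(2)] sob_borel'[OF s(1)] sob_borel'[OF s(2)] test_borel[OF X] test_borel[OF test_pd[OF X e]]
  test_borel[OF P(1)] test_borel[OF S(1)] test_grad_borel[OF P(1)] test_grad_borel[OF S(1)]
 have [measurable]: "(\<lambda>x. dG (a x) (b x) (c x) (d x)) \<in> BM"
  if [measurable]: "a \<in> BM" "b \<in> BM" "c \<in> BM" "d \<in> BM" for a b c d :: "real^2 => real"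
  unfolding dG_def dFq_def by measurable
 have [measurable]: "(\<lambda>x. GG (a x) (b x)) \<in> BM"
  if [measurable]: "a \<in> BM" "b \<in> BM" for a b :: "real^2 => real"
  unfolding GG_def by measurable
 have "(\<lambda>n. LBINT x. ?h n x) ----> (LBINT x. ?l x)"
  by (rule integral_dominated_convergence[where w="\<lambda>x. (D * (c * 18) + B * (c * 50)) * (M x + N x)"])
   (measurable, use P(2) S(2) lim dom in auto)
 then have l0: "(LBINT x. ?l x) = 0" unfolding z using LIMSEQ_unique tendsto_const by blast
 have W: "L1 (\<lambda>x. wt (u x) + wt (v x))" and W2: "L1 (\<lambda>x. wt (u x) + wt (v x) + (g x \<bullet> e)^2 + (h x \<bullet> e)^2)"
  using sob_wt[OF s(1)] sob_wt[OF s(2)] ltwo_int_real[OF ltwo_component[OF sob_ltwo(2)[OF s(1)]], of e] ltwo_int_real[OF ltwo_component[OF sob_ltwo(2)[OF s(2)]], of e] by simp_all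
 have i1: "L1 (\<lambda>x. pd e X x * GG (u x) (v x))"
 proof (rule integrable_dom[OF integrable_mult_right[OF W, of "D * (c * 18)"]])
  have bb: "\<bar>pd e X x * GG (u x) (v x)\<bar> <= D * (c * (18 * (wt (u x) + wt (v x))))" for x unfolding abs_mult by (intro mult_mono D Gb BD) auto
  show "AE x in lborel. norm (pd e X x * GG (u x) (v x)) <= norm (D * (c * 18) * (wt (u x) + wt (v x)))"
   by (simp only: real_norm_def mult.assoc) (intro AE_I2 order_trans[OF bb abs_ge_self])
 qed measurable
 have i2: "L1 (\<lambda>x. X x * dG (u x) (v x) (g x \<bullet> e) (h x \<bullet> e))"
 proof (rule integrable_dom[OF integrable_mult_right[OF W2, of "B * (c * 50)"]])
  have bb: "\<bar>X x * dG (u x) (v x) (g x \<bullet> e) (h x \<bullet> e)\<bar> <= B * (c * (50 * (wt (u x) + wt (v x) + (g x \<bullet> e)^2 + (h x \<bullet> e)^2)))" for x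
   unfolding abs_mult by (intro mult_mono B dGb BD) auto
  show "AE x in lborel. norm (X x * dG (u x) (v x) (g x \<bullet> e) (h x \<bullet> e)) <= norm (B * (c * 50) * (wt (u x) + wt (v x) + (g x \<bullet> e)^2 + (h x \<bullet> e)^2))"
   by (simp only: real_norm_def mult.assoc) (intro AE_I2 order_trans[OF bb abs_ge_self])
 qed measurable
 show ?thesis using l0 i1 i2 by simp
qed

text \<open>By scaling, \<open>x \<bullet> e\<close> times the derivative of \<open>cut n\<close> at
  \<open>x\<close> equals the same function for \<open>n = 0\<close> at \<open>x / (n + 1)\<close>;
  hence a bound independent of \<open>n\<close> although \<open>x\<close> is unbounded.\<close>

lemma cut_moment:
 fixes e b :: "real^2"
 assumes e: "e \<in> Basis" and b: "b \<in> Basis"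
 obtains B where "!!n x. \<bar>pd b (cut n) x * (x \<bullet> e)\<bar> <= B" "!!x. (\<lambda>n. pd b (cut n) x * (x \<bullet> e)) ----> 0"
proof -
 have T: "test_function (\<lambda>x. (x \<bullet> e) * pd b (cut 0) x)" by (intro test_smooth_mult Ck_inner test_pd cut_test b)
 obtain B where B: "!!x. \<bar>(x \<bullet> e) * pd b (cut 0) x\<bar> <= B" by (rule test_bounded[OF T]) blast
 show ?thesis
 proof (rule that)
  show "\<bar>pd b (cut n) x * (x \<bullet> e)\<bar> <= B" for n x
   using B[of "(1 / real (Suc n)) *\<^sub>R x"] unfolding cut_pd[of b n] by (simp add: mult_ac)
  show "(\<lambda>n. pd b (cut n) x * (x \<bullet> e)) ----> 0" for x
   using tendsto_mult[OF cut_pd_lim[OF b, of x] tendsto_const, of "x \<bullet> e"] by simp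
 qed
qed

text \<open>The local identity is used with \<open>X = (x \<bullet> e) * cut n\<close> for both
  coordinate directions, which amounts to the generator of dilations. In dimension two the Dirichlet
  terms cancel in the sum over \<open>e\<close> and the potential with its multipliers remains. The
  second identity is the system tested with its own solution.\<close>

theorem pohozaev:
 fixes u v :: "real^2 => real" and \<mu>1 \<mu>2 \<rho> \<beta> l1 l2 :: real
 defines "f1 \<equiv> \<lambda>u v x. \<beta> * u x * v x + \<mu>1 * u x ^ 3 + \<rho> * (v x)^2 * u (x :: real^2)"
  and "f2 \<equiv> \<lambda>u v x. \<beta>/2 * (u x)^2 + \<mu>2 * v x ^ 3 + \<rho> * (u x)^2 * v (x :: real^2)"
 assumes s: "sob u g" "sob v h"
  and eq1: "!!\<phi>. test_function \<phi> ==> (LBINT x. g x \<bullet> grad \<phi> x) + l1 * (LBINT x. u x * \<phi> x) = (LBINT x. f1 u v x * \<phi> x)"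
  and eq2: "!!\<phi>. test_function \<phi> ==> (LBINT x. h x \<bullet> grad \<phi> x) + l2 * (LBINT x. v x * \<phi> x) = (LBINT x. f2 u v x * \<phi> x)"
 shows "(LBINT x. Fq (\<mu>1/4) (\<mu>2/4) (\<rho>/2) (\<beta>/2) (u x) (v x)) = 1/2 * (l1 * msq u + l2 * msq v)"
  "msq g + msq h + l1 * msq u + l2 * msq v = (LBINT x. dFq (\<mu>1/4) (\<mu>2/4) (\<rho>/2) (\<beta>/2) (u x) (v x) (u x) (v x))"
proof -
 note i2 = sob_int34(3) and i3 = sob_int34(4)
 have "ltwo (\<lambda>x. \<beta> * (u x * v x) + \<mu>1 * (u x * u x * u x) + \<rho> * (v x * v x * u x))"
  by (intro ltwo_add ltwo_cmult i2[OF s s] i3[OF s(1,1,1,1)] i3[OF s(2,2,1,1)])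
 then have f1: "ltwo (f1 u v)" by (simp add: f1_def[abs_def] power2_eq_square power3_eq_cube mult_ac)
 have "ltwo (\<lambda>x. \<beta>/2 * (u x * u x) + \<mu>2 * (v x * v x * v x) + \<rho> * (u x * u x * v x))"
  by (intro ltwo_add ltwo_cmult i2[OF s(1,1,1,1)] i3[OF s(2,2,2,2)] i3[OF s(1,1,2,2)])
 then have f2: "ltwo (f2 u v)" by (simp add: f2_def[abs_def] power2_eq_square power3_eq_cube mult_ac)
 note ul = sob_ltwo(1)[OF s(1)] sob_ltwo(1)[OF s(2)] and gl = sob_ltwo(2)[OF s(1)] sob_ltwo(2)[OF s(2)]
 define F1 F2 where "F1 x = f1 u v x - l1 * u x" and "F2 x = f2 u v x - l2 * v x" for x
 have F: "ltwo F1" "ltwo F2" unfolding F1_def F2_def by (intro ltwo_minus ltwo_cmult f1 f2 ul)+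
 have E1: "(LBINT x. g x \<bullet> grad \<phi> x) = (LBINT x. F1 x * \<phi> x)" and E2: "(LBINT x. h x \<bullet> grad \<phi> x) = (LBINT x. F2 x * \<phi> x)"
  if t: "test_function \<phi>" for \<phi>
  using eq1[OF t] eq2[OF t] test_integrable_mult[OF f1 t] test_integrable_mult[OF f2 t] test_integrable_mult[OF ul(1) t] test_integrable_mult[OF ul(2) t]
  by (simp_all add: F1_def F2_def left_diff_distrib mult.assoc)
 have N: "msq g = (LBINT x. F1 x * u x)" "msq h = (LBINT x. F2 x * v x)"
  using weak_eq_extend[OF gl(1) F(1) E1 s(1)] weak_eq_extend[OF gl(2) F(2) E2 s(2)] by (simp_all add: msq_def power2_norm_eq_inner)
 have "(LBINT x. F1 x * u x) = (LBINT x. f1 u v x * u x) - l1 * msq u" "(LBINT x. F2 x * v x) = (LBINT x. f2 u v x * v x) - l2 * msq v"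
  using ltwo_mult[OF f1 ul(1)] ltwo_mult[OF f2 ul(2)] ltwo_mult[OF ul(1) ul(1)] ltwo_mult[OF ul(2) ul(2)]
  by (simp_all add: F1_def F2_def left_diff_distrib mult.assoc msq_real power2_eq_square)
 moreover have "(LBINT x. dFq (\<mu>1/4) (\<mu>2/4) (\<rho>/2) (\<beta>/2) (u x) (v x) (u x) (v x)) = (LBINT x. f1 u v x * u x + f2 u v x * v x)"
  by (rule bochner_cong) (auto simp: dFq_def f1_def f2_def power2_eq_square power3_eq_cube algebra_simps)
 ultimately show "msq g + msq h + l1 * msq u + l2 * msq v = (LBINT x. dFq (\<mu>1/4) (\<mu>2/4) (\<rho>/2) (\<beta>/2) (u x) (v x) (u x) (v x))"
  using N ltwo_mult[OF f1 ul(1)] ltwo_mult[OF f2 ul(2)] by simp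
 define GG where "GG x = Fq (\<mu>1/4) (\<mu>2/4) (\<rho>/2) (\<beta>/2) (u x) (v x) + (- l1/2) * (u x * u x) + (- l2/2) * (v x * v x)" for x
 define W where "W x = (norm (g x))^2 + (norm (h x))^2" for x
 note [measurable] = s[THEN sob_borel] s[THEN sob_borel']
 have GGi: "L1 GG" unfolding GG_def using Fq_int[OF s] sob_int2[OF s(1,1)] sob_int2[OF s(2,2)] by simp
 have Wi: "L1 W" unfolding W_def using ltwo_int[OF gl(1)] ltwo_int[OF gl(2)] by simp
 have [measurable]: "GG \<in> BM" "W \<in> BM" using GGi Wi by auto
 have key: "(LBINT x. ((g x \<bullet> e)^2 + (h x \<bullet> e)^2) + (GG x - 1/2 * W x)) = 0" if e: "e \<in> Basis" for e
 proof -
  define Q where "Q b x = (g x \<bullet> b) * (g x \<bullet> e) + (h x \<bullet> b) * (h x \<bullet> e)" for b x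
  define Z where "Z b n x = pd b (cut n) x * (x \<bullet> e)" for b n x
  \<comment> \<open>The integrand after insertion of \<open>X\<close>; the terms with
    \<open>Z\<close> carry derivatives of the cut-off and vanish in the limit.\<close>
  define H where "H n x = cut n x * (Q e x + (GG x - 1/2 * W x)) + (Z ex n x * Q ex x + Z ey n x * Q ey x) + Z e n x * (GG x - 1/2 * W x)" for n x
  have H0: "(LBINT x. H n x) = 0" for n
  proof -
   let ?X = "\<lambda>x. (x \<bullet> e) * cut n x"
   have X: "test_function ?X" by (intro test_smooth_mult Ck_inner cut_test)
   have pX: "pd b ?X x = cut n x * (b \<bullet> e) + Z b n x" for b x
   proof -
    have d: "((\<lambda>x. x \<bullet> e) has_derivative (\<lambda>k. k \<bullet> e)) (at x)" by (auto intro!: derivative_eq_intros)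
    show ?thesis using pd_mult[OF differentiableI[OF d] test_differentiable[OF cut_test], of b n] pd_eq[OF d, of b] by (simp add: Z_def mult.commute)
   qed
   have gX: "k \<bullet> grad ?X x = cut n x * (k \<bullet> e) + (Z ex n x * (k \<bullet> ex) + Z ey n x * (k \<bullet> ey))" for k x
   proof -
    have "k \<bullet> e = (k \<bullet> ex) * (ex \<bullet> e) + (k \<bullet> ey) * (ey \<bullet> e)" using e by (auto simp: Basis_R2)
    then show ?thesis by (simp add: grad_pd Basis_R2 inner_add_right pX algebra_simps)
   qed
   obtain B where B: "!!x. \<bar>pd e ?X x\<bar> <= B" using test_bounded[OF test_pd[OF X e]] by metis
   obtain C where C: "!!x. norm (grad ?X x) <= C" using test_grad_bounded[OF X] by metis
   obtain D where D: "!!x. \<bar>?X x\<bar> <= D" using test_bounded[OF X] by metis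
   note [measurable] = test_borel[OF test_pd[OF X e]] test_grad_borel[OF X] test_borel[OF X]
   have p: "L1 (\<lambda>x. (k x \<bullet> grad ?X x) * (k x \<bullet> e))" "L1 (\<lambda>x. pd e ?X x * (norm (k x))^2)" if k: "ltwo k" for k
   proof -
    have [measurable]: "k \<in> BM" using k by (rule ltwo_borel)
    show "L1 (\<lambda>x. (k x \<bullet> grad ?X x) * (k x \<bullet> e))"
    proof (rule integrable_dom[OF integrable_mult_right[OF ltwo_int[OF k], of C]])
     have b: "\<bar>(k x \<bullet> grad ?X x) * (k x \<bullet> e)\<bar> <= C * (norm (k x))^2" for x
     proof -
      have "\<bar>k x \<bullet> grad ?X x\<bar> * \<bar>k x \<bullet> e\<bar> <= (norm (k x) * C) * (norm (k x))"
       using Cauchy_Schwarz_ineq2[of "k x" "grad ?X x"] mult_left_mono[OF C[of x] norm_ge_zero[of "k x"]] Basis_le_norm[OF e, of "k x"] order_trans[OF norm_ge_zero C[of x]]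
       by (intro mult_mono) auto
      then show ?thesis by (simp add: abs_mult power2_eq_square mult_ac)
     qed
     show "AE x in lborel. norm ((k x \<bullet> grad ?X x) * (k x \<bullet> e)) <= norm (C * (norm (k x))^2)"
      unfolding real_norm_def by (intro AE_I2 order_trans[OF b abs_ge_self])
    qed measurable
    show "L1 (\<lambda>x. pd e ?X x * (norm (k x))^2)"
    proof (rule integrable_dom[OF integrable_mult_right[OF ltwo_int[OF k], of B]])
     have b: "\<bar>pd e ?X x * (norm (k x))^2\<bar> <= B * (norm (k x))^2" for x using mult_right_mono[OF B[of x], of "(norm (k x))^2"] by (simp add: abs_mult)
     show "AE x in lborel. norm (pd e ?X x * (norm (k x))^2) <= norm (B * (norm (k x))^2)"
      unfolding real_norm_def by (intro AE_I2 order_trans[OF b abs_ge_self])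
    qed measurable
   qed
   have FX: "L1 (\<lambda>x. (f x * ?X x) * (k x \<bullet> e))" if k: "ltwo k" and f: "ltwo f" for f and k :: "real^2 => real^2"
    using ltwo_mult[OF ltwo_bounded_scale[OF f test_borel[OF X] D] ltwo_component[OF k, of e]] by (simp add: mult_ac)
   have GX: "L1 (\<lambda>x. pd e ?X x * GG x)"
   proof (rule integrable_dom[OF integrable_mult_right[OF integrable_abs[OF GGi], of B]])
    have b: "\<bar>pd e ?X x * GG x\<bar> <= B * \<bar>GG x\<bar>" for x using mult_right_mono[OF B[of x], of "\<bar>GG x\<bar>"] by (simp add: abs_mult)
    show "AE x in lborel. norm (pd e ?X x * GG x) <= norm (B * \<bar>GG x\<bar>)"
     unfolding real_norm_def by (intro AE_I2 order_trans[OF b abs_ge_self])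
   qed measurable
   have "(LBINT x. pd e ?X x * GG x) = - (LBINT x. (F1 x * ?X x) * (g x \<bullet> e) + (F2 x * ?X x) * (h x \<bullet> e))"
    unfolding GG_def chain_rule[OF s X e] F1_def F2_def
    by (intro arg_cong[where f=uminus] bochner_cong) (auto simp: dFq_def f1_def f2_def power2_eq_square power3_eq_cube algebra_simps)
   also have "\<dots> = - ((LBINT x. (F1 x * ?X x) * (g x \<bullet> e)) + (LBINT x. (F2 x * ?X x) * (h x \<bullet> e)))"
    using FX[OF gl(1) F(1)] FX[OF gl(2) F(2)] by simp
   finally have ch: "(LBINT x. pd e ?X x * GG x) = - ((LBINT x. (F1 x * ?X x) * (g x \<bullet> e)) + (LBINT x. (F2 x * ?X x) * (h x \<bullet> e)))" .
   have "H n x = (g x \<bullet> grad ?X x) * (g x \<bullet> e) + (h x \<bullet> grad ?X x) * (h x \<bullet> e)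
     - 1/2 * (pd e ?X x * (norm (g x))^2 + pd e ?X x * (norm (h x))^2) + pd e ?X x * GG x" for x
    unfolding H_def gX pX Q_def W_def using e by (simp add: algebra_simps)
   then have "(LBINT x. H n x) = (LBINT x. (g x \<bullet> grad ?X x) * (g x \<bullet> e)) + (LBINT x. (h x \<bullet> grad ?X x) * (h x \<bullet> e))
     - 1/2 * ((LBINT x. pd e ?X x * (norm (g x))^2) + (LBINT x. pd e ?X x * (norm (h x))^2)) + (LBINT x. pd e ?X x * GG x)"
    using p(1)[OF gl(1)] p(1)[OF gl(2)] p(2)[OF gl(1)] p(2)[OF gl(2)] GX by simp
   also have "\<dots> = 0"
    using local_pohozaev[OF s(1) F(1) E1 X e] local_pohozaev[OF s(2) F(2) E2 X e] unfolding ch distrib_left by linarith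
   finally show ?thesis .
  qed
  obtain B1 where B1: "!!n x. \<bar>Z ex n x\<bar> <= B1" "!!x. (\<lambda>n. Z ex n x) ----> 0" unfolding Z_def by (rule cut_moment[OF e ex_ey_Basis(1)]) blast
  obtain B2 where B2: "!!n x. \<bar>Z ey n x\<bar> <= B2" "!!x. (\<lambda>n. Z ey n x) ----> 0" unfolding Z_def by (rule cut_moment[OF e ex_ey_Basis(2)]) blast
  have Ze: "(\<lambda>n. Z e n x) ----> 0" "\<bar>Z e n x\<bar> <= B1 + B2" for n x
   using e B1(2) B2(2) B1(1)[of n x] B2(1)[of n x] by (auto simp: Basis_R2)
  have B0: "0 <= B1" "0 <= B2" using B1(1)[of 0 0] B2(1)[of 0 0] by linarith+
  have Qb: "\<bar>Q b x\<bar> <= W x" if "b \<in> Basis" for b x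
  proof -
   have "\<bar>(k \<bullet> b) * (k \<bullet> e)\<bar> <= (norm k)^2" for k
    using mult_mono[OF Basis_le_norm[OF that, of k] Basis_le_norm[OF e, of k]] by (simp add: abs_mult power2_eq_square)
   from this[of "g x"] this[of "h x"] show ?thesis unfolding Q_def W_def by linarith
  qed
  have lim: "(\<lambda>n. H n x) ----> 1 * (Q e x + (GG x - 1/2 * W x)) + (0 * Q ex x + 0 * Q ey x) + 0 * (GG x - 1/2 * W x)" for x
   unfolding H_def by (intro tendsto_intros cut_lim B1(2) B2(2) Ze(1))
  have dom: "\<bar>H n x\<bar> <= (2 + 2 * (B1 + B2)) * (\<bar>GG x\<bar> + W x)" for n x
  proof -
   have W0: "0 <= W x" by (simp add: W_def)
   have G: "\<bar>GG x - 1/2 * W x\<bar> <= \<bar>GG x\<bar> + W x" using W0 by linarith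
   have 0: "\<bar>cut n x\<bar> <= 1" using cut_nonneg[of n x] cut_le1[of n x] by simp
   have "\<bar>Q e x + (GG x - 1/2 * W x)\<bar> <= 2 * (\<bar>GG x\<bar> + W x)" unfolding distrib_left using Qb[OF e, of x] W0 by linarith
   then have "\<bar>cut n x * (Q e x + (GG x - 1/2 * W x))\<bar> <= 1 * (2 * (\<bar>GG x\<bar> + W x))" unfolding abs_mult by (intro mult_mono 0) auto
   moreover have "\<bar>Z ex n x * Q ex x\<bar> <= B1 * (\<bar>GG x\<bar> + W x)" "\<bar>Z ey n x * Q ey x\<bar> <= B2 * (\<bar>GG x\<bar> + W x)" unfolding abs_mult
    by (intro mult_mono B1(1) B2(1) B0 order_trans[OF Qb]; simp)+
   moreover have "\<bar>Z e n x * (GG x - 1/2 * W x)\<bar> <= (B1 + B2) * (\<bar>GG x\<bar> + W x)" unfolding abs_mult by (intro mult_mono Ze(2) G) (use B0 in auto)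
   moreover have "(2 + 2 * (B1 + B2)) * (\<bar>GG x\<bar> + W x) = 1 * (2 * (\<bar>GG x\<bar> + W x)) + (B1 * (\<bar>GG x\<bar> + W x) + B2 * (\<bar>GG x\<bar> + W x)) + (B1 + B2) * (\<bar>GG x\<bar> + W x)"
    by (simp add: algebra_simps)
   ultimately show ?thesis unfolding H_def by linarith
  qed
  have zm[measurable]: "Z b n \<in> BM" if "b \<in> Basis" for b n
   using test_borel[OF test_pd[OF cut_test that]] unfolding Z_def[abs_def] by measurable
  note [measurable] = zm[OF ex_ey_Basis(1)] zm[OF ex_ey_Basis(2)] zm[OF e]
  have "(\<lambda>n. LBINT x. H n x) ----> (LBINT x. Q e x + (GG x - 1/2 * W x))"
  proof (rule integral_dominated_convergence[where w="\<lambda>x. (2 + 2 * (B1 + B2)) * (\<bar>GG x\<bar> + W x)"])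
   show "L1 (\<lambda>x. (2 + 2 * (B1 + B2)) * (\<bar>GG x\<bar> + W x))" using GGi Wi by simp
   show "(\<lambda>x. Q e x + (GG x - 1/2 * W x)) \<in> borel_measurable lborel" unfolding Q_def by measurable
   show "H n \<in> borel_measurable lborel" for n unfolding H_def Q_def by measurable
  qed (use lim dom in auto)
  then have "(LBINT x. Q e x + (GG x - 1/2 * W x)) = 0" unfolding H0 using LIMSEQ_unique tendsto_const by blast
  then show ?thesis by (simp add: Q_def power2_eq_square)
 qed
 have ci: "L1 (\<lambda>x. (g x \<bullet> e)^2)" "L1 (\<lambda>x. (h x \<bullet> e)^2)" for e
  using ltwo_int_real[OF ltwo_component[OF gl(1)]] ltwo_int_real[OF ltwo_component[OF gl(2)]] by auto
 have W: "W x = ((g x \<bullet> ex)^2 + (h x \<bullet> ex)^2) + ((g x \<bullet> ey)^2 + (h x \<bullet> ey)^2)" for x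
  unfolding W_def power2_norm_eq_inner euclidean_inner[of "g x" "g x"] euclidean_inner[of "h x" "h x"]
  using Basis_R2(2) by (simp add: Basis_R2(1) power2_eq_square)
 have "0 = (LBINT x. (((g x \<bullet> ex)^2 + (h x \<bullet> ex)^2) + (GG x - 1/2 * W x)) + (((g x \<bullet> ey)^2 + (h x \<bullet> ey)^2) + (GG x - 1/2 * W x)))"
  using key[OF ex_ey_Basis(1)] key[OF ex_ey_Basis(2)] ci GGi Wi by simp
 \<comment> \<open>The Dirichlet terms cancel here: the squared components add up to
   \<open>W\<close>, and \<open>1/2 * W\<close> is subtracted twice.\<close>
 also have "\<dots> = (LBINT x. 2 * GG x)" by (rule bochner_cong) (auto simp: W)
 finally have "(LBINT x. GG x) = 0" by simp
 moreover have "(LBINT x. GG x) = (LBINT x. Fq (\<mu>1/4) (\<mu>2/4) (\<rho>/2) (\<beta>/2) (u x) (v x)) + (- l1/2) * msq u + (- l2/2) * msq v"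
  unfolding GG_def msq_real power2_eq_square using Fq_int[OF s] sob_int2[OF s(1,1)] sob_int2[OF s(2,2)] by simp
 ultimately show "(LBINT x. Fq (\<mu>1/4) (\<mu>2/4) (\<rho>/2) (\<beta>/2) (u x) (v x)) = 1/2 * (l1 * msq u + l2 * msq v)" by simp
qed

section \<open>Nonexistence, unboundedness and attainment for the given problem\<close>

lemma mass_sphere_sob:
 assumes "u \<in> mass_sphere b"
 obtains u' g where "sob u' g" "AE x in lborel. u x = u' x" "AE x in lborel. weak_grad u x = g x" "msq u' = b^2"
proof -
 have u: "u \<in> H1" "(\<integral>x. (u x)^2 \<partial>lebesgue) = b^2" using assms by (auto simp: mass_sphere_def)
 obtain u' g where *: "sob u' g" "AE x in lborel. u x = u' x" "AE x in lborel. weak_grad u x = g x" by (rule H1_sob[OF u(1)]) blast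
 show ?thesis by (rule that[OF *]) (use mass_sob[OF *(1,2)] u(2) in simp)
qed

lemma sob_mass_sphere: "sob u g ==> msq u = b^2 ==> u \<in> mass_sphere b"
 using sob_H1(1) mass_sob[of u g u] by (auto simp: mass_sphere_def)

lemma no_positive_solution:
 fixes q \<mu>1 \<mu>2 \<rho> \<beta> b1 b2 :: real
 assumes q: "q > 0" and GN: "!!u g. sob (u :: real^2 => real) g ==> (LBINT x. u x ^ 4) <= 2 / q * msq u * msq g"
  and c: "\<mu>1 > 0" "\<mu>2 > 0" "\<rho> > 0" "b1 > 0" "b2 > 0" "(\<mu>1 + \<rho>) * b1^2 < q" "(\<mu>2 + \<rho>) * b2^2 < q" and \<beta>: "\<beta> < 0"
 shows "\<not> positive_normalized_solution \<mu>1 \<mu>2 \<rho> \<beta> b1 b2 u0 v0"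
proof
 assume sol: "positive_normalized_solution \<mu>1 \<mu>2 \<rho> \<beta> b1 b2 u0 v0"
 then obtain l1 l2 where eq: "weakly_solves l1 u0 (\<lambda>x. \<beta> * u0 x * v0 x + \<mu>1 * u0 x ^ 3 + \<rho> * (v0 x)^2 * u0 x)"
   "weakly_solves l2 v0 (\<lambda>x. \<beta>/2 * (u0 x)^2 + \<mu>2 * v0 x ^ 3 + \<rho> * (u0 x)^2 * v0 x)"
  and ms: "u0 \<in> mass_sphere b1" "v0 \<in> mass_sphere b2" and pos: "AE x in lborel. 0 < u0 x" "AE x in lborel. 0 < v0 x"
  by (auto simp: positive_normalized_solution_def normalized_solution_def mass_sphere_def ae_positive_def AE_completion_iff)
 obtain u g where u: "sob u g" "AE x in lborel. u0 x = u x" "AE x in lborel. weak_grad u0 x = g x" "msq u = b1^2"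
  by (rule mass_sphere_sob[OF ms(1)]) blast
 obtain v h where v: "sob v h" "AE x in lborel. v0 x = v x" "AE x in lborel. weak_grad v0 x = h x" "msq v = b2^2"
  by (rule mass_sphere_sob[OF ms(2)]) blast
 note [measurable] = sob_borel[OF u(1)] sob_borel[OF v(1)]
 have ae: "AE x in lborel. \<beta> * u0 x * v0 x + \<mu>1 * u0 x ^ 3 + \<rho> * (v0 x)^2 * u0 x = \<beta> * u x * v x + \<mu>1 * u x ^ 3 + \<rho> * (v x)^2 * u x"
  "AE x in lborel. \<beta>/2 * (u0 x)^2 + \<mu>2 * v0 x ^ 3 + \<rho> * (u0 x)^2 * v0 x = \<beta>/2 * (u x)^2 + \<mu>2 * v x ^ 3 + \<rho> * (u x)^2 * v x"
  using u(2) v(2) by (eventually_elim, simp)+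
 have bm: "(\<lambda>x. \<beta> * u x * v x + \<mu>1 * u x ^ 3 + \<rho> * (v x)^2 * u x) \<in> BM"
  "(\<lambda>x. \<beta>/2 * (u x)^2 + \<mu>2 * v x ^ 3 + \<rho> * (u x)^2 * v x) \<in> BM" by measurable
 note EL = eq(1)[unfolded weakly_solves_iff[OF u(1-3) bm(1) ae(1)], rule_format] eq(2)[unfolded weakly_solves_iff[OF v(1-3) bm(2) ae(2)], rule_format]
 define A q4 c3 where "A = msq g + msq h" and "q4 = (LBINT x. Fq (\<mu>1/4) (\<mu>2/4) (\<rho>/2) 0 (u x) (v x))" and "c3 = (LBINT x. Fq 0 0 0 1 (u x) (v x))"
 have i: "L1 (\<lambda>x. Fq a1 a2 r b (u x) (v x))" for a1 a2 r b by (rule Fq_int[OF u(1) v(1)])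
 have "Fq (\<mu>1/4) (\<mu>2/4) (\<rho>/2) (\<beta>/2) s t = Fq (\<mu>1/4) (\<mu>2/4) (\<rho>/2) 0 s t + \<beta>/2 * Fq 0 0 0 1 s t"
  "dFq (\<mu>1/4) (\<mu>2/4) (\<rho>/2) (\<beta>/2) s t s t = 4 * Fq (\<mu>1/4) (\<mu>2/4) (\<rho>/2) 0 s t + 3 * (\<beta>/2) * Fq 0 0 0 1 s t" for s t
  by (simp_all add: Fq_def dFq_def power2_eq_square power4_eq_xxxx algebra_simps)
 with pohozaev[OF u(1) v(1) EL] i have "q4 + \<beta>/2 * c3 = 1/2 * (l1 * msq u + l2 * msq v)" "A + l1 * msq u + l2 * msq v = 4 * q4 + 3 * (\<beta>/2) * c3"
  by (simp_all add: A_def q4_def c3_def)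
 \<comment> \<open>Eliminating the sum of the multiplier terms; the cubic integral enters the two
   identities with different weights and keeps the coefficient \<open>\<beta>/2\<close>.\<close>
 then have A: "A = 2 * q4 + \<beta>/2 * c3" by argo
 have "c3 > 0"
 proof (rule ccontr)
  have p: "AE x in lborel. 0 < u x & 0 < v x" using pos u(2) v(2) by eventually_elim simp
  then have nn: "AE x in lborel. 0 <= Fq 0 0 0 1 (u x) (v x)" by eventually_elim (simp add: Fq_def)
  assume "\<not> 0 < c3"
  then have "c3 = 0" using integral_nonneg_AE[OF nn] by (simp add: c3_def)
  then have "AE x in lborel. Fq 0 0 0 1 (u x) (v x) = 0" using integral_nonneg_eq_0_iff_AE[OF i nn] by (simp add: c3_def)
  with p have "AE x in lborel. (u x)^2 = 0" by eventually_elim (simp add: Fq_def)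
  then have "msq u = 0" unfolding msq_real by (rule integral_eq_zero_AE)
  then show False using u(4) c by simp
 qed
 then have neg: "\<beta>/2 * c3 < 0" using \<beta> by (simp add: mult_neg_pos)
 obtain k where k: "k > 0" "k * A <= 1/2 * A - q4"
  unfolding A_def q4_def
  apply (rule coercive[OF q GN c(1-3) order_refl _ _ c(6,7)])
  subgoal by assumption
  subgoal using c by simp
  subgoal using c by simp
  subgoal premises p for k K using p(1)[OF p(2)] p(3)[OF u(1) v(1)] u(4) v(4) by simp
  done
 moreover have "0 <= k * A" using k by (simp add: A_def)
 ultimately show False using A neg by linarith
qed

lemma min_energy_unbounded:
 fixes R :: "real^2 => real"
 assumes R: "sob R k" "msq R = q" "msq k = q" "(LBINT x. R x ^ 4) = 2 * q" and q: "q > 0" and b: "b1 > 0" "b2 > 0"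
  and c: "(\<mu>1 * b1^4 + \<mu>2 * b2^4 + 2 * \<rho> * b1^2 * b2^2) / (b1^2 + b2^2) > q"
 shows "min_energy \<mu>1 \<mu>2 \<rho> \<beta> b1 b2 = -\<infinity>"
proof (rule ereal_bot)
 fix B :: real
 define c1 c2 where "c1 = b1 / sqrt q" and "c2 = b2 / sqrt q"
 have c12: "c1^2 = b1^2 / q" "c2^2 = b2^2 / q" using q by (auto simp: c1_def c2_def power_divide)
 have p4: "x ^ 4 = (x^2)^2" for x :: real by simp
 define N where "N = \<mu>1 * b1^4 + \<mu>2 * b2^4 + 2 * \<rho> * b1^2 * b2^2"
 have F4: "Fq (\<mu>1/4) (\<mu>2/4) (\<rho>/2) 0 c1 c2 * (2 * q) = N / (2 * q)"
  unfolding Fq_def N_def p4[of c1] p4[of c2] c12 using q by (simp add: field_simps power2_eq_square power4_eq_xxxx)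
 \<comment> \<open>The coefficient of \<open>- s^2\<close> in the energy of the dilated pair, which
   is \<open>- (s * (a * s + d))\<close>; the mass hypothesis makes it positive.\<close>
 define a where "a = (N / q - (b1^2 + b2^2)) / 2"
 have bb: "b1^2 + b2^2 > 0" using b by (simp add: add_pos_pos)
 have "q * (b1^2 + b2^2) < N" using c bb unfolding N_def[symmetric] by (simp add: pos_less_divide_eq)
 then have a: "a > 0" using q by (simp add: a_def pos_less_divide_eq mult.commute)
 define d where "d = Fq 0 0 0 (\<beta>/2) c1 c2 * (LBINT x. R x ^ 3)"
 \<comment> \<open>At least one and such that \<open>a * s + d \<ge> |B|\<close>, so that the energy
   is at most \<open>- |B|\<close>.\<close>
 define s where "s = 1 + (\<bar>d\<bar> + \<bar>B\<bar>) / a"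
 have s: "s >= 1" using a by (simp add: s_def)
 then have s0: "s > 0" by simp
 have as: "a * s = a + \<bar>d\<bar> + \<bar>B\<bar>" using a by (simp add: s_def field_simps)
 note w = dilated_pair[OF R(1) s0]
 let ?u = "\<lambda>x. (c1 * s) * R (s *\<^sub>R x)" and ?v = "\<lambda>x. (c2 * s) * R (s *\<^sub>R x)"
 have "energy \<mu>1 \<mu>2 \<rho> \<beta> ?u ?v = 1/2 * (s^2 * b1^2 + s^2 * b2^2) - (s^2 * (N / (2 * q)) + s * d)"
  unfolding energy_sob[OF w(1)[of c1] w(1)[of c2] AE_I2[OF refl] sob_H1(2)[OF w(1)] AE_I2[OF refl] sob_H1(2)[OF w(1)]] w(3,4) R d_def F4 c12
  using q by simp
 also have "\<dots> = - (s * (a * s + d))" using q by (simp add: a_def field_simps power2_eq_square)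
 also have "\<dots> <= - (1 * \<bar>B\<bar>)"
 proof -
  have "1 * \<bar>B\<bar> <= s * (a * s + d)" using s a unfolding as by (intro mult_mono) auto
  then show ?thesis by simp
 qed
 finally have le: "energy \<mu>1 \<mu>2 \<rho> \<beta> ?u ?v <= B" by simp
 have "?u \<in> mass_sphere b1" "?v \<in> mass_sphere b2" using w(2)[of c1] w(2)[of c2] q by (auto intro!: sob_mass_sphere[OF w(1)] simp: c12 R)
 then have "min_energy \<mu>1 \<mu>2 \<rho> \<beta> b1 b2 <= ereal (energy \<mu>1 \<mu>2 \<rho> \<beta> ?u ?v)"
  unfolding min_energy_def by (intro INF_lower2[of "(?u, ?v)"]) auto
 also have "\<dots> <= ereal B" using le by simp
 finally show "min_energy \<mu>1 \<mu>2 \<rho> \<beta> b1 b2 <= ereal B" .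
qed

text \<open>\<open>minimizer\<close> compares Borel representatives only; every pair in the product
  of the spheres has such representatives with the same energy, so the comparison extends to the
  infimum.\<close>

lemma min_energy_attained:
 fixes q \<mu>1 \<mu>2 \<rho> \<beta> b1 b2 :: real and R :: "real^2 => real"
 assumes q: "q > 0" and GN: "!!u g. sob (u :: real^2 => real) g ==> (LBINT x. u x ^ 4) <= 2 / q * msq u * msq g"
  and R: "sob R r" "!!x. R x >= 0" "msq R = q" "msq r = q"
  and c: "\<mu>1 > 0" "\<mu>2 > 0" "\<rho> > 0" "\<beta> > 0" "b1 > 0" "b2 > 0" "(\<mu>1 + \<rho>) * b1^2 < q" "(\<mu>2 + \<rho>) * b2^2 < q"
 obtains u v where "u \<in> mass_sphere b1" "v \<in> mass_sphere b2" "ereal (energy \<mu>1 \<mu>2 \<rho> \<beta> u v) = min_energy \<mu>1 \<mu>2 \<rho> \<beta> b1 b2"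
  "energy \<mu>1 \<mu>2 \<rho> \<beta> u v < 0" "positive_normalized_solution \<mu>1 \<mu>2 \<rho> \<beta> b1 b2 u v"
proof -
 let ?I = "\<lambda>u v. LBINT x. Fq (\<mu>1/4) (\<mu>2/4) (\<rho>/2) (\<beta>/2) (u x) (v (x :: real^2))"
 have m: "b1^2 > 0" "b2^2 > 0" using c by auto
 obtain u g v h l1 l2 where s: "sob u g" "sob v h" and ms: "msq u = b1^2" "msq v = b2^2" and pos: "AE x in lborel. u x > 0" "AE x in lborel. v x > 0"
  and neg: "1/2 * (msq g + msq h) - ?I u v < 0"
  and min: "!!u' g' v' h'. sob u' g' ==> sob v' h' ==> msq u' = b1^2 ==> msq v' = b2^2 ==> 1/2 * (msq g + msq h) - ?I u v <= 1/2 * (msq g' + msq h') - ?I u' v'"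
  and EL: "!!\<phi>. test_function \<phi> ==> (LBINT x. g x \<bullet> grad \<phi> x) + l1 * (LBINT x. u x * \<phi> x) = (LBINT x. (\<beta> * u x * v x + \<mu>1 * u x ^ 3 + \<rho> * (v x)^2 * u x) * \<phi> x)"
  "!!\<phi>. test_function \<phi> ==> (LBINT x. h x \<bullet> grad \<phi> x) + l2 * (LBINT x. v x * \<phi> x) = (LBINT x. (\<beta>/2 * (u x)^2 + \<mu>2 * v x ^ 3 + \<rho> * (u x)^2 * v x) * \<phi> x)"
  apply (rule minimizer[OF q _ R c(1-4) m c(7,8)])
  subgoal by (rule GN)
  subgoal premises p by (rule p(1)[OF p(2-8)]; rule p(9-11); assumption)
  done
 note [measurable] = s[THEN sob_borel]
 have mem: "u \<in> mass_sphere b1" "v \<in> mass_sphere b2" using sob_mass_sphere s ms by blast+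
 note wg = sob_H1(2)[OF s(1)] sob_H1(2)[OF s(2)] and rf = AE_I2[OF refl]
 have E: "energy \<mu>1 \<mu>2 \<rho> \<beta> u v = 1/2 * (msq g + msq h) - ?I u v" by (rule energy_sob[OF s rf wg(1) rf wg(2)])
 have "ereal (energy \<mu>1 \<mu>2 \<rho> \<beta> u v) = min_energy \<mu>1 \<mu>2 \<rho> \<beta> b1 b2"
 proof (rule antisym)
  show "ereal (energy \<mu>1 \<mu>2 \<rho> \<beta> u v) <= min_energy \<mu>1 \<mu>2 \<rho> \<beta> b1 b2"
   unfolding min_energy_def
  proof (rule INF_greatest, clarify)
   fix u0 v0 assume uv: "u0 \<in> mass_sphere b1" "v0 \<in> mass_sphere b2"
   obtain u' g' where u': "sob u' g'" "AE x in lborel. u0 x = u' x" "AE x in lborel. weak_grad u0 x = g' x" "msq u' = b1^2"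
    by (rule mass_sphere_sob[OF uv(1)]) blast
   obtain v' h' where v': "sob v' h'" "AE x in lborel. v0 x = v' x" "AE x in lborel. weak_grad v0 x = h' x" "msq v' = b2^2"
    by (rule mass_sphere_sob[OF uv(2)]) blast
   show "ereal (energy \<mu>1 \<mu>2 \<rho> \<beta> u v) <= ereal (energy \<mu>1 \<mu>2 \<rho> \<beta> u0 v0)"
    unfolding E energy_sob[OF u'(1) v'(1) u'(2,3) v'(2,3)] using min[OF u'(1) v'(1) u'(4) v'(4)] by simp
  qed
  show "min_energy \<mu>1 \<mu>2 \<rho> \<beta> b1 b2 <= ereal (energy \<mu>1 \<mu>2 \<rho> \<beta> u v)"
   unfolding min_energy_def by (intro INF_lower2[of "(u, v)"]) (use mem in auto)
 qed
 moreover have "weakly_solves l1 u (\<lambda>x. \<beta> * u x * v x + \<mu>1 * u x ^ 3 + \<rho> * (v x)^2 * u x)"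
  by (subst weakly_solves_iff[OF s(1) rf wg(1) _ rf]) (measurable, use EL in blast)
 moreover have "weakly_solves l2 v (\<lambda>x. \<beta>/2 * (u x)^2 + \<mu>2 * v x ^ 3 + \<rho> * (u x)^2 * v x)"
  by (subst weakly_solves_iff[OF s(2) rf wg(2) _ rf]) (measurable, use EL in blast)
 ultimately show ?thesis using that[OF mem] E neg mem pos
  by (auto simp: positive_normalized_solution_def normalized_solution_def mass_sphere_def ae_positive_def AE_completion_iff)
qed

theorem theorem1p2:
 fixes \<mu>1 \<mu>2 \<rho> b1 b2 :: real and Q :: "real^2 \<Rightarrow> real"
 assumes "is_unique_positive_radial_solution Q"
  and "\<mu>1 > 0" and "\<mu>2 > 0" and "\<rho> > 0" and "b1 > 0" and "b2 > 0"
 shows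
  "(max ((\<mu>1 + \<rho>) * b1\<^sup>2) ((\<mu>2 + \<rho>) * b2\<^sup>2) < (L2_norm Q)\<^sup>2 \<longrightarrow>
    (\<forall>\<beta><0. \<not> (\<exists>u v. positive_normalized_solution \<mu>1 \<mu>2 \<rho> \<beta> b1 b2 u v)) \<and>
    (\<forall>\<beta>>0. 0 < b2 \<and> b2 \<le> L2_norm Q \<longrightarrow>
      -\<infinity> < min_energy \<mu>1 \<mu>2 \<rho> \<beta> b1 b2 \<and> min_energy \<mu>1 \<mu>2 \<rho> \<beta> b1 b2 < 0 \<and>
      (\<exists>u v. u \<in> mass_sphere b1 \<and> v \<in> mass_sphere b2 \<and>
       ereal (energy \<mu>1 \<mu>2 \<rho> \<beta> u v) = min_energy \<mu>1 \<mu>2 \<rho> \<beta> b1 b2 \<and>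
       positive_normalized_solution \<mu>1 \<mu>2 \<rho> \<beta> b1 b2 u v))) \<and>
   ((\<mu>1 * b1^4 + \<mu>2 * b2^4 + 2 * \<rho> * b1\<^sup>2 * b2\<^sup>2) / (b1\<^sup>2 + b2\<^sup>2) > (L2_norm Q)\<^sup>2 \<longrightarrow>
    (\<forall>\<beta>. min_energy \<mu>1 \<mu>2 \<rho> \<beta> b1 b2 = -\<infinity>))"
proof -
 obtain R :: "real^2 \<Rightarrow> real" and k where R: "sob R k" "\<And>x. R x \<ge> 0" and q: "(L2_norm Q)\<^sup>2 > 0" and mR: "msq R = (L2_norm Q)\<^sup>2" "msq k = (L2_norm Q)\<^sup>2"
  "(LBINT x. R x ^ 4) = 2 * (L2_norm Q)\<^sup>2"
  and GN: "\<And>u g. sob (u :: real^2 \<Rightarrow> real) g \<Longrightarrow> (LBINT x. u x ^ 4) \<le> 2 / (L2_norm Q)\<^sup>2 * msq u * msq g"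
  by (rule ground_state[OF assms(1)]) blast
 show ?thesis
 proof (intro conjI impI allI)
  fix \<beta> :: real
  assume max: "max ((\<mu>1 + \<rho>) * b1\<^sup>2) ((\<mu>2 + \<rho>) * b2\<^sup>2) < (L2_norm Q)\<^sup>2"
  then have c: "(\<mu>1 + \<rho>) * b1\<^sup>2 < (L2_norm Q)\<^sup>2" "(\<mu>2 + \<rho>) * b2\<^sup>2 < (L2_norm Q)\<^sup>2" by simp_all
  show "\<not> (\<exists>u v. positive_normalized_solution \<mu>1 \<mu>2 \<rho> \<beta> b1 b2 u v)" if "\<beta> < 0"
   using no_positive_solution[OF q _ assms(2-6) c that] GN by blast
  assume \<beta>: "\<beta> > 0"
  obtain u v where uv: "u \<in> mass_sphere b1" "v \<in> mass_sphere b2" "ereal (energy \<mu>1 \<mu>2 \<rho> \<beta> u v) = min_energy \<mu>1 \<mu>2 \<rho> \<beta> b1 b2"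
   "energy \<mu>1 \<mu>2 \<rho> \<beta> u v < 0" "positive_normalized_solution \<mu>1 \<mu>2 \<rho> \<beta> b1 b2 u v"
   using min_energy_attained[OF q _ R mR(1,2) assms(2-4) \<beta> assms(5,6) c] GN by blast
  show "-\<infinity> < min_energy \<mu>1 \<mu>2 \<rho> \<beta> b1 b2" "min_energy \<mu>1 \<mu>2 \<rho> \<beta> b1 b2 < 0" unfolding uv(3)[symmetric] using uv(4) by simp_all
  show "\<exists>u v. u \<in> mass_sphere b1 \<and> v \<in> mass_sphere b2 \<and> ereal (energy \<mu>1 \<mu>2 \<rho> \<beta> u v) = min_energy \<mu>1 \<mu>2 \<rho> \<beta> b1 b2 \<and>
    positive_normalized_solution \<mu>1 \<mu>2 \<rho> \<beta> b1 b2 u v" using uv by blast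
 next
  fix \<beta> :: real
  assume "(\<mu>1 * b1^4 + \<mu>2 * b2^4 + 2 * \<rho> * b1\<^sup>2 * b2\<^sup>2) / (b1\<^sup>2 + b2\<^sup>2) > (L2_norm Q)\<^sup>2"
  then show "min_energy \<mu>1 \<mu>2 \<rho> \<beta> b1 b2 = -\<infinity>" by (rule min_energy_unbounded[OF R(1) mR q assms(5,6)])
 qed
qed

end
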